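(* Let $\delta>0$ and suppose $\mathbf n\in W^{1,2}(D_1,\mathbb S^2)$ satisfies $$\int_{D_1}|\partial_1\mathbf n\times\partial_2\mathbf n|\,dX\le 4\pi-\delta .$$ Let $\Phi=\mathbf n\cdot(\partial_1\mathbf n\times\partial_2\mathbf n)$. Then there exist $\Omega_i\in L^2(D_1)$ with $\|\Omega_i\|_{L^2(D_1)}\le (2^3\pi/\delta)\,\|\nabla\mathbf n\|_{L^2(D_1)}$, $i=1,2$, such that for every $\zeta\in C_0^\infty(D_1)$, $$\int_{D_1}\Phi\,\zeta\,dX=\int_{D_1}(\Omega_2\,\partial_1\zeta-\Omega_1\,\partial_2\zeta)\,dX .$$ In particular, for an absolute constant $c$, $$\|\Phi\|_{W_0^{-1,2}(D_1)}\le\frac{c}{\delta}\,\|\nabla\mathbf n\|_{L^2(D_1)} .$$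
   Context: $D_1=\{X=(X_1,X_2)\in\mathbb R^2:|X|\le1\}$ is the closed unit disc, $\partial_i=\partial/\partial X_i$, $\mathbb S^2$ is the unit sphere in $\mathbb R^3$, and $W^{1,2}(D_1,\mathbb S^2)$ is the set of $\mathbf u\in W^{1,2}(D_1,\mathbb R^3)$ with $\mathbf u(X)\in\mathbb S^2$ for almost every $X\in D_1$. $C_0^\infty(D_1)$ denotes the smooth real-valued functions with compact support in the open unit disc, and $W_0^{-1,2}(D_1)$ is the dual of $W_0^{1,2}(D_1)$ (the closure of $C_0^\infty(D_1)$ in $W^{1,2}(D_1)$), with $\Phi\in L^1(D_1)$ acting by $\zeta\mapsto\int_{D_1}\Phi\zeta\,dX$ on $C_0^\infty(D_1)$. *)

theory Defs
  imports "HOL-Analysis.Analysis"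
begin

abbreviation unit_disc :: "(real^2) set" where
  "unit_disc \<equiv> cball 0 1"

abbreviation disc_measure :: "(real^2) measure" where
  "disc_measure \<equiv> lebesgue_on unit_disc"

definition partial_deriv :: "2 \<Rightarrow> (real^2 \<Rightarrow> real) \<Rightarrow> real^2 \<Rightarrow> real" where
  "partial_deriv i f x = frechet_derivative f (at x) (axis i 1)"

primrec Ck :: "nat \<Rightarrow> (real^2 \<Rightarrow> real) \<Rightarrow> bool" where
  "Ck 0 f \<longleftrightarrow> continuous_on UNIV f"
| "Ck (Suc k) f \<longleftrightarrow> (\<forall>x. f differentiable (at x)) \<and> (\<forall>i. Ck k (partial_deriv i f))"

text \<open>Elements of \<open>C\<^sub>0\<^sup>\<infinity>\<close> are represented by their extensions by zero to the whole plane.\<close>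

definition test_functions :: "(real^2 \<Rightarrow> real) set" where
  "test_functions = {f. (\<forall>k. Ck k f) \<and> compact (closure {x. f x \<noteq> 0})
     \<and> closure {x. f x \<noteq> 0} \<subseteq> ball 0 1}"

text \<open>Elements of function spaces on the disc are represented by functions on the whole plane, of
  which only the values on the disc matter (up to null sets).\<close>

definition L2_disc :: "(real^2 \<Rightarrow> 'b::euclidean_space) set" where
  "L2_disc = {f. f \<in> borel_measurable disc_measure \<and> integrable disc_measure (\<lambda>x. (norm (f x))\<^sup>2)}"

definition L2_disc_norm :: "(real^2 \<Rightarrow> 'b::euclidean_space) \<Rightarrow> real" where
  "L2_disc_norm f = sqrt (LINT x|disc_measure. (norm (f x))\<^sup>2)"

text \<open>Only meaningful when \<open>u\<close> and \<open>v\<close> are (locally) integrable; it is used for \<open>u\<close>, \<open>v\<close> in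
  \<open>L\<^sup>2\<close> below.\<close>

definition has_weak_partial ::
    "2 \<Rightarrow> (real^2 \<Rightarrow> 'b::euclidean_space) \<Rightarrow> (real^2 \<Rightarrow> 'b) \<Rightarrow> bool" where
  "has_weak_partial i u v \<longleftrightarrow> (\<forall>\<phi>\<in>test_functions.
     (LINT x|disc_measure. partial_deriv i \<phi> x *\<^sub>R u x) = - (LINT x|disc_measure. \<phi> x *\<^sub>R v x))"

definition W12 :: "(real^2 \<Rightarrow> 'b::euclidean_space) set" where
  "W12 = {u \<in> L2_disc. \<forall>i. \<exists>v\<in>L2_disc. has_weak_partial i u v}"

text \<open>Weak derivatives are unique up to null sets, so the choice of representative is immaterial.\<close>

definition weak_partial ::
    "2 \<Rightarrow> (real^2 \<Rightarrow> 'b::euclidean_space) \<Rightarrow> real^2 \<Rightarrow> 'b" where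
  "weak_partial i u = (SOME v. v \<in> L2_disc \<and> has_weak_partial i u v)"

definition weak_grad :: "(real^2 \<Rightarrow> 'b::euclidean_space) \<Rightarrow> real^2 \<Rightarrow> 'b^2" where
  "weak_grad u x = (\<chi> i. weak_partial i u x)"

definition W12_norm :: "(real^2 \<Rightarrow> 'b::euclidean_space) \<Rightarrow> real" where
  "W12_norm u = sqrt ((L2_disc_norm u)\<^sup>2 + (L2_disc_norm (weak_grad u))\<^sup>2)"

definition W12_sphere :: "(real^2 \<Rightarrow> real^3) set" where
  "W12_sphere = {u \<in> W12. AE x in disc_measure. u x \<in> sphere 0 1}"

definition W12_0 :: "(real^2 \<Rightarrow> real) set" where
  "W12_0 = {u \<in> W12. \<forall>e>0. \<exists>\<phi>\<in>test_functions. W12_norm (\<lambda>x. u x - \<phi> x) < e}"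

text \<open>The dual of \<open>W12_0\<close>. A bounded linear functional automatically respects equality almost
  everywhere; its values outside \<open>W12_0\<close> are irrelevant.\<close>

definition W12_0_dual :: "((real^2 \<Rightarrow> real) \<Rightarrow> real) set" where
  "W12_0_dual = {T.
     (\<forall>u\<in>W12_0. \<forall>v\<in>W12_0. \<forall>a b. T (\<lambda>x. a * u x + b * v x) = a * T u + b * T v)
     \<and> (\<exists>C. \<forall>u\<in>W12_0. \<bar>T u\<bar> \<le> C * W12_norm u)}"

definition W12_0_dual_norm :: "((real^2 \<Rightarrow> real) \<Rightarrow> real) \<Rightarrow> real" where
  "W12_0_dual_norm T = Sup {\<bar>T u\<bar> | u. u \<in> W12_0 \<and> W12_norm u \<le> 1}"

text \<open>\<open>T\<close> is the element of the dual given by the \<open>L\<^sup>1\<close> function \<open>\<Phi>\<close>. By density of the test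
  functions, \<open>T\<close> is determined on \<open>W12_0\<close>, and hence so is its dual norm.\<close>

definition induces_functional :: "(real^2 \<Rightarrow> real) \<Rightarrow> ((real^2 \<Rightarrow> real) \<Rightarrow> real) \<Rightarrow> bool" where
  "induces_functional \<Phi> T \<longleftrightarrow> integrable disc_measure \<Phi> \<and> T \<in> W12_0_dual
     \<and> (\<forall>\<zeta>\<in>test_functions. T \<zeta> = (LINT x|disc_measure. \<Phi> x * \<zeta> x))"

end

theory Submission
  imports Defs
begin

text \<open>
  The cone \<open>(X, t) \<mapsto> t n(X)\<close>, \<open>0 < t \<le> 1\<close>, over the image of \<open>n\<close> has volume at most
  \<open>\<integral> \<bar>\<partial>\<^sub>1 n \<times> \<partial>\<^sub>2 n\<bar> / 3 \<le> (4 pi - \<delta>) / 3\<close>: away from a null set of the disc, \<open>n\<close> is differentiable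
  along each of countably many sets, with the weak derivative, and the volume of a differentiable
  image is at most the integral of the Jacobian. So \<open>n\<close> omits a set of directions of solid angle at least
  \<open>\<delta>\<close>.

  For a unit vector \<open>y\<close>, the one-form \<open>a \<mapsto> (y \<times> a) / (1 - a \<bullet> y)\<close> is a primitive of the area form (up to sign) on the
  sphere without \<open>y\<close>, of length \<open>cot (\<theta>/2)\<close> at angle \<open>\<theta>\<close> from \<open>y\<close>. Average it over the
  omitted directions \<open>y\<close>, or rather over a compact set of them of solid angle at least \<open>pi \<delta> / 4\<close>. Since \<open>cot (\<theta>/2)\<close>
  has integral \<open>2 pi\<^sup>2\<close> over the sphere, the average is bounded by \<open>8 pi / \<delta>\<close>; its pullback under \<open>n\<close> has
  components \<open>\<Omega>\<^sub>i\<close>. To justify this, replace \<open>1 - a \<bullet> y\<close> by \<open>1 + e - a \<bullet> y\<close>,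
  which changes the area form by the factor \<open>1 - \<rho>\<close> with \<open>\<rho>\<close> an approximate identity at \<open>y\<close>, pull
  back by mollifying \<open>n\<close>, and let \<open>e\<close> tend to \<open>0\<close>: the average of \<open>\<rho>\<close> tends to \<open>0\<close> off the omitted directions,
  hence along \<open>n\<close>.
\<close>

section \<open>Smooth functions on the plane\<close>

text \<open>The primitive belonging to a single omitted direction y is unbounded near y, and n may
  come arbitrarily close to y, so one direction yields no bound. Averaging over a set of positive
  solid angle makes the singularity integrable and the bound uniform in n. Solid angles are measured
  throughout as volumes of cones in the unit ball, a third of the area on the sphere; this also
  brings the image of n within reach of the volume estimate for differentiable maps between spaces
  of equal dimension. Compactness of the omitted set K keeps each value n(x) at a positive angle
  from K, so that the limit e -> 0 exists pointwise; the price is a small loss of volume. The full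
  volume \<delta>/3 would give the bound 2 pi^2/\<delta>, and since pi < 4 the constant 8
  pi/\<delta> leaves room for that loss. The obstacle is that a W^{1,2} map of the disc need not be
  continuous and may blow up null sets, hence the Lusin-type decomposition by a maximal function.
  The image of the remaining null set is never estimated: K has to be avoided by n(x) only for
  almost every x.\<close>

definition has_partials :: "(real^2 \<Rightarrow> 'b::real_normed_vector) \<Rightarrow> (real^2 \<Rightarrow> 'b) \<Rightarrow> (real^2 \<Rightarrow> 'b) \<Rightarrow> bool" where
  "has_partials f f1 f2 \<longleftrightarrow> (\<forall>x. (f has_derivative (\<lambda>h. h$1 *\<^sub>R f1 x + h$2 *\<^sub>R f2 x)) (at x))"

lemma partial_deriv_eqI:
  "(f has_derivative D) (at x) \<Longrightarrow> partial_deriv i f x = D (axis i 1)"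
  unfolding partial_deriv_def by (simp add: frechet_derivative_at[symmetric])

text \<open>Bridge from the real-valued \<open>partial_deriv\<close> of the statement to
  \<open>has_partials\<close>, which also covers vector-valued maps and names the partials in
  advance, so that derivatives of a convolution can be carried as convolutions with known
  kernels.\<close>

lemma has_partials_partial_deriv:
  assumes "\<And>x. f differentiable (at x)"
  shows "has_partials f (partial_deriv 1 f) (partial_deriv 2 f)"
  unfolding has_partials_def
proof
  fix x
  let ?D = "frechet_derivative f (at x)"
  have D: "(f has_derivative ?D) (at x)"
    using assms frechet_derivative_works by blast
  have lin: "linear ?D"
    using D by (simp add: has_derivative_linear)
  have "?D h = h$1 *\<^sub>R partial_deriv 1 f x + h$2 *\<^sub>R partial_deriv 2 f x" for h
  proof -
    have "h = h$1 *\<^sub>R axis 1 1 + h$2 *\<^sub>R axis 2 1"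
      by (simp add: vec_eq_iff forall_2 axis_def)
    then have "?D h = ?D (h$1 *\<^sub>R axis 1 1 + h$2 *\<^sub>R axis 2 1)" by simp
    also have "\<dots> = h$1 *\<^sub>R partial_deriv 1 f x + h$2 *\<^sub>R partial_deriv 2 f x"
      using lin by (simp add: linear_add linear_scale partial_deriv_def)
    finally show ?thesis .
  qed
  then have "?D = (\<lambda>h. h$1 *\<^sub>R partial_deriv 1 f x + h$2 *\<^sub>R partial_deriv 2 f x)" by blast
  then show "(f has_derivative (\<lambda>h. h$1 *\<^sub>R partial_deriv 1 f x + h$2 *\<^sub>R partial_deriv 2 f x)) (at x)"
    using D by simp
qed

lemma partial_deriv_has_partials:
  assumes "has_partials f f1 f2"
  shows "partial_deriv 1 f = f1" "partial_deriv 2 f = f2"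
proof -
  have "partial_deriv i f x = (axis i 1 :: real^2)$1 *\<^sub>R f1 x + (axis i 1 :: real^2)$2 *\<^sub>R f2 x" for i x
    using assms partial_deriv_eqI unfolding has_partials_def by blast
  then show "partial_deriv 1 f = f1" "partial_deriv 2 f = f2"
    by (auto simp: axis_def fun_eq_iff)
qed

lemma has_partials_differentiable: "has_partials f f1 f2 \<Longrightarrow> f differentiable (at x)"
  unfolding has_partials_def differentiable_def by blast

lemma has_partials_continuous: "has_partials f f1 f2 \<Longrightarrow> continuous_on UNIV f"
  by (meson continuous_at_imp_continuous_on differentiable_imp_continuous_within has_partials_differentiable)

lemma Ck_SucD: "Ck (Suc k) f \<Longrightarrow> Ck k f"
proof (induction k arbitrary: f)
  case 0
  then show ?case
    by (auto intro!: continuous_at_imp_continuous_on differentiable_imp_continuous_within)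
next
  case (Suc k)
  then show ?case by auto
qed

lemma Ck_add: "Ck k f \<Longrightarrow> Ck k g \<Longrightarrow> Ck k (\<lambda>x. f x + g x)"
proof (induction k arbitrary: f g)
  case 0
  then show ?case by (simp add: continuous_on_add)
next
  case (Suc k)
  have "partial_deriv i (\<lambda>x. f x + g x) = (\<lambda>x. partial_deriv i f x + partial_deriv i g x)" for i
    using Suc.prems
    by (auto simp: fun_eq_iff partial_deriv_def frechet_derivative_works
        intro!: partial_deriv_eqI[unfolded partial_deriv_def] has_derivative_add)
  then show ?case using Suc by auto
qed

lemma Ck_mult: "Ck k f \<Longrightarrow> Ck k g \<Longrightarrow> Ck k (\<lambda>x. f x * g x)"
proof (induction k arbitrary: f g)
  case 0
  then show ?case by (simp add: continuous_on_mult)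
next
  case (Suc k)
  have "partial_deriv i (\<lambda>x. f x * g x)
      = (\<lambda>x. f x * partial_deriv i g x + partial_deriv i f x * g x)" for i
    using Suc.prems
    by (auto simp: fun_eq_iff partial_deriv_def frechet_derivative_works
        intro!: partial_deriv_eqI[unfolded partial_deriv_def] has_derivative_mult)
  \<comment> \<open>The product rule pairs a derivative with an undifferentiated factor, so the
    factors themselves are needed one order lower.\<close>
  then show ?case using Suc Ck_SucD[OF Suc.prems(1)] Ck_SucD[OF Suc.prems(2)]
    by (auto intro!: Ck_add)
qed

lemma Ck_const [simp]: "Ck k (\<lambda>x. c)"
proof (induction k arbitrary: c)
  case (Suc k)
  have "partial_deriv i (\<lambda>x. c) = (\<lambda>x. 0)" for i
    by (simp add: partial_deriv_def fun_eq_iff)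
  then show ?case using Suc by simp
qed simp

lemma Ck_component [simp]: "Ck k (\<lambda>x. x $ j)"
proof (cases k)
  case (Suc l)
  have D: "((\<lambda>x. x $ j) has_derivative (\<lambda>h. h $ j)) (at x)" for x :: "real^2"
    by (rule bounded_linear_imp_has_derivative[OF bounded_linear_vec_nth])
  then have "partial_deriv i (\<lambda>x. x $ j) = (\<lambda>x. axis i 1 $ j)" for i
    by (auto simp: fun_eq_iff dest: partial_deriv_eqI)
  then show ?thesis using Suc D by (auto simp: differentiable_def)
qed (simp add: continuous_on_component continuous_on_id)

lemma Ck_diff: "Ck k f \<Longrightarrow> Ck k g \<Longrightarrow> Ck k (\<lambda>x. f x - g x)"
  using Ck_add[of k f "\<lambda>x. (-1) * g x"] Ck_mult[of k "\<lambda>x. -1" g] by simp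

text \<open>\<open>flat 0\<close> is the classical smooth function vanishing to infinite order at the origin; the other
  ones are needed because the family is closed under differentiation.\<close>

definition flat :: "nat \<Rightarrow> real \<Rightarrow> real" where
  "flat m t = (if t > 0 then (1/t)^m * exp (- (1/t)) else 0)"

lemma flat_tendsto_0: "(flat m \<longlongrightarrow> 0) (at 0)"
proof -
  have "((\<lambda>t::real. (1/t)^m * exp (- (1/t))) \<longlongrightarrow> 0) (at_right 0)"
  proof -
    have "((\<lambda>x::real. x^m / exp x) \<longlongrightarrow> 0) at_top"
      by (rule tendsto_power_div_exp_0)
    then have "((\<lambda>t::real. (inverse t)^m / exp (inverse t)) \<longlongrightarrow> 0) (at_right 0)"
      by (rule filterlim_compose[OF _ filterlim_inverse_at_top_right])
    then show ?thesis by (simp add: exp_minus divide_inverse)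
  qed
  then have "(flat m \<longlongrightarrow> 0) (at_right 0)"
    by (rule Lim_transform_eventually) (auto simp: eventually_at_filter flat_def)
  moreover have "(flat m \<longlongrightarrow> 0) (at_left 0)"
    by (rule Lim_transform_eventually[OF tendsto_const]) (auto simp: eventually_at_filter flat_def)
  ultimately show ?thesis by (simp add: filterlim_at_split)
qed

text \<open>For t > 0, differentiating (1/t)^m exp(-1/t) only raises the power, so the family is
  closed under differentiation. At 0 the difference quotient of \<open>flat m\<close> is
  \<open>flat (m + 1)\<close>, which tends to 0.\<close>

lemma flat_DERIV: "(flat m has_real_derivative (flat (m + 2) t - real m * flat (m + 1) t)) (at t)"
proof (cases t "0::real" rule: linorder_cases)
  case less
  have "((\<lambda>_. 0) has_real_derivative 0) (at t)" by simp
  then have "(flat m has_real_derivative 0) (at t)"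
    by (rule has_field_derivative_transform_within_open[where S="{..<0}"]) (use less in \<open>auto simp: flat_def\<close>)
  then show ?thesis using less by (simp add: flat_def)
next
  case equal
  have "((\<lambda>y. (flat m y - flat m 0) / (y - 0)) \<longlongrightarrow> 0) (at 0)"
  proof -
    have "(flat m y - flat m 0) / (y - 0) = flat (m + 1) y" if "y \<noteq> 0" for y
      using that by (simp add: flat_def)
    then show ?thesis
      using flat_tendsto_0[of "m+1"]
      by (auto intro: Lim_transform_eventually simp: eventually_at_filter)
  qed
  then show ?thesis
    using equal by (simp add: has_field_derivative_iff flat_def)
next
  case greater
  have inv: "((\<lambda>t. 1/t) has_real_derivative (- (1/t\<^sup>2))) (at t)"
    using greater by (auto intro!: derivative_eq_intros simp: power2_eq_square)
  have "((\<lambda>t. (1/t)^m * exp (- (1/t))) has_real_derivative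
      real m * (- (1/t\<^sup>2) * (1/t)^(m - Suc 0)) * exp (- (1/t)) + exp (- (1/t)) * (- (- (1/t\<^sup>2))) * (1/t)^m) (at t)"
    by (intro DERIV_mult DERIV_power[OF inv] DERIV_fun_exp DERIV_minus inv)
  \<comment> \<open>For m = 0 the truncated exponent \<open>m - Suc 0\<close> is harmless because
    the factor \<open>real m\<close> vanishes.\<close>
  moreover have "real m * (- (1/t\<^sup>2) * (1/t)^(m - Suc 0)) * exp (- (1/t)) + exp (- (1/t)) * (- (- (1/t\<^sup>2))) * (1/t)^m
      = flat (m + 2) t - real m * flat (m + 1) t"
    using greater by (cases m) (simp_all add: flat_def power2_eq_square mult_ac)
  ultimately have "((\<lambda>t. (1/t)^m * exp (- (1/t))) has_real_derivative (flat (m + 2) t - real m * flat (m + 1) t)) (at t)"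
    by simp
  then show ?thesis
    by (rule has_field_derivative_transform_within_open[where S="{0<..}"]) (use greater in \<open>auto simp: flat_def\<close>)
qed

lemma flat_nonneg: "flat m t \<ge> 0"
  by (simp add: flat_def)

lemma continuous_flat: "continuous_on UNIV (flat m)"
  by (auto intro!: continuous_at_imp_continuous_on DERIV_isCont[OF flat_DERIV])

text \<open>Induction on the order with \<open>m\<close> arbitrary, since one derivative leads from
  \<open>flat m\<close> to \<open>flat (m + 1)\<close> and \<open>flat (m + 2)\<close>.\<close>

lemma Ck_flat:
  assumes "\<And>k. Ck k g"
  shows "Ck k (\<lambda>x. flat m (g x))"
proof (induction k arbitrary: m)
  case 0
  have "continuous_on UNIV g" using assms[of 0] by simp
  then show ?case
    using continuous_on_compose2[OF continuous_flat] by fastforce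
next
  case (Suc k)
  have gd: "(g has_derivative frechet_derivative g (at x)) (at x)" for x
    using assms[of 1] by (simp add: frechet_derivative_works)
  have D: "((\<lambda>x. flat m (g x)) has_derivative
     (\<lambda>h. (flat (m + 2) (g x) - real m * flat (m + 1) (g x)) * frechet_derivative g (at x) h)) (at x)" for x
    using has_derivative_compose[OF gd flat_DERIV[unfolded has_field_derivative_def]]
    by (simp add: mult.commute)
  have "partial_deriv i (\<lambda>x. flat m (g x))
     = (\<lambda>x. (flat (m + 2) (g x) - real m * flat (m + 1) (g x)) * partial_deriv i g x)" for i
    by (auto simp: fun_eq_iff partial_deriv_eqI[OF D]) (simp add: partial_deriv_def)
  moreover have "Ck k (\<lambda>x. (flat (m + 2) (g x) - real m * flat (m + 1) (g x)) * partial_deriv i g x)" for i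
    using Suc assms[of "Suc k"] by (intro Ck_mult Ck_diff) auto
  ultimately show ?case
    using D by (auto simp: differentiable_def)
qed

section \<open>Radial bump functions\<close>

lemma norm_square_real2: "(norm (x::real^2))\<^sup>2 = (x$1)\<^sup>2 + (x$2)\<^sup>2"
  by (simp add: norm_vec_def L2_set_def UNIV_2)

text \<open>Smooth and radial, and for e > 0 positive exactly on the open ball of radius
  \<open>e\<close>. The index \<open>m\<close> is kept because the partials of \<open>bump m\<close>
  are built from \<open>bump (m + 1)\<close> and \<open>bump (m + 2)\<close>.\<close>

definition bump :: "nat \<Rightarrow> real \<Rightarrow> real^2 \<Rightarrow> real" where
  "bump m e x = flat m (1 - (norm x)\<^sup>2 / e\<^sup>2)"

lemma bump_alt: "bump m e x = flat m (1 - ((x$1)\<^sup>2 + (x$2)\<^sup>2) / e\<^sup>2)"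
  by (simp add: bump_def norm_square_real2)

lemma bump_nonneg: "bump m e x \<ge> 0"
  by (simp add: bump_def flat_nonneg)

lemma bump_eq_0: "e > 0 \<Longrightarrow> norm x \<ge> e \<Longrightarrow> bump m e x = 0"
proof -
  assume "e > 0" "norm x \<ge> e"
  then have "1 - (norm x)\<^sup>2 / e\<^sup>2 \<le> 0" using power_mono[of e "norm x" 2] by (simp add: field_simps)
  then show ?thesis by (simp add: bump_def flat_def)
qed

lemma bump_pos: "norm x < e \<Longrightarrow> bump m e x > 0"
proof -
  assume a: "norm x < e"
  then have "e > 0" by (meson norm_ge_zero order_le_less_trans)
  moreover from a have "(norm x)\<^sup>2 < e\<^sup>2" by (simp add: power_strict_mono)
  ultimately show ?thesis by (simp add: bump_def flat_def)
qed

lemma has_partials_bump: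
  "has_partials (bump m e)
     (\<lambda>x. (bump (m + 2) e x - real m * bump (m + 1) e x) * (- 2 * x$1 / e\<^sup>2))
     (\<lambda>x. (bump (m + 2) e x - real m * bump (m + 1) e x) * (- 2 * x$2 / e\<^sup>2))"
  unfolding has_partials_def
proof
  fix x :: "real^2"
  have "((\<lambda>x. 1 - ((x$1)\<^sup>2 + (x$2)\<^sup>2) / e\<^sup>2) has_derivative (\<lambda>h. - (2 * x$1 * h$1 + 2 * x$2 * h$2) / e\<^sup>2)) (at x)"
    unfolding divide_inverse
    by (auto intro!: derivative_eq_intros bounded_linear_imp_has_derivative[OF bounded_linear_vec_nth]
        simp: algebra_simps)
  from has_derivative_compose[OF this flat_DERIV[unfolded has_field_derivative_def]]
  show "(bump m e has_derivative
     (\<lambda>h. h$1 *\<^sub>R ((bump (m + 2) e x - real m * bump (m + 1) e x) * (- 2 * x$1 / e\<^sup>2)) +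
          h$2 *\<^sub>R ((bump (m + 2) e x - real m * bump (m + 1) e x) * (- 2 * x$2 / e\<^sup>2)))) (at x)"
    unfolding bump_alt[abs_def]
    by (rule has_derivative_eq_rhs) (auto simp: fun_eq_iff algebra_simps add_divide_distrib diff_divide_distrib)
qed

lemma continuous_bump: "continuous_on UNIV (bump m e)"
  using has_partials_bump has_partials_continuous by blast

text \<open>The quadratic is written out as a polynomial in the coordinates, so that
  \<open>Ck_flat\<close> applies. Reflected and translated bumps are the test functions that turn
  weak derivatives into convolutions.\<close>

lemma Ck_bump_shift: "Ck k (\<lambda>y. bump m e (x - y))"
proof -
  have "Ck k (\<lambda>y. 1 - ((x$1 - y$1)*(x$1 - y$1) + (x$2 - y$2)*(x$2 - y$2)) * inverse (e\<^sup>2))" for k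
    by (intro Ck_diff Ck_mult Ck_add Ck_const Ck_component)
  from Ck_flat[OF this, of k m] show ?thesis
    by (simp add: bump_alt power2_eq_square divide_inverse)
qed

section \<open>Integration of partial derivatives\<close>

lemma lborel_distr_reflect: "distr lborel borel (\<lambda>y. c - y) = (lborel :: 'a::euclidean_space measure)"
  by (subst (2) lborel_affine[of "-1" c]) (simp_all add: density_1)

lemma lborel_integral_translate:
  fixes f :: "'a::euclidean_space \<Rightarrow> 'b::{banach, second_countable_topology}"
  assumes "f \<in> borel_measurable borel"
  shows "(LINT x|lborel. f (x + c)) = (LINT x|lborel. f x)"
proof -
  have "(LINT x|lborel. f x) = (LINT x|distr lborel borel ((+) c). f x)" by (simp add: lborel_distr_plus)
  also have "\<dots> = (LINT x|lborel. f (c + x))" using assms by (subst integral_distr) auto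
  finally show ?thesis by (simp add: add.commute)
qed

lemma lborel_nn_integral_translate:
  fixes f :: "'a::euclidean_space \<Rightarrow> ennreal"
  assumes "f \<in> borel_measurable borel"
  shows "(\<integral>\<^sup>+x. f (x - c) \<partial>lborel) = (\<integral>\<^sup>+x. f x \<partial>lborel)"
proof -
  have "(\<integral>\<^sup>+x. f x \<partial>lborel) = (\<integral>\<^sup>+x. f x \<partial>distr lborel borel ((+) (-c)))" by (simp add: lborel_distr_plus)
  also have "\<dots> = (\<integral>\<^sup>+x. f (-c + x) \<partial>lborel)" using assms by (subst nn_integral_distr) auto
  finally show ?thesis by simp
qed

lemma lborel_integral_reflect:
  fixes f :: "'a::euclidean_space \<Rightarrow> 'b::{banach, second_countable_topology}"
  assumes "f \<in> borel_measurable borel"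
  shows "(LINT x|lborel. f (c - x)) = (LINT x|lborel. f x)"
proof -
  have "(LINT x|lborel. f x) = (LINT x|distr lborel borel (\<lambda>y. c - y). f x)" by (simp add: lborel_distr_reflect)
  also have "\<dots> = (LINT x|lborel. f (c - x))" using assms by (subst integral_distr) auto
  finally show ?thesis by simp
qed

lemma lborel_integrable_reflect:
  fixes f :: "'a::euclidean_space \<Rightarrow> 'b::{banach, second_countable_topology}"
  assumes "integrable lborel f"
  shows "integrable lborel (\<lambda>x. f (c - x))"
proof -
  have "integrable (distr lborel borel (\<lambda>y. c - y)) f" using assms by (simp add: lborel_distr_reflect)
  then show ?thesis by (rule integrable_distr[rotated]) simp
qed

lemma continuous_compact_support_bounded:
  fixes f :: "'a::euclidean_space \<Rightarrow> 'b::real_normed_vector"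
  assumes "continuous_on UNIV f" "\<And>x. norm x \<ge> R \<Longrightarrow> f x = 0"
  obtains B where "B > 0" "\<And>x. norm (f x) \<le> B"
proof -
  have "compact (f ` cball 0 R)"
    using assms(1) by (intro compact_continuous_image continuous_on_subset[OF assms(1)]) auto
  then have "bounded (f ` cball 0 R)" by (rule compact_imp_bounded)
  then obtain B where B: "B > 0" "\<And>x. x \<in> cball 0 R \<Longrightarrow> norm (f x) \<le> B"
    by (auto simp: bounded_pos)
  have "norm (f x) \<le> B" for x
  proof (cases "norm x \<le> R")
    case True
    then show ?thesis using B by auto
  next
    case False
    then show ?thesis using assms(2)[of x] B(1) by simp
  qed
  then show ?thesis using that B by blast
qed

lemma integrable_bounded_support:
  fixes f :: "'a::euclidean_space \<Rightarrow> 'b::{banach, second_countable_topology}"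
  assumes "f \<in> borel_measurable borel" "\<And>x. norm x \<ge> R \<Longrightarrow> f x = 0" "\<And>x. norm (f x) \<le> B"
  shows "integrable lborel f"
proof (rule Bochner_Integration.integrable_bound)
  show "integrable lborel (\<lambda>x::'a. indicator (cball 0 R) x *\<^sub>R B)"
    by (intro integrable_scaleR_left integrable_real_indicator) (use emeasure_lborel_cball_finite in \<open>auto simp: infinity_ennreal_def\<close>)
  show "AE x in lborel. norm (f x) \<le> norm (indicator (cball 0 R) x *\<^sub>R B :: real)"
  proof (rule AE_I2)
    fix x :: 'a
    have "B \<ge> 0" using assms(3)[of x] norm_ge_zero order_trans by blast
    then show "norm (f x) \<le> norm (indicator (cball 0 R) x *\<^sub>R B :: real)"
      using assms(2)[of x] assms(3)[of x] by (cases "norm x \<le> R") (auto simp: indicator_def)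
  qed
qed (use assms in auto)

lemma integrable_continuous_compact_support:
  fixes f :: "'a::euclidean_space \<Rightarrow> 'b::{banach, second_countable_topology}"
  assumes "continuous_on UNIV f" "\<And>x. norm x \<ge> R \<Longrightarrow> f x = 0"
  shows "integrable lborel f"
proof -
  obtain B where "\<And>x. norm (f x) \<le> B"
    using continuous_compact_support_bounded[OF assms] by blast
  with borel_measurable_continuous_onI[OF assms(1)] assms(2) show ?thesis
    by (rule integrable_bounded_support)
qed

lemma vector_derivative_quotient:
  assumes "(f has_vector_derivative v) (at 0)"
  shows "((\<lambda>t. (f t - f 0) /\<^sub>R t) \<longlongrightarrow> v) (at 0)"
proof -
  have "((\<lambda>t. (1 / norm (t - 0)) *\<^sub>R (f t - (f 0 + (t - 0) *\<^sub>R v))) \<longlongrightarrow> 0) (at 0)"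
    using assms unfolding has_vector_derivative_def has_derivative_within by simp
  then have lim: "((\<lambda>t. norm ((1 / norm (t - 0)) *\<^sub>R (f t - (f 0 + (t - 0) *\<^sub>R v)))) \<longlongrightarrow> 0) (at 0)"
    by (rule tendsto_norm_zero)
  have eq: "norm ((1 / norm (t - 0)) *\<^sub>R (f t - (f 0 + (t - 0) *\<^sub>R v))) = norm ((f t - f 0) /\<^sub>R t - v)"
    if "t \<noteq> 0" for t :: real
  proof -
    have "(f t - f 0) /\<^sub>R t - v = (1/t) *\<^sub>R (f t - (f 0 + t *\<^sub>R v))"
      using that by (simp add: scaleR_diff_right scaleR_add_right divide_inverse)
    then show ?thesis by simp
  qed
  have "((\<lambda>t. norm ((f t - f 0) /\<^sub>R t - v)) \<longlongrightarrow> 0) (at 0)"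
    by (rule Lim_transform_eventually[OF lim]) (unfold eventually_at_filter, rule always_eventually, use eq in blast)
  then show ?thesis
    by (rule LIM_zero_cancel[OF tendsto_norm_zero_cancel])
qed

text \<open>Mean value inequality on the segment; the factor 2 comes from |h1| + |h2| <= 2
  |h|.\<close>

lemma has_partials_increment:
  fixes g :: "real^2 \<Rightarrow> 'b::euclidean_space"
  assumes "has_partials g g1 g2" "\<And>y. y \<in> closed_segment x z \<Longrightarrow> norm (g1 y) \<le> B \<and> norm (g2 y) \<le> B"
  shows "norm (g z - g x) \<le> 2 * B * norm (z - x)"
proof -
  have "norm (g1 x) \<le> B" using assms(2)[OF ends_in_segment(1)] by simp
  then have B: "B \<ge> 0" by (rule order_trans[OF norm_ge_zero])
  have "norm (g z - g x) \<le> (2 * B) * norm (z - x)"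
  proof (rule differentiable_bound[of "closed_segment x z"])
    show "(g has_derivative (\<lambda>h. h$1 *\<^sub>R g1 y + h$2 *\<^sub>R g2 y)) (at y within closed_segment x z)" for y
      by (rule has_derivative_at_withinI) (use assms(1) in \<open>simp add: has_partials_def\<close>)
    show "onorm (\<lambda>h::real^2. h$1 *\<^sub>R g1 y + h$2 *\<^sub>R g2 y) \<le> 2 * B" if "y \<in> closed_segment x z" for y
    proof (rule onorm_le)
      fix h :: "real^2"
      have "norm (h$1 *\<^sub>R g1 y + h$2 *\<^sub>R g2 y) \<le> \<bar>h$1\<bar> * norm (g1 y) + \<bar>h$2\<bar> * norm (g2 y)"
        by (metis norm_scaleR norm_triangle_ineq)
      also have "\<dots> \<le> norm h * B + norm h * B"
        using assms(2)[OF that] component_le_norm_cart[of h] B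
        by (intro add_mono mult_mono) auto
      finally show "norm (h$1 *\<^sub>R g1 y + h$2 *\<^sub>R g2 y) \<le> 2 * B * norm h" by simp
    qed
  qed auto
  then show ?thesis .
qed

text \<open>The difference quotient of \<open>g\<close> in a unit direction has integral zero by
  translation invariance, and dominated convergence, with a Lipschitz bound for \<open>g\<close>,
  carries this over to the directional derivative. Every integration by parts below rests on
  this.\<close>

lemma integral_partial_eq_0:
  fixes g :: "real^2 \<Rightarrow> 'b::euclidean_space"
  assumes g: "has_partials g g1 g2" and cont: "continuous_on UNIV g1" "continuous_on UNIV g2"
    and supp: "\<And>x. norm x \<ge> R \<Longrightarrow> g x = 0" "\<And>x. norm x \<ge> R \<Longrightarrow> g1 x = 0" "\<And>x. norm x \<ge> R \<Longrightarrow> g2 x = 0"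
  shows "(LINT x|lborel. g1 x) = 0" "(LINT x|lborel. g2 x) = 0"
proof -
  have cg: "continuous_on UNIV g" using g by (rule has_partials_continuous)
  obtain B1 where B1: "\<And>x. norm (g1 x) \<le> B1" using continuous_compact_support_bounded[OF cont(1) supp(2)] by blast
  obtain B2 where B2: "\<And>x. norm (g2 x) \<le> B2" using continuous_compact_support_bounded[OF cont(2) supp(3)] by blast
  define B where "B = max B1 B2"
  have B: "norm (g1 x) \<le> B" "norm (g2 x) \<le> B" for x
    using B1[of x] B2[of x] by (auto simp: B_def)
  have B0: "B \<ge> 0" using B(1)[of 0] norm_ge_zero order_trans by blast
  have ig: "integrable lborel g" using cg supp(1) by (rule integrable_continuous_compact_support)
  \<comment> \<open>A general unit vector \<open>e\<close> treats both partials at once; the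
    coordinate directions are inserted at the end.\<close>
  have "(LINT x|lborel. e$1 *\<^sub>R g1 x + e$2 *\<^sub>R g2 x) = 0" if e: "norm e = 1" for e :: "real^2"
  proof -
    define q where "q = (\<lambda>n x. real (Suc n) *\<^sub>R (g (x + (1 / real (Suc n)) *\<^sub>R e) - g x))"
    \<comment> \<open>The shifts have length at most 1, so all difference quotients vanish outside
      the ball of radius R + 1.\<close>
    have far: "norm x - 1 \<le> norm (x + (1 / real (Suc n)) *\<^sub>R e)" for x n
    proof -
      have "norm ((1 / real (Suc n)) *\<^sub>R e) \<le> 1" using e by simp
      then show ?thesis using norm_diff_ineq[of x "(1 / real (Suc n)) *\<^sub>R e"] by linarith
    qed
    have cq: "continuous_on UNIV (\<lambda>x. g (x + (1 / real (Suc n)) *\<^sub>R e))" for n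
      by (intro continuous_on_compose2[OF cg] continuous_intros) auto
    have q0: "(LINT x|lborel. q n x) = 0" for n
    proof -
      have "integrable lborel (\<lambda>x. g (x + (1 / real (Suc n)) *\<^sub>R e))"
      proof (rule integrable_continuous_compact_support[OF cq])
        show "R + 1 \<le> norm x \<Longrightarrow> g (x + (1 / real (Suc n)) *\<^sub>R e) = 0" for x
          using supp(1) far[of x n] by simp
      qed
      then show ?thesis
        using ig by (simp add: q_def lborel_integral_translate[OF borel_measurable_integrable[OF ig, simplified]])
    qed
    have "(\<lambda>n. LINT x|lborel. q n x) \<longlonglongrightarrow> (LINT x|lborel. e$1 *\<^sub>R g1 x + e$2 *\<^sub>R g2 x)"
    proof (rule integral_dominated_convergence[where w="\<lambda>x. indicator (cball 0 (R + 1)) x *\<^sub>R (2 * B)"])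
      show "AE x in lborel. (\<lambda>n. q n x) \<longlonglongrightarrow> e$1 *\<^sub>R g1 x + e$2 *\<^sub>R g2 x"
      proof (rule AE_I2)
        fix x
        have aff: "((\<lambda>t. x + t *\<^sub>R e) has_derivative (\<lambda>t. t *\<^sub>R e)) (at 0)"
          by (auto intro!: derivative_eq_intros)
        have "(g has_derivative (\<lambda>h. h$1 *\<^sub>R g1 x + h$2 *\<^sub>R g2 x)) (at (x + 0 *\<^sub>R e))"
          using g unfolding has_partials_def by simp
        from has_derivative_compose[OF aff this]
        have "((\<lambda>t. g (x + t *\<^sub>R e)) has_derivative (\<lambda>t. (t *\<^sub>R e)$1 *\<^sub>R g1 x + (t *\<^sub>R e)$2 *\<^sub>R g2 x)) (at 0)" .
        then have "((\<lambda>t. g (x + t *\<^sub>R e)) has_vector_derivative (e$1 *\<^sub>R g1 x + e$2 *\<^sub>R g2 x)) (at 0)"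
          unfolding has_vector_derivative_def
          by (rule has_derivative_eq_rhs) (auto simp: algebra_simps)
        from vector_derivative_quotient[OF this]
        have "filterlim (\<lambda>t. (g (x + t *\<^sub>R e) - g x) /\<^sub>R t) (nhds (e$1 *\<^sub>R g1 x + e$2 *\<^sub>R g2 x)) (at 0)"
          by simp
        moreover have "filterlim (\<lambda>n. 1 / real (Suc n)) (at 0) sequentially"
          using LIMSEQ_inverse_real_of_nat
          by (auto simp: filterlim_at inverse_eq_divide)
        ultimately have "(\<lambda>n. (g (x + (1 / real (Suc n)) *\<^sub>R e) - g x) /\<^sub>R (1 / real (Suc n))) \<longlonglongrightarrow> (e$1 *\<^sub>R g1 x + e$2 *\<^sub>R g2 x)"
          by (rule filterlim_compose)
        then show "(\<lambda>n. q n x) \<longlonglongrightarrow> e$1 *\<^sub>R g1 x + e$2 *\<^sub>R g2 x"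
          by (simp add: q_def)
      qed
      show "integrable lborel (\<lambda>x::real^2. indicator (cball 0 (R + 1)) x *\<^sub>R (2 * B))"
        by (intro integrable_scaleR_left integrable_real_indicator) (use emeasure_lborel_cball_finite in \<open>auto simp: infinity_ennreal_def\<close>)
      show "AE x in lborel. norm (q n x) \<le> indicator (cball 0 (R + 1)) x *\<^sub>R (2 * B)" for n
      proof (rule AE_I2)
        fix x
        show "norm (q n x) \<le> indicator (cball 0 (R + 1)) x *\<^sub>R (2 * B)"
        proof (cases "norm x \<le> R + 1")
          case True
          have "norm (g (x + (1 / real (Suc n)) *\<^sub>R e) - g x) \<le> 2 * B * norm ((x + (1 / real (Suc n)) *\<^sub>R e) - x)"
            using B by (intro has_partials_increment[OF g]) auto
          also have "\<dots> = 2 * B / real (Suc n)" using e by simp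
          finally have "real (Suc n) * norm (g (x + (1 / real (Suc n)) *\<^sub>R e) - g x) \<le> 2 * B"
            by (simp add: field_simps)
          moreover have "norm (q n x) = real (Suc n) * norm (g (x + (1 / real (Suc n)) *\<^sub>R e) - g x)"
            unfolding q_def norm_scaleR by simp
          ultimately show ?thesis using True by simp
        next
          case False
          then show ?thesis using False far[of x n] supp(1)[of x] supp(1)[of "x + (1 / real (Suc n)) *\<^sub>R e"]
            by (simp add: q_def)
        qed
      qed
      show "(\<lambda>x. e$1 *\<^sub>R g1 x + e$2 *\<^sub>R g2 x) \<in> borel_measurable lborel"
        using cont by (auto intro!: borel_measurable_continuous_onI continuous_intros)
      have "continuous_on UNIV (q n)" for n
        unfolding q_def by (intro continuous_intros cg cq)
      then show "q n \<in> borel_measurable lborel" for n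
        by (simp add: borel_measurable_continuous_onI)
    qed
    then show ?thesis using q0 by (simp add: LIMSEQ_const_iff)
  qed
  from this[of "axis 1 1"] this[of "axis 2 1"]
  show "(LINT x|lborel. g1 x) = 0" "(LINT x|lborel. g2 x) = 0"
    by (simp_all add: norm_axis_1) (simp_all add: axis_def)
qed

section \<open>Mollification of square integrable functions\<close>

definition conv :: "('a::euclidean_space \<Rightarrow> real) \<Rightarrow> ('a \<Rightarrow> 'b::{banach, second_countable_topology}) \<Rightarrow> 'a \<Rightarrow> 'b" where
  "conv \<phi> f x = (LINT y|lborel. \<phi> (x - y) *\<^sub>R f y)"

lemma continuous_compact_support_uniform:
  fixes f :: "'a::euclidean_space \<Rightarrow> 'b::real_normed_vector"
  assumes "continuous_on UNIV f" "\<And>x. norm x \<ge> R \<Longrightarrow> f x = 0" "e > 0"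
  obtains d where "d > 0" "\<And>x y. norm (x - y) < d \<Longrightarrow> norm (f x - f y) < e"
proof -
  have "uniformly_continuous_on (cball 0 (R + 1)) f"
    by (intro compact_uniformly_continuous continuous_on_subset[OF assms(1)]) auto
  then obtain d where d: "d > 0"
     "\<And>x y. x \<in> cball 0 (R+1) \<Longrightarrow> y \<in> cball 0 (R+1) \<Longrightarrow> dist y x < d \<Longrightarrow> dist (f y) (f x) < e"
    using assms(3) unfolding uniformly_continuous_on_def by meson
  \<comment> \<open>Points closer than 1 either both lie in the ball of radius R + 1, where uniform
    continuity applies, or both lie where \<open>f\<close> vanishes.\<close>
  have "norm (f x - f y) < e" if xy: "norm (x - y) < min d 1" for x y
  proof (cases "norm x \<le> R + 1 \<and> norm y \<le> R + 1")
    case True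
    then show ?thesis using d(2)[of y x] xy by (auto simp: dist_norm)
  next
    case False
    have "\<bar>norm x - norm y\<bar> < 1" using xy norm_triangle_ineq3[of x y] by linarith
    then have "norm x \<ge> R" "norm y \<ge> R" using False by linarith+
    then show ?thesis using assms by simp
  qed
  then show ?thesis using that[of "min d 1"] d(1) by simp
qed

lemma integrable_bounded_scaleR:
  fixes f :: "'a::euclidean_space \<Rightarrow> 'b::{banach, second_countable_topology}"
  assumes "integrable lborel f" "g \<in> borel_measurable borel" "\<And>x. \<bar>g x\<bar> \<le> B"
  shows "integrable lborel (\<lambda>x. g x *\<^sub>R f x)"
proof (rule Bochner_Integration.integrable_bound)
  show "integrable lborel (\<lambda>x. B * norm (f x))" using assms(1) by auto
  show "AE x in lborel. norm (g x *\<^sub>R f x) \<le> norm (B * norm (f x))"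
  proof (rule AE_I2)
    fix x
    have "\<bar>g x\<bar> \<le> \<bar>B\<bar>" using assms(3)[of x] by linarith
    then show "norm (g x *\<^sub>R f x) \<le> norm (B * norm (f x))" by (simp add: abs_mult mult_right_mono)
  qed
qed (use assms in auto)

lemma conv_integrand_integrable:
  fixes f :: "'a::euclidean_space \<Rightarrow> 'b::{banach, second_countable_topology}"
  assumes "continuous_on UNIV \<phi>" "\<And>x. norm x \<ge> R \<Longrightarrow> \<phi> x = 0" "integrable lborel f"
  shows "integrable lborel (\<lambda>y. \<phi> (x - y) *\<^sub>R f y)"
proof -
  obtain B where "\<And>x. norm (\<phi> x) \<le> B"
    using continuous_compact_support_bounded[OF assms(1,2)] by blast
  moreover have "(\<lambda>y. \<phi> (x - y)) \<in> borel_measurable borel"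
    by (intro borel_measurable_continuous_onI continuous_on_compose2[OF assms(1)] continuous_intros) auto
  ultimately show ?thesis using assms(3) by (intro integrable_bounded_scaleR) auto
qed

lemma conv_continuous:
  fixes f :: "'a::euclidean_space \<Rightarrow> 'b::{banach, second_countable_topology}"
  assumes \<phi>: "continuous_on UNIV \<phi>" "\<And>x. norm x \<ge> R \<Longrightarrow> \<phi> x = 0" and f: "integrable lborel f"
  shows "continuous_on UNIV (conv \<phi> f)"
  unfolding continuous_on_iff
proof (intro ballI allI impI)
  fix x :: 'a and e :: real
  assume "e > 0"
  define F where "F = (LINT y|lborel. norm (f y))"
  have F: "F \<ge> 0" by (simp add: F_def)
  \<comment> \<open>Dividing by F + 1 rather than F covers the case that \<open>f\<close> vanishes
    almost everywhere.\<close>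
  obtain d where d: "d > 0" "\<And>x y. norm (x - y) < d \<Longrightarrow> norm (\<phi> x - \<phi> y) < e / (F + 1)"
    using continuous_compact_support_uniform[OF \<phi>, where e="e / (F + 1)"] \<open>e > 0\<close> F by auto
  have "dist (conv \<phi> f x') (conv \<phi> f x) < e" if x': "dist x' x < d" for x'
  proof -
    have i: "integrable lborel (\<lambda>y. \<phi> (x - y) *\<^sub>R f y)" for x
      by (rule conv_integrand_integrable[OF \<phi> f])
    have "norm (conv \<phi> f x' - conv \<phi> f x) = norm (LINT y|lborel. (\<phi> (x' - y) - \<phi> (x - y)) *\<^sub>R f y)"
      by (simp add: conv_def i scaleR_diff_left)
    also have "\<dots> \<le> (LINT y|lborel. e / (F + 1) * norm (f y))"
    proof (rule order_trans[OF integral_norm_bound integral_mono])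
      show "integrable lborel (\<lambda>y. norm ((\<phi> (x' - y) - \<phi> (x - y)) *\<^sub>R f y))"
        unfolding scaleR_diff_left using i by (intro integrable_norm Bochner_Integration.integrable_diff)
      show "integrable lborel (\<lambda>y. e / (F + 1) * norm (f y))" using f by auto
      show "norm ((\<phi> (x' - y) - \<phi> (x - y)) *\<^sub>R f y) \<le> e / (F + 1) * norm (f y)" for y
        unfolding norm_scaleR using d(2)[of "x' - y" "x - y"] x'
        by (intro mult_right_mono) (auto simp: dist_norm)
    qed
    also have "\<dots> = e * (F / (F + 1))" by (simp add: F_def)
    also have "\<dots> < e" using \<open>e > 0\<close> F by (simp add: field_simps)
    finally show ?thesis by (simp add: dist_norm)
  qed
  then show "\<exists>d>0. \<forall>x'\<in>UNIV. dist x' x < d \<longrightarrow> dist (conv \<phi> f x') (conv \<phi> f x) < e" using d(1) by blast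
qed

text \<open>All derivatives fall on the kernel. Uniform continuity of its partials makes its
  first-order remainder at most 2 e' |h|, uniformly in the base point, and integration against |f|
  keeps that rate.\<close>

lemma conv_has_partials:
  fixes f :: "real^2 \<Rightarrow> 'b::euclidean_space"
  assumes \<phi>: "has_partials \<phi> \<phi>1 \<phi>2" and supp: "\<And>x. norm x \<ge> R \<Longrightarrow> \<phi> x = 0"
    and \<phi>1: "continuous_on UNIV \<phi>1" "\<And>x. norm x \<ge> R \<Longrightarrow> \<phi>1 x = 0"
    and \<phi>2: "continuous_on UNIV \<phi>2" "\<And>x. norm x \<ge> R \<Longrightarrow> \<phi>2 x = 0"
    and f: "integrable lborel f"
  shows "has_partials (conv \<phi> f) (conv \<phi>1 f) (conv \<phi>2 f)"
  unfolding has_partials_def has_derivative_within_alt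
proof (intro allI conjI impI)
  fix x :: "real^2"
  show "bounded_linear (\<lambda>h::real^2. h$1 *\<^sub>R conv \<phi>1 f x + h$2 *\<^sub>R conv \<phi>2 f x)"
    by (intro bounded_linear_add bounded_linear_scaleR_const bounded_linear_vec_nth)
  fix e :: real
  assume "e > 0"
  define F where "F = (LINT y|lborel. norm (f y))"
  have F: "F \<ge> 0" by (simp add: F_def)
  define e' where "e' = e / (2 * (F + 1))"
  have e': "e' > 0" using \<open>e > 0\<close> F by (simp add: e'_def)
  obtain d1 where d1: "d1 > 0" "\<And>x y. norm (x - y) < d1 \<Longrightarrow> norm (\<phi>1 x - \<phi>1 y) < e'"
    using continuous_compact_support_uniform[OF \<phi>1 e'] by blast
  obtain d2 where d2: "d2 > 0" "\<And>x y. norm (x - y) < d2 \<Longrightarrow> norm (\<phi>2 x - \<phi>2 y) < e'"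
    using continuous_compact_support_uniform[OF \<phi>2 e'] by blast
  define d where "d = min d1 d2"
  have inc: "\<bar>\<phi> (x + h) - \<phi> x - (h$1 * \<phi>1 x + h$2 * \<phi>2 x)\<bar> \<le> 2 * e' * norm h" if h: "norm h < d" for x h
  proof -
    \<comment> \<open>Subtracting the linear part at \<open>x\<close> turns the remainder into an
      increment of a function with small partials.\<close>
    define \<psi> where "\<psi> y = \<phi> y - (y$1 *\<^sub>R \<phi>1 x + y$2 *\<^sub>R \<phi>2 x)" for y
    have p\<psi>: "has_partials \<psi> (\<lambda>y. \<phi>1 y - \<phi>1 x) (\<lambda>y. \<phi>2 y - \<phi>2 x)"
      unfolding has_partials_def
    proof
      fix y
      have "(\<phi> has_derivative (\<lambda>h. h$1 *\<^sub>R \<phi>1 y + h$2 *\<^sub>R \<phi>2 y)) (at y)"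
        using \<phi> unfolding has_partials_def by blast
      moreover have "bounded_linear (\<lambda>y::real^2. y$1 *\<^sub>R \<phi>1 x + y$2 *\<^sub>R \<phi>2 x)"
        by (intro bounded_linear_add bounded_linear_scaleR_const bounded_linear_vec_nth)
      ultimately show "(\<psi> has_derivative (\<lambda>h. h$1 *\<^sub>R (\<phi>1 y - \<phi>1 x) + h$2 *\<^sub>R (\<phi>2 y - \<phi>2 x))) (at y)"
        unfolding \<psi>_def[abs_def]
        by (intro has_derivative_eq_rhs[OF has_derivative_diff[OF _ bounded_linear_imp_has_derivative]])
          (auto simp: algebra_simps)
    qed
    have "norm (\<psi> (x + h) - \<psi> x) \<le> 2 * e' * norm ((x + h) - x)"
    proof (rule has_partials_increment[OF p\<psi>])
      fix y assume "y \<in> closed_segment x (x + h)"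
      then have "norm (y - x) \<le> norm h"
        using segment_bound(1)[of y x "x+h"] by simp
      then have "norm (y - x) < d1" "norm (y - x) < d2" using h by (auto simp: d_def)
      then show "norm (\<phi>1 y - \<phi>1 x) \<le> e' \<and> norm (\<phi>2 y - \<phi>2 x) \<le> e'"
        using d1(2) d2(2) less_imp_le by blast
    qed
    then show ?thesis by (simp add: \<psi>_def algebra_simps)
  qed
  have i: "integrable lborel (\<lambda>y. \<phi> (x - y) *\<^sub>R f y)" for x
    using conv_integrand_integrable[OF has_partials_continuous[OF \<phi>] supp f] .
  have i1: "integrable lborel (\<lambda>y. \<phi>1 (x - y) *\<^sub>R f y)" for x by (rule conv_integrand_integrable[OF \<phi>1 f])
  have i2: "integrable lborel (\<lambda>y. \<phi>2 (x - y) *\<^sub>R f y)" for x by (rule conv_integrand_integrable[OF \<phi>2 f])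
  have "norm (conv \<phi> f x' - conv \<phi> f x - ((x' - x)$1 *\<^sub>R conv \<phi>1 f x + (x' - x)$2 *\<^sub>R conv \<phi>2 f x)) \<le> e * norm (x' - x)"
    if x': "norm (x' - x) < d" for x'
  proof -
    define h where "h = x' - x"
    let ?r = "\<lambda>y. (\<phi> (x' - y) - \<phi> (x - y) - (h$1 * \<phi>1 (x - y) + h$2 * \<phi>2 (x - y)))"
    have r: "?r y *\<^sub>R f y = \<phi> (x' - y) *\<^sub>R f y - \<phi> (x - y) *\<^sub>R f y -
        (h$1 *\<^sub>R (\<phi>1 (x - y) *\<^sub>R f y) + h$2 *\<^sub>R (\<phi>2 (x - y) *\<^sub>R f y))" for y
      by (simp add: algebra_simps)
    have ir: "integrable lborel (\<lambda>y. ?r y *\<^sub>R f y)"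
      unfolding r by (intro Bochner_Integration.integrable_diff Bochner_Integration.integrable_add integrable_scaleR_right i i1 i2)
    have "conv \<phi> f x' - conv \<phi> f x - (h$1 *\<^sub>R conv \<phi>1 f x + h$2 *\<^sub>R conv \<phi>2 f x) = (LINT y|lborel. ?r y *\<^sub>R f y)"
      unfolding r using i i1 i2 by (simp add: conv_def scaleR_scaleR[symmetric] del: scaleR_scaleR)
    also have "norm \<dots> \<le> (LINT y|lborel. (2 * e' * norm h) * norm (f y))"
    proof (rule order_trans[OF integral_norm_bound integral_mono])
      show "integrable lborel (\<lambda>y. norm (?r y *\<^sub>R f y))" using ir by (rule integrable_norm)
      show "integrable lborel (\<lambda>y. (2 * e' * norm h) * norm (f y))" using f by auto
      fix y
      have "\<bar>?r y\<bar> \<le> 2 * e' * norm h" using inc[of h "x - y"] x' by (simp add: h_def)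
      then show "norm (?r y *\<^sub>R f y) \<le> (2 * e' * norm h) * norm (f y)"
        by (simp only: norm_scaleR real_norm_def) (intro mult_right_mono, auto)
    qed
    also have "\<dots> = e * norm h * (F / (F + 1))" using F by (simp add: F_def[symmetric] e'_def field_simps)
    also have "\<dots> \<le> e * norm h * 1" using F \<open>e > 0\<close> by (intro mult_left_mono) auto
    finally show ?thesis by (simp add: h_def)
  qed
  then show "\<exists>d>0. \<forall>y\<in>UNIV. norm (y - x) < d \<longrightarrow> norm (conv \<phi> f y - conv \<phi> f x
      - ((y - x)$1 *\<^sub>R conv \<phi>1 f x + (y - x)$2 *\<^sub>R conv \<phi>2 f x)) \<le> e * norm (y - x)"
    using d1(1) d2(1) by (intro exI[of _ d]) (auto simp: d_def)
qed

lemma conv_eq_0: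
  assumes "\<And>x. norm x \<ge> e \<Longrightarrow> \<phi> x = 0" "\<And>x. norm x \<ge> R \<Longrightarrow> f x = 0" "norm x \<ge> R + e"
  shows "conv \<phi> f x = 0"
proof -
  have "\<phi> (x - y) *\<^sub>R f y = 0" for y
  proof (cases "norm y \<ge> R")
    case False
    then have "norm (x - y) \<ge> e" using norm_triangle_ineq2[of x y] assms(3) by linarith
    then show ?thesis using assms(1) by simp
  qed (use assms(2) in simp)
  then have "(\<lambda>y. \<phi> (x - y) *\<^sub>R f y) = (\<lambda>_. 0)" by blast
  then show ?thesis by (simp add: conv_def)
qed

section \<open>Mollifiers and convergence in mean square\<close>

definition mollifier :: "real \<Rightarrow> ('a::euclidean_space \<Rightarrow> real) \<Rightarrow> bool" where
  "mollifier e \<phi> \<longleftrightarrow> continuous_on UNIV \<phi> \<and> (\<forall>x. \<phi> x \<ge> 0) \<and> (\<forall>x. norm x \<ge> e \<longrightarrow> \<phi> x = 0) \<and> (LINT x|lborel. \<phi> x) = 1"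

lemma mollifierD:
  assumes "mollifier e \<phi>"
  shows "continuous_on UNIV \<phi>" "\<phi> x \<ge> 0" "norm x \<ge> e \<Longrightarrow> \<phi> x = 0" "(LINT x|lborel. \<phi> x) = 1"
    "integrable lborel \<phi>"
  using assms integrable_continuous_compact_support[of \<phi> e] by (auto simp: mollifier_def)

lemma mollifier_reflect:
  assumes "mollifier e \<phi>"
  shows "integrable lborel (\<lambda>y. \<phi> (x - y))" "(LINT y|lborel. \<phi> (x - y)) = 1"
  using lborel_integrable_reflect[OF mollifierD(5)[OF assms]]
    lborel_integral_reflect[of \<phi> x] mollifierD(4)[OF assms] borel_measurable_continuous_onI[OF mollifierD(1)[OF assms]]
  by auto

text \<open>An average of values in a ball stays in the ball. For the mollified map and a unit
  vector y this keeps 1 + e - a . y at least \<open>e\<close>, so the smoothed primitive can be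
  evaluated along it.\<close>

lemma conv_norm_le:
  fixes f :: "'a::euclidean_space \<Rightarrow> 'b::{banach, second_countable_topology}"
  assumes \<phi>: "mollifier e \<phi>" and f: "\<And>x. norm (f x) \<le> M" "integrable lborel f"
  shows "norm (conv \<phi> f x) \<le> M"
proof -
  have "norm (conv \<phi> f x) \<le> (LINT y|lborel. \<phi> (x - y) * M)"
    unfolding conv_def
  proof (rule order_trans[OF integral_norm_bound integral_mono])
    show "integrable lborel (\<lambda>y. norm (\<phi> (x - y) *\<^sub>R f y))"
      using conv_integrand_integrable[OF mollifierD(1)[OF \<phi>] mollifierD(3)[OF \<phi>] f(2)] by (rule integrable_norm)
    show "integrable lborel (\<lambda>y. \<phi> (x - y) * M)" using mollifier_reflect[OF \<phi>] by auto
    show "norm (\<phi> (x - y) *\<^sub>R f y) \<le> \<phi> (x - y) * M" for y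
      using f(1)[of y] mollifierD(2)[OF \<phi>, of "x - y"] by (simp add: mult_left_mono)
  qed
  also have "\<dots> = M" using mollifier_reflect[OF \<phi>] by simp
  finally show ?thesis .
qed

lemma norm_add_square_le:
  fixes a b :: "'a::real_inner"
  shows "(norm (a + b))\<^sup>2 \<le> 2 * (norm a)\<^sup>2 + 2 * (norm b)\<^sup>2"
proof -
  have "(norm (a + b))\<^sup>2 + (norm (a - b))\<^sup>2 = 2 * (norm a)\<^sup>2 + 2 * (norm b)\<^sup>2"
    by (simp add: power2_norm_eq_inner algebra_simps)
  then show ?thesis by (smt (verit) zero_le_power2)
qed

lemma norm_diff_square_le:
  fixes a b :: "'a::real_inner"
  shows "(norm (a - b))\<^sup>2 \<le> 2 * (norm a)\<^sup>2 + 2 * (norm b)\<^sup>2"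
  using norm_add_square_le[of a "- b"] by simp

text \<open>Jensen's inequality for the square, from \<open>0 \<le> \<integral> \<phi> |h - m|\<^sup>2\<close> with \<open>m\<close> the mean of \<open>h\<close>.\<close>

lemma mean_square_le:
  fixes h :: "'a \<Rightarrow> 'b::euclidean_space"
  assumes \<phi>: "integrable M \<phi>" "(LINT x|M. \<phi> x) = 1" "\<And>x. \<phi> x \<ge> 0"
    and h: "integrable M (\<lambda>x. \<phi> x *\<^sub>R h x)" and h2: "integrable M (\<lambda>x. \<phi> x * (norm (h x))\<^sup>2)"
  shows "(norm (LINT x|M. \<phi> x *\<^sub>R h x))\<^sup>2 \<le> (LINT x|M. \<phi> x * (norm (h x))\<^sup>2)"
proof -
  define m where "m = (LINT x|M. \<phi> x *\<^sub>R h x)"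
  have eq: "\<phi> x * (norm (h x - m))\<^sup>2 = \<phi> x * (norm (h x))\<^sup>2 - 2 * ((\<phi> x *\<^sub>R h x) \<bullet> m) + (norm m)\<^sup>2 * \<phi> x" for x
    by (simp add: power2_norm_eq_inner algebra_simps inner_commute)
  have "0 \<le> (LINT x|M. \<phi> x * (norm (h x - m))\<^sup>2)"
    using \<phi>(3) by (intro integral_nonneg_AE) auto
  also have "\<dots> = (LINT x|M. \<phi> x * (norm (h x))\<^sup>2) - 2 * (m \<bullet> m) + (norm m)\<^sup>2"
  proof -
    have i: "integrable M (\<lambda>x. (\<phi> x *\<^sub>R h x) \<bullet> m)" using h by (rule integrable_inner_left)
    have "(LINT x|M. (\<phi> x *\<^sub>R h x) \<bullet> m) = m \<bullet> m" using h by (simp add: integral_inner_left m_def del: inner_scaleR_left)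
    then show ?thesis unfolding eq using i h2 \<phi> by (simp del: inner_scaleR_left)
  qed
  finally show ?thesis by (simp add: m_def power2_norm_eq_inner)
qed

lemma L2_truncation:
  fixes f :: "'a::euclidean_space \<Rightarrow> 'b::euclidean_space"
  assumes f: "f \<in> borel_measurable borel" "integrable lborel (\<lambda>x. (norm (f x))\<^sup>2)" and "e > 0"
  obtains M where "M > 0" "(LINT x|lborel. (norm (f x - (if norm (f x) \<le> M then f x else 0)))\<^sup>2) < e"
proof -
  let ?g = "\<lambda>n x. (norm (f x - (if norm (f x) \<le> real (Suc n) then f x else 0)))\<^sup>2"
  have "(\<lambda>n. LINT x|lborel. ?g n x) \<longlonglongrightarrow> (LINT x|(lborel::'a measure). 0)"
  proof (rule integral_dominated_convergence[where w="\<lambda>x. (norm (f x))\<^sup>2"])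
    show "AE x in lborel. (\<lambda>n. ?g n x) \<longlonglongrightarrow> 0"
    proof (rule AE_I2)
      fix x
      obtain N where N: "norm (f x) \<le> real N" using real_arch_simple by blast
      have "\<forall>\<^sub>F n in sequentially. ?g n x = 0"
        using eventually_ge_at_top[of N] by eventually_elim (use N in auto)
      then show "(\<lambda>n. ?g n x) \<longlonglongrightarrow> 0" by (rule tendsto_eventually)
    qed
  qed (use f in auto)
  then have "\<forall>\<^sub>F n in sequentially. (LINT x|lborel. ?g n x) < e"
    using \<open>e > 0\<close> by (intro order_tendstoD(2)) simp_all
  then obtain n where "(LINT x|lborel. ?g n x) < e" by (auto simp: eventually_sequentially)
  then show ?thesis using that[of "real (Suc n)"] by simp
qed

text \<open>Truncation makes \<open>f\<close> bounded. Continuous functions approximating it almost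
  everywhere are then forced into the same ball by the nearest-point projection and multiplied by a
  cutoff; bounded and with a common support, they converge in mean square by dominated
  convergence.\<close>

lemma L2_approx_continuous:
  fixes f :: "'a::euclidean_space \<Rightarrow> 'b::euclidean_space"
  assumes f: "f \<in> borel_measurable borel" "integrable lborel (\<lambda>x. (norm (f x))\<^sup>2)"
    and supp: "\<And>x. norm x \<ge> R \<Longrightarrow> f x = 0" and "e > 0"
  obtains g where "continuous_on UNIV g" "\<And>x. norm x \<ge> R + 1 \<Longrightarrow> g x = 0"
    "integrable lborel (\<lambda>x. (norm (f x - g x))\<^sup>2)" "(LINT x|lborel. (norm (f x - g x))\<^sup>2) < e"
proof -
  obtain M where M: "M > 0" "(LINT x|lborel. (norm (f x - (if norm (f x) \<le> M then f x else 0)))\<^sup>2) < e / 4"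
    using L2_truncation[OF f, of "e/4"] \<open>e > 0\<close> by auto
  define f' where "f' x = (if norm (f x) \<le> M then f x else 0)" for x
  have f'm[measurable]: "f' \<in> borel_measurable borel"
    unfolding f'_def[abs_def] using f(1) by measurable
  have "f' \<in> borel_measurable lebesgue" by (simp add: f'm measurable_completion)
  then have "f' measurable_on UNIV" by (rule lebesgue_measurable_imp_measurable_on) simp
  then obtain N g where N: "negligible N" and g: "\<And>n. continuous_on UNIV (g n)" "\<And>x. x \<notin> N \<Longrightarrow> (\<lambda>n. g n x) \<longlonglongrightarrow> f' x"
    unfolding measurable_on_def by auto
  \<comment> \<open>Equal to 1 for |x| <= R and to 0 for |x| >= R + 1, so the pointwise limit is
    unchanged wherever \<open>f'\<close> is non-zero.\<close>
  define cut where "cut x = max 0 (min 1 (R + 1 - norm x))" for x :: 'a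
  define h where "h n x = cut x *\<^sub>R closest_point (cball 0 M) (g n x)" for n x
  have clc: "continuous_on UNIV (closest_point (cball (0::'b) M))"
    using M(1) by (intro continuous_on_closest_point) auto
  have hc: "continuous_on UNIV (h n)" for n
    unfolding h_def[abs_def] cut_def
    by (intro continuous_intros continuous_on_compose2[OF clc g(1)]) auto
  have h0: "h n x = 0" if "norm x \<ge> R + 1" for n x using that by (simp add: h_def cut_def)
  have clM: "norm (closest_point (cball 0 M) y) \<le> M" for y :: 'b
    using closest_point_in_set[of "cball (0::'b) M" y] M(1) by auto
  have hM: "norm (h n x) \<le> M" for n x
    using mult_mono[of "\<bar>cut x\<bar>" 1, OF _ clM[of "g n x"]] by (auto simp: h_def cut_def)
  have f'M: "norm (f' x) \<le> M" for x using M(1) by (simp add: f'_def)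
  have hf: "(\<lambda>n. h n x) \<longlonglongrightarrow> f' x" if "x \<notin> N" for x
  proof -
    have "(\<lambda>n. closest_point (cball 0 M) (g n x)) \<longlonglongrightarrow> closest_point (cball 0 M) (f' x)"
      using clc g(2)[OF that] by (rule continuous_on_tendsto_compose) auto
    also have "closest_point (cball 0 M) (f' x) = f' x"
      using f'M[of x] by (intro closest_point_self) simp
    finally have "(\<lambda>n. h n x) \<longlonglongrightarrow> cut x *\<^sub>R f' x" unfolding h_def by (intro tendsto_intros)
    also have "cut x *\<^sub>R f' x = f' x"
      using supp[of x] by (cases "norm x \<ge> R") (auto simp: f'_def cut_def)
    finally show ?thesis .
  qed
  have hm[measurable]: "h n \<in> borel_measurable borel" for n using hc by (rule borel_measurable_continuous_onI)
  have "(\<lambda>n. LINT x|lborel. (norm (f' x - h n x))\<^sup>2) \<longlonglongrightarrow> (LINT x|(lborel::'a measure). 0)"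
  proof (rule integral_dominated_convergence[where w="\<lambda>x. indicator (cball 0 (R + 1)) x *\<^sub>R (4 * M\<^sup>2)"])
    show "integrable lborel (\<lambda>x::'a. indicator (cball 0 (R + 1)) x *\<^sub>R (4 * M\<^sup>2))"
      by (intro integrable_scaleR_left integrable_real_indicator) (use emeasure_lborel_cball_finite in \<open>auto simp: infinity_ennreal_def\<close>)
    show "AE x in lborel. (\<lambda>n. (norm (f' x - h n x))\<^sup>2) \<longlonglongrightarrow> 0"
    proof -
      have "AE x in lebesgue. x \<notin> N" using N by (simp add: negligible_iff_null_sets AE_not_in)
      then have "AE x in lborel. x \<notin> N" by (simp add: AE_completion_iff)
      then show ?thesis
      proof eventually_elim
        case (elim x)
        have "(\<lambda>n. (norm (f' x - h n x))\<^sup>2) \<longlonglongrightarrow> (norm (f' x - f' x))\<^sup>2"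
          by (intro tendsto_intros hf elim)
        then show ?case by simp
      qed
    qed
    show "AE x in lborel. norm ((norm (f' x - h n x))\<^sup>2) \<le> indicator (cball 0 (R + 1)) x *\<^sub>R (4 * M\<^sup>2)" for n
    proof (rule AE_I2)
      fix x
      have "norm (f' x - h n x) \<le> 2 * M" using f'M[of x] hM[of n x] norm_triangle_ineq4[of "f' x" "h n x"] by linarith
      then have "(norm (f' x - h n x))\<^sup>2 \<le> (2 * M)\<^sup>2" by (rule power_mono) simp
      moreover have "f' x - h n x = 0" if "norm x > R + 1" using that supp[of x] h0[of x n] by (simp add: f'_def)
      ultimately show "norm ((norm (f' x - h n x))\<^sup>2) \<le> indicator (cball 0 (R + 1)) x *\<^sub>R (4 * M\<^sup>2)"
        by (cases "norm x \<le> R + 1") (auto simp: power_mult_distrib)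
    qed
  qed auto
  then have "\<forall>\<^sub>F n in sequentially. (LINT x|lborel. (norm (f' x - h n x))\<^sup>2) < e / 4"
    using order_tendstoD(2)[of _ _ _ "e / 4"] \<open>e > 0\<close> by fastforce
  then obtain n where n: "(LINT x|lborel. (norm (f' x - h n x))\<^sup>2) < e / 4" by (auto simp: eventually_sequentially)
  have i1: "integrable lborel (\<lambda>x. (norm (f x - f' x))\<^sup>2)"
    by (rule Bochner_Integration.integrable_bound[OF f(2)]) (use f(1) in \<open>auto simp: f'_def\<close>)
  have i2: "integrable lborel (\<lambda>x. (norm (f' x - h n x))\<^sup>2)"
  proof (rule integrable_bounded_support[where R="R + 1" and B="(2*M)\<^sup>2"])
    fix x
    have "norm (f' x - h n x) \<le> 2 * M" using f'M[of x] hM[of n x] norm_triangle_ineq4[of "f' x" "h n x"] by linarith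
    then show "norm ((norm (f' x - h n x))\<^sup>2) \<le> (2 * M)\<^sup>2" using power_mono[of _ "2 * M" 2] by simp
    show "(norm (f' x - h n x))\<^sup>2 = 0" if "R + 1 \<le> norm x" using that supp[of x] h0[of x n] by (simp add: f'_def)
  qed measurable
  have le: "(norm (f x - h n x))\<^sup>2 \<le> 2 * (norm (f x - f' x))\<^sup>2 + 2 * (norm (f' x - h n x))\<^sup>2" for x
    using norm_add_square_le[of "f x - f' x" "f' x - h n x"] by simp
  have i3: "integrable lborel (\<lambda>x. 2 * (norm (f x - f' x))\<^sup>2 + 2 * (norm (f' x - h n x))\<^sup>2)"
    using i1 i2 by auto
  have i4: "integrable lborel (\<lambda>x. (norm (f x - h n x))\<^sup>2)"
    by (rule Bochner_Integration.integrable_bound[OF i3]) (use f(1) le in \<open>auto intro!: AE_I2 order_trans[OF le] \<close>)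
  have "(LINT x|lborel. (norm (f x - h n x))\<^sup>2) \<le> (LINT x|lborel. 2 * (norm (f x - f' x))\<^sup>2 + 2 * (norm (f' x - h n x))\<^sup>2)"
    by (intro integral_mono i3 i4 le)
  also have "\<dots> < e" using M(2) n i1 i2 by (simp add: f'_def[symmetric])
  finally show ?thesis using that[OF hc h0 i4] by blast
qed

text \<open>For a continuous function of compact support this is uniform continuity. The error of
  replacing \<open>f\<close> by such a \<open>g\<close> enters twice, once translated, and
  translation invariance makes both contributions equal.\<close>

lemma L2_translation_continuous:
  fixes f :: "'a::euclidean_space \<Rightarrow> 'b::euclidean_space"
  assumes f: "f \<in> borel_measurable borel" "integrable lborel (\<lambda>x. (norm (f x))\<^sup>2)"
    and supp: "\<And>x. norm x \<ge> R \<Longrightarrow> f x = 0" and "e > 0"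
  obtains d where "d > 0"
    "\<And>z. norm z < d \<Longrightarrow> (\<integral>\<^sup>+x. ennreal ((norm (f (x - z) - f x))\<^sup>2) \<partial>lborel) \<le> ennreal e"
proof -
  have e12: "e / 12 > 0" using \<open>e > 0\<close> by simp
  obtain g where g: "continuous_on UNIV g" "\<And>x. norm x \<ge> R + 1 \<Longrightarrow> g x = 0"
    and gi: "integrable lborel (\<lambda>x. (norm (f x - g x))\<^sup>2)" and ge: "(LINT x|lborel. (norm (f x - g x))\<^sup>2) < e / 12"
    using L2_approx_continuous[OF f supp e12] by blast
  note [measurable] = f(1) borel_measurable_continuous_onI[OF g(1)]
  define V where "V = measure lborel (cball (0::'a) (R + 2))"
  have V: "emeasure lborel (cball (0::'a) (R + 2)) = ennreal V" "V \<ge> 0"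
    using emeasure_lborel_cball_finite[of "0::'a" "R+2"] unfolding V_def
    by (auto simp: emeasure_eq_ennreal_measure)
  \<comment> \<open>Chosen so that the contribution 2 b^2 V of \<open>g\<close> is at most e/3; the
    two copies of the approximation error contribute 4 (e/12) each.\<close>
  define b where "b = sqrt (e / (6 * (V + 1)))"
  have b: "b > 0" "b\<^sup>2 = e / (6 * (V + 1))" using \<open>e > 0\<close> V(2) by (auto simp: b_def)
  obtain d where d: "d > 0" "\<And>x y. norm (x - y) < d \<Longrightarrow> norm (g x - g y) < b"
    using continuous_compact_support_uniform[OF g b(1)] by blast
  have ge': "(\<integral>\<^sup>+x. ennreal ((norm (f x - g x))\<^sup>2) \<partial>lborel) \<le> ennreal (e / 12)"
    using gi ge by (subst nn_integral_eq_integral) (auto intro!: ennreal_leI)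
  have "(\<integral>\<^sup>+x. ennreal ((norm (f (x - z) - f x))\<^sup>2) \<partial>lborel) \<le> ennreal e" if z: "norm z < min d 1" for z
  proof -
    have p: "ennreal ((norm (f (x - z) - f x))\<^sup>2) \<le> 4 * ennreal ((norm (f (x - z) - g (x - z)))\<^sup>2)
        + (4 * ennreal ((norm (f x - g x))\<^sup>2) + ennreal (2 * b\<^sup>2) * indicator (cball 0 (R + 2)) x)" for x
    proof -
      have gz: "(norm (g (x - z) - g x))\<^sup>2 \<le> b\<^sup>2 * indicator (cball 0 (R + 2)) x"
      proof (cases "norm x \<le> R + 2")
        case True
        have "norm (g (x - z) - g x) < b" using d(2)[of "x - z" x] z by simp
        then show ?thesis using True by (simp add: power_mono)
      next
        case False
        then have "norm (x - z) \<ge> R + 1" using norm_triangle_ineq2[of x z] z by linarith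
        then show ?thesis using False g(2) by simp
      qed
      have "f (x - z) - f x = ((f (x - z) - g (x - z)) - (f x - g x)) + (g (x - z) - g x)" by simp
      then have "(norm (f (x - z) - f x))\<^sup>2 \<le> 2 * (norm ((f (x - z) - g (x - z)) - (f x - g x)))\<^sup>2 + 2 * (norm (g (x - z) - g x))\<^sup>2"
        using norm_add_square_le by metis
      moreover have "(norm ((f (x - z) - g (x - z)) - (f x - g x)))\<^sup>2 \<le> 2 * (norm (f (x - z) - g (x - z)))\<^sup>2 + 2 * (norm (f x - g x))\<^sup>2"
        by (rule norm_diff_square_le)
      ultimately have "(norm (f (x - z) - f x))\<^sup>2 \<le> 4 * (norm (f (x - z) - g (x - z)))\<^sup>2
          + (4 * (norm (f x - g x))\<^sup>2 + 2 * b\<^sup>2 * indicator (cball 0 (R + 2)) x)"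
        using gz by linarith
      then have "ennreal ((norm (f (x - z) - f x))\<^sup>2) \<le> ennreal (4 * (norm (f (x - z) - g (x - z)))\<^sup>2
          + (4 * (norm (f x - g x))\<^sup>2 + 2 * b\<^sup>2 * indicator (cball 0 (R + 2)) x))" by (rule ennreal_leI)
      then show ?thesis by (simp add: ennreal_plus ennreal_mult ennreal_indicator)
    qed
    have "(\<integral>\<^sup>+x. ennreal ((norm (f (x - z) - f x))\<^sup>2) \<partial>lborel)
      \<le> (\<integral>\<^sup>+x. 4 * ennreal ((norm (f (x - z) - g (x - z)))\<^sup>2)
        + (4 * ennreal ((norm (f x - g x))\<^sup>2) + ennreal (2 * b\<^sup>2) * indicator (cball 0 (R + 2)) x) \<partial>lborel)"
      using p by (rule nn_integral_mono)
    also have "\<dots> = 4 * (\<integral>\<^sup>+x. ennreal ((norm (f (x - z) - g (x - z)))\<^sup>2) \<partial>lborel)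
        + (4 * (\<integral>\<^sup>+x. ennreal ((norm (f x - g x))\<^sup>2) \<partial>lborel) + ennreal (2 * b\<^sup>2) * ennreal V)"
    proof -
      have m: "(\<lambda>x. ennreal ((norm (f (x - z) - g (x - z)))\<^sup>2)) \<in> borel_measurable lborel"
        "(\<lambda>x. ennreal ((norm (f x - g x))\<^sup>2)) \<in> borel_measurable lborel"
        by measurable
      have m3: "(\<lambda>x. ennreal (2 * b\<^sup>2) * indicator (cball 0 (R + 2)) x) \<in> borel_measurable (lborel :: 'a measure)"
        by (intro borel_measurable_times_ennreal borel_measurable_const borel_measurable_indicator) simp
      have m': "(\<lambda>x. 4 * ennreal ((norm (f (x - z) - g (x - z)))\<^sup>2)) \<in> borel_measurable lborel"
        "(\<lambda>x. 4 * ennreal ((norm (f x - g x))\<^sup>2)) \<in> borel_measurable lborel"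
        by measurable
      note m'' = borel_measurable_add[OF m'(2) m3]
      show ?thesis
        unfolding nn_integral_add[OF m'(1) m''] nn_integral_add[OF m'(2) m3] nn_integral_cmult[OF m(1)] nn_integral_cmult[OF m(2)]
        by (subst nn_integral_cmult_indicator) (simp_all add: V(1))
    qed
    also have "(\<integral>\<^sup>+x. ennreal ((norm (f (x - z) - g (x - z)))\<^sup>2) \<partial>lborel) = (\<integral>\<^sup>+x. ennreal ((norm (f x - g x))\<^sup>2) \<partial>lborel)"
      by (rule lborel_nn_integral_translate[where f="\<lambda>x. ennreal ((norm (f x - g x))\<^sup>2)"]) measurable
    also have "4 * (\<integral>\<^sup>+x. ennreal ((norm (f x - g x))\<^sup>2) \<partial>lborel)
        + (4 * (\<integral>\<^sup>+x. ennreal ((norm (f x - g x))\<^sup>2) \<partial>lborel) + ennreal (2 * b\<^sup>2) * ennreal V)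
        \<le> 4 * ennreal (e / 12) + (4 * ennreal (e / 12) + ennreal (2 * b\<^sup>2) * ennreal V)"
      by (intro add_mono mult_left_mono ge') auto
    also have "\<dots> = ennreal (4 * (e / 12) + (4 * (e / 12) + (2 * b\<^sup>2) * V))"
    proof -
      have *: "4 * ennreal a + (4 * ennreal a + ennreal c * ennreal v) = ennreal (4 * a + (4 * a + c * v))"
        if "a \<ge> 0" "c \<ge> 0" "v \<ge> 0" for a c v
      proof -
        have e: "ennreal (4 * a) = 4 * ennreal a" "ennreal (c * v) = ennreal c * ennreal v"
          using that by (simp_all add: ennreal_mult)
        have plus: "ennreal (x + (y + z)) = ennreal x + (ennreal y + ennreal z)" if "x \<ge> 0" "y \<ge> 0" "z \<ge> 0" for x y z
          using that by (simp add: ennreal_plus)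
        have "ennreal (4 * a + (4 * a + c * v)) = ennreal (4 * a) + (ennreal (4 * a) + ennreal (c * v))"
          by (rule plus) (use that in auto)
        then show ?thesis unfolding e by (rule sym)
      qed
      show ?thesis by (rule *) (use \<open>e > 0\<close> V(2) in auto)
    qed
    also have "\<dots> \<le> ennreal e"
    proof (rule ennreal_leI)
      have "(2 * b\<^sup>2) * V \<le> e / 3" using \<open>e > 0\<close> V(2) unfolding b(2) by (simp add: field_simps)
      then show "4 * (e / 12) + (4 * (e / 12) + (2 * b\<^sup>2) * V) \<le> e" by simp
    qed
    finally show ?thesis .
  qed
  then show ?thesis using that[of "min d 1"] d(1) by simp
qed

text \<open>Uses |f| <= 1 + |f|^2 on a ball, which has finite measure.\<close>

lemma integrable_of_L2_bounded_support:
  fixes f :: "'a::euclidean_space \<Rightarrow> 'b::euclidean_space"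
  assumes f: "f \<in> borel_measurable borel" "integrable lborel (\<lambda>x. (norm (f x))\<^sup>2)"
    and supp: "\<And>x. norm x \<ge> R \<Longrightarrow> f x = 0"
  shows "integrable lborel f"
proof (rule Bochner_Integration.integrable_bound)
  show "integrable lborel (\<lambda>x::'a. indicator (cball 0 R) x *\<^sub>R 1 + (norm (f x))\<^sup>2)"
    by (intro Bochner_Integration.integrable_add integrable_scaleR_left integrable_real_indicator f(2))
      (use emeasure_lborel_cball_finite in \<open>auto simp: infinity_ennreal_def\<close>)
  show "AE x in lborel. norm (f x) \<le> norm (indicator (cball 0 R) x *\<^sub>R 1 + (norm (f x))\<^sup>2 :: real)"
  proof (rule AE_I2)
    fix x
    have "norm (f x) \<le> 1 + (norm (f x))\<^sup>2"
      using zero_le_power2[of "norm (f x) - 1 / 2"] by (simp add: power2_eq_square algebra_simps)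
    then show "norm (f x) \<le> norm (indicator (cball 0 R) x *\<^sub>R 1 + (norm (f x))\<^sup>2 :: real)"
      using supp[of x] by (cases "norm x \<le> R") auto
  qed
qed (use f in auto)

text \<open>Jensen's inequality bounds |conv f - f|^2 at x by the kernel average of |f(x - z) -
  f(x)|^2, and exchanging the integrals leaves an average of translation errors over |z| < r. The
  threshold \<open>d\<close> serves every mollifier, so one kernel can be used for a map and its
  weak derivatives together.\<close>

lemma conv_L2_tendsto:
  fixes f :: "'a::euclidean_space \<Rightarrow> 'b::euclidean_space"
  assumes f: "f \<in> borel_measurable borel" "integrable lborel (\<lambda>x. (norm (f x))\<^sup>2)"
    and supp: "\<And>x. norm x \<ge> R \<Longrightarrow> f x = 0" and "e > 0"
  obtains d where "d > 0"
    "\<And>r \<phi>. mollifier r \<phi> \<Longrightarrow> r < d \<Longrightarrow> (\<integral>\<^sup>+x. ennreal ((norm (conv \<phi> f x - f x))\<^sup>2) \<partial>lborel) \<le> ennreal e"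
proof -
  obtain d where d: "d > 0"
    "\<And>z. norm z < d \<Longrightarrow> (\<integral>\<^sup>+x. ennreal ((norm (f (x - z) - f x))\<^sup>2) \<partial>lborel) \<le> ennreal e"
    using L2_translation_continuous[OF assms] by blast
  note [measurable] = f(1)
  have fi: "integrable lborel f" by (rule integrable_of_L2_bounded_support[OF f supp])
  have "(\<integral>\<^sup>+x. ennreal ((norm (conv \<phi> f x - f x))\<^sup>2) \<partial>lborel) \<le> ennreal e"
    if m: "mollifier r \<phi>" and r: "r < d" for r \<phi>
  proof -
    note \<phi> = mollifierD[OF m]
    note [measurable] = borel_measurable_continuous_onI[OF \<phi>(1)]
    obtain B where B: "\<And>x. \<bar>\<phi> x\<bar> \<le> B"
      using continuous_compact_support_bounded[OF \<phi>(1) \<phi>(3)] unfolding real_norm_def by blast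
    have pt: "ennreal ((norm (conv \<phi> f x - f x))\<^sup>2) \<le> (\<integral>\<^sup>+z. ennreal (\<phi> z) * ennreal ((norm (f (x - z) - f x))\<^sup>2) \<partial>lborel)" for x
    proof -
      have i1: "integrable lborel (\<lambda>z. \<phi> z *\<^sub>R f (x - z))"
        by (rule integrable_bounded_scaleR[OF lborel_integrable_reflect[OF fi] _ B]) measurable
      have i2: "integrable lborel (\<lambda>z. \<phi> z *\<^sub>R f x)" using \<phi>(5) by auto
      have i12: "integrable lborel (\<lambda>z. \<phi> z *\<^sub>R (f (x - z) - f x))"
        unfolding scaleR_diff_right using i1 i2 by (rule Bochner_Integration.integrable_diff)
      have j1: "integrable lborel (\<lambda>z. \<phi> z *\<^sub>R (2 * (norm (f (x - z)))\<^sup>2))"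
        by (rule integrable_bounded_scaleR[OF _ _ B])
          (use lborel_integrable_reflect[OF f(2), of x] in auto)
      have j2: "integrable lborel (\<lambda>z. \<phi> z *\<^sub>R (2 * (norm (f x))\<^sup>2))"
        using \<phi>(5) by auto
      have j12: "integrable lborel (\<lambda>z. \<phi> z * (norm (f (x - z) - f x))\<^sup>2)"
      proof (rule Bochner_Integration.integrable_bound[OF Bochner_Integration.integrable_add[OF j1 j2]])
        show "AE z in lborel. norm (\<phi> z * (norm (f (x - z) - f x))\<^sup>2)
            \<le> norm (\<phi> z *\<^sub>R (2 * (norm (f (x - z)))\<^sup>2) + \<phi> z *\<^sub>R (2 * (norm (f x))\<^sup>2))"
        proof (rule AE_I2)
          fix z
          have "\<phi> z * (norm (f (x - z) - f x))\<^sup>2 \<le> \<phi> z * (2 * (norm (f (x - z)))\<^sup>2 + 2 * (norm (f x))\<^sup>2)"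
            using norm_add_square_le[of "f (x - z)" "- f x"] \<phi>(2)[of z] by (intro mult_left_mono) auto
          then show "norm (\<phi> z * (norm (f (x - z) - f x))\<^sup>2)
            \<le> norm (\<phi> z *\<^sub>R (2 * (norm (f (x - z)))\<^sup>2) + \<phi> z *\<^sub>R (2 * (norm (f x))\<^sup>2))"
            using \<phi>(2)[of z] by (simp add: abs_mult distrib_left)
        qed
      qed measurable
      have "conv \<phi> f x = (LINT z|lborel. \<phi> z *\<^sub>R f (x - z))"
        unfolding conv_def using lborel_integral_reflect[of "\<lambda>z. \<phi> z *\<^sub>R f (x - z)" x] by simp
      then have eq: "conv \<phi> f x - f x = (LINT z|lborel. \<phi> z *\<^sub>R (f (x - z) - f x))"
        unfolding scaleR_diff_right using i1 i2 \<phi>(4,5) by simp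
      have "(norm (conv \<phi> f x - f x))\<^sup>2 \<le> (LINT z|lborel. \<phi> z * (norm (f (x - z) - f x))\<^sup>2)"
        unfolding eq by (rule mean_square_le[OF \<phi>(5,4,2) i12 j12])
      then have "ennreal ((norm (conv \<phi> f x - f x))\<^sup>2) \<le> ennreal (LINT z|lborel. \<phi> z * (norm (f (x - z) - f x))\<^sup>2)"
        by (rule ennreal_leI)
      also have "\<dots> = (\<integral>\<^sup>+z. ennreal (\<phi> z * (norm (f (x - z) - f x))\<^sup>2) \<partial>lborel)"
        using j12 \<phi>(2) by (subst nn_integral_eq_integral) auto
      also have "\<dots> = (\<integral>\<^sup>+z. ennreal (\<phi> z) * ennreal ((norm (f (x - z) - f x))\<^sup>2) \<partial>lborel)"
        using \<phi>(2) by (simp add: ennreal_mult)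
      finally show ?thesis .
    qed
    have "(\<integral>\<^sup>+x. ennreal ((norm (conv \<phi> f x - f x))\<^sup>2) \<partial>lborel)
      \<le> (\<integral>\<^sup>+x. (\<integral>\<^sup>+z. ennreal (\<phi> z) * ennreal ((norm (f (x - z) - f x))\<^sup>2) \<partial>lborel) \<partial>lborel)"
      by (intro nn_integral_mono pt)
    also have "\<dots> = (\<integral>\<^sup>+z. (\<integral>\<^sup>+x. ennreal (\<phi> z) * ennreal ((norm (f (x - z) - f x))\<^sup>2) \<partial>lborel) \<partial>lborel)"
      by (rule lborel_pair.Fubini') measurable
    also have "\<dots> = (\<integral>\<^sup>+z. ennreal (\<phi> z) * (\<integral>\<^sup>+x. ennreal ((norm (f (x - z) - f x))\<^sup>2) \<partial>lborel) \<partial>lborel)"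
      by (intro nn_integral_cong nn_integral_cmult) measurable
    also have "\<dots> \<le> (\<integral>\<^sup>+z. ennreal (\<phi> z) * ennreal e \<partial>lborel)"
    proof (rule nn_integral_mono)
      fix z
      show "ennreal (\<phi> z) * (\<integral>\<^sup>+x. ennreal ((norm (f (x - z) - f x))\<^sup>2) \<partial>lborel) \<le> ennreal (\<phi> z) * ennreal e"
        using \<phi>(3)[of z] d(2)[of z] r by (cases "norm z < d") (auto intro!: mult_left_mono)
    qed
    also have "\<dots> = (\<integral>\<^sup>+z. ennreal (\<phi> z) \<partial>lborel) * ennreal e" by (rule nn_integral_multc) measurable
    also have "\<dots> = ennreal e" using \<phi>(2,4,5) by (subst nn_integral_eq_integral) auto
    finally show ?thesis .
  qed
  then show ?thesis using that d(1) by blast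
qed

section \<open>Smooth approximation of weakly differentiable maps\<close>

lemma has_partials_mult:
  fixes f g :: "real^2 \<Rightarrow> real"
  assumes "has_partials f f1 f2" "has_partials g g1 g2"
  shows "has_partials (\<lambda>x. f x * g x) (\<lambda>x. f x * g1 x + f1 x * g x) (\<lambda>x. f x * g2 x + f2 x * g x)"
  unfolding has_partials_def
proof
  fix x
  show "((\<lambda>x. f x * g x) has_derivative (\<lambda>h. h$1 *\<^sub>R (f x * g1 x + f1 x * g x) + h$2 *\<^sub>R (f x * g2 x + f2 x * g x))) (at x)"
    by (rule has_derivative_eq_rhs[OF has_derivative_mult])
      (use assms in \<open>auto simp: has_partials_def algebra_simps\<close>)
qed

lemma has_partials_component:
  "has_partials (\<lambda>x. x $ 1) (\<lambda>_. 1) (\<lambda>_. 0)" "has_partials (\<lambda>x. x $ 2) (\<lambda>_. 0) (\<lambda>_. 1)"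
  unfolding has_partials_def by (auto intro!: bounded_linear_imp_has_derivative bounded_linear_vec_nth)

lemma has_partials_const: "has_partials (\<lambda>_. c) (\<lambda>_. 0) (\<lambda>_. 0)"
  unfolding has_partials_def by simp

lemma has_partials_eq:
  assumes "has_partials f f1 f2" "f = g" "\<And>x. f1 x = g1 x" "\<And>x. f2 x = g2 x"
  shows "has_partials g g1 g2"
proof -
  have "f1 = g1" "f2 = g2" using assms by auto
  then show ?thesis using assms by simp
qed

lemma bump_integral_pos:
  assumes "e > 0" shows "(LINT x|lborel. bump 0 e x) > 0"
proof -
  have i: "integrable lborel (bump 0 e)"
    using continuous_bump bump_eq_0[OF assms] by (rule integrable_continuous_compact_support)
  have "(LINT x|lborel. bump 0 e x) \<noteq> 0"
  proof
    assume "(LINT x|lborel. bump 0 e x) = 0"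
    then have "AE x in lborel. bump 0 e x = 0"
      using i by (subst (asm) integral_nonneg_eq_0_iff_AE) (auto simp: bump_nonneg)
    then have "AE x in lborel. x \<notin> ball (0::real^2) e"
    proof eventually_elim
      case (elim x)
      then show ?case using bump_pos[of x e 0] by auto
    qed
    then have "emeasure lborel (ball (0::real^2) e) = 0"
      by (subst (asm) AE_iff_measurable[where N="ball 0 e"]) auto
    then have "measure lborel (ball (0::real^2) e) = 0" by (simp add: measure_def)
    then show False using assms content_ball_gt_0_iff[of "0::real^2" e] by simp
  qed
  moreover have "(LINT x|lborel. bump 0 e x) \<ge> 0" by (intro integral_nonneg_AE) (auto simp: bump_nonneg)
  ultimately show ?thesis by linarith
qed

text \<open>A normalised bump. Two orders of derivatives are made explicit, with one and the same
  mixed partial \<open>\<phi>12\<close>, because the cancellation of mixed derivatives makes the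
  divergence identity work. The last property lets the kernel be inserted into the definition of a
  weak derivative.\<close>

lemma smooth_mollifier:
  assumes e: "e > 0"
  obtains \<phi> \<phi>1 \<phi>2 \<phi>11 \<phi>12 \<phi>22 where
    "mollifier e \<phi>"
    "has_partials \<phi> \<phi>1 \<phi>2" "has_partials \<phi>1 \<phi>11 \<phi>12" "has_partials \<phi>2 \<phi>12 \<phi>22"
    "continuous_on UNIV \<phi>11" "continuous_on UNIV \<phi>12" "continuous_on UNIV \<phi>22"
    "\<And>x. norm x \<ge> e \<Longrightarrow> \<phi>1 x = 0 \<and> \<phi>2 x = 0 \<and> \<phi>11 x = 0 \<and> \<phi>12 x = 0 \<and> \<phi>22 x = 0"
    "\<And>x. norm x + e < 1 \<Longrightarrow> (\<lambda>y. \<phi> (x - y)) \<in> test_functions"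
proof
  define c where "c = 1 / (LINT x|lborel. bump 0 e x)"
  have c: "c > 0" using bump_integral_pos[OF e] by (simp add: c_def)
  \<comment> \<open>The factor \<open>real 0\<close> removes \<open>bump 1\<close> from the first
    partials of \<open>bump 0\<close>, so only \<open>bump 2\<close> and then \<open>bump 3\<close>
    and \<open>bump 4\<close> occur.\<close>
  let ?q = "\<lambda>x. bump 4 e x - 2 * bump 3 e x"
  let ?\<phi> = "\<lambda>x. c * bump 0 e x"
  let ?\<phi>1 = "\<lambda>x. c * (bump 2 e x * (- 2 * x$1 / e\<^sup>2))"
  let ?\<phi>2 = "\<lambda>x. c * (bump 2 e x * (- 2 * x$2 / e\<^sup>2))"
  let ?\<phi>11 = "\<lambda>x. c * (bump 2 e x * (- 2 / e\<^sup>2) + ?q x * (- 2 * x$1 / e\<^sup>2) * (- 2 * x$1 / e\<^sup>2))"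
  let ?\<phi>12 = "\<lambda>x. c * (?q x * (- 2 * x$1 / e\<^sup>2) * (- 2 * x$2 / e\<^sup>2))"
  let ?\<phi>22 = "\<lambda>x. c * (bump 2 e x * (- 2 / e\<^sup>2) + ?q x * (- 2 * x$2 / e\<^sup>2) * (- 2 * x$2 / e\<^sup>2))"
  have b: "bump m e x = 0" if "norm x \<ge> e" for m x using bump_eq_0[OF e that] .
  have [continuous_intros]: "continuous_on UNIV (\<lambda>x. bump m e x)" for m using continuous_bump by simp
  show "mollifier e ?\<phi>"
    unfolding mollifier_def using c b bump_integral_pos[OF e]
    by (auto simp: bump_nonneg c_def intro!: continuous_intros)
  show "has_partials ?\<phi> ?\<phi>1 ?\<phi>2"
    by (rule has_partials_eq[OF has_partials_mult[OF has_partials_const has_partials_bump]]) (auto simp: numeral_2_eq_2)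
  have n: "2 + 2 = (4::nat)" "2 + 1 = (3::nat)" "real 2 = 2" by auto
  note p2 = has_partials_bump[of 2 e, unfolded n]
  have "has_partials (\<lambda>x. c * (-2 / e\<^sup>2)) (\<lambda>_. 0) (\<lambda>_. 0)" by (rule has_partials_const)
  note pp = has_partials_mult[OF this has_partials_mult[OF p2 has_partials_component(1)]]
    has_partials_mult[OF this has_partials_mult[OF p2 has_partials_component(2)]]
  show "has_partials ?\<phi>1 ?\<phi>11 ?\<phi>12" by (rule has_partials_eq[OF pp(1)]) (auto simp: algebra_simps)
  show "has_partials ?\<phi>2 ?\<phi>12 ?\<phi>22" by (rule has_partials_eq[OF pp(2)]) (auto simp: algebra_simps)
  show "continuous_on UNIV ?\<phi>11" "continuous_on UNIV ?\<phi>12" "continuous_on UNIV ?\<phi>22"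
    unfolding divide_inverse by (intro continuous_intros)+
  show "\<And>x. norm x \<ge> e \<Longrightarrow> ?\<phi>1 x = 0 \<and> ?\<phi>2 x = 0 \<and> ?\<phi>11 x = 0 \<and> ?\<phi>12 x = 0 \<and> ?\<phi>22 x = 0"
    by (simp add: b)
  show "(\<lambda>y. ?\<phi> (x - y)) \<in> test_functions" if x: "norm x + e < 1" for x
  proof -
    have "{y. c * bump 0 e (x - y) \<noteq> 0} \<subseteq> cball x e" using b[of "x - _"] by (auto simp: dist_norm not_le intro: less_imp_le) (meson linorder_not_le less_imp_le)
    then have sub: "closure {y. c * bump 0 e (x - y) \<noteq> 0} \<subseteq> cball x e" by (rule closure_minimal) simp
    moreover have "cball x e \<subseteq> ball 0 1"
    proof
      fix y assume "y \<in> cball x e"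
      then show "y \<in> ball 0 1" using x norm_triangle_sub[of y x] by (simp add: dist_norm norm_minus_commute)
    qed
    moreover have "compact (closure {y. c * bump 0 e (x - y) \<noteq> 0})"
      using sub by (meson bounded_cball bounded_subset closed_closure compact_eq_bounded_closed)
    ultimately show ?thesis
      unfolding test_functions_def by (auto intro!: Ck_mult[OF Ck_const Ck_bump_shift])
  qed
qed

lemma has_partials_reflect:
  assumes "has_partials \<phi> \<phi>1 \<phi>2"
  shows "has_partials (\<lambda>y. \<phi> (x - y)) (\<lambda>y. - \<phi>1 (x - y)) (\<lambda>y. - \<phi>2 (x - y))"
  unfolding has_partials_def
proof
  fix y
  have a: "((\<lambda>y. x - y) has_derivative (\<lambda>h. - h)) (at y)" by (auto intro!: derivative_eq_intros)
  have "(\<phi> has_derivative (\<lambda>h. h$1 *\<^sub>R \<phi>1 (x - y) + h$2 *\<^sub>R \<phi>2 (x - y))) (at (x - y))"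
    using assms by (simp add: has_partials_def)
  from has_derivative_compose[OF a this]
  show "((\<lambda>y. \<phi> (x - y)) has_derivative (\<lambda>h. h$1 *\<^sub>R - \<phi>1 (x - y) + h$2 *\<^sub>R - \<phi>2 (x - y))) (at y)"
    by (simp add: algebra_simps)
qed

text \<open>A Borel version of a weakly differentiable map on the disc, extended by zero to the plane.\<close>

definition weak_diff :: "(real^2 \<Rightarrow> 'b::euclidean_space) \<Rightarrow> (real^2 \<Rightarrow> 'b) \<Rightarrow> (real^2 \<Rightarrow> 'b) \<Rightarrow> bool" where
  "weak_diff N V1 V2 \<longleftrightarrow>
     (\<forall>f\<in>{N, V1, V2}. f \<in> borel_measurable borel \<and> integrable lborel (\<lambda>x. (norm (f x))\<^sup>2) \<and> (\<forall>x. norm x \<ge> 1 \<longrightarrow> f x = 0)) \<and>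
     (\<forall>\<phi>\<in>test_functions.
        (LINT x|lborel. partial_deriv 1 \<phi> x *\<^sub>R N x) = - (LINT x|lborel. \<phi> x *\<^sub>R V1 x) \<and>
        (LINT x|lborel. partial_deriv 2 \<phi> x *\<^sub>R N x) = - (LINT x|lborel. \<phi> x *\<^sub>R V2 x))"

lemma weak_diffD:
  assumes "weak_diff N V1 V2"
  shows "N \<in> borel_measurable borel" "V1 \<in> borel_measurable borel" "V2 \<in> borel_measurable borel"
    "integrable lborel (\<lambda>x. (norm (N x))\<^sup>2)" "integrable lborel (\<lambda>x. (norm (V1 x))\<^sup>2)" "integrable lborel (\<lambda>x. (norm (V2 x))\<^sup>2)"
    "norm x \<ge> 1 \<Longrightarrow> N x = 0" "norm x \<ge> 1 \<Longrightarrow> V1 x = 0" "norm x \<ge> 1 \<Longrightarrow> V2 x = 0"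
    "\<phi> \<in> test_functions \<Longrightarrow> (LINT x|lborel. partial_deriv 1 \<phi> x *\<^sub>R N x) = - (LINT x|lborel. \<phi> x *\<^sub>R V1 x)"
    "\<phi> \<in> test_functions \<Longrightarrow> (LINT x|lborel. partial_deriv 2 \<phi> x *\<^sub>R N x) = - (LINT x|lborel. \<phi> x *\<^sub>R V2 x)"
    "integrable lborel N" "integrable lborel V1" "integrable lborel V2"
proof -
  have "f \<in> borel_measurable borel \<and> integrable lborel (\<lambda>x. (norm (f x))\<^sup>2) \<and> (\<forall>x. norm x \<ge> 1 \<longrightarrow> f x = 0)"
    if "f \<in> {N, V1, V2}" for f
    using assms that unfolding weak_diff_def by (elim conjE) (drule (1) bspec)
  from this[of N] this[of V1] this[of V2]
  have "\<forall>f\<in>{N, V1, V2}. f \<in> borel_measurable borel \<and> integrable lborel (\<lambda>x. (norm (f x))\<^sup>2) \<and> (\<forall>x. norm x \<ge> 1 \<longrightarrow> f x = 0)"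
    by simp
  then have *: "N \<in> borel_measurable borel" "V1 \<in> borel_measurable borel" "V2 \<in> borel_measurable borel"
    "integrable lborel (\<lambda>x. (norm (N x))\<^sup>2)" "integrable lborel (\<lambda>x. (norm (V1 x))\<^sup>2)" "integrable lborel (\<lambda>x. (norm (V2 x))\<^sup>2)"
    "\<And>x. norm x \<ge> 1 \<Longrightarrow> N x = 0" "\<And>x. norm x \<ge> 1 \<Longrightarrow> V1 x = 0" "\<And>x. norm x \<ge> 1 \<Longrightarrow> V2 x = 0"
    by auto
  then show "N \<in> borel_measurable borel" "V1 \<in> borel_measurable borel" "V2 \<in> borel_measurable borel"
    "integrable lborel (\<lambda>x. (norm (N x))\<^sup>2)" "integrable lborel (\<lambda>x. (norm (V1 x))\<^sup>2)" "integrable lborel (\<lambda>x. (norm (V2 x))\<^sup>2)"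
    "norm x \<ge> 1 \<Longrightarrow> N x = 0" "norm x \<ge> 1 \<Longrightarrow> V1 x = 0" "norm x \<ge> 1 \<Longrightarrow> V2 x = 0" by auto
  show "integrable lborel N" by (rule integrable_of_L2_bounded_support[OF *(1,4,7)])
  show "integrable lborel V1" by (rule integrable_of_L2_bounded_support[OF *(2,5,8)])
  show "integrable lborel V2" by (rule integrable_of_L2_bounded_support[OF *(3,6,9)])
  show "\<phi> \<in> test_functions \<Longrightarrow> (LINT x|lborel. partial_deriv 1 \<phi> x *\<^sub>R N x) = - (LINT x|lborel. \<phi> x *\<^sub>R V1 x)"
    "\<phi> \<in> test_functions \<Longrightarrow> (LINT x|lborel. partial_deriv 2 \<phi> x *\<^sub>R N x) = - (LINT x|lborel. \<phi> x *\<^sub>R V2 x)"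
    using assms unfolding weak_diff_def by blast+
qed

text \<open>The sign produced by reflecting the kernel cancels the sign in the definition of the
  weak derivative.\<close>

lemma conv_weak_partial:
  assumes w: "weak_diff N V1 V2" and \<phi>: "has_partials \<phi> \<phi>1 \<phi>2" and t: "(\<lambda>y. \<phi> (x - y)) \<in> test_functions"
  shows "conv \<phi>1 N x = conv \<phi> V1 x" "conv \<phi>2 N x = conv \<phi> V2 x"
  using weak_diffD(10,11)[OF w t] partial_deriv_has_partials[OF has_partials_reflect[OF \<phi>, of x]]
  by (auto simp: conv_def)

text \<open>The pointwise sum of the |f k|^2 has finite integral, hence is finite almost everywhere;
  it dominates each term, and the terms of a convergent series tend to 0.\<close>

lemma AE_tendsto_of_L2_summable:
  fixes f :: "nat \<Rightarrow> 'a \<Rightarrow> 'b::euclidean_space"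
  assumes [measurable]: "\<And>k. f k \<in> borel_measurable M"
    and le: "\<And>k. (\<integral>\<^sup>+x. ennreal ((norm (f k x))\<^sup>2) \<partial>M) \<le> ennreal ((1/4)^k)"
  obtains D where "integrable M D" "\<And>x. D x \<ge> 0" "AE x in M. (\<forall>k. (norm (f k x))\<^sup>2 \<le> D x) \<and> (\<lambda>k. f k x) \<longlonglongrightarrow> 0"
proof
  define S where "S x = (\<Sum>k. ennreal ((norm (f k x))\<^sup>2))" for x
  have [measurable]: "S \<in> borel_measurable M" unfolding S_def[abs_def] by measurable
  have "(\<integral>\<^sup>+x. S x \<partial>M) = (\<Sum>k. \<integral>\<^sup>+x. ennreal ((norm (f k x))\<^sup>2) \<partial>M)"
    unfolding S_def by (rule nn_integral_suminf) measurable
  also have "\<dots> \<le> (\<Sum>k. ennreal ((1/4)^k))" by (intro suminf_le le) auto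
  also have "\<dots> = ennreal (\<Sum>k. (1/4)^k)" by (rule suminf_ennreal2) (auto intro: summable_geometric)
  also have "\<dots> < \<infinity>" by simp
  finally have fin: "(\<integral>\<^sup>+x. S x \<partial>M) < \<infinity>" .
  then have AES: "AE x in M. S x \<noteq> \<infinity>" by (intro nn_integral_noteq_infinite) auto
  show "integrable M (\<lambda>x. enn2real (S x))"
  proof (rule integrableI_nonneg)
    have "(\<integral>\<^sup>+x. ennreal (enn2real (S x)) \<partial>M) \<le> (\<integral>\<^sup>+x. S x \<partial>M)"
      by (intro nn_integral_mono) (simp add: ennreal_enn2real_if)
    then show "(\<integral>\<^sup>+x. ennreal (enn2real (S x)) \<partial>M) < \<infinity>" using fin by (rule le_less_trans)
  qed auto
  show "enn2real (S x) \<ge> 0" for x by simp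
  show "AE x in M. (\<forall>k. (norm (f k x))\<^sup>2 \<le> enn2real (S x)) \<and> (\<lambda>k. f k x) \<longlonglongrightarrow> 0"
    using AES
  proof eventually_elim
    case (elim x)
    have s: "summable (\<lambda>k. (norm (f k x))\<^sup>2)"
      by (rule summable_suminf_not_top) (use elim in \<open>auto simp: S_def\<close>)
    have "(norm (f k x))\<^sup>2 \<le> enn2real (S x)" for k
    proof -
      have "F k \<le> suminf F" for F :: "nat \<Rightarrow> ennreal"
      proof -
        have "sum F {k} \<le> suminf F" by (rule sum_le_suminf[OF summableI]) auto
        then show ?thesis by simp
      qed
      from this[of "\<lambda>k. ennreal ((norm (f k x))\<^sup>2)"]
      have "ennreal ((norm (f k x))\<^sup>2) \<le> S x" unfolding S_def .
      then have "enn2real (ennreal ((norm (f k x))\<^sup>2)) \<le> enn2real (S x)"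
        using elim by (intro enn2real_mono) (auto simp: top.not_eq_extremum)
      then show ?thesis by simp
    qed
    moreover have "(\<lambda>k. f k x) \<longlonglongrightarrow> 0"
    proof -
      have "(\<lambda>k. sqrt ((norm (f k x))\<^sup>2)) \<longlonglongrightarrow> sqrt 0"
        by (intro tendsto_intros summable_LIMSEQ_zero s)
      then show ?thesis by (simp add: tendsto_norm_zero_iff)
    qed
    ultimately show ?case by blast
  qed
qed

text \<open>The mollification scale shrinks so fast that the squared mean-square errors are at most
  16^-k. This yields almost everywhere convergence with an integrable majorant, and later a
  geometric rate for consecutive differences. The mollified weak derivatives \<open>v1\<close>,
  \<open>v2\<close> are kept apart from the derivatives \<open>u1\<close>, \<open>u2\<close> of the
  mollified map: agreement is available only further than 1/(k+1) inside the circle, since the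
  extension by zero may jump there.\<close>

lemma weak_diff_approx:
  fixes N V1 V2 :: "real^2 \<Rightarrow> 'b::euclidean_space"
  assumes w: "weak_diff N V1 V2" and N1: "\<And>x. norm (N x) \<le> 1"
  obtains u u1 u2 u11 u12 u22 v1 v2 :: "nat \<Rightarrow> real^2 \<Rightarrow> 'b" and D :: "real^2 \<Rightarrow> real" where
    "\<And>k. has_partials (u k) (u1 k) (u2 k)" "\<And>k. has_partials (u1 k) (u11 k) (u12 k)" "\<And>k. has_partials (u2 k) (u12 k) (u22 k)"
    "\<And>k. continuous_on UNIV (u11 k)" "\<And>k. continuous_on UNIV (u12 k)" "\<And>k. continuous_on UNIV (u22 k)"
    "\<And>k x. norm (u k x) \<le> 1"
    "\<And>k x. norm x + 1 / real (Suc k) < 1 \<Longrightarrow> u1 k x = v1 k x \<and> u2 k x = v2 k x"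
    "\<And>k. continuous_on UNIV (v1 k)" "\<And>k. continuous_on UNIV (v2 k)"
    "\<And>k x. norm x \<ge> 2 \<Longrightarrow> v1 k x = 0 \<and> v2 k x = 0"
    "\<And>k. (\<integral>\<^sup>+x. ennreal ((norm (v1 k x - V1 x))\<^sup>2) \<partial>lborel) \<le> ennreal ((1/16)^k)"
    "\<And>k. (\<integral>\<^sup>+x. ennreal ((norm (v2 k x - V2 x))\<^sup>2) \<partial>lborel) \<le> ennreal ((1/16)^k)"
    "integrable lborel D" "AE x in lborel. (\<forall>k. (norm (v1 k x))\<^sup>2 \<le> D x \<and> (norm (v2 k x))\<^sup>2 \<le> D x) \<and>
        (\<lambda>k. u k x) \<longlonglongrightarrow> N x \<and> (\<lambda>k. v1 k x) \<longlonglongrightarrow> V1 x \<and> (\<lambda>k. v2 k x) \<longlonglongrightarrow> V2 x"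
proof -
  note W = weak_diffD[OF w]
  note [measurable] = W(1,2,3)
  \<comment> \<open>One radius for the map and both weak derivatives. The cap 1/(k+1) makes the
    region of agreement exhaust the disc.\<close>
  define good where "good k e \<longleftrightarrow> 0 < e \<and> e < 1 / real (Suc k) \<and> (\<forall>r \<phi>. mollifier r \<phi> \<longrightarrow> r < e \<longrightarrow>
      (\<integral>\<^sup>+x. ennreal ((norm (conv \<phi> N x - N x))\<^sup>2) \<partial>lborel) \<le> ennreal ((1/16)^k) \<and>
      (\<integral>\<^sup>+x. ennreal ((norm (conv \<phi> V1 x - V1 x))\<^sup>2) \<partial>lborel) \<le> ennreal ((1/16)^k) \<and>
      (\<integral>\<^sup>+x. ennreal ((norm (conv \<phi> V2 x - V2 x))\<^sup>2) \<partial>lborel) \<le> ennreal ((1/16)^k))" for k e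
  have ex: "\<exists>e. good k e" for k
  proof -
    have p: "(1/16::real)^k > 0" by simp
    obtain d0 where d0: "d0 > 0" "\<And>r \<phi>. mollifier r \<phi> \<Longrightarrow> r < d0 \<Longrightarrow>
      (\<integral>\<^sup>+x. ennreal ((norm (conv \<phi> N x - N x))\<^sup>2) \<partial>lborel) \<le> ennreal ((1/16)^k)"
      using conv_L2_tendsto[OF W(1,4,7) p] by blast
    obtain d1 where d1: "d1 > 0" "\<And>r \<phi>. mollifier r \<phi> \<Longrightarrow> r < d1 \<Longrightarrow>
      (\<integral>\<^sup>+x. ennreal ((norm (conv \<phi> V1 x - V1 x))\<^sup>2) \<partial>lborel) \<le> ennreal ((1/16)^k)"
      using conv_L2_tendsto[OF W(2,5,8) p] by blast
    obtain d2 where d2: "d2 > 0" "\<And>r \<phi>. mollifier r \<phi> \<Longrightarrow> r < d2 \<Longrightarrow>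
      (\<integral>\<^sup>+x. ennreal ((norm (conv \<phi> V2 x - V2 x))\<^sup>2) \<partial>lborel) \<le> ennreal ((1/16)^k)"
      using conv_L2_tendsto[OF W(3,6,9) p] by blast
    define e where "e = min (min d0 d1) (min d2 (1 / real (Suc (Suc k))))"
    have "e > 0" using d0(1) d1(1) d2(1) by (simp add: e_def)
    moreover have "e < 1 / real (Suc k)"
    proof -
      have "e \<le> 1 / real (Suc (Suc k))" by (simp add: e_def)
      also have "\<dots> < 1 / real (Suc k)" by (simp add: field_simps)
      finally show ?thesis .
    qed
    moreover have "e \<le> d0" "e \<le> d1" "e \<le> d2" by (auto simp: e_def)
    ultimately have "good k e" unfolding good_def using d0(2) d1(2) d2(2) by (meson less_le_trans)
    then show ?thesis ..
  qed
  \<comment> \<open>\<open>good\<close> speaks of mollifiers of radius strictly below its argument,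
    so half of a good radius can itself be used.\<close>
  define e where "e k = (SOME e. good k e) / 2" for k
  have g: "good k (2 * e k)" for k using someI_ex[OF ex[of k]] by (simp add: e_def)
  then have e0: "e k > 0" for k unfolding good_def by (simp add: zero_less_mult_iff)
  have ek: "e k < 2 * e k" for k using e0[of k] by simp
  have ek1: "e k < 1 / real (Suc k)" for k using g[of k] e0[of k] unfolding good_def by linarith
  \<comment> \<open>The kernel and its five derivatives form one tuple, so that a single choice over
    all \<open>k\<close> fixes them consistently.\<close>
  define P where "P k T \<longleftrightarrow> (case T of (\<phi>, \<phi>1, \<phi>2, \<phi>11, \<phi>12, \<phi>22) \<Rightarrow>
    mollifier (e k) \<phi> \<and>
    has_partials \<phi> \<phi>1 \<phi>2 \<and> has_partials \<phi>1 \<phi>11 \<phi>12 \<and> has_partials \<phi>2 \<phi>12 \<phi>22 \<and>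
    continuous_on UNIV \<phi>11 \<and> continuous_on UNIV \<phi>12 \<and> continuous_on UNIV \<phi>22 \<and>
    (\<forall>x. norm x \<ge> e k \<longrightarrow> \<phi>1 x = 0 \<and> \<phi>2 x = 0 \<and> \<phi>11 x = 0 \<and> \<phi>12 x = 0 \<and> \<phi>22 x = 0) \<and>
    (\<forall>x. norm x + e k < 1 \<longrightarrow> (\<lambda>y. \<phi> (x - y)) \<in> test_functions))" for k T
  have "\<exists>T. P k T" for k
  proof (rule smooth_mollifier[OF e0[of k]], goal_cases)
    case (1 \<phi> \<phi>1 \<phi>2 \<phi>11 \<phi>12 \<phi>22)
    then have "P k (\<phi>, \<phi>1, \<phi>2, \<phi>11, \<phi>12, \<phi>22)" unfolding P_def by simp
    then show ?case ..
  qed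
  then obtain T where T: "\<And>k. P k (T k)" by metis
  define \<phi> \<phi>1 \<phi>2 \<phi>11 \<phi>12 \<phi>22 where defs: "\<phi> k = fst (T k)" "\<phi>1 k = fst (snd (T k))" "\<phi>2 k = fst (snd (snd (T k)))"
    "\<phi>11 k = fst (snd (snd (snd (T k))))" "\<phi>12 k = fst (snd (snd (snd (snd (T k)))))" "\<phi>22 k = snd (snd (snd (snd (snd (T k)))))" for k
  have Pk: "P k (\<phi> k, \<phi>1 k, \<phi>2 k, \<phi>11 k, \<phi>12 k, \<phi>22 k)" for k using T[of k] by (simp add: defs)
  have m: "mollifier (e k) (\<phi> k)" for k using Pk[of k] by (simp add: P_def)
  have p: "has_partials (\<phi> k) (\<phi>1 k) (\<phi>2 k)" "has_partials (\<phi>1 k) (\<phi>11 k) (\<phi>12 k)" "has_partials (\<phi>2 k) (\<phi>12 k) (\<phi>22 k)" for k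
    using Pk[of k] by (simp_all add: P_def)
  have c: "continuous_on UNIV (\<phi>11 k)" "continuous_on UNIV (\<phi>12 k)" "continuous_on UNIV (\<phi>22 k)" for k
    using Pk[of k] by (simp_all add: P_def)
  have z: "\<phi>1 k x = 0" "\<phi>2 k x = 0" "\<phi>11 k x = 0" "\<phi>12 k x = 0" "\<phi>22 k x = 0" if "norm x \<ge> e k" for k x
    using Pk[of k] that by (simp_all add: P_def)
  have t: "(\<lambda>y. \<phi> k (x - y)) \<in> test_functions" if "norm x + e k < 1" for k x
    using Pk[of k] that by (simp add: P_def)
  have c1: "continuous_on UNIV (\<phi>1 k)" "continuous_on UNIV (\<phi>2 k)" for k
    using p has_partials_continuous by blast+
  have L2: "(\<integral>\<^sup>+x. ennreal ((norm (conv (\<phi> k) N x - N x))\<^sup>2) \<partial>lborel) \<le> ennreal ((1/16)^k)"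
    "(\<integral>\<^sup>+x. ennreal ((norm (conv (\<phi> k) V1 x - V1 x))\<^sup>2) \<partial>lborel) \<le> ennreal ((1/16)^k)"
    "(\<integral>\<^sup>+x. ennreal ((norm (conv (\<phi> k) V2 x - V2 x))\<^sup>2) \<partial>lborel) \<le> ennreal ((1/16)^k)" for k
    using g[of k] m[of k] ek[of k] unfolding good_def by blast+
  have q: "ennreal ((1/16)^k) \<le> ennreal ((1/4)^k)" for k by (intro ennreal_leI power_mono) auto
  have cc: "continuous_on UNIV (conv (\<phi> k) f)" if "integrable lborel f" for k and f :: "real^2 \<Rightarrow> 'b"
    by (rule conv_continuous[OF mollifierD(1,3)[OF m] that])
  have cm: "conv (\<phi> k) f \<in> borel_measurable borel" if "integrable lborel f" for k and f :: "real^2 \<Rightarrow> 'b"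
    using cc[OF that] by (rule borel_measurable_continuous_onI)
  note [measurable] = cm[OF W(12)] cm[OF W(13)] cm[OF W(14)]
  obtain D0 where D0: "AE x in lborel. (\<forall>k. (norm (conv (\<phi> k) N x - N x))\<^sup>2 \<le> D0 x) \<and> (\<lambda>k. conv (\<phi> k) N x - N x) \<longlonglongrightarrow> 0"
    by (rule AE_tendsto_of_L2_summable[where f="\<lambda>k x. conv (\<phi> k) N x - N x" and M=lborel])
      (use order_trans[OF L2(1) q] in auto)
  obtain D1 where D1: "integrable lborel D1" "\<And>x. D1 x \<ge> 0" "AE x in lborel. (\<forall>k. (norm (conv (\<phi> k) V1 x - V1 x))\<^sup>2 \<le> D1 x) \<and> (\<lambda>k. conv (\<phi> k) V1 x - V1 x) \<longlonglongrightarrow> 0"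
    by (rule AE_tendsto_of_L2_summable[where f="\<lambda>k x. conv (\<phi> k) V1 x - V1 x" and M=lborel])
      (use order_trans[OF L2(2) q] in auto)
  obtain D2 where D2: "integrable lborel D2" "\<And>x. D2 x \<ge> 0" "AE x in lborel. (\<forall>k. (norm (conv (\<phi> k) V2 x - V2 x))\<^sup>2 \<le> D2 x) \<and> (\<lambda>k. conv (\<phi> k) V2 x - V2 x) \<longlonglongrightarrow> 0"
    by (rule AE_tendsto_of_L2_summable[where f="\<lambda>k x. conv (\<phi> k) V2 x - V2 x" and M=lborel])
      (use order_trans[OF L2(3) q] in auto)
  \<comment> \<open>From |v|^2 <= 2 |v - V|^2 + 2 |V|^2 for each partial; the sum of the two bounds
    is a common majorant.\<close>
  define D where "D x = 2 * D1 x + 2 * (norm (V1 x))\<^sup>2 + (2 * D2 x + 2 * (norm (V2 x))\<^sup>2)" for x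
  have Di: "integrable lborel D" unfolding D_def[abs_def] using D1(1) D2(1) W(5,6) by auto
  have AED: "AE x in lborel. (\<forall>k. (norm (conv (\<phi> k) V1 x))\<^sup>2 \<le> D x \<and> (norm (conv (\<phi> k) V2 x))\<^sup>2 \<le> D x) \<and>
        (\<lambda>k. conv (\<phi> k) N x) \<longlonglongrightarrow> N x \<and> (\<lambda>k. conv (\<phi> k) V1 x) \<longlonglongrightarrow> V1 x \<and> (\<lambda>k. conv (\<phi> k) V2 x) \<longlonglongrightarrow> V2 x"
    using D0 D1(3) D2(3)
  proof eventually_elim
    case (elim x)
    have "(norm (conv (\<phi> k) V1 x))\<^sup>2 \<le> D x" for k
    proof -
      have "(norm (conv (\<phi> k) V1 x))\<^sup>2 \<le> 2 * (norm (conv (\<phi> k) V1 x - V1 x))\<^sup>2 + 2 * (norm (V1 x))\<^sup>2"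
        using norm_add_square_le[of "conv (\<phi> k) V1 x - V1 x" "V1 x"] by simp
      moreover have "(norm (conv (\<phi> k) V1 x - V1 x))\<^sup>2 \<le> D1 x" using elim by blast
      ultimately show ?thesis using D2(2)[of x] by (simp add: D_def) (smt (verit) zero_le_power2)
    qed
    moreover have "(norm (conv (\<phi> k) V2 x))\<^sup>2 \<le> D x" for k
    proof -
      have "(norm (conv (\<phi> k) V2 x))\<^sup>2 \<le> 2 * (norm (conv (\<phi> k) V2 x - V2 x))\<^sup>2 + 2 * (norm (V2 x))\<^sup>2"
        using norm_add_square_le[of "conv (\<phi> k) V2 x - V2 x" "V2 x"] by simp
      moreover have "(norm (conv (\<phi> k) V2 x - V2 x))\<^sup>2 \<le> D2 x" using elim by blast
      ultimately show ?thesis using D1(2)[of x] by (simp add: D_def) (smt (verit) zero_le_power2)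
    qed
    ultimately show ?case using elim by (auto intro: LIM_zero_cancel)
  qed
  show ?thesis
  proof (rule that[of "\<lambda>k. conv (\<phi> k) N" "\<lambda>k. conv (\<phi>1 k) N" "\<lambda>k. conv (\<phi>2 k) N" "\<lambda>k. conv (\<phi>11 k) N" "\<lambda>k. conv (\<phi>12 k) N" "\<lambda>k. conv (\<phi>22 k) N"
        "\<lambda>k. conv (\<phi> k) V1" "\<lambda>k. conv (\<phi> k) V2" D])
    fix k
    show "has_partials (conv (\<phi> k) N) (conv (\<phi>1 k) N) (conv (\<phi>2 k) N)"
      by (rule conv_has_partials[OF p(1) mollifierD(3)[OF m] c1(1) z(1) c1(2) z(2) W(12)])
    show "has_partials (conv (\<phi>1 k) N) (conv (\<phi>11 k) N) (conv (\<phi>12 k) N)"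
      by (rule conv_has_partials[OF p(2) z(1) c(1) z(3) c(2) z(4) W(12)])
    show "has_partials (conv (\<phi>2 k) N) (conv (\<phi>12 k) N) (conv (\<phi>22 k) N)"
      by (rule conv_has_partials[OF p(3) z(2) c(2) z(4) c(3) z(5) W(12)])
    show "continuous_on UNIV (conv (\<phi>11 k) N)" by (rule conv_continuous[OF c(1) z(3) W(12)])
    show "continuous_on UNIV (conv (\<phi>12 k) N)" by (rule conv_continuous[OF c(2) z(4) W(12)])
    show "continuous_on UNIV (conv (\<phi>22 k) N)" by (rule conv_continuous[OF c(3) z(5) W(12)])
    show "norm (conv (\<phi> k) N x) \<le> 1" for x by (rule conv_norm_le[OF m N1 W(12)])
    show "conv (\<phi>1 k) N x = conv (\<phi> k) V1 x \<and> conv (\<phi>2 k) N x = conv (\<phi> k) V2 x" if "norm x + 1 / real (Suc k) < 1" for x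
    proof -
      have "norm x + e k < 1" using that ek1[of k] by linarith
      from conv_weak_partial[OF w p(1) t[OF this]] show ?thesis by simp
    qed
    show "conv (\<phi> k) V1 x = 0 \<and> conv (\<phi> k) V2 x = 0" if "norm x \<ge> 2" for x
    proof -
      have "1 / real (Suc k) \<le> 1" by simp
      then have "e k \<le> 1" using ek1[of k] by linarith
      then have "norm x \<ge> 1 + e k" using that by linarith
      then show ?thesis
        by (auto intro!: conv_eq_0[where e="e k" and R=1] mollifierD(3)[OF m] W(8) W(9))
    qed
  qed (use L2 cc W Di AED in auto)
qed

section \<open>The smoothed area form\<close>

lemma test_functionD:
  assumes "\<zeta> \<in> test_functions"
  obtains r where "0 < r" "r < 1" "has_partials \<zeta> (partial_deriv 1 \<zeta>) (partial_deriv 2 \<zeta>)"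
    "continuous_on UNIV (partial_deriv 1 \<zeta>)" "continuous_on UNIV (partial_deriv 2 \<zeta>)"
    "\<And>x. norm x \<ge> r \<Longrightarrow> \<zeta> x = 0" "\<And>x. norm x \<ge> r \<Longrightarrow> partial_deriv 1 \<zeta> x = 0" "\<And>x. norm x \<ge> r \<Longrightarrow> partial_deriv 2 \<zeta> x = 0"
proof -
  let ?C = "closure {x. \<zeta> x \<noteq> 0}"
  have C: "compact ?C" "?C \<subseteq> ball 0 1" and Ck: "\<And>k. Ck k \<zeta>" using assms by (auto simp: test_functions_def)
  have d: "\<zeta> differentiable (at x)" for x using Ck[of 1] by simp
  have c: "continuous_on UNIV (partial_deriv i \<zeta>)" for i using Ck[of "Suc 0"] by simp
  \<comment> \<open>Compactness leaves a gap between the support and the circle. The strict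
    inequality r < 1 later places the support where the derivatives of the mollified map are the
    mollified weak derivatives.\<close>
  obtain r where r: "r < 1" "0 < r" "\<And>x. x \<in> ?C \<Longrightarrow> norm x < r"
  proof (cases "?C = {}")
    case True
    show ?thesis by (rule that[of "1/2"]) (use True in auto)
  next
    case False
    obtain x0 where x0: "x0 \<in> ?C" "\<And>x. x \<in> ?C \<Longrightarrow> norm x \<le> norm x0"
      using continuous_attains_sup[OF C(1) False continuous_on_norm[OF continuous_on_id]] by auto
    have "norm x0 < 1" using x0(1) C(2) by auto
    show ?thesis
    proof (rule that[of "(norm x0 + 1) / 2"])
      show "(norm x0 + 1) / 2 < 1" using \<open>norm x0 < 1\<close> by simp
      show "0 < (norm x0 + 1) / 2" by (simp add: add_nonneg_pos)
      show "norm x < (norm x0 + 1) / 2" if "x \<in> ?C" for x using x0(2)[OF that] \<open>norm x0 < 1\<close> by (simp add: field_simps)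
    qed
  qed
  have out: "x \<notin> ?C" if "norm x \<ge> r" for x using r(3)[of x] that by fastforce
  have z: "\<zeta> x = 0" if "x \<notin> ?C" for x using that closure_subset[of "{x. \<zeta> x \<noteq> 0}"] by blast
  \<comment> \<open>Off the closed support the function is zero on an open set, so its derivative
    vanishes there too.\<close>
  have zp: "partial_deriv i \<zeta> x = 0" if "x \<notin> ?C" for i x
  proof -
    have "((\<lambda>_. 0) has_derivative (\<lambda>_. 0)) (at x)" by simp
    then have "(\<zeta> has_derivative (\<lambda>_. 0)) (at x)"
    proof (rule has_derivative_transform_within_open)
      show "open (- ?C)" by (rule open_Compl) simp
      show "x \<in> - ?C" using that by (simp only: Compl_iff not_False_eq_True)
      show "0 = \<zeta> y" if "y \<in> - ?C" for y using z[OF ComplD[OF that]] by (rule sym)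
    qed
    from partial_deriv_eqI[OF this] show ?thesis .
  qed
  show ?thesis
    using that[OF r(2) r(1) has_partials_partial_deriv[OF d] c c] z zp out by blast
qed

lemma test_function_bounds:
  assumes "\<zeta> \<in> test_functions"
  obtains r B where "0 < r" "r < 1" "has_partials \<zeta> (partial_deriv 1 \<zeta>) (partial_deriv 2 \<zeta>)"
    "continuous_on UNIV \<zeta>" "continuous_on UNIV (partial_deriv 1 \<zeta>)" "continuous_on UNIV (partial_deriv 2 \<zeta>)"
    "\<And>x. norm x \<ge> r \<Longrightarrow> \<zeta> x = 0" "\<And>x. norm x \<ge> r \<Longrightarrow> partial_deriv 1 \<zeta> x = 0" "\<And>x. norm x \<ge> r \<Longrightarrow> partial_deriv 2 \<zeta> x = 0"
    "B > 0" "\<And>x. \<bar>\<zeta> x\<bar> \<le> B" "\<And>x. \<bar>partial_deriv 1 \<zeta> x\<bar> \<le> B" "\<And>x. \<bar>partial_deriv 2 \<zeta> x\<bar> \<le> B"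
proof -
  obtain r where r: "0 < r" "r < 1" and t: "has_partials \<zeta> (partial_deriv 1 \<zeta>) (partial_deriv 2 \<zeta>)"
    and tc: "continuous_on UNIV (partial_deriv 1 \<zeta>)" "continuous_on UNIV (partial_deriv 2 \<zeta>)"
    and tz: "\<And>x. norm x \<ge> r \<Longrightarrow> \<zeta> x = 0" "\<And>x. norm x \<ge> r \<Longrightarrow> partial_deriv 1 \<zeta> x = 0" "\<And>x. norm x \<ge> r \<Longrightarrow> partial_deriv 2 \<zeta> x = 0"
    by (rule test_functionD[OF assms]) blast
  have zc: "continuous_on UNIV \<zeta>" using t by (rule has_partials_continuous)
  obtain B0 where B0: "B0 > 0" "\<And>x. norm (\<zeta> x) \<le> B0" using continuous_compact_support_bounded[OF zc tz(1)] by blast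
  obtain B1 where B1: "B1 > 0" "\<And>x. norm (partial_deriv 1 \<zeta> x) \<le> B1" using continuous_compact_support_bounded[OF tc(1) tz(2)] by blast
  obtain B2 where B2: "B2 > 0" "\<And>x. norm (partial_deriv 2 \<zeta> x) \<le> B2" using continuous_compact_support_bounded[OF tc(2) tz(3)] by blast
  define B where "B = B0 + B1 + B2"
  have B: "B > 0" "\<bar>\<zeta> x\<bar> \<le> B" "\<bar>partial_deriv 1 \<zeta> x\<bar> \<le> B" "\<bar>partial_deriv 2 \<zeta> x\<bar> \<le> B" for x
    using B0(1) B1(1) B2(1) B0(2)[of x] B1(2)[of x] B2(2)[of x] by (auto simp: B_def)
  show ?thesis by (rule that[OF r t zc tc tz B]; assumption)
qed

text \<open>On a smaller disc the mollification of \<open>w\<close> is a pairing with test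
  functions, hence 0, and it is also close to \<open>w\<close> in mean square. So the integral of
  |w|^2 over the smaller disc lies below every positive bound.\<close>

lemma weak_zero_imp_AE_zero:
  fixes w :: "real^2 \<Rightarrow> 'b::euclidean_space"
  assumes w: "w \<in> borel_measurable borel" "integrable lborel (\<lambda>x. (norm (w x))\<^sup>2)" "\<And>x. norm x \<ge> 1 \<Longrightarrow> w x = 0"
    and z: "\<And>\<zeta>. \<zeta> \<in> test_functions \<Longrightarrow> (LINT x|lborel. \<zeta> x *\<^sub>R w x) = 0"
  shows "AE x in lborel. w x = 0"
proof -
  note [measurable] = w(1)
  have "AE x in lborel. norm x < 1 - 1 / real (Suc n) \<longrightarrow> w x = 0" for n
  proof -
    let ?B = "ball (0::real^2) (1 - 1 / real (Suc n))"
    have bnd: "(\<integral>\<^sup>+x. ennreal ((norm (w x))\<^sup>2) * indicator ?B x \<partial>lborel) \<le> ennreal \<eta>" if "\<eta> > 0" for \<eta>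
    proof -
      obtain d where d: "d > 0" "\<And>r \<phi>. mollifier r \<phi> \<Longrightarrow> r < d \<Longrightarrow>
          (\<integral>\<^sup>+x. ennreal ((norm (conv \<phi> w x - w x))\<^sup>2) \<partial>lborel) \<le> ennreal \<eta>"
        using conv_L2_tendsto[OF w \<open>\<eta> > 0\<close>] by blast
      define e where "e = min (d / 2) (1 / real (Suc n))"
      have e: "e > 0" "e < d" "e \<le> 1 / real (Suc n)" using d(1) by (auto simp: e_def min_def)
      obtain \<phi> where m: "mollifier e \<phi>" and t: "\<And>x. norm x + e < 1 \<Longrightarrow> (\<lambda>y. \<phi> (x - y)) \<in> test_functions"
        by (rule smooth_mollifier[OF e(1)]) blast
      have "(\<integral>\<^sup>+x. ennreal ((norm (w x))\<^sup>2) * indicator ?B x \<partial>lborel) \<le> (\<integral>\<^sup>+x. ennreal ((norm (conv \<phi> w x - w x))\<^sup>2) \<partial>lborel)"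
      proof (rule nn_integral_mono)
        fix x
        show "ennreal ((norm (w x))\<^sup>2) * indicator ?B x \<le> ennreal ((norm (conv \<phi> w x - w x))\<^sup>2)"
        proof (cases "x \<in> ?B")
          case True
          then have "conv \<phi> w x = 0" using z[OF t[of x]] e(3) by (simp add: conv_def)
          then show ?thesis using True by simp
        qed simp
      qed
      also have "\<dots> \<le> ennreal \<eta>" by (rule d(2)[OF m e(2)])
      finally show ?thesis .
    qed
    have "(\<integral>\<^sup>+x. ennreal ((norm (w x))\<^sup>2) * indicator ?B x \<partial>lborel) \<le> 0"
      by (rule ennreal_le_epsilon) (simp only: add_0 bnd)
    then have "(\<integral>\<^sup>+x. ennreal ((norm (w x))\<^sup>2) * indicator ?B x \<partial>lborel) = 0" by (simp only: le_zero_eq)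
    then have "AE x in lborel. ennreal ((norm (w x))\<^sup>2) * indicator ?B x = 0"
      by (subst (asm) nn_integral_0_iff_AE) (intro borel_measurable_times_ennreal borel_measurable_indicator; simp)
    then show ?thesis
    proof eventually_elim
      case (elim x)
      have "w x = 0" if "norm x < 1 - 1 / real (Suc n)"
      proof -
        have "x \<in> ?B" using that by simp
        then have "ennreal ((norm (w x))\<^sup>2) = 0" using elim by (simp only: indicator_simps mult_1_right)
        then show ?thesis by simp
      qed
      then show ?case by blast
    qed
  qed
  then have "AE x in lborel. \<forall>n. norm x < 1 - 1 / real (Suc n) \<longrightarrow> w x = 0" unfolding AE_all_countable by blast
  then show ?thesis
  proof eventually_elim
    case (elim x)
    show ?case
    proof (cases "norm x < 1")
      case True
      then obtain n where "inverse (real (Suc n)) < 1 - norm x" using reals_Archimedean[of "1 - norm x"] by auto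
      then have "norm x < 1 - 1 / real (Suc n)" by (simp add: inverse_eq_divide)
      then show ?thesis using elim by blast
    qed (use w(3) in simp)
  qed
qed

section \<open>Product and chain rules, and the cross product\<close>

lemma has_partials_linear:
  assumes "bounded_linear T" "has_partials f f1 f2"
  shows "has_partials (\<lambda>x. T (f x)) (\<lambda>x. T (f1 x)) (\<lambda>x. T (f2 x))"
  unfolding has_partials_def
proof
  fix x
  interpret bounded_linear T by fact
  have "(f has_derivative (\<lambda>h. h$1 *\<^sub>R f1 x + h$2 *\<^sub>R f2 x)) (at x)" using assms(2) by (simp add: has_partials_def)
  from has_derivative[OF this]
  show "((\<lambda>x. T (f x)) has_derivative (\<lambda>h. h$1 *\<^sub>R T (f1 x) + h$2 *\<^sub>R T (f2 x))) (at x)"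
    by (simp add: add scale)
qed

lemma has_partials_inner:
  fixes f g :: "real^2 \<Rightarrow> 'b::real_inner"
  assumes "has_partials f f1 f2" "has_partials g g1 g2"
  shows "has_partials (\<lambda>x. f x \<bullet> g x) (\<lambda>x. f x \<bullet> g1 x + f1 x \<bullet> g x) (\<lambda>x. f x \<bullet> g2 x + f2 x \<bullet> g x)"
  unfolding has_partials_def
proof
  fix x
  show "((\<lambda>x. f x \<bullet> g x) has_derivative (\<lambda>h. h$1 *\<^sub>R (f x \<bullet> g1 x + f1 x \<bullet> g x) + h$2 *\<^sub>R (f x \<bullet> g2 x + f2 x \<bullet> g x))) (at x)"
    by (rule has_derivative_eq_rhs[OF has_derivative_inner])
      (use assms in \<open>auto simp: has_partials_def algebra_simps inner_add_left inner_add_right\<close>)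
qed

lemma has_partials_compose_real:
  fixes f :: "real^2 \<Rightarrow> real"
  assumes "has_partials f f1 f2" "\<And>x. (g has_real_derivative g' (f x)) (at (f x))"
  shows "has_partials (\<lambda>x. g (f x)) (\<lambda>x. g' (f x) * f1 x) (\<lambda>x. g' (f x) * f2 x)"
  unfolding has_partials_def
proof
  fix x
  have "(f has_derivative (\<lambda>h. h$1 *\<^sub>R f1 x + h$2 *\<^sub>R f2 x)) (at x)" using assms(1) by (simp add: has_partials_def)
  from has_derivative_compose[OF this assms(2)[unfolded has_field_derivative_def]]
  show "((\<lambda>x. g (f x)) has_derivative (\<lambda>h. h$1 *\<^sub>R (g' (f x) * f1 x) + h$2 *\<^sub>R (g' (f x) * f2 x))) (at x)"
    by (simp add: algebra_simps)
qed

lemma norm_cross_le: "norm (cross3 x y) \<le> norm x * norm y"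
proof -
  have "(norm (cross3 x y))\<^sup>2 \<le> (norm x * norm y)\<^sup>2" using norm_cross_dot[of x y] by (smt (verit) zero_le_power2)
  then show ?thesis by (rule power2_le_imp_le) simp
qed

text \<open>Makes the area density integrable when the partials are square integrable.\<close>

lemma norm_cross_le_squares: "norm (cross3 a b) \<le> (norm a)\<^sup>2 + (norm b)\<^sup>2"
proof -
  have "2 * (norm a * norm b) \<le> (norm a)\<^sup>2 + (norm b)\<^sup>2"
    using zero_le_power2[of "norm a - norm b"] by (simp add: power2_eq_square algebra_simps)
  moreover have "0 \<le> norm a * norm b" by simp
  ultimately show ?thesis using norm_cross_le[of a b] by linarith
qed

lemma abs_inner_le:
  fixes v w :: "'a::real_inner"
  assumes "norm v \<le> 1" shows "\<bar>v \<bullet> w\<bar> \<le> norm w"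
  using Cauchy_Schwarz_ineq2[of v w] mult_right_mono[OF assms norm_ge_zero[of w]] by simp

lemma bounded_bilinear_cross: "bounded_bilinear cross3"
  using bilinear_cross bilinear_conv_bounded_bilinear by blast

lemmas tendsto_cross [tendsto_intros] = bounded_bilinear.tendsto[OF bounded_bilinear_cross]

lemma continuous_on_cross' [continuous_intros]:
  fixes f g :: "'a::topological_space \<Rightarrow> real^3"
  shows "continuous_on S f \<Longrightarrow> continuous_on S g \<Longrightarrow> continuous_on S (\<lambda>x. cross3 (f x) (g x))"
  by (rule bounded_bilinear.continuous_on[OF bounded_bilinear_cross])

lemma borel_measurable_cross [measurable (raw)]:
  assumes "f \<in> borel_measurable M" "g \<in> borel_measurable M"
  shows "(\<lambda>x. cross3 (f x) (g x)) \<in> borel_measurable M"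
  by (rule borel_measurable_continuous_Pair[OF assms]) (intro continuous_intros)

text \<open>The integrand of the divergence identity for the field \<open>A a = (y \<times> a) / (1 + e - a \<bullet> y)\<close>:
  with \<open>h\<close> and \<open>k\<close> the partial derivatives of \<open>a\<close> and \<open>z1\<close>, \<open>z2\<close> those of \<open>z0\<close>, it is
  \<open>\<partial>\<^sub>1 (z0 A \<bullet> k) - \<partial>\<^sub>2 (z0 A \<bullet> h)\<close>.\<close>

definition div_integrand :: "real \<Rightarrow> real^3 \<Rightarrow> real \<Rightarrow> real \<Rightarrow> real \<Rightarrow> real^3 \<Rightarrow> real^3 \<Rightarrow> real^3 \<Rightarrow> real" where
  "div_integrand e y z0 z1 z2 a h k =
     (let g = 1 / (1 + e - a \<bullet> y); A = cross3 y a in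
      z1 * (g * (A \<bullet> k)) - z2 * (g * (A \<bullet> h))
      + z0 * (g\<^sup>2 * ((h \<bullet> y) * (A \<bullet> k) - (k \<bullet> y) * (A \<bullet> h)) + g * (cross3 y h \<bullet> k - cross3 y k \<bullet> h)))"

lemma denominator_ge:
  assumes "norm a \<le> 1" "norm y = 1" "(e::real) > 0"
  shows "1 + e - a \<bullet> y \<ge> e"
  using norm_cauchy_schwarz[of a y] assms by simp

text \<open>What matters is the growth: at most quadratic in \<open>h\<close> and \<open>k\<close>,
  so the integrable majorant of the squared mollified derivatives dominates it. The powers of 1/e
  are harmless while \<open>e\<close> is fixed.\<close>

lemma div_integrand_bound:
  assumes "norm a \<le> 1" "norm y = 1" "e > 0" "\<bar>z0\<bar> \<le> B" "\<bar>z1\<bar> \<le> B" "\<bar>z2\<bar> \<le> B"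
  shows "\<bar>div_integrand e y z0 z1 z2 a h k\<bar> \<le> B * (2 / e + 1 / e\<^sup>2) * (1 + (norm h)\<^sup>2 + (norm k)\<^sup>2)"
proof -
  define g where "g = 1 / (1 + e - a \<bullet> y)"
  have d: "1 + e - a \<bullet> y \<ge> e" by (rule denominator_ge[OF assms(1-3)])
  have g: "0 \<le> g" "g \<le> 1 / e" using d assms(3) by (auto simp: g_def intro!: divide_left_mono mult_pos_pos)
  have B: "B \<ge> 0" using assms(4) by linarith
  have A: "norm (cross3 y a) \<le> 1" using norm_cross_le[of y a] assms by simp
  have Ak: "\<bar>cross3 y a \<bullet> k\<bar> \<le> norm k" for k
    using Cauchy_Schwarz_ineq2[of "cross3 y a" k] A mult_right_mono[OF A, of "norm k"] by simp
  have hy: "\<bar>h \<bullet> y\<bar> \<le> norm h" for h using Cauchy_Schwarz_ineq2[of h y] assms by simp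
  have ch: "\<bar>cross3 y h \<bullet> k\<bar> \<le> norm h * norm k" for h k
    using Cauchy_Schwarz_ineq2[of "cross3 y h" k] norm_cross_le[of y h] mult_right_mono[OF norm_cross_le[of y h], of "norm k"] assms by simp
  have one: "2 * norm k \<le> 1 + (norm k)\<^sup>2" for k :: "real^3"
    using zero_le_power2[of "norm k - 1"] by (simp add: power2_eq_square algebra_simps)
  have two: "2 * (norm h * norm k) \<le> (norm h)\<^sup>2 + (norm k)\<^sup>2"
    using zero_le_power2[of "norm h - norm k"] by (simp add: power2_eq_square algebra_simps)
  let ?s = "1 + (norm h)\<^sup>2 + (norm k)\<^sup>2"
  have t1: "\<bar>z1 * (g * (cross3 y a \<bullet> k))\<bar> \<le> B * (1 / e * norm k)"
    unfolding abs_mult using g B assms Ak[of k] by (intro mult_mono) auto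
  have t2: "\<bar>z2 * (g * (cross3 y a \<bullet> h))\<bar> \<le> B * (1 / e * norm h)"
    unfolding abs_mult using g B assms Ak[of h] by (intro mult_mono) auto
  have m1: "\<bar>(h \<bullet> y) * (cross3 y a \<bullet> k)\<bar> \<le> norm h * norm k" unfolding abs_mult using hy[of h] Ak[of k] by (intro mult_mono) auto
  have m2: "\<bar>(k \<bullet> y) * (cross3 y a \<bullet> h)\<bar> \<le> norm h * norm k" unfolding abs_mult using hy[of k] Ak[of h]
    by (subst mult.commute[of "norm h"], intro mult_mono) auto
  have "\<bar>(h \<bullet> y) * (cross3 y a \<bullet> k) - (k \<bullet> y) * (cross3 y a \<bullet> h)\<bar> \<le> ?s" using m1 m2 two by linarith
  moreover have "g\<^sup>2 \<le> 1 / e\<^sup>2" using power_mono[OF g(2) g(1), of 2] by (simp add: power_divide)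
  ultimately have t3: "\<bar>g\<^sup>2 * ((h \<bullet> y) * (cross3 y a \<bullet> k) - (k \<bullet> y) * (cross3 y a \<bullet> h))\<bar> \<le> 1 / e\<^sup>2 * ?s"
    unfolding abs_mult by (intro mult_mono) auto
  have "\<bar>cross3 y h \<bullet> k - cross3 y k \<bullet> h\<bar> \<le> (norm h)\<^sup>2 + (norm k)\<^sup>2" using ch[of h k] ch[of k h] two by (simp add: mult.commute)
  then have t4: "\<bar>g * (cross3 y h \<bullet> k - cross3 y k \<bullet> h)\<bar> \<le> 1 / e * ((norm h)\<^sup>2 + (norm k)\<^sup>2)"
    unfolding abs_mult using g assms(3) by (intro mult_mono) auto
  have t34: "\<bar>z0 * (g\<^sup>2 * ((h \<bullet> y) * (cross3 y a \<bullet> k) - (k \<bullet> y) * (cross3 y a \<bullet> h)) + g * (cross3 y h \<bullet> k - cross3 y k \<bullet> h))\<bar>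
      \<le> B * (1 / e\<^sup>2 * ?s + 1 / e * ((norm h)\<^sup>2 + (norm k)\<^sup>2))"
    unfolding abs_mult[of z0] using t3 t4 B assms by (intro mult_mono order_trans[OF abs_triangle_ineq] add_mono) auto
  have "B * (1 / e * norm k) + B * (1 / e * norm h) \<le> B * (1 / e * ?s)"
  proof -
    have "norm k + norm h \<le> ?s" using one[of h] one[of k] by (smt (verit) zero_le_power2)
    then have "B * (1 / e) * (norm k + norm h) \<le> B * (1 / e) * ?s" using B assms(3) by (intro mult_left_mono) auto
    then show ?thesis by (simp add: algebra_simps)
  qed
  moreover have "B * (1 / e * ((norm h)\<^sup>2 + (norm k)\<^sup>2)) \<le> B * (1 / e * ?s)" using B assms(3) by (intro mult_left_mono) auto
  moreover have "B * (1 / e\<^sup>2 * ?s + 1 / e * ((norm h)\<^sup>2 + (norm k)\<^sup>2)) = B * (1 / e\<^sup>2 * ?s) + B * (1 / e * ((norm h)\<^sup>2 + (norm k)\<^sup>2))"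
    by (rule distrib_left)
  moreover have "B * (2 / e + 1 / e\<^sup>2) * ?s = B * (1 / e * ?s) + B * (1 / e * ?s) + B * (1 / e\<^sup>2 * ?s)"
    by (simp add: algebra_simps)
  ultimately show ?thesis
    using t1 t2 t34 unfolding div_integrand_def Let_def g_def[symmetric] by linarith
qed

text \<open>For tangent \<open>h\<close>, \<open>k\<close> the vector \<open>cross3 h k\<close> is J
  times \<open>a\<close>. With s = 1 + e - a . y the J-terms combine by completing the square, (a .
  y)^2 - 1 + 2 s (a . y) = (1 + e)^2 - 1 - s^2; this is the origin of the defect (2 e +
  e^2)/s^2.\<close>

lemma div_integrand_tangent:
  assumes "norm a = 1" "norm y = 1" "e > 0" "a \<bullet> h = 0" "a \<bullet> k = 0"
  shows "div_integrand e y z0 z1 z2 a h k =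
    z1 * (cross3 y a \<bullet> k / (1 + e - a \<bullet> y)) - z2 * (cross3 y a \<bullet> h / (1 + e - a \<bullet> y))
    - z0 * ((1 - (2 * e + e\<^sup>2) / (1 + e - a \<bullet> y)\<^sup>2) * (a \<bullet> cross3 h k))"
proof -
  define s where "s = 1 + e - a \<bullet> y"
  have s: "s > 0" using denominator_ge[of a y e] assms by (simp add: s_def)
  have aa: "a \<bullet> a = 1" "y \<bullet> y = 1" using assms by (simp_all add: dot_square_norm)
  \<comment> \<open>Triple products: tangency makes (h x k) x a vanish, and a x ((h x k) x a) then
    identifies h x k as a multiple of a.\<close>
  have "cross3 (cross3 h k) a = (a \<bullet> h) *\<^sub>R k - (a \<bullet> k) *\<^sub>R h"
    by (simp add: cross3_simps forall_3)
  then have "cross3 (cross3 h k) a = 0" using assms by simp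
  moreover have "cross3 a (cross3 (cross3 h k) a) = (a \<bullet> a) *\<^sub>R cross3 h k - (a \<bullet> cross3 h k) *\<^sub>R a"
    by (simp add: cross3_simps forall_3)
  ultimately have hk: "cross3 h k = (a \<bullet> cross3 h k) *\<^sub>R a" using aa by simp
  define J where "J = a \<bullet> cross3 h k"
  have yhk: "y \<bullet> cross3 h k = J * (a \<bullet> y)" by (subst hk) (simp add: J_def inner_commute)
  have b1: "(h \<bullet> y) * (cross3 y a \<bullet> k) - (k \<bullet> y) * (cross3 y a \<bullet> h) = - (y \<bullet> y) * (a \<bullet> cross3 h k) + (a \<bullet> y) * (y \<bullet> cross3 h k)"
    by (simp add: cross3_simps)
  have b2: "cross3 y h \<bullet> k - cross3 y k \<bullet> h = 2 * (y \<bullet> cross3 h k)"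
    by (simp add: cross3_simps)
  have key: "(1 / s)\<^sup>2 * (- J + (a \<bullet> y) * (J * (a \<bullet> y))) + 1 / s * (2 * (J * (a \<bullet> y))) = - ((1 - (2 * e + e\<^sup>2) / s\<^sup>2) * J)"
  proof -
    have ay: "a \<bullet> y = 1 + e - s" by (simp add: s_def)
    show ?thesis unfolding ay using s by (simp add: field_simps power2_eq_square)
  qed
  show ?thesis
    unfolding div_integrand_def Let_def s_def[symmetric] b1 b2 yhk aa J_def[symmetric] mult_minus_left mult_1 key by simp
qed

text \<open>The output of \<open>weak_diff_approx\<close> as a locale, shared by the limit passages
  and the Lusin decomposition.\<close>

locale smooth_approx =
  fixes N V1 V2 :: "real^2 \<Rightarrow> 'b::euclidean_space"
    and u u1 u2 u11 u12 u22 v1 v2 :: "nat \<Rightarrow> real^2 \<Rightarrow> 'b" and D :: "real^2 \<Rightarrow> real"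
  assumes w: "weak_diff N V1 V2" and N1: "\<And>x. norm (N x) \<le> 1"
    and up: "\<And>k. has_partials (u k) (u1 k) (u2 k)" "\<And>k. has_partials (u1 k) (u11 k) (u12 k)" "\<And>k. has_partials (u2 k) (u12 k) (u22 k)"
    and uc: "\<And>k. continuous_on UNIV (u11 k)" "\<And>k. continuous_on UNIV (u12 k)" "\<And>k. continuous_on UNIV (u22 k)"
    and u_le: "\<And>k x. norm (u k x) \<le> 1"
    and uv: "\<And>k x. norm x + 1 / real (Suc k) < 1 \<Longrightarrow> u1 k x = v1 k x \<and> u2 k x = v2 k x"
    and vc: "\<And>k. continuous_on UNIV (v1 k)" "\<And>k. continuous_on UNIV (v2 k)"
    and vz: "\<And>k x. norm x \<ge> 2 \<Longrightarrow> v1 k x = 0 \<and> v2 k x = 0"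
    and v1L: "\<And>k. (\<integral>\<^sup>+x. ennreal ((norm (v1 k x - V1 x))\<^sup>2) \<partial>lborel) \<le> ennreal ((1/16)^k)"
    and v2L: "\<And>k. (\<integral>\<^sup>+x. ennreal ((norm (v2 k x - V2 x))\<^sup>2) \<partial>lborel) \<le> ennreal ((1/16)^k)"
    and Di: "integrable lborel D"
    and lim: "AE x in lborel. (\<forall>k. (norm (v1 k x))\<^sup>2 \<le> D x \<and> (norm (v2 k x))\<^sup>2 \<le> D x) \<and>
        (\<lambda>k. u k x) \<longlonglongrightarrow> N x \<and> (\<lambda>k. v1 k x) \<longlonglongrightarrow> V1 x \<and> (\<lambda>k. v2 k x) \<longlonglongrightarrow> V2 x"

section \<open>Integral identities carried from smooth maps to weakly differentiable ones\<close>

lemma smooth_approx_exists: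
  assumes "weak_diff N V1 V2" "\<And>x. norm (N x) \<le> 1"
  obtains u u1 u2 u11 u12 u22 v1 v2 D where "smooth_approx N V1 V2 u u1 u2 u11 u12 u22 v1 v2 D"
proof (rule weak_diff_approx[OF assms], goal_cases)
  case (1 u u1 u2 u11 u12 u22 v1 v2 D)
  show thesis
    by (rule that, rule smooth_approx.intro) (fact+)
qed

context smooth_approx
begin

lemmas W = weak_diffD[OF w]

lemma u_continuous: "continuous_on UNIV (u k)" "continuous_on UNIV (u1 k)" "continuous_on UNIV (u2 k)"
  using up has_partials_continuous by blast+

text \<open>The integrand lives on a disc of radius r < 1, where \<open>u1\<close>,
  \<open>u2\<close> eventually coincide with \<open>v1\<close>, \<open>v2\<close>; these converge
  almost everywhere and their squares have the majorant \<open>D\<close>, so quadratic growth in the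
  derivatives allows dominated convergence.\<close>

lemma limit_passage:
  fixes H :: "real^2 \<Rightarrow> 'b \<Rightarrow> 'b \<Rightarrow> 'b \<Rightarrow> real"
  assumes meas: "\<And>k. (\<lambda>x. H x (u k x) (u1 k x) (u2 k x)) \<in> borel_measurable borel"
    "(\<lambda>x. H x (N x) (V1 x) (V2 x)) \<in> borel_measurable borel"
    and r: "r < 1" and zero: "\<And>x a h k. norm x \<ge> r \<Longrightarrow> H x a h k = 0"
    and bound: "\<And>x a h k. norm a \<le> 1 \<Longrightarrow> \<bar>H x a h k\<bar> \<le> B * (1 + (norm h)\<^sup>2 + (norm k)\<^sup>2)" and B: "B \<ge> 0"
    and cont: "\<And>x a h k as hs ks. as \<longlonglongrightarrow> a \<Longrightarrow> hs \<longlonglongrightarrow> h \<Longrightarrow> ks \<longlonglongrightarrow> k \<Longrightarrow> (\<And>n. norm (as n) \<le> 1) \<Longrightarrow> norm a \<le> 1 \<Longrightarrow>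
       (\<lambda>n. H x (as n) (hs n) (ks n)) \<longlonglongrightarrow> H x a h k"
    and int0: "\<And>k. (LINT x|lborel. H x (u k x) (u1 k x) (u2 k x)) = 0"
  shows "(LINT x|lborel. H x (N x) (V1 x) (V2 x)) = 0"
proof -
  \<comment> \<open>From index \<open>m\<close> on, the disc of radius \<open>r\<close> lies in the
    region where u1 = v1 and u2 = v2; the sequence is started there.\<close>
  obtain m where m: "inverse (real (Suc m)) < 1 - r" using reals_Archimedean[of "1 - r"] r by auto
  have eqv: "u1 k x = v1 k x \<and> u2 k x = v2 k x" if "k \<ge> m" "norm x < r" for k x
  proof -
    have "1 / real (Suc k) \<le> inverse (real (Suc m))" using that(1) by (simp add: inverse_eq_divide frac_le)
    then show ?thesis using m that(2) by (intro uv) linarith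
  qed
  have "(\<lambda>k. LINT x|lborel. H x (u (k + m) x) (u1 (k + m) x) (u2 (k + m) x)) \<longlonglongrightarrow> (LINT x|lborel. H x (N x) (V1 x) (V2 x))"
  proof (rule integral_dominated_convergence[where w="\<lambda>x. indicator (cball 0 r) x *\<^sub>R (B * 1) + 2 * B * \<bar>D x\<bar>"])
    show "integrable lborel (\<lambda>x::real^2. indicator (cball 0 r) x *\<^sub>R (B * 1) + 2 * B * \<bar>D x\<bar>)"
      by (intro Bochner_Integration.integrable_add integrable_scaleR_left integrable_real_indicator integrable_mult_right integrable_abs Di)
        (use emeasure_lborel_cball_finite in \<open>auto simp: infinity_ennreal_def\<close>)
    show "AE x in lborel. (\<lambda>k. H x (u (k + m) x) (u1 (k + m) x) (u2 (k + m) x)) \<longlonglongrightarrow> H x (N x) (V1 x) (V2 x)"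
      using lim
    proof eventually_elim
      case (elim x)
      show ?case
      proof (cases "norm x < r")
        case True
        have l: "(\<lambda>k. u (k + m) x) \<longlonglongrightarrow> N x" "(\<lambda>k. v1 (k + m) x) \<longlonglongrightarrow> V1 x" "(\<lambda>k. v2 (k + m) x) \<longlonglongrightarrow> V2 x"
          using elim by (auto intro: LIMSEQ_ignore_initial_segment)
        show ?thesis using cont[OF l u_le N1] eqv[OF _ True] by simp
      qed (use zero in simp)
    qed
    show "AE x in lborel. norm (H x (u (k + m) x) (u1 (k + m) x) (u2 (k + m) x)) \<le> indicator (cball 0 r) x *\<^sub>R (B * 1) + 2 * B * \<bar>D x\<bar>" for k
      using lim
    proof eventually_elim
      case (elim x)
      show ?case
      proof (cases "norm x < r")
        case True
        have "\<bar>H x (u (k + m) x) (u1 (k + m) x) (u2 (k + m) x)\<bar> \<le> B * (1 + (norm (v1 (k+m) x))\<^sup>2 + (norm (v2 (k+m) x))\<^sup>2)"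
          using bound[OF u_le] eqv[of "k+m" x] True by simp
        also have "\<dots> \<le> B * (1 + \<bar>D x\<bar> + \<bar>D x\<bar>)" using elim B by (intro mult_left_mono add_mono) (auto intro: order_trans)
        finally show ?thesis using True by (simp add: algebra_simps)
      next
        case False
        then show ?thesis using zero[of x] B by (simp add: zero_le_mult_iff)
      qed
    qed
  qed (use meas in auto)
  then show ?thesis using int0 by (simp add: LIMSEQ_const_iff)
qed

end

text \<open>Integrating the derivative of z |u k|^2 for a test function z and passing to the limit
  gives twice the integral of z (N . V) plus that of (dz) |N|^2. As |N| = 1 on the disc, the second
  integral is that of dz, hence 0, and the fundamental lemma finishes.\<close>

lemma has_partials_orthogonal:
  assumes w: "weak_diff N V1 V2" and N1: "\<And>x. norm (N x) \<le> 1" and NS: "AE x in lborel. norm x < 1 \<longrightarrow> norm (N x) = 1"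
  shows "AE x in lborel. N x \<bullet> V1 x = 0 \<and> N x \<bullet> V2 x = 0"
proof -
  obtain u u1 u2 u11 u12 u22 v1 v2 D where "smooth_approx N V1 V2 u u1 u2 u11 u12 u22 v1 v2 D"
    using smooth_approx_exists[OF w N1] by blast
  then interpret smooth_approx N V1 V2 u u1 u2 u11 u12 u22 v1 v2 D .
  note [measurable] = W(1,2,3)
  have [measurable]: "u k \<in> borel_measurable borel" "u1 k \<in> borel_measurable borel" "u2 k \<in> borel_measurable borel" for k
    using u_continuous by (auto intro: borel_measurable_continuous_onI)
  have sq: "(norm (N x \<bullet> V))\<^sup>2 \<le> (norm V)\<^sup>2" for x V
    using Cauchy_Schwarz_ineq2[of "N x" V] mult_right_mono[OF N1[of x], of "norm V"] by (intro power_mono) auto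
  have z: "(LINT x|lborel. \<zeta> x *\<^sub>R (N x \<bullet> V1 x)) = 0 \<and> (LINT x|lborel. \<zeta> x *\<^sub>R (N x \<bullet> V2 x)) = 0" if \<zeta>: "\<zeta> \<in> test_functions" for \<zeta>
  proof -
    obtain r B where r: "0 < r" "r < 1" and t: "has_partials \<zeta> (partial_deriv 1 \<zeta>) (partial_deriv 2 \<zeta>)"
      and zc: "continuous_on UNIV \<zeta>" and tc: "continuous_on UNIV (partial_deriv 1 \<zeta>)" "continuous_on UNIV (partial_deriv 2 \<zeta>)"
      and tz: "\<And>x. norm x \<ge> r \<Longrightarrow> \<zeta> x = 0" "\<And>x. norm x \<ge> r \<Longrightarrow> partial_deriv 1 \<zeta> x = 0" "\<And>x. norm x \<ge> r \<Longrightarrow> partial_deriv 2 \<zeta> x = 0"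
      and B: "B > 0" "\<And>x. \<bar>\<zeta> x\<bar> \<le> B" "\<And>x. \<bar>partial_deriv 1 \<zeta> x\<bar> \<le> B" "\<And>x. \<bar>partial_deriv 2 \<zeta> x\<bar> \<le> B"
      by (rule test_function_bounds[OF \<zeta>]) blast
    note [measurable] = borel_measurable_continuous_onI[OF zc] borel_measurable_continuous_onI[OF tc(1)] borel_measurable_continuous_onI[OF tc(2)]
    note pg = has_partials_mult[OF t has_partials_inner[OF up(1) up(1)]]
    have pc: "continuous_on UNIV (\<lambda>x. \<zeta> x * (u k x \<bullet> u1 k x + u1 k x \<bullet> u k x) + partial_deriv 1 \<zeta> x * (u k x \<bullet> u k x))"
       "continuous_on UNIV (\<lambda>x. \<zeta> x * (u k x \<bullet> u2 k x + u2 k x \<bullet> u k x) + partial_deriv 2 \<zeta> x * (u k x \<bullet> u k x))" for k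
      by (intro continuous_intros zc tc u_continuous)+
    have I0: "(LINT x|lborel. \<zeta> x * (u k x \<bullet> u1 k x + u1 k x \<bullet> u k x) + partial_deriv 1 \<zeta> x * (u k x \<bullet> u k x)) = 0"
      "(LINT x|lborel. \<zeta> x * (u k x \<bullet> u2 k x + u2 k x \<bullet> u k x) + partial_deriv 2 \<zeta> x * (u k x \<bullet> u k x)) = 0" for k
      by (rule integral_partial_eq_0[OF pg pc, where R=r]; simp add: tz)+
    have bnd: "\<bar>\<zeta> x * (a \<bullet> h + h \<bullet> a) + z * (a \<bullet> a)\<bar> \<le> (2 * B) * (1 + (norm h)\<^sup>2)"
      if "norm a \<le> 1" "\<bar>z\<bar> \<le> B" for x z and a h :: 'a
    proof -
      have ah: "\<bar>a \<bullet> h\<bar> \<le> norm h" using Cauchy_Schwarz_ineq2[of a h] mult_right_mono[OF that(1), of "norm h"] by simp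
      have one: "2 * norm h \<le> 1 + (norm h)\<^sup>2"
        using zero_le_power2[of "norm h - 1"] by (simp add: power2_eq_square algebra_simps)
      have "\<bar>a \<bullet> h + h \<bullet> a\<bar> \<le> 1 + (norm h)\<^sup>2" using ah one by (simp add: inner_commute)
      then have "\<bar>\<zeta> x * (a \<bullet> h + h \<bullet> a)\<bar> \<le> B * (1 + (norm h)\<^sup>2)"
        unfolding abs_mult using B(1) B(2)[of x] by (intro mult_mono) auto
      moreover have "\<bar>z * (a \<bullet> a)\<bar> \<le> B * (1 + (norm h)\<^sup>2)"
      proof -
        have "a \<bullet> a \<le> 1" using that(1) by (simp add: dot_square_norm power_le_one)
        then have "\<bar>a \<bullet> a\<bar> \<le> 1 + (norm h)\<^sup>2" by (smt (verit) zero_le_power2 inner_ge_zero)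
        then show ?thesis unfolding abs_mult using B(1) that(2) by (intro mult_mono) auto
      qed
      ultimately show ?thesis by (simp add: algebra_simps)
    qed
    have L1: "(LINT x|lborel. \<zeta> x * (N x \<bullet> V1 x + V1 x \<bullet> N x) + partial_deriv 1 \<zeta> x * (N x \<bullet> N x)) = 0"
    proof (rule limit_passage[where H="\<lambda>x a h k. \<zeta> x * (a \<bullet> h + h \<bullet> a) + partial_deriv 1 \<zeta> x * (a \<bullet> a)" and B="2 * B"])
      show "\<bar>\<zeta> x * (a \<bullet> h + h \<bullet> a) + partial_deriv 1 \<zeta> x * (a \<bullet> a)\<bar> \<le> 2 * B * (1 + (norm h)\<^sup>2 + (norm k)\<^sup>2)"
        if "norm a \<le> 1" for x and a h k :: 'a
        by (rule order_trans[OF bnd[OF that B(3)]]) (use B(1) in \<open>auto intro!: mult_left_mono\<close>)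
    qed (use r tz B(1) I0 in \<open>auto intro!: tendsto_intros\<close>)
    have L2: "(LINT x|lborel. \<zeta> x * (N x \<bullet> V2 x + V2 x \<bullet> N x) + partial_deriv 2 \<zeta> x * (N x \<bullet> N x)) = 0"
    proof (rule limit_passage[where H="\<lambda>x a h k. \<zeta> x * (a \<bullet> k + k \<bullet> a) + partial_deriv 2 \<zeta> x * (a \<bullet> a)" and B="2 * B"])
      show "\<bar>\<zeta> x * (a \<bullet> k + k \<bullet> a) + partial_deriv 2 \<zeta> x * (a \<bullet> a)\<bar> \<le> 2 * B * (1 + (norm h)\<^sup>2 + (norm k)\<^sup>2)"
        if "norm a \<le> 1" for x and a h k :: 'a
        by (rule order_trans[OF bnd[OF that B(4)]]) (use B(1) in \<open>auto intro!: mult_left_mono\<close>)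
    qed (use r tz B(1) I0 in \<open>auto intro!: tendsto_intros\<close>)
    have NN: "AE x in lborel. z x * (N x \<bullet> N x) = z x" if "\<And>x. norm x \<ge> r \<Longrightarrow> z x = 0" for z :: "real^2 \<Rightarrow> real"
      using NS
    proof eventually_elim
      case (elim x)
      then show ?case using that[of x] r by (cases "norm x < 1") (auto simp: dot_square_norm)
    qed
    have fin: "(LINT x|lborel. \<zeta> x *\<^sub>R (N x \<bullet> V x)) = 0"
      if L: "(LINT x|lborel. \<zeta> x * (N x \<bullet> V x + V x \<bullet> N x) + z x * (N x \<bullet> N x)) = 0"
        and zc: "continuous_on UNIV z" and zz: "\<And>x. norm x \<ge> r \<Longrightarrow> z x = 0" and z0: "(LINT x|lborel. z x) = 0"
        and V: "integrable lborel V" "V \<in> borel_measurable borel" for V z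
    proof -
      note [measurable] = V(2) borel_measurable_continuous_onI[OF zc]
      have iNV: "integrable lborel (\<lambda>x. N x \<bullet> V x)"
      proof (rule Bochner_Integration.integrable_bound[OF integrable_norm[OF V(1)]])
        show "AE x in lborel. norm (N x \<bullet> V x) \<le> norm (norm (V x))"
        proof (rule AE_I2)
          fix x
          show "norm (N x \<bullet> V x) \<le> norm (norm (V x))"
            using Cauchy_Schwarz_ineq2[of "N x" "V x"] mult_right_mono[OF N1[of x], of "norm (V x)"] by simp
        qed
      qed measurable
      have i1: "integrable lborel (\<lambda>x. \<zeta> x *\<^sub>R (N x \<bullet> V x))"
        by (rule integrable_bounded_scaleR[OF iNV _ B(2)]) measurable
      have i2: "integrable lborel z" by (rule integrable_continuous_compact_support[OF zc zz])
      have "(LINT x|lborel. \<zeta> x * (N x \<bullet> V x + V x \<bullet> N x) + z x * (N x \<bullet> N x)) = (LINT x|lborel. 2 * (\<zeta> x *\<^sub>R (N x \<bullet> V x)) + z x)"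
      proof (rule integral_cong_AE)
        show "AE x in lborel. \<zeta> x * (N x \<bullet> V x + V x \<bullet> N x) + z x * (N x \<bullet> N x) = 2 * (\<zeta> x *\<^sub>R (N x \<bullet> V x)) + z x"
        proof -
          have "AE x in lborel. z x * (N x \<bullet> N x) = z x" by (rule NN) (rule zz)
          then show ?thesis by eventually_elim (simp add: inner_commute algebra_simps)
        qed
      qed measurable
      also have "\<dots> = 2 * (LINT x|lborel. \<zeta> x *\<^sub>R (N x \<bullet> V x))"
        using i1 i2 z0 by simp
      finally show ?thesis using L by simp
    qed
    show ?thesis
      using fin[OF L1 tc(1) tz(2) integral_partial_eq_0(1)[OF t tc tz] W(13) W(2)]
        fin[OF L2 tc(2) tz(3) integral_partial_eq_0(2)[OF t tc tz] W(14) W(3)] by blast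
  qed
  have i: "integrable lborel (\<lambda>x. (norm (N x \<bullet> V x))\<^sup>2)" if "integrable lborel (\<lambda>x. (norm (V x))\<^sup>2)" "V \<in> borel_measurable borel" for V
    by (rule Bochner_Integration.integrable_bound[OF that(1)]) (use that(2) sq in auto)
  have "AE x in lborel. N x \<bullet> V1 x = 0"
    by (rule weak_zero_imp_AE_zero) (use i[OF W(5) W(2)] z W(7) in auto)
  moreover have "AE x in lborel. N x \<bullet> V2 x = 0"
    by (rule weak_zero_imp_AE_zero) (use i[OF W(6) W(3)] z W(7) in auto)
  ultimately show ?thesis by eventually_elim blast
qed

text \<open>The pullback of the primitive, away from \<open>y\<close>, of the area form of the sphere, smoothed at scale \<open>e\<close>.
  The factor \<open>1 - \<dots>\<close> is \<open>1\<close> minus an approximate identity of total mass \<open>4 * pi\<close> concentrating at \<open>y\<close>.\<close>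

lemma smoothed_area_form_exact:
  assumes w: "weak_diff N V1 V2" and N1: "\<And>x. norm (N x) \<le> 1" and NS: "AE x in lborel. norm x < 1 \<longrightarrow> norm (N x) = 1"
    and y: "norm y = 1" and e: "e > 0" and \<zeta>: "\<zeta> \<in> test_functions"
  shows "(LINT x|lborel. partial_deriv 1 \<zeta> x * (cross3 y (N x) \<bullet> V2 x / (1 + e - N x \<bullet> y))
      - partial_deriv 2 \<zeta> x * (cross3 y (N x) \<bullet> V1 x / (1 + e - N x \<bullet> y))
      - \<zeta> x * ((1 - (2 * e + e\<^sup>2) / (1 + e - N x \<bullet> y)\<^sup>2) * (N x \<bullet> cross3 (V1 x) (V2 x)))) = 0"
    (is "integral\<^sup>L _ ?F = 0")
proof -
  obtain u u1 u2 u11 u12 u22 v1 v2 D where "smooth_approx N V1 V2 u u1 u2 u11 u12 u22 v1 v2 D"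
    using smooth_approx_exists[OF w N1] by blast
  then interpret smooth_approx N V1 V2 u u1 u2 u11 u12 u22 v1 v2 D .
  note [measurable] = W(1,2,3)
  have [measurable]: "u k \<in> borel_measurable borel" "u1 k \<in> borel_measurable borel" "u2 k \<in> borel_measurable borel" for k
    using u_continuous by (auto intro: borel_measurable_continuous_onI)
  obtain r B where r: "0 < r" "r < 1" and t: "has_partials \<zeta> (partial_deriv 1 \<zeta>) (partial_deriv 2 \<zeta>)"
    and zc: "continuous_on UNIV \<zeta>" and tc: "continuous_on UNIV (partial_deriv 1 \<zeta>)" "continuous_on UNIV (partial_deriv 2 \<zeta>)"
    and tz: "\<And>x. norm x \<ge> r \<Longrightarrow> \<zeta> x = 0" "\<And>x. norm x \<ge> r \<Longrightarrow> partial_deriv 1 \<zeta> x = 0" "\<And>x. norm x \<ge> r \<Longrightarrow> partial_deriv 2 \<zeta> x = 0"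
    and B: "B > 0" "\<And>x. \<bar>\<zeta> x\<bar> \<le> B" "\<And>x. \<bar>partial_deriv 1 \<zeta> x\<bar> \<le> B" "\<And>x. \<bar>partial_deriv 2 \<zeta> x\<bar> \<le> B"
    by (rule test_function_bounds[OF \<zeta>]) blast
  note [measurable] = borel_measurable_continuous_onI[OF zc] borel_measurable_continuous_onI[OF tc(1)] borel_measurable_continuous_onI[OF tc(2)]
  let ?z1 = "partial_deriv 1 \<zeta>" and ?z2 = "partial_deriv 2 \<zeta>"
  let ?H = "\<lambda>x. div_integrand e y (\<zeta> x) (?z1 x) (?z2 x)"
  have dn: "1 + e - u k x \<bullet> y \<ge> e" for k x by (rule denominator_ge[OF u_le y e])
  have dn0: "1 + e - u k x \<bullet> y \<noteq> 0" for k x using dn[of k x] e by linarith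
  have I0: "(LINT x|lborel. ?H x (u k x) (u1 k x) (u2 k x)) = 0" for k
  proof -
    define g g' where "g s = 1 / (1 + e - s)" and "g' s = 1 / (1 + e - s)\<^sup>2" for s :: real
    have gd: "(g has_real_derivative g' (u k x \<bullet> y)) (at (u k x \<bullet> y))" for x
      unfolding g_def[abs_def] g'_def using dn0[of k x] by (auto intro!: derivative_eq_intros simp: power2_eq_square)
    have cu: "continuous_on UNIV (\<lambda>x. g (u k x \<bullet> y))" "continuous_on UNIV (\<lambda>x. g' (u k x \<bullet> y))"
      unfolding g_def g'_def using dn0 by (auto intro!: continuous_intros u_continuous)
    have pp: "has_partials (\<lambda>x. u k x \<bullet> y) (\<lambda>x. u1 k x \<bullet> y) (\<lambda>x. u2 k x \<bullet> y)"
      by (rule has_partials_linear[OF bounded_linear_inner_left up(1)])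
    note pG = has_partials_compose_real[OF pp gd]
    have lc: "bounded_linear (cross3 y)" by (rule bounded_bilinear.bounded_linear_right[OF bounded_bilinear_cross])
    note pA = has_partials_linear[OF lc up(1)]
    note pP = has_partials_mult[OF t has_partials_mult[OF pG has_partials_inner[OF pA up(3)]]]
    note pQ = has_partials_mult[OF t has_partials_mult[OF pG has_partials_inner[OF pA up(2)]]]
    \<comment> \<open>With A = y x u, these are the first partial of z g (A . u2) and the second
      partial of z g (A . u1). Both contain z g (A . u12), which cancels in the difference; no
      second derivative survives, so the limit in the mollification can be taken.\<close>
    let ?P1 = "\<lambda>x. \<zeta> x * (g (u k x \<bullet> y) * (cross3 y (u k x) \<bullet> u12 k x + cross3 y (u1 k x) \<bullet> u2 k x)
        + (g' (u k x \<bullet> y) * (u1 k x \<bullet> y)) * (cross3 y (u k x) \<bullet> u2 k x)) + ?z1 x * (g (u k x \<bullet> y) * (cross3 y (u k x) \<bullet> u2 k x))"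
    let ?Q2 = "\<lambda>x. \<zeta> x * (g (u k x \<bullet> y) * (cross3 y (u k x) \<bullet> u12 k x + cross3 y (u2 k x) \<bullet> u1 k x)
        + (g' (u k x \<bullet> y) * (u2 k x \<bullet> y)) * (cross3 y (u k x) \<bullet> u1 k x)) + ?z2 x * (g (u k x \<bullet> y) * (cross3 y (u k x) \<bullet> u1 k x))"
    have cP: "continuous_on UNIV ?P1" "continuous_on UNIV ?Q2"
      by (intro continuous_intros zc tc u_continuous uc cu)+
    have iP: "integrable lborel ?P1" "integrable lborel ?Q2"
      by (rule integrable_continuous_compact_support[OF cP(1), where R=r]; simp add: tz)
        (rule integrable_continuous_compact_support[OF cP(2), where R=r]; simp add: tz)
    have "integral\<^sup>L lborel ?P1 = 0"
      by (rule integral_partial_eq_0(1)[OF pP, where R=r]; (simp add: tz)?)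
        (intro continuous_intros zc tc u_continuous uc cu)+
    moreover have "integral\<^sup>L lborel ?Q2 = 0"
      by (rule integral_partial_eq_0(2)[OF pQ, where R=r]; (simp add: tz)?)
        (intro continuous_intros zc tc u_continuous uc cu)+
    moreover have "?H x (u k x) (u1 k x) (u2 k x) = ?P1 x - ?Q2 x" for x
      unfolding div_integrand_def Let_def g_def g'_def by (simp add: algebra_simps power_divide)
    ultimately show ?thesis using iP by simp
  qed
  have L: "(LINT x|lborel. ?H x (N x) (V1 x) (V2 x)) = 0"
  proof (rule limit_passage[where H="?H" and B="B * (2 / e + 1 / e\<^sup>2)" and r=r])
    show "(\<lambda>x. ?H x (u k x) (u1 k x) (u2 k x)) \<in> borel_measurable borel" for k
      unfolding div_integrand_def Let_def by measurable
    show "(\<lambda>x. ?H x (N x) (V1 x) (V2 x)) \<in> borel_measurable borel"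
      unfolding div_integrand_def Let_def by measurable
    show "\<bar>?H x a h k\<bar> \<le> B * (2 / e + 1 / e\<^sup>2) * (1 + (norm h)\<^sup>2 + (norm k)\<^sup>2)" if "norm a \<le> 1" for x a h k
      by (rule div_integrand_bound[OF that y e B(2,3,4)])
    show "(\<lambda>n. ?H x (as n) (hs n) (ks n)) \<longlonglongrightarrow> ?H x a h k"
      if "as \<longlonglongrightarrow> a" "hs \<longlonglongrightarrow> h" "ks \<longlonglongrightarrow> k" "\<And>n. norm (as n) \<le> 1" "norm a \<le> 1" for x as a hs h ks k
    proof -
      have "1 + e - a \<bullet> y \<noteq> 0" using denominator_ge[OF that(5) y e] e by linarith
      then show ?thesis unfolding div_integrand_def Let_def using that(1-3) by (intro tendsto_intros)
    qed
    show "?H x a h k = 0" if "norm x \<ge> r" for x a h k using tz[OF that] by (simp add: div_integrand_def)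
  qed (use r B(1) e I0 in auto)
  have "(LINT x|lborel. ?H x (N x) (V1 x) (V2 x)) = integral\<^sup>L lborel ?F"
  proof (rule integral_cong_AE)
    show "AE x in lborel. ?H x (N x) (V1 x) (V2 x) = ?F x"
      using NS has_partials_orthogonal[OF w N1 NS]
    proof eventually_elim
      case (elim x)
      show ?case
      proof (cases "norm x < 1")
        case True
        then show ?thesis using elim div_integrand_tangent[OF _ y e] by simp
      next
        case False
        then show ?thesis using tz[of x] r by (simp add: div_integrand_def)
      qed
    qed
    show "(\<lambda>x. ?H x (N x) (V1 x) (V2 x)) \<in> borel_measurable lborel"
      unfolding div_integrand_def Let_def by measurable
  qed measurable
  then show ?thesis using L by simp
qed

section \<open>The maximal function and Lusin's theorem for weakly differentiable maps\<close>

text \<open>Vitali covering: the balls on which the average of \<open>g\<close> exceeds the level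
  are covered by the fivefold enlargements of a countable disjoint subfamily, whose total measure is
  controlled by the integral of \<open>g\<close>. Capping the radii at 1 supplies the bound that the
  covering lemma asks for and still serves increments over short distances.\<close>

lemma maximal_weak_type:
  fixes g :: "'a::euclidean_space \<Rightarrow> real"
  assumes g: "g \<in> borel_measurable borel" "\<And>x. g x \<ge> 0" and \<mu>: "\<mu> > 0"
  obtains U where "U \<in> sets borel" "ennreal \<mu> * emeasure lborel U \<le> ennreal (5 ^ DIM('a)) * (\<integral>\<^sup>+x. ennreal (g x) \<partial>lborel)"
    "\<And>x r. x \<notin> U \<Longrightarrow> 0 < r \<Longrightarrow> r \<le> 1 \<Longrightarrow>
       (\<integral>\<^sup>+z. ennreal (g z) * indicator (ball x r) z \<partial>lborel) \<le> ennreal \<mu> * emeasure lborel (ball x r)"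
proof -
  note [measurable] = g(1)
  let ?I = "\<lambda>x r. (\<integral>\<^sup>+z. ennreal (g z) * indicator (ball x r) z \<partial>lborel)"
  define K where "K = {(x::'a, r::real). 0 < r \<and> r \<le> 1 \<and> ?I x r > ennreal \<mu> * emeasure lborel (ball x r)}"
  let ?b = "\<lambda>i::'a \<times> real. ball (fst i) (snd i)" and ?B = "\<lambda>i::'a \<times> real. ball (fst i) (5 * snd i)"
  obtain C where C: "countable C" "C \<subseteq> K" "pairwise (\<lambda>i j. disjnt (?b i) (?b j)) C" "(\<Union>i\<in>K. ?b i) \<subseteq> (\<Union>i\<in>C. ?B i)"
  proof (rule Vitali_covering_lemma_balls[where S="\<Union>i\<in>K. ?b i" and K=K and a=fst and r=snd and B=1])
    show "0 < snd i \<and> snd i \<le> 1" if "i \<in> K" for i using that by (auto simp: K_def)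
  qed (rule order_refl, rule that)
  \<comment> \<open>The countable subfamily, possibly finite, becomes a sequence by filling up with
    empty sets.\<close>
  define c where "c = from_nat_into C"
  define P where "P n = (if n \<in> to_nat_on C ` C then ?b (c n) else {})" for n
  define Q where "Q n = (if n \<in> to_nat_on C ` C then ?B (c n) else {})" for n
  have cn: "c n \<in> C" if "n \<in> to_nat_on C ` C" for n using that C(1) by (auto simp: c_def)
  have QU: "(\<Union>i\<in>C. ?B i) \<subseteq> (\<Union>n. Q n)"
  proof
    fix x assume "x \<in> (\<Union>i\<in>C. ?B i)"
    then obtain i where i: "i \<in> C" "x \<in> ?B i" by blast
    then have "x \<in> Q (to_nat_on C i)" using C(1) by (simp add: Q_def c_def)
    then show "x \<in> (\<Union>n. Q n)" by blast
  qed
  have Qm: "range Q \<subseteq> sets lborel" and Pm: "range P \<subseteq> sets lborel" by (auto simp: Q_def P_def)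
  have disj: "disjoint_family P"
    unfolding disjoint_family_on_def
  proof (intro ballI impI)
    fix m n :: nat assume "m \<noteq> n"
    show "P m \<inter> P n = {}"
    proof (cases "m \<in> to_nat_on C ` C \<and> n \<in> to_nat_on C ` C")
      case True
      then have "c m \<noteq> c n" using \<open>m \<noteq> n\<close> C(1) by (auto simp: c_def)
      then show ?thesis using C(3) cn True by (auto simp: P_def pairwise_def disjnt_def)
    qed (auto simp: P_def)
  qed
  \<comment> \<open>Reading the integral of \<open>g\<close> as a measure with density turns the sum
    over the disjoint balls into countable additivity.\<close>
  have QP: "ennreal \<mu> * emeasure lborel (Q n) \<le> ennreal (5 ^ DIM('a)) * emeasure (density lborel g) (P n)" for n
  proof (cases "n \<in> to_nat_on C ` C")
    case True
    obtain x r where xr: "c n = (x, r)" by (cases "c n")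
    then have "(x, r) \<in> K" using cn[OF True] C(2) by auto
    then have K: "0 < r" "ennreal \<mu> * emeasure lborel (ball x r) \<le> ?I x r" by (auto simp: K_def)
    have "emeasure lborel (ball x (5 * r)) = ennreal (5 ^ DIM('a)) * emeasure lborel (ball x r)"
      using K(1) by (simp add: emeasure_ball power_mult_distrib ennreal_mult[symmetric] mult_ac)
    then have "ennreal \<mu> * emeasure lborel (Q n) = ennreal (5 ^ DIM('a)) * (ennreal \<mu> * emeasure lborel (ball x r))"
      using True xr by (simp add: Q_def mult_ac)
    also have "\<dots> \<le> ennreal (5 ^ DIM('a)) * ?I x r" using K(2) by (rule mult_left_mono) simp
    also have "?I x r = emeasure (density lborel g) (P n)"
      using True xr by (simp add: P_def emeasure_density)
    finally show ?thesis .
  qed (simp add: Q_def)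
  have "ennreal \<mu> * emeasure lborel (\<Union>n. Q n) \<le> ennreal \<mu> * (\<Sum>n. emeasure lborel (Q n))"
    by (intro mult_left_mono emeasure_subadditive_countably Qm) simp
  also have "\<dots> = (\<Sum>n. ennreal \<mu> * emeasure lborel (Q n))" by simp
  also have "\<dots> \<le> (\<Sum>n. ennreal (5 ^ DIM('a)) * emeasure (density lborel g) (P n))" by (intro suminf_le QP summableI)
  also have "\<dots> = ennreal (5 ^ DIM('a)) * (\<Sum>n. emeasure (density lborel g) (P n))" by simp
  also have "(\<Sum>n. emeasure (density lborel g) (P n)) = emeasure (density lborel g) (\<Union>n. P n)"
    by (rule suminf_emeasure) (use Pm disj in auto)
  also have "\<dots> \<le> emeasure (density lborel g) UNIV" by (rule emeasure_mono) auto
  also have "\<dots> = (\<integral>\<^sup>+x. ennreal (g x) \<partial>lborel)" by (simp add: emeasure_density)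
  finally have le: "ennreal \<mu> * emeasure lborel (\<Union>n. Q n) \<le> ennreal (5 ^ DIM('a)) * (\<integral>\<^sup>+x. ennreal (g x) \<partial>lborel)"
    by (simp add: mult_left_mono)
  show ?thesis
  proof (rule that[OF _ le])
    show "(\<Union>n. Q n) \<in> sets borel" using Qm by auto
    show "?I x r \<le> ennreal \<mu> * emeasure lborel (ball x r)" if "x \<notin> (\<Union>n. Q n)" "0 < r" "r \<le> 1" for x r
    proof (rule ccontr)
      assume "\<not> ?thesis"
      then have "(x, r) \<in> K" using that by (simp add: K_def not_le)
      then have "x \<in> (\<Union>i\<in>K. ?b i)" using that by force
      then show False using C(4) QU that(1) by blast
    qed
  qed
qed

section \<open>Increments controlled by the maximal function\<close>

lemma nn_integral_dilate:
  fixes f :: "'a::euclidean_space \<Rightarrow> ennreal"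
  assumes "f \<in> borel_measurable borel" "t > 0"
  shows "(\<integral>\<^sup>+x. f x \<partial>lborel) = ennreal (t ^ DIM('a)) * (\<integral>\<^sup>+z. f (c + t *\<^sub>R z) \<partial>lborel)"
proof -
  have "(\<integral>\<^sup>+x. f x \<partial>lborel) = (\<integral>\<^sup>+x. f x \<partial>density (distr lborel borel (\<lambda>x. c + t *\<^sub>R x)) (\<lambda>_. ennreal (\<bar>t\<bar> ^ DIM('a))))"
    using lborel_affine[of t c] assms(2) by simp
  also have "\<dots> = ennreal (t ^ DIM('a)) * (\<integral>\<^sup>+z. f (c + t *\<^sub>R z) \<partial>lborel)"
    using assms by (subst nn_integral_density) (auto simp: nn_integral_cmult nn_integral_distr)
  finally show ?thesis .
qed

text \<open>Fundamental theorem of calculus along the segment. The bound stays an integral over the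
  segment so that it can be exchanged with an integral over the endpoint \<open>z\<close>.\<close>

lemma segment_increment:
  fixes w :: "real^2 \<Rightarrow> 'b::euclidean_space"
  assumes w: "has_partials w w1 w2" "continuous_on UNIV w1" "continuous_on UNIV w2"
    and g: "continuous_on UNIV g" "\<And>y. y \<in> closed_segment p z \<Longrightarrow> norm (w1 y) \<le> g y \<and> norm (w2 y) \<le> g y"
    and \<rho>: "norm (z - p) \<le> \<rho>"
  shows "ennreal (norm (w z - w p)) \<le> (\<integral>\<^sup>+t. indicator {0..1} t * ennreal (2 * \<rho> * g (p + t *\<^sub>R (z - p))) \<partial>lborel)"
proof -
  let ?h = "z - p"
  define f where "f t = ?h$1 *\<^sub>R w1 (p + t *\<^sub>R ?h) + ?h$2 *\<^sub>R w2 (p + t *\<^sub>R ?h)" for t :: real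
  have fc: "continuous_on UNIV f"
    unfolding f_def by (intro continuous_intros continuous_on_compose2[OF w(2)] continuous_on_compose2[OF w(3)]) auto
  have d: "((\<lambda>t. w (p + t *\<^sub>R ?h)) has_vector_derivative f t) (at t within {0..1})" for t
  proof -
    have aff: "((\<lambda>t. p + t *\<^sub>R ?h) has_derivative (\<lambda>t. t *\<^sub>R ?h)) (at t within {0..1})"
      by (auto intro!: derivative_eq_intros)
    have "(w has_derivative (\<lambda>h. h$1 *\<^sub>R w1 (p + t *\<^sub>R ?h) + h$2 *\<^sub>R w2 (p + t *\<^sub>R ?h))) (at (p + t *\<^sub>R ?h))"
      using w(1) unfolding has_partials_def by blast
    from has_derivative_compose[OF aff this]
    show ?thesis unfolding has_vector_derivative_def f_def
      by (rule has_derivative_eq_rhs) (auto simp: algebra_simps)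
  qed
  have "(LINT t|lborel. indicator {0..1} t *\<^sub>R f t) = w (p + 1 *\<^sub>R ?h) - w (p + 0 *\<^sub>R ?h)"
    by (rule integral_FTC_Icc) (use d continuous_on_subset[OF fc] in auto)
  then have eq: "w z - w p = (LINT t|lborel. indicator {0..1} t *\<^sub>R f t)" by simp
  have "integrable lborel (\<lambda>t. indicator {0..1} t *\<^sub>R f t)"
    by (rule borel_integrable_compact) (use continuous_on_subset[OF fc] in auto)
  then have "ennreal (norm (w z - w p)) \<le> (\<integral>\<^sup>+t. ennreal (norm (indicator {0..1} t *\<^sub>R f t)) \<partial>lborel)"
    unfolding eq by (rule integral_norm_bound_ennreal)
  also have "\<dots> \<le> (\<integral>\<^sup>+t. indicator {0..1} t * ennreal (2 * \<rho> * g (p + t *\<^sub>R ?h)) \<partial>lborel)"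
  proof (rule nn_integral_mono)
    fix t :: real
    show "ennreal (norm (indicator {0..1} t *\<^sub>R f t)) \<le> indicator {0..1} t * ennreal (2 * \<rho> * g (p + t *\<^sub>R ?h))"
    proof (cases "t \<in> {0..1}")
      case True
      let ?y = "p + t *\<^sub>R ?h"
      have "?y \<in> closed_segment p z" using True by (auto simp: closed_segment_def algebra_simps intro!: exI[of _ t])
      note gy = g(2)[OF this]
      have comp: "\<bar>?h $ i\<bar> \<le> \<rho>" for i using component_le_norm_cart[of ?h i] \<rho> by linarith
      have r0: "\<rho> \<ge> 0" using norm_ge_zero \<rho> by (rule order_trans)
      have "norm (f t) \<le> \<bar>?h$1\<bar> * norm (w1 ?y) + \<bar>?h$2\<bar> * norm (w2 ?y)"
        unfolding f_def by (metis norm_scaleR norm_triangle_ineq)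
      also have "\<dots> \<le> \<rho> * g ?y + \<rho> * g ?y" using comp gy r0 by (intro add_mono mult_mono) auto
      finally have "norm (f t) \<le> 2 * \<rho> * g ?y" by simp
      then show ?thesis using True by (simp add: ennreal_leI)
    qed simp
  qed
  finally show ?thesis .
qed

text \<open>After exchanging the integrals, for fixed t the points p + t (z - p) lie in the ball of
  radius 2 \<rho> t around \<open>p\<close>. The substitution costs t^-2, and the maximal bound on
  that ball returns 4 t^2 times \<mu> and the volume of \<open>ball x \<rho>\<close>, so t
  disappears. Together with the factor 4 \<rho> from the segment this makes 16 \<mu> \<rho>.\<close>

lemma mean_increment:
  fixes w :: "real^2 \<Rightarrow> 'b::euclidean_space"
  assumes w: "has_partials w w1 w2" "continuous_on UNIV w1" "continuous_on UNIV w2"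
    and g: "continuous_on UNIV g" "\<And>y. g y \<ge> 0" "\<And>y. y \<in> cball x \<rho> \<Longrightarrow> norm (w1 y) \<le> g y \<and> norm (w2 y) \<le> g y"
    and p: "p \<in> cball x \<rho>" and \<rho>: "0 < \<rho>" "\<rho> \<le> 1/2" and \<mu>: "\<mu> \<ge> 0"
    and max: "\<And>r. 0 < r \<Longrightarrow> r \<le> 1 \<Longrightarrow> (\<integral>\<^sup>+z. ennreal (g z) * indicator (ball p r) z \<partial>lborel) \<le> ennreal \<mu> * emeasure lborel (ball p r)"
  shows "(\<integral>\<^sup>+z. indicator (ball x \<rho>) z * ennreal (norm (w z - w p)) \<partial>lborel) \<le> ennreal (16 * \<mu> * \<rho>) * emeasure lborel (ball x \<rho>)"
proof -
  note [measurable] = borel_measurable_continuous_onI[OF g(1)]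
  let ?Q = "ball x \<rho>"
  have bQ [measurable]: "?Q \<in> sets borel" "{0..1::real} \<in> sets borel" by auto
  have near: "norm (z - p) < 2 * \<rho>" if "z \<in> ?Q" for z
    using that p norm_triangle_ineq[of "z - x" "x - p"] by (simp add: dist_norm norm_minus_commute)
  have "(\<integral>\<^sup>+z. indicator ?Q z * ennreal (norm (w z - w p)) \<partial>lborel)
    \<le> (\<integral>\<^sup>+z. (\<integral>\<^sup>+t. indicator ?Q z * (indicator {0..1} t * ennreal (2 * (2 * \<rho>) * g (p + t *\<^sub>R (z - p)))) \<partial>lborel) \<partial>lborel)"
  proof (rule nn_integral_mono)
    fix z
    show "indicator ?Q z * ennreal (norm (w z - w p))
      \<le> (\<integral>\<^sup>+t. indicator ?Q z * (indicator {0..1} t * ennreal (2 * (2 * \<rho>) * g (p + t *\<^sub>R (z - p)))) \<partial>lborel)"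
    proof (cases "z \<in> ?Q")
      case True
      have "closed_segment p z \<subseteq> cball x \<rho>" using True p by (intro closed_segment_subset) auto
      then have "ennreal (norm (w z - w p)) \<le> (\<integral>\<^sup>+t. indicator {0..1} t * ennreal (2 * (2 * \<rho>) * g (p + t *\<^sub>R (z - p))) \<partial>lborel)"
        using g(3) near[OF True] by (intro segment_increment[OF w g(1)]) auto
      then show ?thesis using True by simp
    qed simp
  qed
  also have "\<dots> = (\<integral>\<^sup>+t. (\<integral>\<^sup>+z. indicator ?Q z * (indicator {0..1} t * ennreal (2 * (2 * \<rho>) * g (p + t *\<^sub>R (z - p)))) \<partial>lborel) \<partial>lborel)"
    by (rule lborel_pair.Fubini') measurable
  also have "\<dots> \<le> (\<integral>\<^sup>+t. indicator {0..1} t * (ennreal (16 * \<mu> * \<rho>) * emeasure lborel ?Q) \<partial>(lborel::real measure))"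
  proof (rule nn_integral_mono_AE)
    have "AE t in (lborel::real measure). t \<noteq> 0" by (rule AE_lborel_singleton)
    then show "AE t in lborel. (\<integral>\<^sup>+z. indicator ?Q z * (indicator {0..1} t * ennreal (2 * (2 * \<rho>) * g (p + t *\<^sub>R (z - p)))) \<partial>lborel)
      \<le> indicator {0..1} t * (ennreal (16 * \<mu> * \<rho>) * emeasure lborel ?Q)"
    proof eventually_elim
      case (elim t)
      show ?case
      proof (cases "t \<in> {0..1}")
        case True
        then have t: "t > 0" "t \<le> 1" using elim by auto
        let ?I = "(\<integral>\<^sup>+z. ennreal (g z) * indicator (ball p (2 * \<rho> * t)) z \<partial>lborel)"
        have "(\<integral>\<^sup>+z. indicator ?Q z * ennreal (g (p + t *\<^sub>R (z - p))) \<partial>lborel)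
           \<le> (\<integral>\<^sup>+z. ennreal (g ((p - t *\<^sub>R p) + t *\<^sub>R z)) * indicator (ball p (2 * \<rho> * t)) ((p - t *\<^sub>R p) + t *\<^sub>R z) \<partial>lborel)" (is "?A \<le> ?A'")
        proof (rule nn_integral_mono)
          fix z
          have eq: "(p - t *\<^sub>R p) + t *\<^sub>R z = p + t *\<^sub>R (z - p)" by (simp add: algebra_simps)
          show "indicator ?Q z * ennreal (g (p + t *\<^sub>R (z - p)))
            \<le> ennreal (g ((p - t *\<^sub>R p) + t *\<^sub>R z)) * indicator (ball p (2 * \<rho> * t)) ((p - t *\<^sub>R p) + t *\<^sub>R z)"
          proof (cases "z \<in> ?Q")
            case True
            have "p + t *\<^sub>R (z - p) \<in> ball p (2 * \<rho> * t)"
              using near[OF True] t(1) by (simp add: dist_norm mult.commute)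
            then show ?thesis using True unfolding eq by simp
          qed simp
        qed
        then have "ennreal (t ^ 2) * ?A \<le> ennreal (t ^ 2) * ?A'" by (rule mult_left_mono) simp
        also have "\<dots> = ?I"
        proof -
          have "(\<lambda>z. ennreal (g z) * indicator (ball p (2 * \<rho> * t)) z) \<in> borel_measurable borel"
            by (intro borel_measurable_times_ennreal borel_measurable_indicator) auto
          from nn_integral_dilate[OF this t(1), of "p - t *\<^sub>R p"] show ?thesis by simp
        qed
        also have "\<dots> \<le> ennreal \<mu> * emeasure lborel (ball p (2 * \<rho> * t))"
        proof (rule max)
          have "\<rho> * t \<le> (1/2) * 1" using \<rho> t by (intro mult_mono) auto
          then show "2 * \<rho> * t \<le> 1" by simp
        qed (use \<rho> t in auto)
        also have "\<dots> = ennreal (t^2) * (ennreal (4 * \<mu>) * emeasure lborel ?Q)"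
          using \<rho> t \<mu> by (simp add: emeasure_ball ennreal_mult[symmetric] power_mult_distrib mult_ac)
        finally have A: "?A \<le> ennreal (4 * \<mu>) * emeasure lborel ?Q"
          using t(1) by (subst (asm) ennreal_mult_le_mult_iff) auto
        have "(\<integral>\<^sup>+z. indicator ?Q z * (indicator {0..1} t * ennreal (2 * (2 * \<rho>) * g (p + t *\<^sub>R (z - p)))) \<partial>lborel)
          = (\<integral>\<^sup>+z. ennreal (4 * \<rho>) * (indicator ?Q z * ennreal (g (p + t *\<^sub>R (z - p)))) \<partial>lborel)"
          using True \<rho> g(2) by (intro nn_integral_cong) (simp add: ennreal_mult mult_ac)
        also have "\<dots> = ennreal (4 * \<rho>) * ?A" by (rule nn_integral_cmult) measurable
        also have "\<dots> \<le> ennreal (4 * \<rho>) * (ennreal (4 * \<mu>) * emeasure lborel ?Q)" using A by (rule mult_left_mono) simp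
        also have "\<dots> = ennreal (16 * \<mu> * \<rho>) * emeasure lborel ?Q"
          using \<rho> \<mu> by (simp add: ennreal_mult[symmetric] mult.assoc[symmetric] mult.commute[of \<rho> \<mu>] mult.assoc[of _ \<rho> \<mu>])
        finally show ?thesis using True by simp
      qed simp
    qed
  qed
  also have "\<dots> = ennreal (16 * \<mu> * \<rho>) * emeasure lborel ?Q"
    by (subst nn_integral_multc) auto
  finally show ?thesis .
qed

text \<open>Both endpoint values are compared with the values on the ball around \<open>x\<close> of
  radius |y - x|, which has \<open>y\<close> on its boundary; on average each comparison costs 16
  \<mu> |y - x|. Control of the maximal function at the two endpoints alone thus gives a Lipschitz
  estimate for the pair.\<close>

lemma increment_le_maximal:
  fixes w :: "real^2 \<Rightarrow> 'b::euclidean_space"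
  assumes w: "has_partials w w1 w2" "continuous_on UNIV w1" "continuous_on UNIV w2"
    and g: "continuous_on UNIV g" "\<And>y. g y \<ge> 0" "\<And>z. z \<in> cball x (norm (y - x)) \<Longrightarrow> norm (w1 z) \<le> g z \<and> norm (w2 z) \<le> g z"
    and small: "norm (y - x) \<le> 1/2" and \<mu>: "\<mu> \<ge> 0"
    and max: "\<And>p r. p \<in> {x, y} \<Longrightarrow> 0 < r \<Longrightarrow> r \<le> 1 \<Longrightarrow> (\<integral>\<^sup>+z. ennreal (g z) * indicator (ball p r) z \<partial>lborel) \<le> ennreal \<mu> * emeasure lborel (ball p r)"
  shows "norm (w y - w x) \<le> 32 * \<mu> * norm (y - x)"
proof (cases "x = y")
  case False
  define \<rho> where "\<rho> = norm (y - x)"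
  have \<rho>: "0 < \<rho>" "\<rho> \<le> 1/2" using False small by (auto simp: \<rho>_def)
  let ?Q = "ball x \<rho>"
  note [measurable] = borel_measurable_continuous_onI[OF has_partials_continuous[OF w(1)]]
  have p: "x \<in> cball x \<rho>" "y \<in> cball x \<rho>" using \<rho> by (auto simp: \<rho>_def dist_norm norm_minus_commute)
  have m: "(\<integral>\<^sup>+z. indicator ?Q z * ennreal (norm (w z - w p)) \<partial>lborel) \<le> ennreal (16 * \<mu> * \<rho>) * emeasure lborel ?Q"
    if "p \<in> {x, y}" for p
    by (rule mean_increment[OF w g(1,2) g(3)[folded \<rho>_def] _ \<rho> \<mu> max[OF that]]) (use that p in auto)
  have meas: "(\<lambda>z. indicator ?Q z * ennreal (norm (w z - w p))) \<in> borel_measurable lborel" for p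
    by (intro borel_measurable_times_ennreal borel_measurable_indicator) auto
  have "ennreal (norm (w y - w x)) * emeasure lborel ?Q = (\<integral>\<^sup>+z. ennreal (norm (w y - w x)) * indicator ?Q z \<partial>lborel)"
    by (subst nn_integral_cmult_indicator) auto
  also have "\<dots> \<le> (\<integral>\<^sup>+z. indicator ?Q z * ennreal (norm (w z - w x)) + indicator ?Q z * ennreal (norm (w z - w y)) \<partial>lborel)"
  proof (rule nn_integral_mono)
    fix z
    have "norm (w y - w x) \<le> norm (w z - w x) + norm (w z - w y)"
      using norm_triangle_ineq[of "w z - w x" "w y - w z"] by (simp add: norm_minus_commute)
    then have "ennreal (norm (w y - w x)) \<le> ennreal (norm (w z - w x)) + ennreal (norm (w z - w y))"
      by (simp add: ennreal_plus[symmetric] ennreal_leI del: ennreal_plus)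
    then show "ennreal (norm (w y - w x)) * indicator ?Q z \<le> indicator ?Q z * ennreal (norm (w z - w x)) + indicator ?Q z * ennreal (norm (w z - w y))"
      by (auto simp: indicator_def)
  qed
  also have "\<dots> = (\<integral>\<^sup>+z. indicator ?Q z * ennreal (norm (w z - w x)) \<partial>lborel) + (\<integral>\<^sup>+z. indicator ?Q z * ennreal (norm (w z - w y)) \<partial>lborel)"
    by (rule nn_integral_add[OF meas meas])
  also have "\<dots> \<le> ennreal (16 * \<mu> * \<rho>) * emeasure lborel ?Q + ennreal (16 * \<mu> * \<rho>) * emeasure lborel ?Q"
    by (intro add_mono m) auto
  also have "\<dots> = ennreal (32 * \<mu> * \<rho>) * emeasure lborel ?Q"
    using \<rho> \<mu> by (simp add: distrib_right[symmetric] ennreal_plus[symmetric] del: ennreal_plus)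
  finally have le: "ennreal (norm (w y - w x)) * emeasure lborel ?Q \<le> ennreal (32 * \<mu> * \<rho>) * emeasure lborel ?Q" .
  define q where "q = unit_ball_vol 2 * \<rho>\<^sup>2"
  have q: "q > 0" "emeasure lborel ?Q = ennreal q" using \<rho> by (auto simp: q_def emeasure_ball)
  have "ennreal (norm (w y - w x) * q) \<le> ennreal ((32 * \<mu> * \<rho>) * q)"
    using le q \<rho> \<mu> by (simp add: ennreal_mult)
  then have "norm (w y - w x) * q \<le> (32 * \<mu> * \<rho>) * q" using q \<rho> \<mu> by (subst (asm) ennreal_le_iff) auto
  then have "norm (w y - w x) \<le> 32 * \<mu> * \<rho>" using q(1) by simp
  then show ?thesis by (simp add: \<rho>_def)
qed simp


section \<open>Lusin-type decomposition of the disc\<close>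

context smooth_approx
begin

text \<open>Well inside the disc this bounds the partials of \<open>u (Suc k) - u k\<close>. It is
  formed from \<open>v1\<close>, \<open>v2\<close> because their mean-square errors are controlled
  on the whole plane.\<close>

definition gap :: "nat \<Rightarrow> real^2 \<Rightarrow> real" where
  "gap k x = norm (v1 (Suc k) x - v1 k x) + norm (v2 (Suc k) x - v2 k x)"

lemma gap_continuous: "continuous_on UNIV (gap k)"
  unfolding gap_def by (intro continuous_intros vc)

lemma gap_nonneg: "gap k x \<ge> 0"
  by (simp add: gap_def)

text \<open>Uses a <= s + a^2/s with s = 4^-k. On the ball of radius 2 the first term integrates to
  s times the volume; each of the two squared errors is at most s^2 and, doubled by the triangle
  inequality, contributes 2 s.\<close>

lemma L1_from_L2:
  fixes v :: "nat \<Rightarrow> real^2 \<Rightarrow> 'b"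
  assumes vm [measurable]: "\<And>k. v k \<in> borel_measurable borel" "V \<in> borel_measurable borel"
    and vz: "\<And>k x. norm x \<ge> 2 \<Longrightarrow> v k x = 0"
    and vL: "\<And>k. (\<integral>\<^sup>+x. ennreal ((norm (v k x - V x))\<^sup>2) \<partial>lborel) \<le> ennreal ((1/16)^k)"
  shows "(\<integral>\<^sup>+x. ennreal (norm (v (Suc k) x - v k x)) \<partial>lborel) \<le> ennreal ((measure lborel (ball (0::real^2) 2) + 4) * (1/4)^k)"
proof -
  define s where "s = (1/4::real)^k"
  have s: "s > 0" "s * s = (1/16)^k" by (auto simp: s_def power_mult_distrib[symmetric])
  have bB: "ball (0::real^2) 2 \<in> sets lborel" by simp
  have V: "emeasure lborel (ball (0::real^2) 2) = ennreal (measure lborel (ball (0::real^2) 2))"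
    using emeasure_lborel_ball_finite[of "0::real^2" 2] by (intro emeasure_eq_ennreal_measure) auto
  have pt: "ennreal (norm (v (Suc k) x - v k x)) \<le> ennreal s * indicator (ball 0 2) x
      + (ennreal (2 / s) * ennreal ((norm (v (Suc k) x - V x))\<^sup>2) + ennreal (2 / s) * ennreal ((norm (v k x - V x))\<^sup>2))" for x
  proof (cases "norm x < 2")
    case True
    define a where "a = norm (v (Suc k) x - v k x)"
    have a: "a\<^sup>2 \<le> 2 * (norm (v (Suc k) x - V x))\<^sup>2 + 2 * (norm (v k x - V x))\<^sup>2"
      using norm_diff_square_le[of "v (Suc k) x - V x" "v k x - V x"] by (simp add: a_def)
    have "0 \<le> (a - s)\<^sup>2" by simp
    then have "2 * a * s \<le> a\<^sup>2 + s * s" by (simp add: power2_eq_square algebra_simps)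
    moreover have "a * s \<ge> 0" using s(1) by (simp add: a_def)
    ultimately have "a * s \<le> s * s + a\<^sup>2" by linarith
    then have "a \<le> s + a\<^sup>2 / s" using s(1) by (simp add: field_simps)
    also have "\<dots> \<le> s + (2 * (norm (v (Suc k) x - V x))\<^sup>2 + 2 * (norm (v k x - V x))\<^sup>2) / s"
      using a s(1) by (intro add_left_mono divide_right_mono) auto
    finally have "a \<le> s + (2 / s * (norm (v (Suc k) x - V x))\<^sup>2 + 2 / s * (norm (v k x - V x))\<^sup>2)"
      by (simp add: add_divide_distrib)
    then have "ennreal a \<le> ennreal (s + (2 / s * (norm (v (Suc k) x - V x))\<^sup>2 + 2 / s * (norm (v k x - V x))\<^sup>2))"
      by (rule ennreal_leI)
    also have "\<dots> = ennreal s + (ennreal (2 / s) * ennreal ((norm (v (Suc k) x - V x))\<^sup>2) + ennreal (2 / s) * ennreal ((norm (v k x - V x))\<^sup>2))"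
      using s(1) by (subst ennreal_plus, simp, simp, subst ennreal_plus, simp, simp, subst ennreal_mult, simp, simp, subst ennreal_mult) auto
    finally show ?thesis using True by (simp add: a_def)
  next
    case False
    then show ?thesis using vz[of x] by simp
  qed
  have m: "(\<lambda>x. ennreal s * indicator (ball 0 2) x) \<in> borel_measurable (lborel :: (real^2) measure)"
    by (intro borel_measurable_times_ennreal borel_measurable_indicator) auto
  have m1: "(\<lambda>x. ennreal (2 / s) * ennreal ((norm (v j x - V x))\<^sup>2)) \<in> borel_measurable lborel"
    "(\<lambda>x. ennreal ((norm (v j x - V x))\<^sup>2)) \<in> borel_measurable lborel" for j
    by measurable
  have "(\<integral>\<^sup>+x. ennreal (norm (v (Suc k) x - v k x)) \<partial>lborel) \<le> (\<integral>\<^sup>+x. ennreal s * indicator (ball 0 2) x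
      + (ennreal (2 / s) * ennreal ((norm (v (Suc k) x - V x))\<^sup>2) + ennreal (2 / s) * ennreal ((norm (v k x - V x))\<^sup>2)) \<partial>lborel)"
    by (intro nn_integral_mono pt)
  also have "\<dots> = ennreal s * emeasure lborel (ball (0::real^2) 2)
      + (ennreal (2 / s) * (\<integral>\<^sup>+x. ennreal ((norm (v (Suc k) x - V x))\<^sup>2) \<partial>lborel) + ennreal (2 / s) * (\<integral>\<^sup>+x. ennreal ((norm (v k x - V x))\<^sup>2) \<partial>lborel))"
    unfolding nn_integral_add[OF m borel_measurable_add[OF m1(1) m1(1)]] nn_integral_add[OF m1(1) m1(1)] nn_integral_cmult[OF m1(2)]
      nn_integral_cmult_indicator[OF bB] ..
  also have "\<dots> \<le> ennreal s * emeasure lborel (ball (0::real^2) 2)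
      + (ennreal (2 / s) * ennreal (s * s) + ennreal (2 / s) * ennreal (s * s))"
  proof (intro add_mono mult_left_mono order_refl)
    have "ennreal ((1/16)^Suc k) \<le> ennreal (s * s)" unfolding s(2) by (intro ennreal_leI) simp
    then show "(\<integral>\<^sup>+x. ennreal ((norm (v (Suc k) x - V x))\<^sup>2) \<partial>lborel) \<le> ennreal (s * s)"
      by (rule order_trans[OF vL])
    show "(\<integral>\<^sup>+x. ennreal ((norm (v k x - V x))\<^sup>2) \<partial>lborel) \<le> ennreal (s * s)" unfolding s(2) by (rule vL)
  qed auto
  also have "\<dots> = ennreal ((measure lborel (ball (0::real^2) 2) + 4) * s)"
  proof -
    have "ennreal (2 / s) * ennreal (s * s) = ennreal (2 * s)" using s(1) by (simp add: ennreal_mult[symmetric])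
    moreover have "ennreal s * ennreal M + (ennreal (2 * s) + ennreal (2 * s)) = ennreal ((M + 4) * s)" if "M \<ge> 0" for M
    proof -
      have "(M + 4) * s = s * M + (2 * s + 2 * s)" by (simp add: algebra_simps)
      then show ?thesis using s(1) that by (simp only: ennreal_mult[symmetric] ennreal_plus[symmetric] mult_nonneg_nonneg add_nonneg_nonneg less_imp_le zero_le_numeral)
    qed
    ultimately show ?thesis unfolding V by simp
  qed
  finally show ?thesis by (simp add: s_def)
qed

lemma gap_integral:
  obtains C where "C \<ge> 0" "\<And>k. (\<integral>\<^sup>+x. ennreal (gap k x) \<partial>lborel) \<le> ennreal (C * (1/4)^k)"
proof
  let ?M = "measure lborel (ball (0::real^2) 2)"
  have [measurable]: "v1 k \<in> borel_measurable borel" "v2 k \<in> borel_measurable borel" for k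
    using vc by (auto intro: borel_measurable_continuous_onI)
  show "2 * (?M + 4) \<ge> 0" by simp
  fix k
  have "(\<integral>\<^sup>+x. ennreal (gap k x) \<partial>lborel)
     = (\<integral>\<^sup>+x. ennreal (norm (v1 (Suc k) x - v1 k x)) + ennreal (norm (v2 (Suc k) x - v2 k x)) \<partial>lborel)"
    unfolding gap_def by (intro nn_integral_cong) (simp add: ennreal_plus)
  also have "\<dots> = (\<integral>\<^sup>+x. ennreal (norm (v1 (Suc k) x - v1 k x)) \<partial>lborel) + (\<integral>\<^sup>+x. ennreal (norm (v2 (Suc k) x - v2 k x)) \<partial>lborel)"
    by (rule nn_integral_add) measurable
  also have "\<dots> \<le> ennreal ((?M + 4) * (1/4)^k) + ennreal ((?M + 4) * (1/4)^k)"
  proof (rule add_mono)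
    show "(\<integral>\<^sup>+x. ennreal (norm (v1 (Suc k) x - v1 k x)) \<partial>lborel) \<le> ennreal ((?M + 4) * (1/4)^k)"
      by (rule L1_from_L2[OF _ W(2) _ v1L]) (use vz in auto)
    show "(\<integral>\<^sup>+x. ennreal (norm (v2 (Suc k) x - v2 k x)) \<partial>lborel) \<le> ennreal ((?M + 4) * (1/4)^k)"
      by (rule L1_from_L2[OF _ W(3) _ v2L]) (use vz in auto)
  qed
  also have "\<dots> = ennreal ((?M + 4) * (1/4)^k + (?M + 4) * (1/4)^k)" by (rule ennreal_plus[symmetric]) auto
  also have "\<dots> = ennreal (2 * (?M + 4) * (1/4)^k)" by simp
  finally show "(\<integral>\<^sup>+x. ennreal (gap k x) \<partial>lborel) \<le> ennreal (2 * (?M + 4) * (1/4)^k)" .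
qed

text \<open>The maximal function of \<open>gap k\<close> is at most 2^-k off a set
  \<open>U k\<close> of measure O(2^-k), and by Borel-Cantelli almost every point lies in only
  finitely many \<open>U k\<close>. Between nearby points outside all \<open>U k\<close> with k >=
  m, well inside the disc, \<open>u (Suc k) - u k\<close> is Lipschitz with constant 32 (1/2)^k.
  Summing, N - u K has a Lipschitz constant tending to 0, while the derivatives of u K tend to the
  weak ones; hence differentiability along the set with the weak derivative.\<close>

lemma Lusin_differentiable:
  obtains S :: "nat \<Rightarrow> (real^2) set" where
    "\<And>m. S m \<in> sets borel" "incseq S" "\<And>m. S m \<subseteq> ball 0 1" "AE x in lborel. norm x < 1 \<longrightarrow> x \<in> (\<Union>m. S m)"
    "\<And>m x. x \<in> S m \<Longrightarrow> (N has_derivative (\<lambda>h. h$1 *\<^sub>R V1 x + h$2 *\<^sub>R V2 x)) (at x within S m)"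
proof -
  obtain C where C: "C \<ge> 0" "\<And>k. (\<integral>\<^sup>+x. ennreal (gap k x) \<partial>lborel) \<le> ennreal (C * (1/4)^k)" using gap_integral by blast
  \<comment> \<open>The level 2^-k splits the decay 4^-k of the integral of \<open>gap k\<close>
    into summable measures and summable Lipschitz constants; 25 = 5^2 is the covering constant in
    the plane.\<close>
  define good where "good k U \<longleftrightarrow> U \<in> sets borel \<and> emeasure lborel U \<le> ennreal (25 * C * (1/2)^k) \<and>
    (\<forall>x r. x \<notin> U \<longrightarrow> 0 < r \<longrightarrow> r \<le> 1 \<longrightarrow>
       (\<integral>\<^sup>+z. ennreal (gap k z) * indicator (ball x r) z \<partial>lborel) \<le> ennreal ((1/2)^k) * emeasure lborel (ball x r))" for k and U :: "(real^2) set"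
  have "\<exists>U. good k U" for k
  proof -
    have p: "(1/2::real)^k > 0" by simp
    obtain U where U: "U \<in> sets borel" "ennreal ((1/2)^k) * emeasure lborel U \<le> ennreal (5 ^ DIM(real^2)) * (\<integral>\<^sup>+x. ennreal (gap k x) \<partial>lborel)"
      "\<And>x r. x \<notin> U \<Longrightarrow> 0 < r \<Longrightarrow> r \<le> 1 \<Longrightarrow>
       (\<integral>\<^sup>+z. ennreal (gap k z) * indicator (ball x r) z \<partial>lborel) \<le> ennreal ((1/2)^k) * emeasure lborel (ball x r)"
      by (rule maximal_weak_type[OF borel_measurable_continuous_onI[OF gap_continuous[of k]] gap_nonneg p]) blast
    have "ennreal ((1/2)^k) * emeasure lborel U \<le> ennreal 25 * ennreal (C * (1/4)^k)"
      using U(2) mult_left_mono[OF C(2)[of k], of "ennreal 25"] by simp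
    also have "\<dots> = ennreal ((1/2)^k) * ennreal (25 * C * (1/2)^k)"
    proof -
      have *: "ennreal a * ennreal b = ennreal (a * b)" if "a \<ge> 0" "b \<ge> 0" for a b
        using that by (rule ennreal_mult[symmetric])
      have "ennreal 25 * ennreal (C * (1/4)^k) = ennreal (25 * (C * (1/4)^k))" by (rule *) (use C(1) in auto)
      moreover have "ennreal ((1/2)^k) * ennreal (25 * C * (1/2)^k) = ennreal ((1/2)^k * (25 * C * (1/2)^k))" by (rule *) (use C(1) in auto)
      moreover have "(1/2::real)^k * (1/2)^k = (1/4)^k" by (simp add: power_mult_distrib[symmetric])
      then have "(1/2)^k * (25 * C * (1/2)^k) = 25 * (C * (1/4)^k)" by (simp add: mult.left_commute mult.assoc)
      ultimately show ?thesis by simp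
    qed
    finally have "emeasure lborel U \<le> ennreal (25 * C * (1/2)^k)"
      by (subst (asm) ennreal_mult_le_mult_iff) auto
    then have "good k U" using U unfolding good_def by blast
    then show ?thesis ..
  qed
  then obtain U where "\<And>k. good k (U k)" by metis
  then have U: "U k \<in> sets borel" "emeasure lborel (U k) \<le> ennreal (25 * C * (1/2)^k)"
    "x \<notin> U k \<Longrightarrow> 0 < r \<Longrightarrow> r \<le> 1 \<Longrightarrow>
       (\<integral>\<^sup>+z. ennreal (gap k z) * indicator (ball x r) z \<partial>lborel) \<le> ennreal ((1/2)^k) * emeasure lborel (ball x r)" for k x r
    unfolding good_def by blast+
  have "AE x in lborel. (\<lambda>k. u k x) \<longlonglongrightarrow> N x \<and> (\<lambda>k. v1 k x) \<longlonglongrightarrow> V1 x \<and> (\<lambda>k. v2 k x) \<longlonglongrightarrow> V2 x"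
    using lim by eventually_elim blast
  then obtain Z where Z: "Z \<in> null_sets lborel"
      "{x\<in>space lborel. \<not> ((\<lambda>k. u k x) \<longlonglongrightarrow> N x \<and> (\<lambda>k. v1 k x) \<longlonglongrightarrow> V1 x \<and> (\<lambda>k. v2 k x) \<longlonglongrightarrow> V2 x)} \<subseteq> Z"
    by (rule AE_E) (auto simp: null_sets_def)
  have conv: "(\<lambda>k. u k x) \<longlonglongrightarrow> N x" "(\<lambda>k. v1 k x) \<longlonglongrightarrow> V1 x" "(\<lambda>k. v2 k x) \<longlonglongrightarrow> V2 x" if "x \<notin> Z" for x
    using Z(2) that by auto
  \<comment> \<open>The margin 3/(m+1) has one share for |y - x|, one for the mollification radius
    and one to spare. Removing \<open>Z\<close> makes all limits hold at every point of the
    set.\<close>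
  define S where "S m = (ball 0 (1 - 3 / real (Suc m)) \<inter> (\<Inter>k\<in>{m..}. - U k)) - Z" for m
  have "S m \<in> sets borel" for m
  proof -
    have "(\<Inter>k\<in>{m..}. - U k) \<in> sets borel" using U(1) by (intro sets.countable_INT'') (auto intro: borel_comp)
    moreover have "Z \<in> sets borel" using Z(1) by (auto simp: null_sets_def)
    ultimately show ?thesis unfolding S_def by (intro sets.Diff sets.Int) auto
  qed
  moreover have "incseq S"
  proof (rule incseq_SucI)
    fix m
    have "3 / real (Suc (Suc m)) \<le> 3 / real (Suc m)" by (intro divide_left_mono) auto
    then have "ball (0::real^2) (1 - 3 / real (Suc m)) \<subseteq> ball 0 (1 - 3 / real (Suc (Suc m)))" by (intro subset_ball) simp
    then show "S m \<subseteq> S (Suc m)" unfolding S_def by fastforce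
  qed
  moreover have "S m \<subseteq> ball 0 1" for m
  proof -
    have "3 / real (Suc m) \<ge> 0" by simp
    then have "ball (0::real^2) (1 - 3 / real (Suc m)) \<subseteq> ball 0 1" by (intro subset_ball) linarith
    then show ?thesis unfolding S_def by blast
  qed
  moreover have "AE x in lborel. norm x < 1 \<longrightarrow> x \<in> (\<Union>m. S m)"
  proof -
    have "AE x in lborel. \<forall>\<^sub>F k in sequentially. x \<in> space lborel - U k"
    proof (rule borel_cantelli_AE1)
      show "U k \<in> sets lborel" for k using U(1) by simp
      show "emeasure lborel (U k) < \<infinity>" for k using U(2)[of k] by (rule order.strict_trans1) simp
      have "summable (\<lambda>k. 25 * C * (1/2::real)^k)" by (intro summable_mult summable_geometric) simp
      then show "summable (\<lambda>k. measure lborel (U k))"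
      proof (rule summable_comparison_test'[where N=0])
        show "norm (measure lborel (U k)) \<le> 25 * C * (1/2)^k" for k
          using U(2)[of k] C(1) by (simp add: measure_def enn2real_leI)
      qed
    qed
    moreover have "AE x in lborel. x \<notin> Z" using Z(1) by (rule AE_not_in)
    ultimately show ?thesis
    proof eventually_elim
      case (elim x)
      show ?case
      proof
        assume "norm x < 1"
        from elim obtain m1 where m1: "\<And>k. k \<ge> m1 \<Longrightarrow> x \<notin> U k" by (auto simp: eventually_sequentially)
        obtain m2 where "inverse (real (Suc m2)) < (1 - norm x) / 3" using reals_Archimedean[of "(1 - norm x) / 3"] \<open>norm x < 1\<close> by auto
        then have m2: "3 / real (Suc m2) < 1 - norm x" by (simp add: field_simps)
        define m where "m = max m1 m2"
        have "3 / real (Suc m) \<le> 3 / real (Suc m2)" by (intro divide_left_mono) (auto simp: m_def)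
        then have "x \<in> ball 0 (1 - 3 / real (Suc m))" using m2 by simp
        moreover have "x \<in> (\<Inter>k\<in>{m..}. - U k)" using m1 by (auto simp: m_def)
        ultimately have "x \<in> S m" using elim by (simp add: S_def)
        then show "x \<in> (\<Union>m. S m)" by blast
      qed
    qed
  qed
  moreover have "(N has_derivative (\<lambda>h. h$1 *\<^sub>R V1 x + h$2 *\<^sub>R V2 x)) (at x within S m)" if x: "x \<in> S m" for m x
  proof -
    have step: "norm ((u (Suc k) y - u k y) - (u (Suc k) x - u k x)) \<le> 32 * (1/2)^k * norm (y - x)"
      if y: "y \<in> S m" and k: "k \<ge> m" and small: "norm (y - x) \<le> 1 / real (Suc m)" "norm (y - x) \<le> 1/2" for y k
    proof -
      have sub: "has_partials (\<lambda>z. u (Suc k) z - u k z) (\<lambda>z. u1 (Suc k) z - u1 k z) (\<lambda>z. u2 (Suc k) z - u2 k z)"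
        unfolding has_partials_def
      proof
        fix z
        show "((\<lambda>z. u (Suc k) z - u k z) has_derivative (\<lambda>h. h$1 *\<^sub>R (u1 (Suc k) z - u1 k z) + h$2 *\<^sub>R (u2 (Suc k) z - u2 k z))) (at z)"
          by (rule has_derivative_eq_rhs[OF has_derivative_diff])
            (use up(1) in \<open>auto simp: has_partials_def algebra_simps\<close>)
      qed
      show ?thesis
      proof (rule increment_le_maximal[OF sub _ _ gap_continuous[of k] gap_nonneg])
        show "continuous_on UNIV (\<lambda>z. u1 (Suc k) z - u1 k z)" "continuous_on UNIV (\<lambda>z. u2 (Suc k) z - u2 k z)"
          by (intro continuous_intros u_continuous)+
        show "norm (u1 (Suc k) z - u1 k z) \<le> gap k z \<and> norm (u2 (Suc k) z - u2 k z) \<le> gap k z" if z: "z \<in> cball x (norm (y - x))" for z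
        proof -
          have "norm z \<le> norm x + norm (y - x)" using z norm_triangle_ineq2[of z x] by (simp add: dist_norm norm_minus_commute)
          moreover have "norm x < 1 - 3 / real (Suc m)" using x by (simp add: S_def)
          moreover have "1 / real (Suc k) \<le> 1 / real (Suc m)" "1 / real (Suc (Suc k)) \<le> 1 / real (Suc m)" using k by (auto intro!: divide_left_mono)
          moreover have "3 / real (Suc m) = 1 / real (Suc m) + 1 / real (Suc m) + 1 / real (Suc m)" by (simp add: add_divide_distrib[symmetric])
          moreover have "1 / real (Suc m) > 0" by simp
          ultimately have "norm z + 1 / real (Suc k) < 1" "norm z + 1 / real (Suc (Suc k)) < 1" using small by linarith+
          then show ?thesis using uv by (simp add: gap_def)
        qed
        show "(\<integral>\<^sup>+z. ennreal (gap k z) * indicator (ball p r) z \<partial>lborel) \<le> ennreal ((1/2)^k) * emeasure lborel (ball p r)"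
          if "p \<in> {x, y}" "0 < r" "r \<le> 1" for p r
        proof (rule U(3)[OF _ that(2,3)])
          show "p \<notin> U k" using that(1) x y k by (auto simp: S_def)
        qed
      qed (use small in auto)
    qed
    \<comment> \<open>The constants 32 (1/2)^k for k >= K sum to 64 (1/2)^K. The partial sums are
      bounded exactly by telescoping before the limit is taken.\<close>
    have tail: "norm ((N y - N x) - (u K y - u K x)) \<le> 64 * (1/2)^K * norm (y - x)"
      if y: "y \<in> S m" and K: "K \<ge> m" and small: "norm (y - x) \<le> 1 / real (Suc m)" "norm (y - x) \<le> 1/2" for y K
    proof -
      have part: "norm ((u (K + j) y - u (K + j) x) - (u K y - u K x)) \<le> (64 * (1/2)^K - 64 * (1/2)^(K + j)) * norm (y - x)" for j
      proof (induction j)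
        case (Suc j)
        have "(u (K + Suc j) y - u (K + Suc j) x) - (u K y - u K x)
          = ((u (Suc (K + j)) y - u (K + j) y) - (u (Suc (K + j)) x - u (K + j) x)) + ((u (K + j) y - u (K + j) x) - (u K y - u K x))"
          by simp
        also have "norm \<dots> \<le> 32 * (1/2)^(K + j) * norm (y - x) + (64 * (1/2)^K - 64 * (1/2)^(K + j)) * norm (y - x)"
          using K by (intro order_trans[OF norm_triangle_ineq] add_mono Suc.IH step[OF y _ small]) simp
        also have "\<dots> = (64 * (1/2)^K - 64 * (1/2)^(K + Suc j)) * norm (y - x)" by (simp add: algebra_simps)
        finally show ?case .
      qed simp
      have "(\<lambda>j. norm ((u (j + K) y - u (j + K) x) - (u K y - u K x))) \<longlonglongrightarrow> norm ((N y - N x) - (u K y - u K x))"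
        using x y by (intro tendsto_intros LIMSEQ_ignore_initial_segment conv) (auto simp: S_def)
      then show ?thesis
      proof (rule Lim_bounded)
        show "\<forall>n\<ge>0. norm ((u (n + K) y - u (n + K) x) - (u K y - u K x)) \<le> 64 * (1/2)^K * norm (y - x)"
        proof (intro allI impI)
          fix n
          have "(64 * (1/2)^K - 64 * (1/2)^(K + n)) * norm (y - x) \<le> 64 * (1/2)^K * norm (y - x)" by (intro mult_right_mono) auto
          then show "norm ((u (n + K) y - u (n + K) x) - (u K y - u K x)) \<le> 64 * (1/2)^K * norm (y - x)"
            using part[of n] by (simp add: add.commute)
        qed
      qed
    qed
    show ?thesis
      unfolding has_derivative_within_alt
    proof (intro conjI allI impI)
      show "bounded_linear (\<lambda>h::real^2. h$1 *\<^sub>R V1 x + h$2 *\<^sub>R V2 x)"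
        by (intro bounded_linear_add bounded_linear_scaleR_const bounded_linear_vec_nth)
      fix e :: real
      assume e: "e > 0"
      have xZ: "x \<notin> Z" and xb: "norm x < 1 - 3 / real (Suc m)" using x by (auto simp: S_def)
      have l0: "(\<lambda>k. 64 * (1/2::real)^k) \<longlonglongrightarrow> 64 * 0" by (intro tendsto_intros LIMSEQ_power_zero) simp
      have "\<forall>\<^sub>F k in sequentially. 64 * (1/2::real)^k < e / 4" by (rule order_tendstoD(2)[OF l0]) (use e in simp)
      moreover have "\<forall>\<^sub>F k in sequentially. norm (v1 k x - V1 x) < e / 4" "\<forall>\<^sub>F k in sequentially. norm (v2 k x - V2 x) < e / 4"
        using tendstoD[OF conv(2)[OF xZ], of "e/4"] tendstoD[OF conv(3)[OF xZ], of "e/4"] e by (auto simp: dist_norm)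
      ultimately have "\<forall>\<^sub>F k in sequentially. 64 * (1/2::real)^k < e / 4 \<and> norm (v1 k x - V1 x) < e / 4 \<and> norm (v2 k x - V2 x) < e / 4 \<and> k \<ge> m"
        using eventually_ge_at_top[of m] by eventually_elim blast
      \<comment> \<open>Four errors of e/4 each: the tail beyond K, the differentiability of
        \<open>u K\<close>, and one for each partial.\<close>
      then obtain K where K: "64 * (1/2::real)^K < e / 4" "norm (v1 K x - V1 x) < e / 4" "norm (v2 K x - V2 x) < e / 4" "K \<ge> m"
        by (auto simp: eventually_sequentially)
      have "1 / real (Suc K) \<le> 1 / real (Suc m)" using K(4) by (auto intro!: divide_left_mono)
      moreover have "1 / real (Suc m) \<le> 3 / real (Suc m)" by (intro divide_right_mono) auto
      ultimately have uvx: "u1 K x = v1 K x" "u2 K x = v2 K x" using uv[of x K] xb by auto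
      have "(u K has_derivative (\<lambda>h. h$1 *\<^sub>R u1 K x + h$2 *\<^sub>R u2 K x)) (at x)" using up(1) by (simp add: has_partials_def)
      then have "\<forall>e>0. \<exists>d>0. \<forall>y\<in>UNIV. norm (y - x) < d \<longrightarrow>
          norm (u K y - u K x - ((y - x)$1 *\<^sub>R u1 K x + (y - x)$2 *\<^sub>R u2 K x)) \<le> e * norm (y - x)"
        unfolding has_derivative_within_alt by (rule conjunct2)
      moreover have "e / 4 > 0" using e by simp
      ultimately obtain d where d: "d > 0" "\<And>y. norm (y - x) < d \<Longrightarrow>
          norm (u K y - u K x - ((y - x)$1 *\<^sub>R u1 K x + (y - x)$2 *\<^sub>R u2 K x)) \<le> e / 4 * norm (y - x)"
        by blast
      define d' where "d' = min d (min (1 / real (Suc m)) (1/2))"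
      have "norm (N y - N x - ((y - x)$1 *\<^sub>R V1 x + (y - x)$2 *\<^sub>R V2 x)) \<le> e * norm (y - x)" if y: "y \<in> S m" "norm (y - x) < d'" for y
      proof -
        let ?h = "y - x"
        have a: "norm ((N y - N x) - (u K y - u K x)) \<le> e / 4 * norm ?h"
          using tail[OF y(1) K(4)] y(2) K(1) by (intro order_trans[OF tail[OF y(1) K(4)]] mult_right_mono) (auto simp: d'_def)
        have b: "norm (u K y - u K x - (?h$1 *\<^sub>R u1 K x + ?h$2 *\<^sub>R u2 K x)) \<le> e / 4 * norm ?h"
          using d(2)[of y] y(2) by (simp add: d'_def)
        have c0: "norm (?h$i *\<^sub>R v) \<le> e / 4 * norm ?h" if "norm v < e / 4" for i and v :: 'b
        proof -
          have "\<bar>?h$i\<bar> * norm v \<le> norm ?h * (e / 4)"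
            by (rule mult_mono[OF component_le_norm_cart]) (use that in auto)
          then show ?thesis by (simp only: norm_scaleR mult.commute)
        qed
        note c = c0[OF K(2)] c0[OF K(3)]
        have "N y - N x - (?h$1 *\<^sub>R V1 x + ?h$2 *\<^sub>R V2 x)
          = ((N y - N x) - (u K y - u K x)) + (u K y - u K x - (?h$1 *\<^sub>R u1 K x + ?h$2 *\<^sub>R u2 K x))
            + (?h$1 *\<^sub>R (v1 K x - V1 x) + ?h$2 *\<^sub>R (v2 K x - V2 x))"
          unfolding uvx by (simp add: scaleR_diff_right)
        also have "norm \<dots> \<le> (e / 4 * norm ?h + e / 4 * norm ?h) + (e / 4 * norm ?h + e / 4 * norm ?h)"
          by (intro order_trans[OF norm_triangle_ineq] add_mono a b c)
        also have "\<dots> = e * norm ?h" by simp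
        finally show ?thesis .
      qed
      moreover have "d' > 0" using d(1) by (simp add: d'_def)
      ultimately show "\<exists>d>0. \<forall>y\<in>S m. norm (y - x) < d \<longrightarrow> norm (N y - N x - ((y - x)$1 *\<^sub>R V1 x + (y - x)$2 *\<^sub>R V2 x)) \<le> e * norm (y - x)"
        by blast
    qed
  qed
  ultimately show ?thesis by (rule that)
qed

end

section \<open>The cone over the image\<close>

lemma prod_Basis_cart: "(\<Prod>b\<in>(Basis::(real^'n) set). f b) = (\<Prod>i\<in>UNIV. f (axis i 1))"
proof -
  have B: "(Basis::(real^'n) set) = range (\<lambda>i. axis i 1)" by (auto simp: Basis_vec_def)
  have "inj (\<lambda>i::'n. axis i (1::real))" by (auto simp: inj_on_def axis_eq_axis)
  then show ?thesis unfolding B by (subst prod.reindex) auto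
qed

definition join3 :: "real^2 \<Rightarrow> real \<Rightarrow> real^3" where
  "join3 x t = vector [x$1, x$2, t]"

definition base2 :: "real^3 \<Rightarrow> real^2" where
  "base2 p = vector [p$1, p$2]"

lemma join3_simps [simp]: "join3 x t $ 1 = x$1" "join3 x t $ 2 = x$2" "join3 x t $ 3 = t" "base2 (join3 x t) = x"
  "base2 p $ 1 = p$1" "base2 p $ 2 = p$2"
  by (simp_all add: join3_def base2_def vec_eq_iff forall_2)

lemma bounded_linear_base2: "bounded_linear base2"
proof -
  have "linear base2" by (intro linearI) (simp_all add: vec_eq_iff forall_2)
  then show ?thesis by (simp add: linear_conv_bounded_linear)
qed

lemma continuous_join3: "continuous_on UNIV (\<lambda>z. join3 (fst z) (snd z))"
proof -
  have "join3 (fst z) (snd z) = (\<chi> i. if i = 1 then fst z $ 1 else if i = 2 then fst z $ 2 else snd z)" for z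
    by (simp add: vec_eq_iff forall_3)
  moreover have "continuous_on UNIV (\<lambda>z :: (real^2) \<times> real. if i = 1 then fst z $ 1 else if i = 2 then fst z $ 2 else snd z)" for i :: 3
    by (cases "i = 1"; cases "i = 2") (auto intro!: continuous_intros)
  ultimately show ?thesis
    by (simp only:) (intro continuous_on_vec_lambda)
qed

lemma join3_measurable [measurable]: "(\<lambda>(x, t). join3 x t) \<in> borel_measurable (lborel \<Otimes>\<^sub>M lborel)"
proof -
  have "(\<lambda>z. join3 (fst z) (snd z)) \<in> borel_measurable (borel :: ((real^2) \<times> real) measure)"
    by (rule borel_measurable_continuous_onI[OF continuous_join3])
  then have "(\<lambda>z. join3 (fst z) (snd z)) \<in> borel_measurable (borel \<Otimes>\<^sub>M borel)" by (simp add: borel_prod)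
  moreover have "borel_measurable (lborel \<Otimes>\<^sub>M lborel) = (borel_measurable (borel \<Otimes>\<^sub>M borel) :: ((real^2) \<times> real \<Rightarrow> real^3) set)"
    by (rule measurable_cong_sets) (auto intro!: sets_pair_measure_cong)
  ultimately show ?thesis by (simp add: case_prod_beta')
qed

text \<open>Both measures give a box the product of its three side lengths, and boxes determine
  Lebesgue measure.\<close>

lemma lborel_real3: "(lborel :: (real^3) measure) = distr (lborel \<Otimes>\<^sub>M lborel) borel (\<lambda>(x, t). join3 x t)"
proof (rule lborel_eqI)
  fix l u :: "real^3"
  assume le: "\<And>b. b \<in> Basis \<Longrightarrow> l \<bullet> b \<le> u \<bullet> b"
  have le': "l $ i \<le> u $ i" for i using le[of "axis i 1"] by (simp add: axis_in_Basis_iff inner_axis)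
  have pre: "(\<lambda>(x, t). join3 x t) -` box l u = box (base2 l) (base2 u) \<times> box (l$3) (u$3)"
    by (auto simp: mem_box_cart forall_3 forall_2 box_real)
  have "emeasure (distr (lborel \<Otimes>\<^sub>M lborel) borel (\<lambda>(x, t). join3 x t)) (box l u)
     = emeasure (lborel \<Otimes>\<^sub>M lborel) (box (base2 l) (base2 u) \<times> box (l$3) (u$3))"
    using pre by (subst emeasure_distr) (auto simp: space_pair_measure)
  also have "\<dots> = emeasure lborel (box (base2 l) (base2 u)) * emeasure lborel (box (l$3) (u$3))"
    by (rule lborel.emeasure_pair_measure_Times) auto
  also have "emeasure lborel (box (base2 l) (base2 u)) = ennreal (\<Prod>b\<in>Basis. (base2 u - base2 l) \<bullet> b)"
  proof (rule emeasure_lborel_box)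
    fix b :: "real^2" assume "b \<in> Basis"
    then obtain i where b: "b = axis i 1" by (auto simp: Basis_vec_def)
    have "i = 1 \<or> i = 2" by (rule exhaust_2)
    then show "base2 l \<bullet> b \<le> base2 u \<bullet> b" using le'[of 1] le'[of 2] unfolding b by (auto simp: inner_axis)
  qed
  also have "emeasure lborel (box (l$3) (u$3)) = ennreal (u$3 - l$3)"
    using le'[of 3] by (simp add: box_real)
  also have "(\<Prod>b\<in>Basis. (base2 u - base2 l) \<bullet> b) = (u$1 - l$1) * (u$2 - l$2)"
  proof -
    have prod2: "(\<Prod>i\<in>UNIV. f i) = f 1 * f 2" for f :: "2 \<Rightarrow> real"
      unfolding UNIV_2 by simp
    show ?thesis unfolding prod_Basis_cart prod2 inner_axis by simp
  qed
  also have "ennreal ((u$1 - l$1) * (u$2 - l$2)) * ennreal (u$3 - l$3) = ennreal (\<Prod>b\<in>Basis. (u - l) \<bullet> b)"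
  proof -
    have "(\<Prod>b\<in>Basis. (u - l) \<bullet> b) = ((u$1 - l$1) * (u$2 - l$2)) * (u$3 - l$3)"
    proof -
      have prod3: "(\<Prod>i\<in>UNIV. f i) = f 1 * f 2 * f 3" for f :: "3 \<Rightarrow> real"
        unfolding UNIV_3 by simp
      show ?thesis unfolding prod_Basis_cart prod3 inner_axis by simp
    qed
    moreover have "ennreal (((u$1 - l$1) * (u$2 - l$2)) * (u$3 - l$3)) = ennreal ((u$1 - l$1) * (u$2 - l$2)) * ennreal (u$3 - l$3)"
      by (rule ennreal_mult) (intro mult_nonneg_nonneg, insert le'[of 1] le'[of 2] le'[of 3], linarith+)
    ultimately show ?thesis by simp
  qed
  finally show "emeasure (distr (lborel \<Otimes>\<^sub>M lborel) borel (\<lambda>(x, t). join3 x t)) (box l u) = ennreal (\<Prod>b\<in>Basis. (u - l) \<bullet> b)" .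
qed simp

lemma nn_integral_real3:
  assumes [measurable]: "f \<in> borel_measurable borel"
  shows "(\<integral>\<^sup>+p. f p \<partial>(lborel :: (real^3) measure)) = (\<integral>\<^sup>+x. (\<integral>\<^sup>+t. f (join3 x t) \<partial>lborel) \<partial>lborel)"
proof -
  have "(\<integral>\<^sup>+p. f p \<partial>(lborel :: (real^3) measure)) = (\<integral>\<^sup>+z. f (case z of (x, t) \<Rightarrow> join3 x t) \<partial>(lborel \<Otimes>\<^sub>M lborel))"
    by (subst lborel_real3, rule nn_integral_distr) auto
  also have "\<dots> = (\<integral>\<^sup>+x. (\<integral>\<^sup>+t. f (join3 x t) \<partial>lborel) \<partial>lborel)"
    by (subst lborel.nn_integral_fst[symmetric]) auto
  finally show ?thesis .
qed

section \<open>Volume of the cone over the image\<close>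

lemma det_cone: "det (matrix (\<lambda>h::real^3. h$3 *\<^sub>R a + t *\<^sub>R (h$1 *\<^sub>R b + h$2 *\<^sub>R c))) = t\<^sup>2 * (a \<bullet> cross3 b c)"
  by (simp add: det_3 matrix_def axis_def cross3_simps power2_eq_square)

lemma nn_integral_square_Ioc: "(\<integral>\<^sup>+t. ennreal (t\<^sup>2) * indicator {0<..1} t \<partial>(lborel :: real measure)) = ennreal (1/3)"
proof -
  have "(\<integral>\<^sup>+t. ennreal (t\<^sup>2) * indicator {0<..1} t \<partial>(lborel :: real measure)) = (\<integral>\<^sup>+t. ennreal (t\<^sup>2) * indicator {0..1} t \<partial>lborel)"
  proof (rule nn_integral_cong_AE)
    have "AE t in (lborel :: real measure). t \<noteq> 0" by (rule AE_lborel_singleton)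
    then show "AE t in (lborel :: real measure). ennreal (t\<^sup>2) * indicator {0<..1} t = ennreal (t\<^sup>2) * indicator {0..1} t"
      by eventually_elim (simp split: split_indicator)
  qed
  also have "\<dots> = ennreal ((1::real)^3 / 3 - 0^3 / 3)"
    by (rule nn_integral_FTC_Icc) (auto intro!: derivative_eq_intros)
  finally show ?thesis by simp
qed

text \<open>The map (x, t) -> t N(x) goes from three-space to three-space, so the image estimate for
  maps differentiable within a measurable set applies. Its Jacobian t^2 |N . (V1 x V2)| is at most
  t^2 |V1 x V2|, and integrating t^2 over (0, 1] gives the factor 1/3.\<close>

lemma cone_image_measure:
  fixes N V1 V2 :: "real^2 \<Rightarrow> real^3"
  assumes N: "N \<in> borel_measurable borel" "V1 \<in> borel_measurable borel" "V2 \<in> borel_measurable borel"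
    and S: "S \<in> sets borel" and N1: "\<And>x. norm (N x) \<le> 1"
    and d: "\<And>x. x \<in> S \<Longrightarrow> (N has_derivative (\<lambda>h. h$1 *\<^sub>R V1 x + h$2 *\<^sub>R V2 x)) (at x within S)"
    and i: "(\<integral>\<^sup>+x. ennreal (norm (cross3 (V1 x) (V2 x))) \<partial>lborel) \<le> ennreal A" and A: "A \<ge> 0"
  shows "{t *\<^sub>R N x |t x. 0 < t \<and> t \<le> 1 \<and> x \<in> S} \<in> lmeasurable"
    "measure lebesgue {t *\<^sub>R N x |t x. 0 < t \<and> t \<le> 1 \<and> x \<in> S} \<le> A / 3"
proof -
  note [measurable] = N
  define T where "T = {p. base2 p \<in> S \<and> 0 < p$3 \<and> p$3 \<le> 1}"
  define F where "F p = p$3 *\<^sub>R N (base2 p)" for p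
  define F' where "F' p = (\<lambda>h::real^3. h$3 *\<^sub>R N (base2 p) + p$3 *\<^sub>R (h$1 *\<^sub>R V1 (base2 p) + h$2 *\<^sub>R V2 (base2 p)))" for p
  have [measurable]: "base2 \<in> borel_measurable borel"
    by (rule borel_measurable_continuous_onI) (rule linear_continuous_on[OF bounded_linear_base2])
  have [measurable]: "(\<lambda>p::real^3. p$3) \<in> borel_measurable borel"
    by (rule borel_measurable_continuous_onI) (intro continuous_intros)
  have Tb: "T \<in> sets borel"
  proof -
    have "T = (base2 -` S \<inter> space borel) \<inter> ((\<lambda>p. p$3) -` {0<..1} \<inter> space borel)" by (auto simp: T_def)
    moreover have "base2 -` S \<inter> space borel \<in> sets borel" by (rule measurable_sets[OF _ S]) measurable
    moreover have "(\<lambda>p::real^3. p$3) -` {0<..1} \<inter> space borel \<in> sets borel" by (rule measurable_sets[where A=borel]) auto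
    ultimately show ?thesis by simp
  qed
  have im: "F ` T = {t *\<^sub>R N x |t x. 0 < t \<and> t \<le> 1 \<and> x \<in> S}"
  proof
    show "F ` T \<subseteq> {t *\<^sub>R N x |t x. 0 < t \<and> t \<le> 1 \<and> x \<in> S}" by (auto simp: F_def T_def)
    show "{t *\<^sub>R N x |t x. 0 < t \<and> t \<le> 1 \<and> x \<in> S} \<subseteq> F ` T"
    proof
      fix z assume "z \<in> {t *\<^sub>R N x |t x. 0 < t \<and> t \<le> 1 \<and> x \<in> S}"
      then obtain t x where tx: "z = t *\<^sub>R N x" "0 < t" "t \<le> 1" "x \<in> S" by blast
      then show "z \<in> F ` T" by (intro image_eqI[of _ _ "join3 x t"]) (auto simp: F_def T_def)
    qed
  qed
  have der: "(F has_derivative F' p) (at p within T)" if p: "p \<in> T" for p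
  proof -
    have b: "(base2 has_derivative base2) (at p within T)" by (rule bounded_linear_imp_has_derivative[OF bounded_linear_base2])
    have "(N has_derivative (\<lambda>h. h$1 *\<^sub>R V1 (base2 p) + h$2 *\<^sub>R V2 (base2 p))) (at (base2 p) within base2 ` T)"
      by (rule has_derivative_subset[OF d]) (use p in \<open>auto simp: T_def\<close>)
    from has_derivative_in_compose[OF b this]
    have "((\<lambda>p. N (base2 p)) has_derivative (\<lambda>h. h$1 *\<^sub>R V1 (base2 p) + h$2 *\<^sub>R V2 (base2 p))) (at p within T)" by simp
    from has_derivative_scaleR[OF bounded_linear_imp_has_derivative[OF bounded_linear_vec_nth[of 3]] this]
    show ?thesis unfolding F_def[abs_def] F'_def by (rule has_derivative_eq_rhs) (auto simp: algebra_simps)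
  qed
  define J where "J p = \<bar>det (matrix (F' p))\<bar>" for p
  have J: "J p = (p$3)\<^sup>2 * \<bar>N (base2 p) \<bullet> cross3 (V1 (base2 p)) (V2 (base2 p))\<bar>" for p
    unfolding J_def F'_def det_cone by (simp add: abs_mult)
  define G where "G p = (if p \<in> T then J p else 0)" for p
  have Gm: "G \<in> borel_measurable borel"
    unfolding G_def[abs_def] J using Tb by (intro measurable_If_set) (auto, measurable)
  have Nle: "\<bar>N x \<bullet> v\<bar> \<le> norm v" for x v
    by (rule abs_inner_le[OF N1])
  have "(\<integral>\<^sup>+p. ennreal (G p) \<partial>lborel) = (\<integral>\<^sup>+x. (\<integral>\<^sup>+t. ennreal (G (join3 x t)) \<partial>lborel) \<partial>lborel)"
    by (rule nn_integral_real3) (use Gm in measurable)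
  also have "\<dots> \<le> (\<integral>\<^sup>+x. (\<integral>\<^sup>+t. ennreal (norm (cross3 (V1 x) (V2 x))) * (ennreal (t\<^sup>2) * indicator {0<..1} t) \<partial>lborel) \<partial>lborel)"
  proof (intro nn_integral_mono)
    fix x t
    show "ennreal (G (join3 x t)) \<le> ennreal (norm (cross3 (V1 x) (V2 x))) * (ennreal (t\<^sup>2) * indicator {0<..1} t)"
    proof (cases "join3 x t \<in> T")
      case True
      then have t: "t \<in> {0<..1}" by (simp add: T_def)
      have "G (join3 x t) \<le> norm (cross3 (V1 x) (V2 x)) * t\<^sup>2"
        using True Nle[of x "cross3 (V1 x) (V2 x)"] by (simp add: G_def J mult.commute mult_left_mono)
      then have "ennreal (G (join3 x t)) \<le> ennreal (norm (cross3 (V1 x) (V2 x)) * t\<^sup>2)" by (rule ennreal_leI)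
      then show ?thesis using t by (simp add: ennreal_mult)
    qed (simp add: G_def)
  qed
  also have "\<dots> = (\<integral>\<^sup>+x. ennreal (norm (cross3 (V1 x) (V2 x))) * ennreal (1/3) \<partial>lborel)"
  proof (intro nn_integral_cong)
    fix x
    have "(\<lambda>t::real. ennreal (t\<^sup>2) * indicator {0<..1} t) \<in> borel_measurable lborel"
      by (intro borel_measurable_times_ennreal borel_measurable_indicator) auto
    from nn_integral_cmult[OF this]
    show "(\<integral>\<^sup>+t. ennreal (norm (cross3 (V1 x) (V2 x))) * (ennreal (t\<^sup>2) * indicator {0<..1} t) \<partial>(lborel::real measure)) = ennreal (norm (cross3 (V1 x) (V2 x))) * ennreal (1/3)"
      unfolding nn_integral_square_Ioc .
  qed
  also have "\<dots> = (\<integral>\<^sup>+x. ennreal (norm (cross3 (V1 x) (V2 x))) \<partial>lborel) * ennreal (1/3)"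
    by (rule nn_integral_multc) measurable
  also have "\<dots> \<le> ennreal A * ennreal (1/3)" using i by (rule mult_right_mono) simp
  also have "\<dots> = ennreal (A / 3)" using A by (simp add: ennreal_mult[symmetric])
  finally have le: "(\<integral>\<^sup>+p. ennreal (G p) \<partial>lborel) \<le> ennreal (A / 3)" .
  \<comment> \<open>The image estimate speaks of the gauge integral of the Jacobian; a finite value
    of the Lebesgue integral is what allows the conversion.\<close>
  obtain r where r: "r \<ge> 0" "(\<integral>\<^sup>+p. ennreal (G p) \<partial>lborel) = ennreal r" "r \<le> A / 3"
  proof -
    have "(\<integral>\<^sup>+p. ennreal (G p) \<partial>lborel) < \<infinity>" using le by (rule order.strict_trans1) simp
    then obtain r where r: "r \<ge> 0" "(\<integral>\<^sup>+p. ennreal (G p) \<partial>lborel) = ennreal r" by (cases "(\<integral>\<^sup>+p. ennreal (G p) \<partial>lborel)") auto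
    then show ?thesis using that le A by (simp add: ennreal_le_iff)
  qed
  have G0: "G p \<ge> 0" for p by (simp add: G_def J_def)
  have "(G has_integral r) UNIV"
    by (rule nn_integral_has_integral[OF Gm _ _ r(1)]) (use r(2) G0 in auto)
  then have hi: "(J has_integral r) T"
    unfolding G_def[abs_def] by (simp only: has_integral_restrict_UNIV)
  have Tl: "T \<in> sets lebesgue" using Tb by (simp add: sets_completionI_sets)
  have "(\<lambda>p. \<bar>det (matrix (F' p))\<bar>) integrable_on T" using hi unfolding J_def[abs_def] by blast
  note m = measurable_differentiable_image[OF Tl der this] measure_differentiable_image[OF Tl der this]
  show "{t *\<^sub>R N x |t x. 0 < t \<and> t \<le> 1 \<and> x \<in> S} \<in> lmeasurable" using m(1) unfolding im .
  show "measure lebesgue {t *\<^sub>R N x |t x. 0 < t \<and> t \<le> 1 \<and> x \<in> S} \<le> A / 3"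
    using m(2) integral_unique[OF hi] r(3) unfolding im J_def by simp
qed

text \<open>The unit ball has volume 4 pi/3, and the cones over the Lusin sets have together volume
  at most A/3; inner regularity extracts a compact set from the rest at a loss of \<open>e\<close>.
  On the null set of the disc outside the decomposition \<open>N\<close> may still point into
  \<open>K\<close>, hence the almost everywhere conclusion.\<close>

lemma omitted_compact_set:
  assumes w: "weak_diff N V1 V2" and N1: "\<And>x. norm (N x) \<le> 1"
    and A: "(LINT x|lborel. norm (cross3 (V1 x) (V2 x))) \<le> A" and e: "e > 0"
  obtains K where "compact K" "K \<subseteq> ball 0 1" "0 \<notin> K" "measure lebesgue K \<ge> (4 * pi - A) / 3 - e"
    "AE x in lborel. norm x < 1 \<longrightarrow> (\<forall>y\<in>K. y \<noteq> norm y *\<^sub>R N x)"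
proof -
  obtain u u1 u2 u11 u12 u22 v1 v2 D where "smooth_approx N V1 V2 u u1 u2 u11 u12 u22 v1 v2 D"
    using smooth_approx_exists[OF w N1] by blast
  then interpret smooth_approx N V1 V2 u u1 u2 u11 u12 u22 v1 v2 D .
  note [measurable] = W(1,2,3)
  obtain S where S: "\<And>m. S m \<in> sets borel" "incseq S" "\<And>m. S m \<subseteq> ball 0 1" "AE x in lborel. norm x < 1 \<longrightarrow> x \<in> (\<Union>m. S m)"
    "\<And>m x. x \<in> S m \<Longrightarrow> (N has_derivative (\<lambda>h. h$1 *\<^sub>R V1 x + h$2 *\<^sub>R V2 x)) (at x within S m)"
    using Lusin_differentiable by blast
  have ic: "integrable lborel (\<lambda>x. norm (cross3 (V1 x) (V2 x)))"
  proof (rule Bochner_Integration.integrable_bound)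
    show "integrable lborel (\<lambda>x. (norm (V1 x))\<^sup>2 + (norm (V2 x))\<^sup>2)" using W(5,6) by auto
    show "AE x in lborel. norm (norm (cross3 (V1 x) (V2 x))) \<le> norm ((norm (V1 x))\<^sup>2 + (norm (V2 x))\<^sup>2)"
      using norm_cross_le_squares by (intro AE_I2) simp
  qed measurable
  have A0: "A \<ge> 0" using A by (rule order_trans[rotated]) (rule integral_nonneg_AE, simp)
  have nn: "(\<integral>\<^sup>+x. ennreal (norm (cross3 (V1 x) (V2 x))) \<partial>lborel) \<le> ennreal A"
    using ic A by (subst nn_integral_eq_integral) (auto intro: ennreal_leI)
  define X where "X m = {t *\<^sub>R N x |t x. 0 < t \<and> t \<le> 1 \<and> x \<in> S m}" for m
  have X: "X m \<in> lmeasurable" "measure lebesgue (X m) \<le> A / 3" for m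
    unfolding X_def using cone_image_measure[OF W(1,2,3) S(1) N1 S(5) nn A0] by auto
  \<comment> \<open>Because the cones increase, the bound A/3 passes to their union
    unchanged.\<close>
  have "incseq X" using S(2) unfolding X_def incseq_def by blast
  then have "emeasure lebesgue (\<Union>m. X m) = (SUP m. emeasure lebesgue (X m))"
    by (intro SUP_emeasure_incseq[symmetric]) (use X(1) in auto)
  also have "\<dots> \<le> ennreal (A / 3)"
    using X by (intro SUP_least) (simp add: emeasure_eq_measure2 ennreal_leI)
  finally have XU: "emeasure lebesgue (\<Union>m. X m) \<le> ennreal (A / 3)" .
  have Xs: "(\<Union>m. X m) \<in> sets lebesgue" using X(1) by auto
  have Xm: "(\<Union>m. X m) \<in> lmeasurable" using Xs XU by (intro fmeasurableI) (auto intro: order.strict_trans1)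
  have mX: "measure lebesgue (\<Union>m. X m) \<le> A / 3"
    using XU A0 Xm by (simp add: emeasure_eq_measure2)
  define E where "E = ball 0 1 - ((\<Union>m. X m) \<union> {0})"
  have Es: "E \<in> sets lebesgue" unfolding E_def using Xs by (intro sets.Diff sets.Un) auto
  obtain K where K: "closed K" "K \<subseteq> E" "E - K \<in> lmeasurable" "emeasure lebesgue (E - K) < ennreal e"
    using sets_lebesgue_inner_closed[OF Es e] by blast
  have bK: "bounded K" using K(2) bounded_ball bounded_subset unfolding E_def by blast
  have cK: "compact K" using K(1) bK by (simp add: compact_eq_bounded_closed)
  have sub: "ball (0::real^3) 1 \<subseteq> ((\<Union>m. X m) \<union> {0}) \<union> (K \<union> (E - K))" by (auto simp: E_def)
  have lK: "K \<in> lmeasurable" using cK by (rule lmeasurable_compact)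
  have L0: "{0::real^3} \<in> lmeasurable" by (intro lmeasurable_compact) simp
  note L1 = fmeasurable.Un[OF Xm L0] and L2 = fmeasurable.Un[OF lK K(3)]
  have "measure lebesgue (ball (0::real^3) 1) \<le> measure lebesgue (((\<Union>m. X m) \<union> {0}) \<union> (K \<union> (E - K)))"
    by (rule measure_mono_fmeasurable[OF sub _ fmeasurable.Un[OF L1 L2]]) simp
  also have "\<dots> \<le> measure lebesgue ((\<Union>m. X m) \<union> {0}) + measure lebesgue (K \<union> (E - K))"
    by (rule measure_Un_le[OF fmeasurableD[OF L1] fmeasurableD[OF L2]])
  also have "\<dots> \<le> (measure lebesgue (\<Union>m. X m) + measure lebesgue {0::real^3}) + (measure lebesgue K + measure lebesgue (E - K))"
    by (intro add_mono measure_Un_le fmeasurableD Xm L0 lK K(3))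
  also have "measure lebesgue {0::real^3} = 0" by simp
  finally have b: "measure lebesgue (ball (0::real^3) 1) \<le> A / 3 + measure lebesgue K + measure lebesgue (E - K)" using mX by linarith
  have "measure lebesgue (E - K) < e" using K(3,4) e by (simp add: emeasure_eq_measure2 ennreal_less_iff)
  moreover have "measure lebesgue (ball (0::real^3) 1) = 4 / 3 * pi"
    using content_ball[of 1 "0::real^3"] by (simp add: unit_ball_vol_3)
  ultimately have "measure lebesgue K \<ge> (4 * pi - A) / 3 - e" using b by (simp add: field_simps)
  moreover have "AE x in lborel. norm x < 1 \<longrightarrow> (\<forall>y\<in>K. y \<noteq> norm y *\<^sub>R N x)"
    using S(4)
  proof eventually_elim
    case (elim x)
    show ?case
    proof (intro impI ballI notI)
      \<comment> \<open>A point of \<open>K\<close> on the ray of N x has norm strictly between 0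
        and 1, so it would belong to the cone over x.\<close>
      fix y assume "norm x < 1" and y: "y \<in> K" and eq: "y = norm y *\<^sub>R N x"
      then obtain m where m: "x \<in> S m" using elim by auto
      have "norm y < 1" "y \<noteq> 0" using y K(2) by (auto simp: E_def)
      then have "y \<in> X m" unfolding X_def using eq m by (intro CollectI exI[of _ "norm y"] exI[of _ x]) auto
      then show False using y K(2) by (auto simp: E_def)
    qed
  qed
  ultimately show ?thesis using that[OF cK] K(2) unfolding E_def by blast
qed

section \<open>Solid angles\<close>

text \<open>Spherical coordinates with longitude \<open>p$1\<close>, cosine of the polar angle
  \<open>p$2\<close> and radius \<open>p$3\<close>. Taking the cosine as coordinate leaves the
  radius squared as volume element, and a sector is essentially the image of a box.\<close>

definition spherical :: "real^3 \<Rightarrow> real^3" where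
  "spherical p = p$3 *\<^sub>R ((sqrt (1 - (p$2)\<^sup>2) * cos (p$1)) *\<^sub>R axis 1 1 + (sqrt (1 - (p$2)\<^sup>2) * sin (p$1)) *\<^sub>R axis 2 1 + (p$2) *\<^sub>R axis 3 1)"

lemma spherical_has_derivative:
  assumes "\<bar>p$2\<bar> < 1"
  obtains F' where "(spherical has_derivative F') (at p)" "\<bar>det (matrix F')\<bar> = (p$3)\<^sup>2"
proof -
  define q where "q = sqrt (1 - (p$2)\<^sup>2)"
  have p2: "1 - (p$2)\<^sup>2 > 0" using assms by (simp add: abs_square_less_1)
  then have q: "q > 0" "q\<^sup>2 = 1 - (p$2)\<^sup>2" by (simp_all add: q_def)
  define c s where "c = cos (p$1)" and "s = sin (p$1)"
  let ?e1 = "axis 1 1 :: real^3" and ?e2 = "axis 2 1 :: real^3" and ?e3 = "axis 3 1 :: real^3"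
  define F' where "F' h = p$3 *\<^sub>R ((q * (- s * h$1) + (- (p$2) * h$2 / q) * c) *\<^sub>R ?e1
      + (q * (c * h$1) + (- (p$2) * h$2 / q) * s) *\<^sub>R ?e2 + h$2 *\<^sub>R ?e3)
      + h$3 *\<^sub>R ((q * c) *\<^sub>R ?e1 + (q * s) *\<^sub>R ?e2 + (p$2) *\<^sub>R ?e3)" for h :: "real^3"
  have comp: "((\<lambda>p::real^3. p$i) has_derivative (\<lambda>h. h$i)) (at p)" for i
    by (rule bounded_linear_imp_has_derivative[OF bounded_linear_vec_nth])
  have "((\<lambda>p::real^3. 1 - (p$2)\<^sup>2) has_derivative (\<lambda>h. - (2 * p$2 * h$2))) (at p)"
    by (auto intro!: derivative_eq_intros comp)
  from has_derivative_real_sqrt[OF p2 this]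
  have dq: "((\<lambda>p::real^3. sqrt (1 - (p$2)\<^sup>2)) has_derivative (\<lambda>h. - (p$2) * h$2 / q)) (at p)"
    by (rule has_derivative_eq_rhs) (use q in \<open>auto simp: q_def field_simps\<close>)
  have dc: "((\<lambda>p::real^3. cos (p$1)) has_derivative (\<lambda>h. - s * h$1)) (at p)"
    using has_derivative_cos[OF comp[of 1]] by (rule has_derivative_eq_rhs) (auto simp: c_def s_def)
  have ds: "((\<lambda>p::real^3. sin (p$1)) has_derivative (\<lambda>h. c * h$1)) (at p)"
    using has_derivative_sin[OF comp[of 1]] by (rule has_derivative_eq_rhs) (auto simp: c_def s_def)
  have "(spherical has_derivative F') (at p)"
    unfolding spherical_def[abs_def] F'_def[abs_def]
    by (rule has_derivative_eq_rhs[OF has_derivative_scaleR[OF comp has_derivative_add[OF has_derivative_add[OF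
         has_derivative_scaleR_left[OF has_derivative_mult[OF dq dc]] has_derivative_scaleR_left[OF has_derivative_mult[OF dq ds]]]
         has_derivative_scaleR_left[OF comp]]]])
      (simp add: q_def c_def s_def fun_eq_iff)
  moreover have "\<bar>det (matrix F')\<bar> = (p$3)\<^sup>2"
  proof -
    have cs: "c\<^sup>2 + s\<^sup>2 = 1" by (simp add: c_def s_def)
    have "det (matrix F') = (p$3)\<^sup>2 * ((q\<^sup>2 + (p$2)\<^sup>2) * (c\<^sup>2 + s\<^sup>2))"
      using q(1) by (simp add: det_3 matrix_def F'_def axis_def field_simps power2_eq_square)
    then show ?thesis using q(2) cs by simp
  qed
  ultimately show ?thesis by (rule that)
qed

text \<open>The polar axis is excluded: there the cosine is 1 or -1, where the square root in
  \<open>spherical\<close> is not differentiable.\<close>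

lemma spherical_surj:
  assumes y: "y \<noteq> 0" "norm y \<le> 1" "y$1 \<noteq> 0 \<or> y$2 \<noteq> 0"
  obtains p where "p$1 \<in> {0..2*pi}" "p$2 = y$3 / norm y" "\<bar>p$2\<bar> < 1" "p$3 = norm y" "spherical p = y"
proof -
  define r where "r = norm y"
  define z where "z = y$3 / r"
  have r: "r > 0" using y(1) by (simp add: r_def)
  have r2: "r\<^sup>2 = (y$1)\<^sup>2 + (y$2)\<^sup>2 + (y$3)\<^sup>2"
    by (simp add: r_def norm_vec_def L2_set_def sum_3)
  have pos: "(y$1)\<^sup>2 + (y$2)\<^sup>2 > 0" using y(3) by (simp add: sum_power2_gt_zero_iff)
  have z2: "1 - z\<^sup>2 = ((y$1)\<^sup>2 + (y$2)\<^sup>2) / r\<^sup>2"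
  proof -
    have "1 - z\<^sup>2 = (r\<^sup>2 - (y$3)\<^sup>2) / r\<^sup>2" using r by (simp add: z_def power_divide diff_divide_distrib)
    then show ?thesis by (simp add: r2)
  qed
  then have zpos: "1 - z\<^sup>2 > 0" using pos r by simp
  define q where "q = sqrt (1 - z\<^sup>2)"
  have q: "q > 0" "q\<^sup>2 = 1 - z\<^sup>2" using zpos by (simp_all add: q_def)
  have "(y$1 / (r * q))\<^sup>2 + (y$2 / (r * q))\<^sup>2 = 1"
  proof -
    have "r\<^sup>2 * q\<^sup>2 = (y$1)\<^sup>2 + (y$2)\<^sup>2" unfolding q(2) z2 using r by simp
    then show ?thesis unfolding power_divide power_mult_distrib add_divide_distrib[symmetric] using y(3) by simp
  qed
  then obtain t where t: "0 \<le> t" "t < 2 * pi" "y$1 / (r * q) = cos t" "y$2 / (r * q) = sin t"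
    using sincos_total_2pi by metis
  define p :: "real^3" where "p = vector [t, z, r]"
  have p: "p$1 = t" "p$2 = z" "p$3 = r" by (simp_all add: p_def)
  have "spherical p = y"
    unfolding spherical_def p q_def[symmetric] vec_eq_iff forall_3
    using t(3,4)[symmetric] q(1) r by (simp add: axis_def z_def)
  moreover have "\<bar>z\<bar> < 1" using zpos by (simp add: abs_square_less_1)
  ultimately show ?thesis using that[of p] t p by (auto simp: z_def r_def)
qed

text \<open>For unit \<open>x\<close>, a spherical cap seen as a cone in the ball; its volume is a
  third of the area of the cap.\<close>

definition sector :: "real^3 \<Rightarrow> real \<Rightarrow> (real^3) set" where
  "sector x s = {y \<in> ball 0 1 - {0}. s < x \<bullet> y / norm y}"

lemma sector_borel: "sector x s \<in> sets borel"
proof -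
  have "(\<lambda>y. x \<bullet> y / norm y) \<in> borel_measurable borel" by measurable
  then have "{y \<in> space borel. s < x \<bullet> y / norm y} \<in> sets borel" by measurable
  moreover have "sector x s = (ball 0 1 - {0}) \<inter> {y \<in> space borel. s < x \<bullet> y / norm y}" by (auto simp: sector_def)
  ultimately show ?thesis by simp
qed

lemma sector_lmeasurable: "sector x s \<in> lmeasurable"
proof (rule bounded_set_imp_lmeasurable)
  show "bounded (sector x s)" by (rule bounded_subset[OF bounded_ball[of 0 1]]) (auto simp: sector_def)
  show "sector x s \<in> sets lebesgue" using sector_borel by (simp add: sets_completionI_sets)
qed

text \<open>Up to a plane of measure zero the sector is covered by the image of a box under
  \<open>spherical\<close>. The image estimate bounds volumes only from above; the reverse
  inequality comes later from complementary sectors.\<close>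

lemma sector_axis_measure_le:
  assumes s: "-1 \<le> s" "s \<le> 1"
  shows "measure lebesgue (sector (axis 3 1) s) \<le> 2 * pi / 3 * (1 - s)"
proof -
  define T where "T = {p::real^3. 0 \<le> p$1 \<and> p$1 \<le> 2 * pi \<and> s < p$2 \<and> p$2 < 1 \<and> 0 < p$3 \<and> p$3 \<le> 1}"
  have cm [measurable]: "(\<lambda>p::real^3. p$i) \<in> borel_measurable borel" for i
    by (rule borel_measurable_continuous_onI) (intro continuous_intros)
  have Tb: "T \<in> sets borel"
  proof -
    have "{p \<in> space (borel::(real^3) measure). 0 \<le> p$1 \<and> p$1 \<le> 2 * pi \<and> s < p$2 \<and> p$2 < 1 \<and> 0 < p$3 \<and> p$3 \<le> 1} \<in> sets borel"
      by measurable
    then show ?thesis by (simp add: T_def)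
  qed
  have p2: "\<bar>p$2\<bar> < 1" if "p \<in> T" for p using that s by (auto simp: T_def)
  have "\<forall>p\<in>T. \<exists>F'. (spherical has_derivative F') (at p) \<and> \<bar>det (matrix F')\<bar> = (p$3)\<^sup>2"
    using spherical_has_derivative p2 by metis
  then obtain F' where F': "\<And>p. p \<in> T \<Longrightarrow> (spherical has_derivative F' p) (at p)" "\<And>p. p \<in> T \<Longrightarrow> \<bar>det (matrix (F' p))\<bar> = (p$3)\<^sup>2"
    by metis
  define G where "G p = (if p \<in> T then (p$3)\<^sup>2 else 0)" for p
  have Gm: "G \<in> borel_measurable borel"
    unfolding G_def[abs_def] using Tb by (intro measurable_If_set) (auto, measurable)
  let ?R = "{0..2*pi} \<times> {s<..<1}"
  let ?b = "cbox (vector [0, s]) (vector [2 * pi, 1]) :: (real^2) set"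
  have eb: "emeasure lborel ?b = ennreal (2 * pi * (1 - s))"
  proof -
    have prod2: "(\<Prod>i\<in>UNIV. f i) = f 1 * f 2" for f :: "2 \<Rightarrow> real" unfolding UNIV_2 by simp
    have "emeasure lborel ?b = ennreal (\<Prod>b\<in>Basis. ((vector [2 * pi, 1] :: real^2) - vector [0, s]) \<bullet> b)"
    proof (rule emeasure_lborel_cbox)
      fix b :: "real^2" assume "b \<in> Basis"
      then obtain i where b: "b = axis i 1" by (auto simp: Basis_vec_def)
      have "i = 1 \<or> i = 2" by (rule exhaust_2)
      then show "vector [0, s] \<bullet> b \<le> vector [2 * pi, 1] \<bullet> b" using s unfolding b by (auto simp: inner_axis)
    qed
    also have "\<dots> = ennreal (2 * pi * (1 - s))" unfolding prod_Basis_cart prod2 inner_axis by simp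
    finally show ?thesis .
  qed
  have "(\<integral>\<^sup>+p. ennreal (G p) \<partial>lborel) = (\<integral>\<^sup>+x. (\<integral>\<^sup>+t. ennreal (G (join3 x t)) \<partial>lborel) \<partial>lborel)"
    by (rule nn_integral_real3) (use Gm in measurable)
  also have "\<dots> \<le> (\<integral>\<^sup>+x. (\<integral>\<^sup>+t. indicator ?b x * (ennreal (t\<^sup>2) * indicator {0<..1} t) \<partial>lborel) \<partial>lborel)"
  proof (intro nn_integral_mono)
    fix x :: "real^2" and t :: real
    show "ennreal (G (join3 x t)) \<le> indicator ?b x * (ennreal (t\<^sup>2) * indicator {0<..1} t)"
    proof (cases "join3 x t \<in> T")
      case True
      then have "x \<in> ?b" "t \<in> {0<..1}" by (auto simp: T_def mem_box_cart forall_2)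
      then show ?thesis by (simp add: G_def)
    qed (simp add: G_def)
  qed
  also have "\<dots> = (\<integral>\<^sup>+x. indicator ?b x * ennreal (1/3) \<partial>lborel)"
  proof (intro nn_integral_cong)
    fix x :: "real^2"
    have "(\<lambda>t::real. ennreal (t\<^sup>2) * indicator {0<..1} t) \<in> borel_measurable lborel"
      by (intro borel_measurable_times_ennreal borel_measurable_indicator) auto
    from nn_integral_cmult[OF this]
    show "(\<integral>\<^sup>+t. indicator ?b x * (ennreal (t\<^sup>2) * indicator {0<..1} t) \<partial>(lborel::real measure)) = indicator ?b x * ennreal (1/3)"
      unfolding nn_integral_square_Ioc .
  qed
  also have "\<dots> = emeasure lborel ?b * ennreal (1/3)"
    by (subst nn_integral_multc) auto
  also have "\<dots> = ennreal (2 * pi / 3 * (1 - s))" unfolding eb using s by (simp add: ennreal_mult[symmetric])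
  finally have le: "(\<integral>\<^sup>+p. ennreal (G p) \<partial>lborel) \<le> ennreal (2 * pi / 3 * (1 - s))" .
  then have "(\<integral>\<^sup>+p. ennreal (G p) \<partial>lborel) < \<infinity>" by (rule order.strict_trans1) simp
  then obtain r where r: "r \<ge> 0" "(\<integral>\<^sup>+p. ennreal (G p) \<partial>lborel) = ennreal r" by (cases "(\<integral>\<^sup>+p. ennreal (G p) \<partial>lborel)") auto
  have rle: "r \<le> 2 * pi / 3 * (1 - s)" using le r s by (simp add: ennreal_le_iff)
  have "(G has_integral r) UNIV"
    by (rule nn_integral_has_integral[OF Gm _ _ r(1)]) (use r(2) in \<open>auto simp: G_def\<close>)
  then have "((\<lambda>p. (p$3)\<^sup>2) has_integral r) T"
    unfolding G_def[abs_def] by (simp only: has_integral_restrict_UNIV)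
  then have hi: "((\<lambda>p. \<bar>det (matrix (F' p))\<bar>) has_integral r) T"
    by (rule has_integral_eq[rotated]) (simp add: F'(2))
  have Tl: "T \<in> sets lebesgue" using Tb by (simp add: sets_completionI_sets)
  have der: "(spherical has_derivative F' p) (at p within T)" if "p \<in> T" for p
    using F'(1)[OF that] by (rule has_derivative_at_withinI)
  note m = measurable_differentiable_image[OF Tl der has_integral_integrable[OF hi]] measure_differentiable_image[OF Tl der has_integral_integrable[OF hi]]
  \<comment> \<open>This plane contains the polar axis, the part of the sector that the coordinates
    miss.\<close>
  let ?Z = "{y::real^3. y$1 = 0}"
  have neg: "negligible ?Z"
    using negligible_standard_hyperplane[of "axis 1 1 :: real^3" 0] by (simp add: axis_in_Basis_iff inner_axis inner_commute)
  have sub: "sector (axis 3 1) s \<subseteq> spherical ` T \<union> ?Z"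
  proof
    fix y assume y: "y \<in> sector (axis 3 1) s"
    show "y \<in> spherical ` T \<union> ?Z"
    proof (cases "y$1 = 0")
      case False
      then have "y \<noteq> 0" "norm y \<le> 1" "y$1 \<noteq> 0 \<or> y$2 \<noteq> 0" using y by (auto simp: sector_def)
      from spherical_surj[OF this] obtain p where p: "p$1 \<in> {0..2*pi}" "p$2 = y$3 / norm y" "\<bar>p$2\<bar> < 1" "p$3 = norm y" "spherical p = y"
        by blast
      have "axis 3 1 \<bullet> y = y$3" by (simp add: inner_axis inner_commute)
      then have "s < p$2" using y p(2) by (simp add: sector_def)
      then have "p \<in> T" using p \<open>y \<noteq> 0\<close> \<open>norm y \<le> 1\<close> by (auto simp: T_def)
      then show ?thesis using p(5) by blast
    qed simp
  qed
  have "measure lebesgue (sector (axis 3 1) s) \<le> measure lebesgue (spherical ` T \<union> ?Z)"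
    using sub sector_lmeasurable m(1) neg by (intro measure_mono_fmeasurable) (auto intro: negligible_imp_measurable)
  also have "\<dots> \<le> measure lebesgue (spherical ` T) + measure lebesgue ?Z"
    using m(1) negligible_imp_measurable[OF neg] by (intro measure_Un_le) auto
  also have "measure lebesgue ?Z = 0" using neg by (rule negligible_imp_measure0)
  also have "measure lebesgue (spherical ` T) + 0 \<le> 2 * pi / 3 * (1 - s)" using m(2) integral_unique[OF hi] rle by simp
  finally show ?thesis .
qed

text \<open>A rotation takes the third axis to \<open>x\<close> and preserves volume.\<close>

lemma sector_measure_le:
  assumes x: "norm x = 1" and s: "-1 \<le> s" "s \<le> 1"
  shows "measure lebesgue (sector x s) \<le> 2 * pi / 3 * (1 - s)"
proof -
  obtain f :: "real^3 \<Rightarrow> real^3" where f: "orthogonal_transformation f" "f (axis 3 1) = x"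
    using orthogonal_transformation_exists_1[of "axis 3 1 :: real^3" x] x by (auto simp: norm_axis_1)
  have "sector x s = f ` sector (axis 3 1) s"
  proof
    have inv: "f (axis 3 1) \<bullet> f y = axis 3 1 \<bullet> y" "norm (f y) = norm y" for y
      using f(1) by (auto simp: orthogonal_transformation_def orthogonal_transformation_norm)
    have f0: "f y = 0 \<longleftrightarrow> y = 0" for y using inv(2)[of y] by (metis norm_eq_zero)
    show "f ` sector (axis 3 1) s \<subseteq> sector x s"
      using inv f0 by (auto simp: sector_def f(2)[symmetric])
    show "sector x s \<subseteq> f ` sector (axis 3 1) s"
    proof
      fix y assume y: "y \<in> sector x s"
      obtain z where z: "y = f z" using orthogonal_transformation_surj[OF f(1)] by (meson surjD)
      then have "z \<in> sector (axis 3 1) s" using y inv f0 by (auto simp: sector_def f(2)[symmetric])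
      then show "y \<in> f ` sector (axis 3 1) s" using z by blast
    qed
  qed
  then show ?thesis
    using measure_orthogonal_image[OF f(1) sector_lmeasurable] sector_axis_measure_le[OF s] by simp
qed


section \<open>Distribution of the cosine of the angle to \<open>x\<close> over the punctured unit
  ball\<close>

definition polar_measure :: "real^3 \<Rightarrow> real measure" where
  "polar_measure x = distr (density lborel (indicator (ball 0 1 - {0}))) borel (\<lambda>y. x \<bullet> y / norm y)"

lemma polar_measurable [measurable]: "(\<lambda>y. x \<bullet> y / norm y) \<in> borel_measurable (borel :: (real^3) measure)"
  by measurable

lemma emeasure_polar:
  assumes "A \<in> sets borel"
  shows "emeasure (polar_measure x) A = emeasure lborel {y \<in> ball 0 1 - {0}. x \<bullet> y / norm y \<in> A}"
proof -
  have m: "(\<lambda>y. x \<bullet> y / norm y) -` A \<inter> space borel \<in> sets (borel :: (real^3) measure)"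
    by (rule measurable_sets[OF polar_measurable assms])
  have "emeasure (polar_measure x) A = emeasure (density lborel (indicator (ball 0 1 - {0}))) ((\<lambda>y. x \<bullet> y / norm y) -` A \<inter> space borel)"
    unfolding polar_measure_def using assms by (subst emeasure_distr) auto
  also have "\<dots> = (\<integral>\<^sup>+y. indicator (ball 0 1 - {0}) y * indicator ((\<lambda>y. x \<bullet> y / norm y) -` A \<inter> space borel) y \<partial>lborel)"
  proof (rule emeasure_density)
    show "indicator (ball 0 1 - {0}) \<in> borel_measurable (lborel :: (real^3) measure)"
      by (rule borel_measurable_indicator) simp
  qed (use m in simp)
  also have "\<dots> = (\<integral>\<^sup>+y. indicator {y \<in> ball 0 1 - {0}. x \<bullet> y / norm y \<in> A} y \<partial>lborel)"
    by (intro nn_integral_cong) (auto split: split_indicator)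
  also have "\<dots> = emeasure lborel {y \<in> ball 0 1 - {0}. x \<bullet> y / norm y \<in> A}"
  proof (rule nn_integral_indicator)
    have "{y \<in> ball 0 1 - {0}. x \<bullet> y / norm y \<in> A} = (ball 0 1 - {0}) \<inter> ((\<lambda>y. x \<bullet> y / norm y) -` A \<inter> space borel)" by auto
    then show "{y \<in> ball 0 1 - {0}. x \<bullet> y / norm y \<in> A} \<in> sets lborel" using m by simp
  qed
  finally show ?thesis .
qed

text \<open>A sector and the opposite one, widened by \<eta> to catch the common boundary, cover the
  punctured ball. The upper bounds for the two add up to the whole volume 4 pi/3 as \<eta> tends to
  0, so both must be sharp.\<close>

lemma measure_sector:
  assumes x: "norm x = 1" and s: "-1 \<le> s" "s \<le> 1"
  shows "measure lebesgue (sector x s) = 2 * pi / 3 * (1 - s)"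
proof (rule antisym[OF sector_measure_le[OF assms]])
  have vol: "measure lebesgue (ball (0::real^3) 1) = 4 / 3 * pi"
    using content_ball[of 1 "0::real^3"] by (simp add: unit_ball_vol_3)
  have "2 * pi / 3 * (1 - s) \<le> measure lebesgue (sector x s) + e" if e: "e > 0" for e
  proof (cases "s = 1")
    case False
    \<comment> \<open>At most 1 - s, so that the opposite threshold -s - \<eta> stays at least -1;
      at most e/3, so that the loss (2 pi/3) \<eta> is at most \<open>e\<close>.\<close>
    define \<eta> where "\<eta> = min (e / 3) (1 - s)"
    have \<eta>: "\<eta> > 0" "\<eta> \<le> e / 3" "\<eta> \<le> 1 - s"
      unfolding \<eta>_def using e False s min.cobounded1[of "e/3" "1-s"] by auto
    have sub: "(ball 0 1 :: (real^3) set) \<subseteq> (sector x s \<union> sector (- x) (- s - \<eta>)) \<union> {0}"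
    proof
      fix y :: "real^3" assume y: "y \<in> ball 0 1"
      have "- s - \<eta> < (- x) \<bullet> y / norm y" if "\<not> s < x \<bullet> y / norm y" using that \<eta>(1) by simp
      then show "y \<in> (sector x s \<union> sector (- x) (- s - \<eta>)) \<union> {0}" using y by (auto simp: sector_def)
    qed
    have L0: "{0::real^3} \<in> lmeasurable" by (intro lmeasurable_compact) simp
    note L = sector_lmeasurable[of x s] sector_lmeasurable[of "-x" "-s-\<eta>"]
    have "measure lebesgue (ball (0::real^3) 1) \<le> measure lebesgue ((sector x s \<union> sector (- x) (- s - \<eta>)) \<union> {0})"
      by (rule measure_mono_fmeasurable[OF sub _ fmeasurable.Un[OF fmeasurable.Un[OF L] L0]]) simp
    also have "\<dots> \<le> (measure lebesgue (sector x s) + measure lebesgue (sector (- x) (- s - \<eta>))) + measure lebesgue {0::real^3}"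
      by (rule order_trans[OF measure_Un_le add_right_mono[OF measure_Un_le]])
        (use L L0 in \<open>auto intro: fmeasurableD\<close>)
    also have "\<dots> \<le> (measure lebesgue (sector x s) + 2 * pi / 3 * (1 - (- s - \<eta>))) + 0"
      using \<eta> s x by (intro add_mono order_refl sector_measure_le) auto
    also have "1 - (- s - \<eta>) = 1 + s + \<eta>" by simp
    finally have le: "4 / 3 * pi \<le> measure lebesgue (sector x s) + 2 * pi / 3 * (1 + s + \<eta>)" unfolding vol by simp
    have "2 * pi / 3 * \<eta> \<le> 3 * (e / 3)" using \<eta> pi_less_4 by (intro mult_mono) auto
    moreover have "2 * pi / 3 * (1 - s) = 4 / 3 * pi - 2 * pi / 3 * (1 + s + \<eta>) + 2 * pi / 3 * \<eta>" by (simp add: field_simps)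
    ultimately show ?thesis using le by linarith
  qed (use e in simp)
  then show "2 * pi / 3 * (1 - s) \<le> measure lebesgue (sector x s)" by (rule field_le_epsilon)
qed

text \<open>Archimedes: the projection of the solid angle onto a diameter is uniformly distributed.\<close>

lemma polar_measure_eq:
  assumes x: "norm x = 1"
  shows "polar_measure x = density lborel (\<lambda>z. ennreal (2 * pi / 3) * indicator {-1..1} z)"
proof (rule measure_eqI_lessThan)
  have sec: "emeasure (polar_measure x) {s<..} = emeasure lborel (sector x s)" for s
    by (subst emeasure_polar) (auto simp: sector_def)
  have ub: "x \<bullet> y / norm y \<le> 1" "-1 \<le> x \<bullet> y / norm y" if "y \<noteq> 0" for y
    using norm_cauchy_schwarz[of x y] norm_cauchy_schwarz[of "-x" y] x that by (auto simp: field_simps)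
  have em: "emeasure lborel (sector x s) = ennreal (measure lebesgue (sector x s))" for s
  proof -
    have "emeasure lborel (sector x s) = emeasure lebesgue (sector x s)" using sector_borel[of x s] by simp
    then show ?thesis using emeasure_eq_measure2[OF sector_lmeasurable] by simp
  qed
  have vol: "measure lebesgue (ball (0::real^3) 1) = 4 / 3 * pi"
    using content_ball[of 1 "0::real^3"] by (simp add: unit_ball_vol_3)
  have lhs: "emeasure (polar_measure x) {s<..} = ennreal (2 * pi / 3 * (1 - max (-1) (min 1 s)))" for s
  proof -
    consider "s \<ge> 1" | "-1 \<le> s" "s \<le> 1" | "s < -1" by linarith
    then show ?thesis
    proof cases
      case 1
      have "y \<notin> sector x s" for y
      proof
        assume y: "y \<in> sector x s"
        then have "x \<bullet> y / norm y \<le> 1" by (intro ub(1)) (simp add: sector_def)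
        moreover have "s < x \<bullet> y / norm y" using y by (simp add: sector_def)
        ultimately show False using 1 by linarith
      qed
      then have "sector x s = {}" by blast
      then show ?thesis using 1 by (simp add: sec)
    next
      case 2
      then show ?thesis unfolding sec em measure_sector[OF x 2] by simp
    next
      case 3
      have "measure lebesgue (sector x s) = measure lebesgue (ball (0::real^3) 1)"
      proof (rule measure_negligible_symdiff)
        show "ball (0::real^3) 1 \<in> lmeasurable" by simp
        have "s < x \<bullet> y / norm y" if "y \<noteq> 0" for y using ub(2)[OF that] 3 by linarith
        then have "sector x s = ball 0 1 - {0}" by (auto simp: sector_def)
        then show "negligible (ball 0 1 - sector x s \<union> (sector x s - ball 0 1))"
          by (intro negligible_subset[OF negligible_sing[of "0::real^3"]]) auto
      qed
      then show ?thesis using 3 unfolding sec em vol by simp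
    qed
  qed
  show "emeasure (polar_measure x) {s<..} < \<infinity>" for s unfolding lhs by simp
  show "emeasure (polar_measure x) {s<..} = emeasure (density lborel (\<lambda>z. ennreal (2 * pi / 3) * indicator {-1..1} z)) {s<..}" for s
  proof -
    have "emeasure (density lborel (\<lambda>z. ennreal (2 * pi / 3) * indicator {-1..1} z)) {s<..}
      = (\<integral>\<^sup>+z. ennreal (2 * pi / 3) * indicator ({-1..1} \<inter> {s<..}) z \<partial>lborel)"
      by (subst emeasure_density) (auto intro!: nn_integral_cong split: split_indicator)
    also have "\<dots> = ennreal (2 * pi / 3) * emeasure lborel ({-1..1} \<inter> {s<..})"
      by (rule nn_integral_cmult_indicator) auto
    also have "emeasure lborel ({-1..1} \<inter> {s<..}) = ennreal (1 - max (-1) (min 1 s))"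
    proof -
      consider "s \<ge> 1" | "-1 \<le> s" "s < 1" | "s < -1" by linarith
      then show ?thesis
      proof cases
        case 1
        then have "{-1..1} \<inter> {s<..} = {}" by auto
        then show ?thesis using 1 by simp
      next
        case 2
        then have "{-1..1} \<inter> {s<..} = {s<..1}" by auto
        then show ?thesis using 2 by simp
      next
        case 3
        then have "{-1..1} \<inter> {s<..} = {-1..1}" by auto
        then show ?thesis using 3 by simp
      qed
    qed
    finally show ?thesis unfolding lhs by (simp add: ennreal_mult[symmetric])
  qed
qed (simp_all add: polar_measure_def)

text \<open>The factor is 2 pi, the area on the sphere per unit of cosine, times 1/3 from
  integrating the squared radius.\<close>

lemma nn_integral_polar:
  fixes x :: "real^3"
  assumes x: "norm x = 1" and [measurable]: "H \<in> borel_measurable borel"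
  shows "(\<integral>\<^sup>+y. H (x \<bullet> y / norm y) * indicator (ball 0 1 - {0}) y \<partial>lborel) = ennreal (2 * pi / 3) * (\<integral>\<^sup>+z. H z * indicator {-1..1} z \<partial>lborel)"
proof -
  have "(\<integral>\<^sup>+z. H z \<partial>polar_measure x) = (\<integral>\<^sup>+y. H (x \<bullet> y / norm y) \<partial>density lborel (indicator (ball 0 1 - {0})))"
    unfolding polar_measure_def by (subst nn_integral_distr) auto
  also have "\<dots> = (\<integral>\<^sup>+y. indicator (ball 0 1 - {0}) y * H (x \<bullet> y / norm y) \<partial>lborel)"
  proof (rule nn_integral_density)
    show "indicator (ball 0 1 - {0}) \<in> borel_measurable (lborel :: (real^3) measure)"
      by (rule borel_measurable_indicator) simp
  qed measurable
  finally have 1: "(\<integral>\<^sup>+z. H z \<partial>polar_measure x) = (\<integral>\<^sup>+y. H (x \<bullet> y / norm y) * indicator (ball 0 1 - {0}) y \<partial>lborel)"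
    by (simp add: mult.commute)
  have "(\<integral>\<^sup>+z. H z \<partial>polar_measure x) = (\<integral>\<^sup>+z. (ennreal (2 * pi / 3) * indicator {-1..1} z) * H z \<partial>lborel)"
    unfolding polar_measure_eq[OF x] by (subst nn_integral_density) auto
  also have "\<dots> = (\<integral>\<^sup>+z. ennreal (2 * pi / 3) * (H z * indicator {-1..1} z) \<partial>lborel)" by (intro nn_integral_cong) (simp add: mult_ac)
  also have "\<dots> = ennreal (2 * pi / 3) * (\<integral>\<^sup>+z. H z * indicator {-1..1} z \<partial>lborel)"
    by (rule nn_integral_cmult) (intro borel_measurable_times_ennreal borel_measurable_indicator; simp)
  finally show ?thesis using 1 by simp
qed

text \<open>In the variable z = cos(theta) the function cot(theta/2) is sqrt((1 + z)/(1 - z)), with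
  primitive arcsin z - sqrt(1 - z^2). The primitive is continuous up to z = 1, where the integrand
  is unbounded; hence the fundamental theorem with derivatives in the interior only.\<close>

lemma nn_integral_cot_half:
  "(\<integral>\<^sup>+z. ennreal (sqrt ((1 + z) / (1 - z))) * indicator {-1..1} z \<partial>lborel) = ennreal pi"
proof (rule nn_integral_has_integral_lebesgue')
  have "((\<lambda>z. sqrt ((1 + z) / (1 - z))) has_integral (arcsin 1 - sqrt (1 - 1\<^sup>2)) - (arcsin (-1) - sqrt (1 - (-1)\<^sup>2))) {-1..1::real}"
  proof (rule fundamental_theorem_of_calculus_interior[where f="\<lambda>z. arcsin z - sqrt (1 - z\<^sup>2)"])
    show "continuous_on {-1..1::real} (\<lambda>z. arcsin z - sqrt (1 - z\<^sup>2))"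
      by (intro continuous_intros) auto
    fix z :: real assume z: "z \<in> {-1<..<1}"
    then have "1 - z\<^sup>2 > 0" by (auto simp: abs_square_less_1 abs_less_iff)
    have "((\<lambda>z. arcsin z - sqrt (1 - z\<^sup>2)) has_real_derivative inverse (sqrt (1 - z\<^sup>2)) - (- (2 * z)) * (inverse (sqrt (1 - z\<^sup>2)) / 2)) (at z)"
      using z \<open>1 - z\<^sup>2 > 0\<close> by (auto intro!: derivative_eq_intros)
    moreover have "inverse (sqrt (1 - z\<^sup>2)) - (- (2 * z)) * (inverse (sqrt (1 - z\<^sup>2)) / 2) = sqrt ((1 + z) / (1 - z))"
    proof -
      have f: "1 - z\<^sup>2 = (1 - z) * (1 + z)" by (simp add: power2_eq_square algebra_simps)
      have "1 + z = sqrt (1 + z) * sqrt (1 + z)" using z by simp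
      then show ?thesis using z unfolding f real_sqrt_mult real_sqrt_divide by (simp add: field_simps)
    qed
    ultimately show "((\<lambda>z. arcsin z - sqrt (1 - z\<^sup>2)) has_vector_derivative sqrt ((1 + z) / (1 - z))) (at z)"
      by (simp add: has_real_derivative_iff_has_vector_derivative)
  qed simp
  then show "((\<lambda>z. sqrt ((1 + z) / (1 - z))) has_integral pi) {-1..1::real}" by simp
qed simp

text \<open>The numerator 2 e + e^2 = e (2 + e), forced by the divergence computation, makes the
  value independent of \<open>e\<close>; the averaged defect thereby gets a bound uniform in
  \<open>e\<close>.\<close>

lemma nn_integral_smoothed_delta:
  assumes e: "e > 0"
  shows "(\<integral>\<^sup>+z. ennreal ((2 * e + e\<^sup>2) / (1 + e - z)\<^sup>2) * indicator {-1..1} z \<partial>lborel) = ennreal 2"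
proof -
  have "(\<integral>\<^sup>+z. ennreal ((2 * e + e\<^sup>2) / (1 + e - z)\<^sup>2) * indicator {-1..1} z \<partial>lborel)
      = ennreal ((2 * e + e\<^sup>2) / (1 + e - 1) - (2 * e + e\<^sup>2) / (1 + e - (-1)))"
  proof (rule nn_integral_FTC_Icc[where F="\<lambda>z. (2 * e + e\<^sup>2) / (1 + e - z)"])
    show "((\<lambda>z. (2 * e + e\<^sup>2) / (1 + e - z)) has_real_derivative (2 * e + e\<^sup>2) / (1 + e - z)\<^sup>2) (at z)"
      if "z \<in> {-1..1}" for z
      using e that by (auto intro!: derivative_eq_intros simp: power2_eq_square)
  qed (use e in auto)
  also have "(2 * e + e\<^sup>2) / (1 + e - 1) - (2 * e + e\<^sup>2) / (1 + e - (-1)) = 2"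
  proof -
    have "2 * e + e\<^sup>2 = e * (2 + e)" by (simp add: power2_eq_square algebra_simps)
    then show ?thesis using e by simp
  qed
  finally show ?thesis .
qed

section \<open>Averaging over the omitted directions\<close>

text \<open>The continuous function 1 - a . y/|y| attains its minimum on \<open>K\<close>. The value
  0 would be equality in the Cauchy-Schwarz inequality and put a point of \<open>K\<close> on the
  ray of \<open>a\<close>.\<close>

lemma angle_gap:
  fixes K :: "(real^3) set"
  assumes K: "compact K" "0 \<notin> K" and a: "norm a = 1" "\<And>y. y \<in> K \<Longrightarrow> y \<noteq> norm y *\<^sub>R a"
  obtains c where "c > 0" "\<And>y. y \<in> K \<Longrightarrow> 1 - a \<bullet> (y /\<^sub>R norm y) \<ge> c"
proof (cases "K = {}")
  case False
  have n0: "norm y \<noteq> 0" if "y \<in> K" for y using that K(2) by auto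
  have "continuous_on K (\<lambda>y. 1 - a \<bullet> (y /\<^sub>R norm y))"
    using n0 by (intro continuous_intros) auto
  from continuous_attains_inf[OF K(1) False this]
  obtain y0 where y0: "y0 \<in> K" "\<And>y. y \<in> K \<Longrightarrow> 1 - a \<bullet> (y0 /\<^sub>R norm y0) \<le> 1 - a \<bullet> (y /\<^sub>R norm y)" by blast
  have "norm (y0 /\<^sub>R norm y0) = 1" using n0[OF y0(1)] by simp
  then have "a \<bullet> (y0 /\<^sub>R norm y0) \<le> 1" using norm_cauchy_schwarz[of a "y0 /\<^sub>R norm y0"] a(1) by simp
  moreover have "a \<bullet> (y0 /\<^sub>R norm y0) \<noteq> 1"
  proof
    assume eq: "a \<bullet> (y0 /\<^sub>R norm y0) = 1"
    have "(norm (a - b))\<^sup>2 = (norm a)\<^sup>2 + (norm b)\<^sup>2 - 2 * (a \<bullet> b)" for b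
      by (simp add: power2_norm_eq_inner algebra_simps inner_commute)
    then have "(norm (a - y0 /\<^sub>R norm y0))\<^sup>2 = (norm a)\<^sup>2 + (norm (y0 /\<^sub>R norm y0))\<^sup>2 - 2 * (a \<bullet> (y0 /\<^sub>R norm y0))"
      by blast
    also have "\<dots> = 0" using eq \<open>norm (y0 /\<^sub>R norm y0) = 1\<close> a(1) by simp
    finally have "a = y0 /\<^sub>R norm y0" by simp
    then have "norm y0 *\<^sub>R a = y0" using n0[OF y0(1)] by simp
    then show False using a(2)[OF y0(1)] by simp
  qed
  ultimately have "1 - a \<bullet> (y0 /\<^sub>R norm y0) > 0" by simp
  then show ?thesis using that y0(2) by blast
qed (use that[of 1] in simp)

text \<open>A point y of \<open>K\<close> stands for the direction y/|y|, and a direction is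
  weighted by the volume of \<open>K\<close> along it. Lebesgue measure on three-space thus takes
  the place of surface measure on the sphere.\<close>

locale averaging =
  fixes K :: "(real^3) set" and M :: real
  assumes K: "compact K" "K \<subseteq> ball 0 1" "0 \<notin> K" and M: "M = measure lborel K" "M > 0"
begin

text \<open>The smoothed primitive at \<open>a\<close>, given by the vector that represents it: a
  tangent vector v is sent to \<open>field e a y \<bullet> v\<close>.\<close>

definition field :: "real \<Rightarrow> real^3 \<Rightarrow> real^3 \<Rightarrow> real^3" where
  "field e a y = (1 / (1 + e - a \<bullet> (y /\<^sub>R norm y))) *\<^sub>R cross3 (y /\<^sub>R norm y) a"

text \<open>The defect of the smoothed primitive: up to sign, its exterior derivative on the sphere
  is 1 - \<open>peak\<close> times the area form.\<close>

definition peak :: "real \<Rightarrow> real^3 \<Rightarrow> real^3 \<Rightarrow> real" where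
  "peak e a y = (2 * e + e\<^sup>2) / (1 + e - a \<bullet> (y /\<^sub>R norm y))\<^sup>2"

definition avg_field :: "real \<Rightarrow> real^3 \<Rightarrow> real^3" where
  "avg_field e a = (1 / M) *\<^sub>R (LINT y|lborel. indicator K y *\<^sub>R field e a y)"

definition avg_peak :: "real \<Rightarrow> real^3 \<Rightarrow> real" where
  "avg_peak e a = (1 / M) * (LINT y|lborel. indicator K y *\<^sub>R peak e a y)"

lemma K_borel: "K \<in> sets borel"
  using K(1) by (simp add: borel_compact)

lemma K_finite: "emeasure lborel K < \<infinity>"
  by (rule emeasure_bounded_finite[OF compact_imp_bounded[OF K(1)]])

lemma integrable_K: "integrable lborel (\<lambda>y. indicator K y *\<^sub>R (c::real))"
  using K_borel K_finite by (intro integrable_scaleR_left integrable_real_indicator) auto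

lemma unit_direction:
  assumes "y \<in> K" shows "norm (y /\<^sub>R norm y) = 1"
proof -
  have "y \<noteq> 0" using assms K(3) by auto
  then show ?thesis by simp
qed

lemma denominator: "norm a \<le> 1 \<Longrightarrow> e > 0 \<Longrightarrow> y \<in> K \<Longrightarrow> 1 + e - a \<bullet> (y /\<^sub>R norm y) \<ge> e"
  by (rule denominator_ge[OF _ unit_direction])

lemma norm_field_le:
  assumes "norm a \<le> 1" "e > 0" "y \<in> K"
  shows "norm (field e a y) \<le> 1 / e"
proof -
  have "norm (cross3 (y /\<^sub>R norm y) a) \<le> 1"
    using norm_cross_le[of "y /\<^sub>R norm y" a] unit_direction[OF assms(3)] assms(1) by simp
  moreover have "\<bar>1 / (1 + e - a \<bullet> (y /\<^sub>R norm y))\<bar> \<le> 1 / e"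
    using denominator[OF assms] assms(2) by (simp add: frac_le)
  ultimately have "\<bar>1 / (1 + e - a \<bullet> (y /\<^sub>R norm y))\<bar> * norm (cross3 (y /\<^sub>R norm y) a) \<le> 1 / e * 1"
    by (intro mult_mono) (use assms in auto)
  then show ?thesis unfolding field_def norm_scaleR by simp
qed

lemma peak_bounds:
  assumes "norm a \<le> 1" "e > 0" "y \<in> K"
  shows "0 \<le> peak e a y" "peak e a y \<le> (2 * e + e\<^sup>2) / e\<^sup>2"
proof -
  have "e\<^sup>2 \<le> (1 + e - a \<bullet> (y /\<^sub>R norm y))\<^sup>2" using denominator[OF assms] assms(2) by (intro power_mono) auto
  then show "0 \<le> peak e a y" "peak e a y \<le> (2 * e + e\<^sup>2) / e\<^sup>2"
    unfolding peak_def using assms(2) by (auto intro!: divide_left_mono mult_pos_pos)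
qed

lemma field_integrable:
  assumes "norm a \<le> 1" "e > 0"
  shows "integrable lborel (\<lambda>y. indicator K y *\<^sub>R field e a y)"
proof (rule Bochner_Integration.integrable_bound[OF integrable_K[of "1 / e"]])
  show "AE y in lborel. norm (indicator K y *\<^sub>R field e a y) \<le> norm (indicator K y *\<^sub>R (1 / e))"
    using norm_field_le[OF assms] assms(2) by (intro AE_I2) (auto split: split_indicator)
  have "(\<lambda>y. field e a y) \<in> borel_measurable borel" unfolding field_def by measurable
  then show "(\<lambda>y. indicator K y *\<^sub>R field e a y) \<in> borel_measurable lborel"
    using K_borel by (intro borel_measurable_scaleR borel_measurable_indicator) auto
qed

lemma peak_integrable:
  assumes "norm a \<le> 1" "e > 0"
  shows "integrable lborel (\<lambda>y. indicator K y *\<^sub>R peak e a y)"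
proof (rule Bochner_Integration.integrable_bound[OF integrable_K[of "(2 * e + e\<^sup>2) / e\<^sup>2"]])
  show "AE y in lborel. norm (indicator K y *\<^sub>R peak e a y) \<le> norm (indicator K y *\<^sub>R ((2 * e + e\<^sup>2) / e\<^sup>2))"
    using peak_bounds[OF assms] assms(2) by (intro AE_I2) (auto split: split_indicator)
  have "(\<lambda>y. peak e a y) \<in> borel_measurable borel" unfolding peak_def by measurable
  then show "(\<lambda>y. indicator K y *\<^sub>R peak e a y) \<in> borel_measurable lborel"
    using K_borel by (intro borel_measurable_scaleR borel_measurable_indicator) auto
qed

text \<open>At angle theta the field has length sqrt(1 - z^2)/(1 + e - z) with z = cos(theta), at
  most cot(theta/2) for every \<open>e\<close>. Enlarging \<open>K\<close> to the whole punctured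
  ball gives (2 pi/3) pi wherever \<open>a\<close> lies; division by \<open>M\<close> leaves a bound
  uniform in \<open>a\<close> and \<open>e\<close>.\<close>

lemma norm_avg_field_le:
  assumes a: "norm a = 1" and e: "e > 0"
  shows "norm (avg_field e a) \<le> 2 * pi\<^sup>2 / (3 * M)"
proof -
  have pt: "ennreal (norm (indicator K y *\<^sub>R field e a y)) \<le> ennreal (sqrt ((1 + a \<bullet> y / norm y) / (1 - a \<bullet> y / norm y))) * indicator (ball 0 1 - {0}) y" for y
  proof (cases "y \<in> K")
    case True
    define z where "z = a \<bullet> y / norm y"
    have z: "a \<bullet> (y /\<^sub>R norm y) = z" by (simp add: z_def divide_inverse mult.commute)
    have nrm: "norm (y /\<^sub>R norm y) = 1" by (rule unit_direction[OF True])
    have "(norm (cross3 (y /\<^sub>R norm y) a))\<^sup>2 = 1 - z\<^sup>2"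
      using norm_cross_dot[of "y /\<^sub>R norm y" a] unfolding nrm a inner_commute[of "y /\<^sub>R norm y" a] z by simp
    then have cr: "norm (cross3 (y /\<^sub>R norm y) a) = sqrt (1 - z\<^sup>2)"
      by (metis norm_ge_zero real_sqrt_unique)
    have z1: "z \<le> 1" using norm_cauchy_schwarz[of a "y /\<^sub>R norm y"] nrm a z by simp
    have "-1 \<le> z" using norm_cauchy_schwarz[of "-a" "y /\<^sub>R norm y"] nrm a z by simp
    have d: "1 + e - z > 0" using z1 e by simp
    have "norm (field e a y) = sqrt (1 - z\<^sup>2) / (1 + e - z)"
      unfolding field_def norm_scaleR cr z using d by simp
    \<comment> \<open>For z = 1 both sides are 0, the right one because division by zero yields
      0.\<close>
    also have "\<dots> \<le> sqrt ((1 + z) / (1 - z))"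
    proof (cases "z = 1")
      case False
      then have z1: "1 - z > 0" using z1 by simp
      have f: "1 - z\<^sup>2 = (1 - z) * (1 + z)" by (simp add: power2_eq_square algebra_simps)
      have "sqrt (1 - z\<^sup>2) / (1 + e - z) \<le> sqrt (1 - z\<^sup>2) / (1 - z)"
        using z1 d e \<open>-1 \<le> z\<close> by (intro divide_left_mono) (auto simp: f)
      also have "\<dots> = sqrt ((1 + z) / (1 - z))"
      proof -
        define s where "s = sqrt (1 - z)"
        have s: "s > 0" "1 - z = s * s" using z1 by (simp_all add: s_def)
        show ?thesis unfolding f real_sqrt_mult real_sqrt_divide s_def[symmetric] by (subst s(2)) (use s(1) in simp)
      qed
      finally show ?thesis .
    qed simp
    finally have "ennreal (norm (field e a y)) \<le> ennreal (sqrt ((1 + z) / (1 - z)))" by (rule ennreal_leI)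
    moreover have "y \<in> ball 0 1 - {0}" using True K by auto
    ultimately show ?thesis using True by (simp add: z_def)
  qed simp
  have "ennreal (norm (LINT y|lborel. indicator K y *\<^sub>R field e a y)) \<le> (\<integral>\<^sup>+y. ennreal (norm (indicator K y *\<^sub>R field e a y)) \<partial>lborel)"
    by (rule integral_norm_bound_ennreal) (use field_integrable a e in simp)
  also have "\<dots> \<le> (\<integral>\<^sup>+y. ennreal (sqrt ((1 + a \<bullet> y / norm y) / (1 - a \<bullet> y / norm y))) * indicator (ball 0 1 - {0}) y \<partial>lborel)"
    by (intro nn_integral_mono pt)
  also have "\<dots> = ennreal (2 * pi / 3) * ennreal pi"
    unfolding nn_integral_cot_half[symmetric]
    by (rule nn_integral_polar[OF a, where H="\<lambda>z. ennreal (sqrt ((1 + z) / (1 - z)))"]) measurable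
  also have "\<dots> = ennreal (2 * pi\<^sup>2 / 3)" by (simp add: ennreal_mult[symmetric] power2_eq_square)
  finally have "norm (LINT y|lborel. indicator K y *\<^sub>R field e a y) \<le> 2 * pi\<^sup>2 / 3" by (simp add: ennreal_le_iff)
  then have "1 / M * norm (LINT y|lborel. indicator K y *\<^sub>R field e a y) \<le> 1 / M * (2 * pi\<^sup>2 / 3)"
    using M(2) by (intro mult_left_mono) auto
  then show ?thesis using M(2) by (simp add: avg_field_def)
qed

text \<open>The integral over \<open>K\<close> is at most that over the whole punctured ball, where
  the mass of the peak is the same for all \<open>e\<close>. This provides the majorant when
  \<open>e\<close> tends to 0 in the averaged identity.\<close>

lemma avg_peak_bounds:
  assumes a: "norm a = 1" and e: "e > 0"
  shows "0 \<le> avg_peak e a" "avg_peak e a \<le> 4 * pi / (3 * M)"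
proof -
  have a': "norm a \<le> 1" using a by simp
  have nn: "0 \<le> indicator K y *\<^sub>R peak e a y" for y using peak_bounds(1)[OF a' e] by (auto split: split_indicator)
  then show "0 \<le> avg_peak e a" unfolding avg_peak_def using M(2) by (intro mult_nonneg_nonneg integral_nonneg_AE) auto
  have "ennreal (LINT y|lborel. indicator K y *\<^sub>R peak e a y) = (\<integral>\<^sup>+y. ennreal (indicator K y *\<^sub>R peak e a y) \<partial>lborel)"
    using nn peak_integrable[OF a' e] by (subst nn_integral_eq_integral) auto
  also have "\<dots> \<le> (\<integral>\<^sup>+y. ennreal ((2 * e + e\<^sup>2) / (1 + e - a \<bullet> y / norm y)\<^sup>2) * indicator (ball 0 1 - {0}) y \<partial>lborel)"
  proof (rule nn_integral_mono)
    fix y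
    show "ennreal (indicator K y *\<^sub>R peak e a y) \<le> ennreal ((2 * e + e\<^sup>2) / (1 + e - a \<bullet> y / norm y)\<^sup>2) * indicator (ball 0 1 - {0}) y"
    proof (cases "y \<in> K")
      case True
      then have "y \<in> ball 0 1 - {0}" using K by auto
      then show ?thesis using True by (simp add: peak_def divide_inverse mult.commute)
    qed simp
  qed
  also have "\<dots> = ennreal (2 * pi / 3) * ennreal 2"
    unfolding nn_integral_smoothed_delta[OF e, symmetric]
    by (rule nn_integral_polar[OF a, where H="\<lambda>z. ennreal ((2 * e + e\<^sup>2) / (1 + e - z)\<^sup>2)"]) measurable
  also have "\<dots> = ennreal (2 * pi / 3 * 2)" by (rule ennreal_mult[symmetric]) auto
  finally have "(LINT y|lborel. indicator K y *\<^sub>R peak e a y) \<le> 2 * pi / 3 * 2" by (subst (asm) ennreal_le_iff) auto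
  then have "1 / M * (LINT y|lborel. indicator K y *\<^sub>R peak e a y) \<le> 1 / M * (2 * pi / 3 * 2)"
    using M(2) by (intro mult_left_mono) auto
  then show "avg_peak e a \<le> 4 * pi / (3 * M)" using M(2) by (simp add: avg_peak_def)
qed

text \<open>If \<open>a\<close> avoids the directions of \<open>K\<close>, the denominators stay
  above a positive constant on all of \<open>K\<close>, uniformly in \<open>e\<close>, so dominated
  convergence applies. The averaged peak tends to 0 because its numerator does.\<close>

lemma averages_tendsto:
  assumes a: "norm a = 1" "\<And>y. y \<in> K \<Longrightarrow> y \<noteq> norm y *\<^sub>R a"
  shows "convergent (\<lambda>n. avg_field (1 / real (Suc n)) a)" "(\<lambda>n. avg_peak (1 / real (Suc n)) a) \<longlonglongrightarrow> 0"
proof -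
  obtain c where c: "c > 0" "\<And>y. y \<in> K \<Longrightarrow> 1 - a \<bullet> (y /\<^sub>R norm y) \<ge> c"
    using angle_gap[OF K(1,3) a] by blast
  have e0: "(\<lambda>n. 1 / real (Suc n)) \<longlonglongrightarrow> 0" using LIMSEQ_inverse_real_of_nat by (simp add: inverse_eq_divide)
  have ep: "1 / real (Suc n) > 0" for n by simp
  have dn: "1 + 1 / real (Suc n) - a \<bullet> (y /\<^sub>R norm y) \<ge> c" if "y \<in> K" for n y using c(2)[OF that] ep[of n] by linarith
  have cr: "norm (cross3 (y /\<^sub>R norm y) a) \<le> 1" if "y \<in> K" for y
    using norm_cross_le[of "y /\<^sub>R norm y" a] unit_direction[OF that] a(1) by simp
  have m: "(\<lambda>y. indicator K y *\<^sub>R field e a y) \<in> borel_measurable lborel"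
    "(\<lambda>y. indicator K y *\<^sub>R peak e a y) \<in> borel_measurable lborel" for e
    using K_borel by (auto intro!: borel_measurable_scaleR borel_measurable_indicator simp: field_def peak_def)
  have "(\<lambda>n. LINT y|lborel. indicator K y *\<^sub>R field (1 / real (Suc n)) a y) \<longlonglongrightarrow> (LINT y|lborel. indicator K y *\<^sub>R field 0 a y)"
  proof (rule integral_dominated_convergence[OF m(1) m(1) integrable_K[of "1 / c"]])
    show "AE y in lborel. (\<lambda>n. indicator K y *\<^sub>R field (1 / real (Suc n)) a y) \<longlonglongrightarrow> indicator K y *\<^sub>R field 0 a y"
    proof (rule AE_I2)
      fix y
      show "(\<lambda>n. indicator K y *\<^sub>R field (1 / real (Suc n)) a y) \<longlonglongrightarrow> indicator K y *\<^sub>R field 0 a y"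
      proof (cases "y \<in> K")
        case True
        have "1 + 0 - a \<bullet> (y /\<^sub>R norm y) \<noteq> 0" using c(1) c(2)[OF True] by linarith
        then show ?thesis unfolding field_def by (intro tendsto_intros e0)
      qed simp
    qed
    show "AE y in lborel. norm (indicator K y *\<^sub>R field (1 / real (Suc n)) a y) \<le> indicator K y *\<^sub>R (1 / c)" for n
    proof (rule AE_I2)
      fix y
      show "norm (indicator K y *\<^sub>R field (1 / real (Suc n)) a y) \<le> indicator K y *\<^sub>R (1 / c)"
      proof (cases "y \<in> K")
        case True
        have "\<bar>1 / (1 + 1 / real (Suc n) - a \<bullet> (y /\<^sub>R norm y))\<bar> \<le> 1 / c"
          using dn[OF True, of n] c(1) by (simp add: frac_le)
        then have "\<bar>1 / (1 + 1 / real (Suc n) - a \<bullet> (y /\<^sub>R norm y))\<bar> * norm (cross3 (y /\<^sub>R norm y) a) \<le> 1 / c * 1"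
          using cr[OF True] by (intro mult_mono) (use c(1) in auto)
        then show ?thesis using True unfolding field_def norm_scaleR by simp
      qed simp
    qed
  qed
  then have "(\<lambda>n. avg_field (1 / real (Suc n)) a) \<longlonglongrightarrow> (1 / M) *\<^sub>R (LINT y|lborel. indicator K y *\<^sub>R field 0 a y)"
    unfolding avg_field_def by (intro tendsto_intros)
  then show "convergent (\<lambda>n. avg_field (1 / real (Suc n)) a)" by (rule convergentI)
  have "(\<lambda>n. LINT y|lborel. indicator K y *\<^sub>R peak (1 / real (Suc n)) a y) \<longlonglongrightarrow> (LINT y|lborel. indicator K y *\<^sub>R peak 0 a y)"
  proof (rule integral_dominated_convergence[OF m(2) m(2) integrable_K[of "3 / c\<^sup>2"]])
    show "AE y in lborel. (\<lambda>n. indicator K y *\<^sub>R peak (1 / real (Suc n)) a y) \<longlonglongrightarrow> indicator K y *\<^sub>R peak 0 a y"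
    proof (rule AE_I2)
      fix y
      show "(\<lambda>n. indicator K y *\<^sub>R peak (1 / real (Suc n)) a y) \<longlonglongrightarrow> indicator K y *\<^sub>R peak 0 a y"
      proof (cases "y \<in> K")
        case True
        have "(1 + 0 - a \<bullet> (y /\<^sub>R norm y))\<^sup>2 \<noteq> 0" using c(1) c(2)[OF True] by simp
        then show ?thesis unfolding peak_def by (intro tendsto_intros e0)
      qed simp
    qed
    show "AE y in lborel. norm (indicator K y *\<^sub>R peak (1 / real (Suc n)) a y) \<le> indicator K y *\<^sub>R (3 / c\<^sup>2)" for n
    proof (rule AE_I2)
      fix y
      let ?e = "1 / real (Suc n)"
      show "norm (indicator K y *\<^sub>R peak ?e a y) \<le> indicator K y *\<^sub>R (3 / c\<^sup>2)"
      proof (cases "y \<in> K")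
        case True
        have e1: "?e \<le> 1" by simp
        then have "?e\<^sup>2 \<le> 1" using ep[of n] by (intro power_le_one) auto
        then have num: "2 * ?e + ?e\<^sup>2 \<le> 3" using e1 by linarith
        have "c\<^sup>2 \<le> (1 + ?e - a \<bullet> (y /\<^sub>R norm y))\<^sup>2" using dn[OF True, of n] c(1) by (intro power_mono) auto
        then have "peak ?e a y \<le> 3 / c\<^sup>2" unfolding peak_def using num c(1) by (intro frac_le) auto
        moreover have "peak ?e a y \<ge> 0" by (rule peak_bounds(1)) (use a True in auto)
        ultimately show ?thesis using True by simp
      qed simp
    qed
  qed
  then have "(\<lambda>n. avg_peak (1 / real (Suc n)) a) \<longlonglongrightarrow> (1 / M) * (LINT y|lborel. indicator K y *\<^sub>R peak 0 a y)"
    unfolding avg_peak_def by (intro tendsto_intros)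
  then show "(\<lambda>n. avg_peak (1 / real (Suc n)) a) \<longlonglongrightarrow> 0" by (simp add: peak_def)
qed

lemma avg_measurable [measurable]:
  assumes [measurable]: "N \<in> borel_measurable borel"
  shows "(\<lambda>x. avg_field e (N x)) \<in> borel_measurable borel" "(\<lambda>x. avg_peak e (N x)) \<in> borel_measurable borel"
proof -
  have [measurable]: "indicator K \<in> borel_measurable (borel :: (real^3) measure)" using K_borel by simp
  have "(\<lambda>(x, y). indicator K y *\<^sub>R field e (N x) y) \<in> borel_measurable (borel \<Otimes>\<^sub>M lborel)"
    unfolding field_def by measurable
  then have "(\<lambda>x. LINT y|lborel. indicator K y *\<^sub>R field e (N x) y) \<in> borel_measurable borel"
    by (rule lborel.borel_measurable_lebesgue_integral)
  then show "(\<lambda>x. avg_field e (N x)) \<in> borel_measurable borel" unfolding avg_field_def by measurable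
  have "(\<lambda>(x, y). indicator K y *\<^sub>R peak e (N x) y) \<in> borel_measurable (borel \<Otimes>\<^sub>M lborel)"
    unfolding peak_def by measurable
  then have "(\<lambda>x. LINT y|lborel. indicator K y *\<^sub>R peak e (N x) y) \<in> borel_measurable borel"
    by (rule lborel.borel_measurable_lebesgue_integral)
  then show "(\<lambda>x. avg_peak e (N x)) \<in> borel_measurable borel" unfolding avg_peak_def by measurable
qed


text \<open>The identity for one direction, integrated over \<open>K\<close> and divided by
  \<open>M\<close>. For fixed \<open>e\<close> the integrand is dominated on \<open>K\<close> by a
  function \<open>G\<close> of x alone, which justifies exchanging the integral over the disc with
  that over \<open>K\<close>.\<close>

lemma averaged_identity:
  assumes w: "weak_diff N V1 V2" and N1: "\<And>x. norm (N x) \<le> 1" and NS: "AE x in lborel. norm x < 1 \<longrightarrow> norm (N x) = 1"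
    and e: "e > 0" and \<zeta>: "\<zeta> \<in> test_functions"
  shows "(LINT x|lborel. partial_deriv 1 \<zeta> x * (avg_field e (N x) \<bullet> V2 x) - partial_deriv 2 \<zeta> x * (avg_field e (N x) \<bullet> V1 x)
      - \<zeta> x * ((1 - avg_peak e (N x)) * (N x \<bullet> cross3 (V1 x) (V2 x)))) = 0"
proof -
  note W = weak_diffD[OF w]
  note [measurable] = W(1,2,3)
  have [measurable]: "indicator K \<in> borel_measurable (borel :: (real^3) measure)" using K_borel by simp
  obtain r B where r: "0 < r" "r < 1" and t: "has_partials \<zeta> (partial_deriv 1 \<zeta>) (partial_deriv 2 \<zeta>)"
    and zc: "continuous_on UNIV \<zeta>" and tc: "continuous_on UNIV (partial_deriv 1 \<zeta>)" "continuous_on UNIV (partial_deriv 2 \<zeta>)"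
    and tz: "\<And>x. norm x \<ge> r \<Longrightarrow> \<zeta> x = 0" "\<And>x. norm x \<ge> r \<Longrightarrow> partial_deriv 1 \<zeta> x = 0" "\<And>x. norm x \<ge> r \<Longrightarrow> partial_deriv 2 \<zeta> x = 0"
    and B: "B > 0" "\<And>x. \<bar>\<zeta> x\<bar> \<le> B" "\<And>x. \<bar>partial_deriv 1 \<zeta> x\<bar> \<le> B" "\<And>x. \<bar>partial_deriv 2 \<zeta> x\<bar> \<le> B"
    by (rule test_function_bounds[OF \<zeta>]) blast
  note [measurable] = borel_measurable_continuous_onI[OF zc] borel_measurable_continuous_onI[OF tc(1)] borel_measurable_continuous_onI[OF tc(2)]
  let ?z1 = "partial_deriv 1 \<zeta>" and ?z2 = "partial_deriv 2 \<zeta>"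
  let ?\<Phi> = "\<lambda>x. N x \<bullet> cross3 (V1 x) (V2 x)"
  define F where "F x y = ?z1 x * (field e (N x) y \<bullet> V2 x) - ?z2 x * (field e (N x) y \<bullet> V1 x) - \<zeta> x * ((1 - peak e (N x) y) * ?\<Phi> x)" for x y
  have Fm: "(\<lambda>(x, y). F x y) \<in> borel_measurable (lborel \<Otimes>\<^sub>M lborel)"
    unfolding F_def field_def peak_def by measurable
  have F0: "(LINT x|lborel. F x y) = 0" if y: "y \<in> K" for y
    using smoothed_area_form_exact[OF w N1 NS unit_direction[OF y] e \<zeta>]
    by (simp add: F_def field_def peak_def mult.commute)
  define P where "P = (2 * e + e\<^sup>2) / e\<^sup>2"
  have P: "P \<ge> 0" using e by (simp add: P_def)
  define G where "G x = B * (1 / e * norm (V2 x)) + B * (1 / e * norm (V1 x)) + B * ((1 + P) * ((norm (V1 x))\<^sup>2 + (norm (V2 x))\<^sup>2))" for x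
  have Gi: "integrable lborel G" unfolding G_def[abs_def] using W(5,6,13,14) by auto
  have G0: "G x \<ge> 0" for x unfolding G_def using B(1) e P by (intro add_nonneg_nonneg mult_nonneg_nonneg) auto
  have \<Phi>le: "\<bar>?\<Phi> x\<bar> \<le> (norm (V1 x))\<^sup>2 + (norm (V2 x))\<^sup>2" for x
    by (rule order_trans[OF abs_inner_le[OF N1] norm_cross_le_squares])
  have FG: "\<bar>F x y\<bar> \<le> G x" if y: "y \<in> K" for x y
  proof -
    have fl: "\<bar>field e (N x) y \<bullet> v\<bar> \<le> 1 / e * norm v" for v
      using Cauchy_Schwarz_ineq2[of "field e (N x) y" v] mult_right_mono[OF norm_field_le[OF N1[of x] e y] norm_ge_zero[of v]] by linarith
    have "\<bar>?z1 x * (field e (N x) y \<bullet> V2 x)\<bar> \<le> B * (1 / e * norm (V2 x))"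
      unfolding abs_mult using B(1) B(3)[of x] fl by (intro mult_mono) auto
    moreover have "\<bar>?z2 x * (field e (N x) y \<bullet> V1 x)\<bar> \<le> B * (1 / e * norm (V1 x))"
      unfolding abs_mult using B(1) B(4)[of x] fl by (intro mult_mono) auto
    moreover have "\<bar>\<zeta> x * ((1 - peak e (N x) y) * ?\<Phi> x)\<bar> \<le> B * ((1 + P) * ((norm (V1 x))\<^sup>2 + (norm (V2 x))\<^sup>2))"
    proof -
      have "\<bar>1 - peak e (N x) y\<bar> \<le> 1 + P" using peak_bounds[OF N1[of x] e y] by (simp add: P_def)
      then show ?thesis unfolding abs_mult using B(1) B(2)[of x] P \<Phi>le[of x] by (intro mult_mono) auto
    qed
    ultimately show ?thesis unfolding F_def G_def by linarith
  qed
  have int: "integrable (lborel \<Otimes>\<^sub>M lborel) (\<lambda>(x, y). indicator K y *\<^sub>R F x y)"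
  proof (rule integrableI_bounded)
    show "(\<lambda>(x, y). indicator K y *\<^sub>R F x y) \<in> borel_measurable (lborel \<Otimes>\<^sub>M lborel)"
      unfolding F_def field_def peak_def by measurable
    have Gm [measurable]: "G \<in> borel_measurable borel" unfolding G_def[abs_def] by measurable
    have "(\<integral>\<^sup>+z. ennreal (norm (case z of (x, y) \<Rightarrow> indicator K y *\<^sub>R F x y)) \<partial>(lborel \<Otimes>\<^sub>M lborel))
      \<le> (\<integral>\<^sup>+z. (case z of (x, y) \<Rightarrow> ennreal (G x) * indicator K y) \<partial>(lborel \<Otimes>\<^sub>M lborel))"
      using ennreal_leI[OF FG] by (intro nn_integral_mono) (auto split: split_indicator)
    also have "\<dots> = (\<integral>\<^sup>+x. (\<integral>\<^sup>+y. ennreal (G x) * indicator K y \<partial>lborel) \<partial>lborel)"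
    proof -
      have "indicator K \<in> borel_measurable (lborel :: (real^3) measure)" using K_borel by (intro borel_measurable_indicator) simp
      then show ?thesis by (subst lborel.nn_integral_fst[symmetric]) auto
    qed
    also have "\<dots> = (\<integral>\<^sup>+x. ennreal (G x) * emeasure lborel K \<partial>lborel)"
      using K_borel by (intro nn_integral_cong nn_integral_cmult_indicator) simp
    also have "\<dots> = (\<integral>\<^sup>+x. ennreal (G x) \<partial>lborel) * emeasure lborel K" by (rule nn_integral_multc) measurable
    also have "\<dots> = ennreal (integral\<^sup>L lborel G) * emeasure lborel K" using Gi G0 by (subst nn_integral_eq_integral) auto
    also have "\<dots> < \<infinity>" using K_finite by (simp add: ennreal_mult_less_top)
    finally show "(\<integral>\<^sup>+z. ennreal (norm (case z of (x, y) \<Rightarrow> indicator K y *\<^sub>R F x y)) \<partial>(lborel \<Otimes>\<^sub>M lborel)) < \<infinity>" .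
  qed
  have inner: "(LINT y|lborel. indicator K y *\<^sub>R F x y) = M * (?z1 x * (avg_field e (N x) \<bullet> V2 x) - ?z2 x * (avg_field e (N x) \<bullet> V1 x)
      - \<zeta> x * ((1 - avg_peak e (N x)) * ?\<Phi> x))" for x
  proof -
    note fi = field_integrable[OF N1[of x] e] and pi = peak_integrable[OF N1[of x] e]
    have ik: "integrable lborel (\<lambda>y. indicator K y :: real)" using K_borel K_finite by (intro integrable_real_indicator) auto
    have fV: "integrable lborel (\<lambda>y. (indicator K y *\<^sub>R field e (N x) y) \<bullet> V)" for V using fi by (rule integrable_inner_left)
    have fV': "(LINT y|lborel. (indicator K y *\<^sub>R field e (N x) y) \<bullet> V) = M * (avg_field e (N x) \<bullet> V)" for V
    proof -
      have "(LINT y|lborel. (indicator K y *\<^sub>R field e (N x) y) \<bullet> V) = (LINT y|lborel. indicator K y *\<^sub>R field e (N x) y) \<bullet> V"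
        using fi by (rule integral_inner_left)
      then show ?thesis using M(2) by (simp add: avg_field_def)
    qed
    have p': "(LINT y|lborel. indicator K y *\<^sub>R peak e (N x) y) = M * avg_peak e (N x)" using M(2) by (simp add: avg_peak_def)
    have k': "(LINT y|lborel. indicator K y) = M" using K_borel K_finite M(1) by simp
    have eq: "indicator K y *\<^sub>R F x y = ?z1 x * ((indicator K y *\<^sub>R field e (N x) y) \<bullet> V2 x) - ?z2 x * ((indicator K y *\<^sub>R field e (N x) y) \<bullet> V1 x)
        - \<zeta> x * ?\<Phi> x * (indicator K y - indicator K y *\<^sub>R peak e (N x) y)" for y
      by (simp add: F_def algebra_simps)
    have "(LINT y|lborel. indicator K y *\<^sub>R F x y) = ?z1 x * (M * (avg_field e (N x) \<bullet> V2 x)) - ?z2 x * (M * (avg_field e (N x) \<bullet> V1 x))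
        - \<zeta> x * ?\<Phi> x * (M - M * avg_peak e (N x))"
    proof -
      have gen: "(LINT y|lborel. c1 * f y - c2 * g y - c3 * (h y - k y)) = c1 * f' - c2 * g' - c3 * (h' - k')"
        if "integrable lborel f" "integrable lborel g" "integrable lborel h" "integrable lborel k"
          "integral\<^sup>L lborel f = f'" "integral\<^sup>L lborel g = g'" "integral\<^sup>L lborel h = h'" "integral\<^sup>L lborel k = k'"
        for c1 c2 c3 f' g' h' k' :: real and f g h k :: "real^3 \<Rightarrow> real"
        using that by simp
      show ?thesis unfolding eq by (rule gen[OF fV fV ik pi fV' fV' k' p'])
    qed
    then show ?thesis by (simp add: algebra_simps)
  qed
  have "(LINT x|lborel. (LINT y|lborel. indicator K y *\<^sub>R F x y)) = (LINT y|lborel. (LINT x|lborel. indicator K y *\<^sub>R F x y))"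
    by (rule lborel_pair.Fubini_integral[OF int, symmetric])
  also have "\<dots> = (LINT y|(lborel :: (real^3) measure). 0)"
    using F0 by (intro Bochner_Integration.integral_cong) (auto split: split_indicator)
  finally have "(LINT x|lborel. (LINT y|lborel. indicator K y *\<^sub>R F x y)) = 0" by simp
  then show ?thesis unfolding inner using M(2) by simp
qed

end

text \<open>The averaged identity in the limit e -> 0. Along n the averaged peak tends to 0 almost
  everywhere and boundedly, while the averaged fields converge to \<open>A\<close>.\<close>

lemma area_form_primitive:
  assumes w: "weak_diff N V1 V2" and N1: "\<And>x. norm (N x) \<le> 1" and NS: "AE x in lborel. norm x < 1 \<longrightarrow> norm (N x) = 1"
    and \<delta>: "\<delta> > 0" and area: "(LINT x|lborel. norm (cross3 (V1 x) (V2 x))) \<le> 4 * pi - \<delta>"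
  obtains A :: "real^2 \<Rightarrow> real^3" where "A \<in> borel_measurable borel" "AE x in lborel. norm x < 1 \<longrightarrow> norm (A x) \<le> 8 * pi / \<delta>"
    "\<And>\<zeta>. \<zeta> \<in> test_functions \<Longrightarrow> (LINT x|lborel. partial_deriv 1 \<zeta> x * (A x \<bullet> V2 x) - partial_deriv 2 \<zeta> x * (A x \<bullet> V1 x)
      - \<zeta> x * (N x \<bullet> cross3 (V1 x) (V2 x))) = 0"
proof -
  note W = weak_diffD[OF w]
  note [measurable] = W(1,2,3)
  \<comment> \<open>The volume given up for compactness, positive since pi < 4. Of the omitted
    volume \<delta>/3 at least pi \<delta>/12 remains.\<close>
  have slack: "(1 - pi / 4) * \<delta> / 3 > 0" using \<delta> pi_less_4 by simp
  obtain K where K: "compact K" "K \<subseteq> ball 0 1" "0 \<notin> K" and mK: "measure lebesgue K \<ge> (4 * pi - (4 * pi - \<delta>)) / 3 - (1 - pi / 4) * \<delta> / 3"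
    and Kx: "AE x in lborel. norm x < 1 \<longrightarrow> (\<forall>y\<in>K. y \<noteq> norm y *\<^sub>R N x)"
    by (rule omitted_compact_set[OF w N1 area slack])
  define M where "M = measure lborel K"
  have M12: "M \<ge> pi * \<delta> / 12" using mK K(1) by (simp add: M_def measure_completion borel_compact field_simps)
  have M0: "M > 0" by (rule less_le_trans[OF _ M12]) (use \<delta> in simp)
  interpret averaging K M by unfold_locales (use K M0 M_def in auto)
  \<comment> \<open>\<open>lim\<close> gives a Borel function on the whole plane; its value is
    meaningful only where the averages converge, which is almost everywhere on the disc.\<close>
  define A where "A x = lim (\<lambda>n. avg_field (1 / real (Suc n)) (N x))" for x
  have Am: "A \<in> borel_measurable borel" unfolding A_def[abs_def] by (rule borel_measurable_lim_metric) measurable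
  note [measurable] = Am
  have ep: "1 / real (Suc n) > 0" for n by simp
  \<comment> \<open>Equality holds for M = pi \<delta>/12, which is how the slack was chosen: this
    is the constant 8 pi/\<delta> of the theorem.\<close>
  have bound: "2 * pi\<^sup>2 / (3 * M) \<le> 8 * pi / \<delta>"
  proof -
    have "2 * pi\<^sup>2 * \<delta> = 24 * pi * (pi * \<delta> / 12)" by (simp add: power2_eq_square)
    also have "\<dots> \<le> 24 * pi * M" using M12 by (intro mult_left_mono) auto
    finally show ?thesis using M0 \<delta> by (simp add: field_simps)
  qed
  have good: "AE x in lborel. norm x < 1 \<longrightarrow> (\<lambda>n. avg_field (1 / real (Suc n)) (N x)) \<longlonglongrightarrow> A x
      \<and> (\<lambda>n. avg_peak (1 / real (Suc n)) (N x)) \<longlonglongrightarrow> 0 \<and> (\<forall>n. norm (avg_field (1 / real (Suc n)) (N x)) \<le> 8 * pi / \<delta>)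
      \<and> (\<forall>n. 0 \<le> avg_peak (1 / real (Suc n)) (N x) \<and> avg_peak (1 / real (Suc n)) (N x) \<le> 4 * pi / (3 * M))"
    using NS Kx
  proof eventually_elim
    case (elim x)
    show ?case
    proof
      assume x: "norm x < 1"
      then have n: "norm (N x) = 1" and k: "\<And>y. y \<in> K \<Longrightarrow> y \<noteq> norm y *\<^sub>R N x" using elim by blast+
      have "(\<lambda>n. avg_field (1 / real (Suc n)) (N x)) \<longlonglongrightarrow> A x"
        unfolding A_def using averages_tendsto(1)[OF n k] by (simp add: convergent_LIMSEQ_iff)
      then show "(\<lambda>n. avg_field (1 / real (Suc n)) (N x)) \<longlonglongrightarrow> A x
      \<and> (\<lambda>n. avg_peak (1 / real (Suc n)) (N x)) \<longlonglongrightarrow> 0 \<and> (\<forall>n. norm (avg_field (1 / real (Suc n)) (N x)) \<le> 8 * pi / \<delta>)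
      \<and> (\<forall>n. 0 \<le> avg_peak (1 / real (Suc n)) (N x) \<and> avg_peak (1 / real (Suc n)) (N x) \<le> 4 * pi / (3 * M))"
        using averages_tendsto(2)[OF n k] order_trans[OF norm_avg_field_le[OF n ep] bound] avg_peak_bounds[OF n ep] by blast
    qed
  qed
  have Ab: "AE x in lborel. norm x < 1 \<longrightarrow> norm (A x) \<le> 8 * pi / \<delta>"
    using good
  proof eventually_elim
    case (elim x)
    show ?case
    proof
      assume "norm x < 1"
      then have l: "(\<lambda>n. avg_field (1 / real (Suc n)) (N x)) \<longlonglongrightarrow> A x" and b: "\<And>n. norm (avg_field (1 / real (Suc n)) (N x)) \<le> 8 * pi / \<delta>"
        using elim by blast+
      show "norm (A x) \<le> 8 * pi / \<delta>" by (rule Lim_bounded[OF tendsto_norm[OF l], of 0]) (use b in blast)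
    qed
  qed
  have "(LINT x|lborel. partial_deriv 1 \<zeta> x * (A x \<bullet> V2 x) - partial_deriv 2 \<zeta> x * (A x \<bullet> V1 x)
      - \<zeta> x * (N x \<bullet> cross3 (V1 x) (V2 x))) = 0" if \<zeta>: "\<zeta> \<in> test_functions" for \<zeta>
  proof -
    obtain r B where r: "0 < r" "r < 1" and t: "has_partials \<zeta> (partial_deriv 1 \<zeta>) (partial_deriv 2 \<zeta>)"
      and zc: "continuous_on UNIV \<zeta>" and tc: "continuous_on UNIV (partial_deriv 1 \<zeta>)" "continuous_on UNIV (partial_deriv 2 \<zeta>)"
      and tz: "\<And>x. norm x \<ge> r \<Longrightarrow> \<zeta> x = 0" "\<And>x. norm x \<ge> r \<Longrightarrow> partial_deriv 1 \<zeta> x = 0" "\<And>x. norm x \<ge> r \<Longrightarrow> partial_deriv 2 \<zeta> x = 0"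
      and B: "B > 0" "\<And>x. \<bar>\<zeta> x\<bar> \<le> B" "\<And>x. \<bar>partial_deriv 1 \<zeta> x\<bar> \<le> B" "\<And>x. \<bar>partial_deriv 2 \<zeta> x\<bar> \<le> B"
      by (rule test_function_bounds[OF \<zeta>]) blast
    note [measurable] = borel_measurable_continuous_onI[OF zc] borel_measurable_continuous_onI[OF tc(1)] borel_measurable_continuous_onI[OF tc(2)]
    let ?z1 = "partial_deriv 1 \<zeta>" and ?z2 = "partial_deriv 2 \<zeta>"
    let ?\<Phi> = "\<lambda>x. N x \<bullet> cross3 (V1 x) (V2 x)"
    define C where "C = 8 * pi / \<delta>"
    define P where "P = 4 * pi / (3 * M)"
    have C: "C \<ge> 0" and P: "P \<ge> 0" using \<delta> M0 by (auto simp: C_def P_def)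
    \<comment> \<open>Unlike the majorant used for fixed \<open>e\<close>, this one rests on the
      bounds for the averages, which do not depend on \<open>e\<close>.\<close>
    define G where "G x = B * (C * norm (V2 x)) + B * (C * norm (V1 x)) + B * ((1 + P) * ((norm (V1 x))\<^sup>2 + (norm (V2 x))\<^sup>2))" for x
    have Gi: "integrable lborel G" unfolding G_def[abs_def] using W(5,6,13,14) by auto
    have G0: "G x \<ge> 0" for x unfolding G_def using B(1) C P by (intro add_nonneg_nonneg mult_nonneg_nonneg) auto
    have \<Phi>le: "\<bar>?\<Phi> x\<bar> \<le> (norm (V1 x))\<^sup>2 + (norm (V2 x))\<^sup>2" for x
      by (rule order_trans[OF abs_inner_le[OF N1] norm_cross_le_squares])
    define F where "F n x = ?z1 x * (avg_field (1 / real (Suc n)) (N x) \<bullet> V2 x) - ?z2 x * (avg_field (1 / real (Suc n)) (N x) \<bullet> V1 x)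
      - \<zeta> x * ((1 - avg_peak (1 / real (Suc n)) (N x)) * ?\<Phi> x)" for n x
    have F0: "(LINT x|lborel. F n x) = 0" for n unfolding F_def by (rule averaged_identity[OF w N1 NS ep \<zeta>])
    have "(\<lambda>n. LINT x|lborel. F n x) \<longlonglongrightarrow> (LINT x|lborel. ?z1 x * (A x \<bullet> V2 x) - ?z2 x * (A x \<bullet> V1 x) - \<zeta> x * ?\<Phi> x)"
    proof (rule integral_dominated_convergence[OF _ _ Gi])
      show "(\<lambda>x. ?z1 x * (A x \<bullet> V2 x) - ?z2 x * (A x \<bullet> V1 x) - \<zeta> x * ?\<Phi> x) \<in> borel_measurable lborel" by measurable
      show "F n \<in> borel_measurable lborel" for n unfolding F_def by measurable
      show "AE x in lborel. (\<lambda>n. F n x) \<longlonglongrightarrow> ?z1 x * (A x \<bullet> V2 x) - ?z2 x * (A x \<bullet> V1 x) - \<zeta> x * ?\<Phi> x"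
        using good
      proof eventually_elim
        case (elim x)
        show ?case
        proof (cases "norm x < 1")
          case True
          then have l: "(\<lambda>n. avg_field (1 / real (Suc n)) (N x)) \<longlonglongrightarrow> A x" "(\<lambda>n. avg_peak (1 / real (Suc n)) (N x)) \<longlonglongrightarrow> 0" using elim by blast+
          have "(\<lambda>n. F n x) \<longlonglongrightarrow> ?z1 x * (A x \<bullet> V2 x) - ?z2 x * (A x \<bullet> V1 x) - \<zeta> x * ((1 - 0) * ?\<Phi> x)"
            unfolding F_def by (intro tendsto_intros l)
          then show ?thesis by simp
        next
          case False
          then show ?thesis using tz[of x] r by (simp add: F_def)
        qed
      qed
      show "AE x in lborel. norm (F n x) \<le> G x" for n
        using good
      proof eventually_elim
        case (elim x)
        show ?case
        proof (cases "norm x < 1")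
          case True
          let ?a = "avg_field (1 / real (Suc n)) (N x)" and ?p = "avg_peak (1 / real (Suc n)) (N x)"
          have a: "norm ?a \<le> C" and p: "0 \<le> ?p" "?p \<le> P" using elim True unfolding C_def P_def by blast+
          have fl: "\<bar>?a \<bullet> v\<bar> \<le> C * norm v" for v
            using Cauchy_Schwarz_ineq2[of ?a v] mult_right_mono[OF a norm_ge_zero[of v]] by linarith
          have "\<bar>?z1 x * (?a \<bullet> V2 x)\<bar> \<le> B * (C * norm (V2 x))"
            unfolding abs_mult using B(1) B(3)[of x] fl by (intro mult_mono) auto
          moreover have "\<bar>?z2 x * (?a \<bullet> V1 x)\<bar> \<le> B * (C * norm (V1 x))"
            unfolding abs_mult using B(1) B(4)[of x] fl by (intro mult_mono) auto
          moreover have "\<bar>\<zeta> x * ((1 - ?p) * ?\<Phi> x)\<bar> \<le> B * ((1 + P) * ((norm (V1 x))\<^sup>2 + (norm (V2 x))\<^sup>2))"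
          proof -
            have "\<bar>1 - ?p\<bar> \<le> 1 + P" using p by simp
            then show ?thesis unfolding abs_mult using B(1) B(2)[of x] P \<Phi>le[of x] by (intro mult_mono) auto
          qed
          ultimately have "\<bar>F n x\<bar> \<le> G x" unfolding F_def G_def by linarith
          then show ?thesis by simp
        next
          case False
          then show ?thesis using tz[of x] r G0[of x] by (simp add: F_def)
        qed
      qed
    qed
    then show ?thesis using F0 by (simp add: LIMSEQ_const_iff)
  qed
  then show ?thesis using that[OF Am Ab] by blast
qed

section \<open>Weak derivatives on the disc and the dual norm\<close>

lemma disc_lmeasurable: "(cball 0 1 :: (real^2) set) \<in> lmeasurable"
  by simp

text \<open>The circle is a null set, and completing the measure does not change what holds almost
  everywhere.\<close>

lemma AE_disc_iff:
  "(AE x in disc_measure. P x) \<longleftrightarrow> (AE x in lborel. norm x < 1 \<longrightarrow> P x)"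
proof -
  have "(AE x in disc_measure. P x) \<longleftrightarrow> (AE x in lebesgue. x \<in> unit_disc \<longrightarrow> P x)"
    by (rule AE_restrict_space_iff) simp
  also have "\<dots> \<longleftrightarrow> (AE x in lborel. x \<in> unit_disc \<longrightarrow> P x)" by (simp add: AE_completion_iff)
  also have "\<dots> \<longleftrightarrow> (AE x in lborel. norm x < 1 \<longrightarrow> P x)"
  proof -
    have "AE x in lebesgue. x \<notin> sphere (0::real^2) 1"
      by (rule AE_not_in) (use negligible_sphere[of "0::real^2" 1] in \<open>simp add: negligible_iff_null_sets\<close>)
    then have "AE x in lborel. x \<notin> sphere (0::real^2) 1" by (simp add: AE_completion_iff)
    then have "AE x in lborel. (x \<in> unit_disc \<longrightarrow> P x) \<longleftrightarrow> (norm x < 1 \<longrightarrow> P x)" by eventually_elim auto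
    then show ?thesis by (rule eventually_subst)
  qed
  finally show ?thesis .
qed

lemma disc_integral_eq:
  fixes h :: "real^2 \<Rightarrow> 'b::euclidean_space"
  assumes h: "h \<in> borel_measurable borel" "\<And>x. norm x \<ge> 1 \<Longrightarrow> h x = 0"
  shows "(LINT x|disc_measure. h x) = (LINT x|lborel. h x)" "integrable disc_measure h \<longleftrightarrow> integrable lborel h"
proof -
  have eq: "(\<lambda>x. indicator unit_disc x *\<^sub>R h x) = h"
    using h(2) by (auto simp: fun_eq_iff indicator_def)
  have hl: "h \<in> borel_measurable lborel" using h(1) by simp
  have "(LINT x|disc_measure. h x) = (LINT x|lebesgue. indicator unit_disc x *\<^sub>R h x)" by (rule integral_restrict_space) simp
  then show "(LINT x|disc_measure. h x) = (LINT x|lborel. h x)" unfolding eq using integral_completion[OF hl] by simp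
  have "integrable disc_measure h \<longleftrightarrow> integrable lebesgue (\<lambda>x. indicator unit_disc x *\<^sub>R h x)" by (rule integrable_restrict_space) simp
  then show "integrable disc_measure h \<longleftrightarrow> integrable lborel h" unfolding eq using integrable_completion[OF hl] by simp
qed

lemma borel_disc_measurable:
  assumes "h \<in> borel_measurable borel" shows "h \<in> borel_measurable disc_measure"
  using assms by (simp add: measurable_completion measurable_restrict_space1)

text \<open>Each coordinate of a Lebesgue measurable function agrees with a Borel function off a
  null set. Multiplying by the indicator of the open disc also fixes the value 0 on the
  circle.\<close>

lemma borel_version:
  fixes f :: "real^2 \<Rightarrow> 'b::euclidean_space"
  assumes f: "f \<in> borel_measurable disc_measure"
  obtains g where "g \<in> borel_measurable borel" "\<And>x. norm x \<ge> 1 \<Longrightarrow> g x = 0" "AE x in disc_measure. g x = f x"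
proof -
  have fm: "(\<lambda>x. indicator unit_disc x *\<^sub>R f x) \<in> borel_measurable lebesgue"
    using f by (subst (asm) borel_measurable_restrict_space_iff) auto
  have ex: "\<exists>g'. g' \<in> borel_measurable lborel \<and> (AE x in lborel. (indicator unit_disc x *\<^sub>R f x) \<bullet> b = g' x)" for b
  proof -
    have "(\<lambda>x. (indicator unit_disc x *\<^sub>R f x) \<bullet> b) \<in> borel_measurable (completion lborel)" using fm by (intro borel_measurable_inner) auto
    from completion_ex_borel_measurable_real[OF this] show ?thesis by blast
  qed
  have "\<exists>G. \<forall>b. G b \<in> borel_measurable lborel \<and> (AE x in lborel. (indicator unit_disc x *\<^sub>R f x) \<bullet> b = G b x)"
    by (intro choice allI ex)
  then obtain G where G: "\<And>b. G b \<in> borel_measurable lborel" "\<And>b. AE x in lborel. (indicator unit_disc x *\<^sub>R f x) \<bullet> b = G b x" by blast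
  define g where "g x = indicator (ball 0 1) x *\<^sub>R (\<Sum>b\<in>Basis. G b x *\<^sub>R b)" for x
  have "g \<in> borel_measurable borel"
    unfolding g_def[abs_def] using G(1)
    by (intro borel_measurable_scaleR borel_measurable_indicator borel_measurable_sum) auto
  moreover have "g x = 0" if "norm x \<ge> 1" for x using that by (simp add: g_def)
  moreover have "AE x in disc_measure. g x = f x"
  proof -
    have "AE x in lborel. \<forall>b\<in>Basis. (indicator unit_disc x *\<^sub>R f x) \<bullet> b = G b x" using G(2) by (subst AE_finite_all) auto
    then have "AE x in lborel. norm x < 1 \<longrightarrow> g x = f x"
    proof eventually_elim
      case (elim x)
      show ?case
      proof
        assume x: "norm x < 1"
        have "g x = (\<Sum>b\<in>Basis. G b x *\<^sub>R b)" using x by (simp add: g_def)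
        also have "\<dots> = (\<Sum>b\<in>Basis. (f x \<bullet> b) *\<^sub>R b)"
          using elim x by (intro sum.cong) auto
        finally show "g x = f x" by (simp add: euclidean_representation)
      qed
    qed
    then show ?thesis by (simp add: AE_disc_iff)
  qed
  ultimately show ?thesis by (rule that)
qed

section \<open>Square integrable functions on the disc\<close>

lemma L2_discD:
  assumes "f \<in> L2_disc"
  shows "f \<in> borel_measurable disc_measure" "integrable disc_measure (\<lambda>x. (norm (f x))\<^sup>2)"
  using assms by (auto simp: L2_disc_def)

lemma L2_disc_integrable:
  fixes f :: "real^2 \<Rightarrow> 'b::euclidean_space"
  assumes f: "f \<in> L2_disc"
  shows "integrable disc_measure f"
proof (rule Bochner_Integration.integrable_bound)
  interpret finite_measure disc_measure by (rule finite_measure_lebesgue_on[OF disc_lmeasurable])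
  show "integrable disc_measure (\<lambda>x. 1 + (norm (f x))\<^sup>2)" using L2_discD(2)[OF f] by (intro Bochner_Integration.integrable_add) auto
  show "AE x in disc_measure. norm (f x) \<le> norm (1 + (norm (f x))\<^sup>2)"
  proof (rule AE_I2)
    fix x
    have "norm (f x) \<le> 1 + (norm (f x))\<^sup>2"
      using zero_le_power2[of "norm (f x) - 1 / 2"] by (simp add: power2_eq_square algebra_simps)
    then show "norm (f x) \<le> norm (1 + (norm (f x))\<^sup>2)" by simp
  qed
qed (rule L2_discD[OF f])

lemma L2_disc_combination:
  fixes f g :: "real^2 \<Rightarrow> 'b::euclidean_space"
  assumes f: "f \<in> L2_disc" and g: "g \<in> L2_disc"
  shows "(\<lambda>x. a *\<^sub>R f x + b *\<^sub>R g x) \<in> L2_disc"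
proof -
  have m: "(\<lambda>x. a *\<^sub>R f x + b *\<^sub>R g x) \<in> borel_measurable disc_measure"
    using L2_discD(1)[OF f] L2_discD(1)[OF g] by measurable
  have "integrable disc_measure (\<lambda>x. 2 * a\<^sup>2 * (norm (f x))\<^sup>2 + 2 * b\<^sup>2 * (norm (g x))\<^sup>2)"
    using L2_discD(2)[OF f] L2_discD(2)[OF g] by auto
  then have "integrable disc_measure (\<lambda>x. (norm (a *\<^sub>R f x + b *\<^sub>R g x))\<^sup>2)"
  proof (rule Bochner_Integration.integrable_bound)
    show "AE x in disc_measure. norm ((norm (a *\<^sub>R f x + b *\<^sub>R g x))\<^sup>2) \<le> norm (2 * a\<^sup>2 * (norm (f x))\<^sup>2 + 2 * b\<^sup>2 * (norm (g x))\<^sup>2)"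
    proof (rule AE_I2)
      fix x
      show "norm ((norm (a *\<^sub>R f x + b *\<^sub>R g x))\<^sup>2) \<le> norm (2 * a\<^sup>2 * (norm (f x))\<^sup>2 + 2 * b\<^sup>2 * (norm (g x))\<^sup>2)"
        using norm_add_square_le[of "a *\<^sub>R f x" "b *\<^sub>R g x"] by (simp add: power_mult_distrib)
    qed
  qed (use m in measurable)
  then show ?thesis using m by (simp add: L2_disc_def)
qed

lemma L2_disc_inner_integrable:
  fixes f g :: "real^2 \<Rightarrow> real"
  assumes f: "f \<in> L2_disc" and g: "g \<in> L2_disc"
  shows "integrable disc_measure (\<lambda>x. f x * g x)"
proof -
  have "integrable disc_measure (\<lambda>x. (norm (f x))\<^sup>2 + (norm (g x))\<^sup>2)"
    using L2_discD(2)[OF f] L2_discD(2)[OF g] by auto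
  then show ?thesis
  proof (rule Bochner_Integration.integrable_bound)
    show "AE x in disc_measure. norm (f x * g x) \<le> norm ((norm (f x))\<^sup>2 + (norm (g x))\<^sup>2)"
    proof (rule AE_I2)
      fix x
      have "2 * (\<bar>f x\<bar> * \<bar>g x\<bar>) \<le> (f x)\<^sup>2 + (g x)\<^sup>2"
        using zero_le_power2[of "\<bar>f x\<bar> - \<bar>g x\<bar>"] by (simp add: power2_eq_square algebra_simps)
      moreover have "0 \<le> \<bar>f x\<bar> * \<bar>g x\<bar>" by simp
      ultimately have "\<bar>f x\<bar> * \<bar>g x\<bar> \<le> (f x)\<^sup>2 + (g x)\<^sup>2" by linarith
      then show "norm (f x * g x) \<le> norm ((norm (f x))\<^sup>2 + (norm (g x))\<^sup>2)" by (simp add: abs_mult)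
    qed
  qed (use L2_discD(1)[OF f] L2_discD(1)[OF g] in measurable)
qed

text \<open>The quadratic t -> |t f + g|^2 has a non-negative integral for all t, so its
  discriminant is not positive. If f has norm 0 it is affine in t, which forces the mixed term to
  vanish.\<close>

lemma L2_disc_Cauchy_Schwarz:
  fixes f g :: "real^2 \<Rightarrow> real"
  assumes f: "f \<in> L2_disc" and g: "g \<in> L2_disc"
  shows "\<bar>LINT x|disc_measure. f x * g x\<bar> \<le> L2_disc_norm f * L2_disc_norm g"
proof -
  define a b c where "a = (LINT x|disc_measure. (norm (f x))\<^sup>2)" and "b = (LINT x|disc_measure. (norm (g x))\<^sup>2)"
    and "c = (LINT x|disc_measure. f x * g x)"
  have a0: "a \<ge> 0" and b0: "b \<ge> 0" by (auto simp: a_def b_def)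
  have i: "integrable disc_measure (\<lambda>x. (f x)\<^sup>2)" "integrable disc_measure (\<lambda>x. (g x)\<^sup>2)" "integrable disc_measure (\<lambda>x. f x * g x)"
    using L2_discD(2)[OF f] L2_discD(2)[OF g] L2_disc_inner_integrable[OF f g] by simp_all
  have q: "0 \<le> t\<^sup>2 * a + 2 * t * c + b" for t
  proof -
    have "0 \<le> (LINT x|disc_measure. (t * f x + g x)\<^sup>2)" by (intro integral_nonneg_AE) simp
    also have "(LINT x|disc_measure. (t * f x + g x)\<^sup>2) = (LINT x|disc_measure. t\<^sup>2 * (f x)\<^sup>2 + (2 * t) * (f x * g x) + (g x)\<^sup>2)"
      by (intro Bochner_Integration.integral_cong) (simp_all add: power2_eq_square algebra_simps)
    also have "\<dots> = t\<^sup>2 * a + 2 * t * c + b" using i by (simp add: a_def b_def c_def)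
    finally show ?thesis .
  qed
  have "c\<^sup>2 \<le> a * b"
  proof (cases "a = 0")
    case True
    have "c = 0"
    proof (rule ccontr)
      assume "c \<noteq> 0"
      \<comment> \<open>At this \<open>t\<close> the affine function would take the value
        -1.\<close>
      then have "2 * (- (b + 1) / (2 * c)) * c = - (b + 1)" by simp
      then show False using q[of "- (b + 1) / (2 * c)"] True by simp
    qed
    then show ?thesis using a0 b0 by simp
  next
    case False
    then have a: "a > 0" using a0 by simp
    have "0 \<le> (- c / a)\<^sup>2 * a + 2 * (- c / a) * c + b" by (rule q)
    also have "\<dots> = b - c\<^sup>2 / a" using a by (simp add: power2_eq_square field_simps)
    finally show ?thesis using a by (simp add: field_simps)
  qed
  then have "sqrt (c\<^sup>2) \<le> sqrt (a * b)" by (rule real_sqrt_le_mono)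
  then show ?thesis by (simp add: real_sqrt_mult L2_disc_norm_def a_def b_def c_def)
qed

section \<open>Weak derivatives: uniqueness, linearity and the classical case\<close>

lemma test_bounded_integrable:
  fixes f :: "real^2 \<Rightarrow> 'b::euclidean_space"
  assumes h: "continuous_on UNIV h" "\<And>x. norm x \<ge> r \<Longrightarrow> h x = (0::real)" and f: "f \<in> L2_disc"
  shows "integrable disc_measure (\<lambda>x. h x *\<^sub>R f x)"
proof -
  obtain B where B: "B > 0" "\<And>x. norm (h x) \<le> B" using continuous_compact_support_bounded[OF h] by blast
  have hm: "h \<in> borel_measurable disc_measure" by (rule borel_disc_measurable[OF borel_measurable_continuous_onI[OF h(1)]])
  have "integrable disc_measure (\<lambda>x. B * norm (f x))" using L2_disc_integrable[OF f] by auto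
  then show ?thesis
  proof (rule Bochner_Integration.integrable_bound)
    show "AE x in disc_measure. norm (h x *\<^sub>R f x) \<le> norm (B * norm (f x))"
      using B by (intro AE_I2) (simp add: abs_mult mult_right_mono)
  qed (use hm L2_discD(1)[OF f] in measurable)
qed

text \<open>The difference of two weak derivatives pairs to zero with every test function, so the
  fundamental lemma applies to its Borel version.\<close>

lemma weak_partial_unique:
  fixes u :: "real^2 \<Rightarrow> 'b::euclidean_space"
  assumes v: "v \<in> L2_disc" "has_weak_partial i u v" and v': "v' \<in> L2_disc" "has_weak_partial i u v'"
  shows "AE x in disc_measure. v x = v' x"
proof -
  define w where "w x = 1 *\<^sub>R v x + (-1) *\<^sub>R v' x" for x
  have w: "w \<in> L2_disc" unfolding w_def[abs_def] by (rule L2_disc_combination[OF v(1) v'(1)])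
  obtain g where g: "g \<in> borel_measurable borel" "\<And>x. norm x \<ge> 1 \<Longrightarrow> g x = 0" "AE x in disc_measure. g x = w x"
    by (rule borel_version[OF L2_discD(1)[OF w]]) blast
  have gd: "g \<in> borel_measurable disc_measure" by (rule borel_disc_measurable[OF g(1)])
  have "integrable disc_measure (\<lambda>x. (norm (g x))\<^sup>2)"
    using L2_discD(2)[OF w] by (rule integrable_cong_AE_imp) (use gd g(3) in \<open>auto elim: eventually_mono\<close>)
  then have gi: "integrable lborel (\<lambda>x. (norm (g x))\<^sup>2)"
    by (subst (asm) disc_integral_eq(2)) (use g(1,2) in auto)
  have "AE x in lborel. g x = 0"
  proof (rule weak_zero_imp_AE_zero[OF g(1) gi g(2)])
    fix \<zeta> assume \<zeta>: "\<zeta> \<in> test_functions"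
    obtain r where t: "has_partials \<zeta> (partial_deriv 1 \<zeta>) (partial_deriv 2 \<zeta>)" and tz: "\<And>x. norm x \<ge> r \<Longrightarrow> \<zeta> x = 0"
      by (rule test_functionD[OF \<zeta>]) blast
    have zc: "continuous_on UNIV \<zeta>" using t by (rule has_partials_continuous)
    have zd: "\<zeta> \<in> borel_measurable disc_measure" by (rule borel_disc_measurable[OF borel_measurable_continuous_onI[OF zc]])
    have "(LINT x|lborel. \<zeta> x *\<^sub>R g x) = (LINT x|disc_measure. \<zeta> x *\<^sub>R g x)"
      by (rule disc_integral_eq(1)[symmetric]) (use g borel_measurable_continuous_onI[OF zc] in auto)
    also have "\<dots> = (LINT x|disc_measure. \<zeta> x *\<^sub>R w x)"
      by (rule integral_cong_AE) (use g(3) gd zd L2_discD(1)[OF w] in \<open>auto elim: eventually_mono\<close>)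
    also have "\<dots> = (LINT x|disc_measure. \<zeta> x *\<^sub>R v x - \<zeta> x *\<^sub>R v' x)"
      by (intro Bochner_Integration.integral_cong) (simp_all add: w_def algebra_simps)
    also have "\<dots> = (LINT x|disc_measure. \<zeta> x *\<^sub>R v x) - (LINT x|disc_measure. \<zeta> x *\<^sub>R v' x)"
      by (intro Bochner_Integration.integral_diff test_bounded_integrable[OF zc tz] v v')
    also have "\<dots> = 0"
    proof -
      have "(LINT x|disc_measure. partial_deriv i \<zeta> x *\<^sub>R u x) = - (LINT x|disc_measure. \<zeta> x *\<^sub>R v x)"
        "(LINT x|disc_measure. partial_deriv i \<zeta> x *\<^sub>R u x) = - (LINT x|disc_measure. \<zeta> x *\<^sub>R v' x)"
        using v(2) v'(2) \<zeta> unfolding has_weak_partial_def by blast+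
      then show ?thesis by simp
    qed
    finally show "(LINT x|lborel. \<zeta> x *\<^sub>R g x) = 0" .
  qed
  then have "AE x in disc_measure. g x = 0" unfolding AE_disc_iff by eventually_elim simp
  with g(3) show ?thesis
  proof eventually_elim
    case (elim x)
    then show ?case by (simp add: w_def)
  qed
qed

lemma W12_weak_partial:
  assumes "u \<in> W12" shows "weak_partial i u \<in> L2_disc" "has_weak_partial i u (weak_partial i u)"
proof -
  have "\<exists>v. v \<in> L2_disc \<and> has_weak_partial i u v" using assms unfolding W12_def by blast
  from someI_ex[OF this] show "weak_partial i u \<in> L2_disc" "has_weak_partial i u (weak_partial i u)"
    unfolding weak_partial_def by auto
qed

text \<open>Identifies the representative chosen in \<open>weak_partial\<close> with whatever weak
  derivative is at hand.\<close>

lemma weak_partial_AE: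
  assumes "v \<in> L2_disc" "has_weak_partial i u v"
  shows "AE x in disc_measure. weak_partial i u x = v x" "weak_partial i u \<in> L2_disc"
proof -
  have "\<exists>v. v \<in> L2_disc \<and> has_weak_partial i u v" using assms by blast
  from someI_ex[OF this] have w: "weak_partial i u \<in> L2_disc" "has_weak_partial i u (weak_partial i u)"
    unfolding weak_partial_def by auto
  then show "AE x in disc_measure. weak_partial i u x = v x" "weak_partial i u \<in> L2_disc"
    using weak_partial_unique[OF w assms] by auto
qed

lemma W12_L2: "u \<in> W12 \<Longrightarrow> u \<in> L2_disc"
  by (simp add: W12_def)

lemma has_weak_partial_combination:
  fixes u v :: "real^2 \<Rightarrow> 'b::euclidean_space"
  assumes u: "u \<in> W12" and v: "v \<in> W12"
  shows "has_weak_partial i (\<lambda>x. a *\<^sub>R u x + b *\<^sub>R v x) (\<lambda>x. a *\<^sub>R weak_partial i u x + b *\<^sub>R weak_partial i v x)"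
  unfolding has_weak_partial_def
proof
  fix \<phi> assume \<phi>: "\<phi> \<in> test_functions"
  obtain r where t: "has_partials \<phi> (partial_deriv 1 \<phi>) (partial_deriv 2 \<phi>)"
    and tc: "continuous_on UNIV (partial_deriv 1 \<phi>)" "continuous_on UNIV (partial_deriv 2 \<phi>)"
    and tz: "\<And>x. norm x \<ge> r \<Longrightarrow> \<phi> x = 0" "\<And>x. norm x \<ge> r \<Longrightarrow> partial_deriv 1 \<phi> x = 0" "\<And>x. norm x \<ge> r \<Longrightarrow> partial_deriv 2 \<phi> x = 0"
    by (rule test_functionD[OF \<phi>]) blast
  have pc: "continuous_on UNIV (partial_deriv i \<phi>)" "\<And>x. norm x \<ge> r \<Longrightarrow> partial_deriv i \<phi> x = 0"
    using exhaust_2[of i] tc tz by auto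
  have zc: "continuous_on UNIV \<phi>" using t by (rule has_partials_continuous)
  have lin: "(LINT x|disc_measure. h x *\<^sub>R (a *\<^sub>R f x + b *\<^sub>R g x)) = a *\<^sub>R (LINT x|disc_measure. h x *\<^sub>R f x) + b *\<^sub>R (LINT x|disc_measure. h x *\<^sub>R g x)"
    if h: "continuous_on UNIV h" "\<And>x. norm x \<ge> r \<Longrightarrow> h x = 0" and fg: "f \<in> L2_disc" "g \<in> L2_disc" for h and f g :: "real^2 \<Rightarrow> 'b"
  proof -
    have i: "integrable disc_measure (\<lambda>x. h x *\<^sub>R f x)" "integrable disc_measure (\<lambda>x. h x *\<^sub>R g x)"
      by (rule test_bounded_integrable[OF h fg(1)], assumption) (rule test_bounded_integrable[OF h fg(2)], assumption)
    have "(LINT x|disc_measure. h x *\<^sub>R (a *\<^sub>R f x + b *\<^sub>R g x)) = (LINT x|disc_measure. a *\<^sub>R (h x *\<^sub>R f x) + b *\<^sub>R (h x *\<^sub>R g x))"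
      by (intro Bochner_Integration.integral_cong) (simp_all add: algebra_simps)
    then show ?thesis using i by (simp del: scaleR_scaleR)
  qed
  have U: "(LINT x|disc_measure. partial_deriv i \<phi> x *\<^sub>R u x) = - (LINT x|disc_measure. \<phi> x *\<^sub>R weak_partial i u x)"
    "(LINT x|disc_measure. partial_deriv i \<phi> x *\<^sub>R v x) = - (LINT x|disc_measure. \<phi> x *\<^sub>R weak_partial i v x)"
    using W12_weak_partial(2)[OF u] W12_weak_partial(2)[OF v] \<phi> unfolding has_weak_partial_def by blast+
  show "(LINT x|disc_measure. partial_deriv i \<phi> x *\<^sub>R (a *\<^sub>R u x + b *\<^sub>R v x))
     = - (LINT x|disc_measure. \<phi> x *\<^sub>R (a *\<^sub>R weak_partial i u x + b *\<^sub>R weak_partial i v x))"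
  proof -
    have "(LINT x|disc_measure. partial_deriv i \<phi> x *\<^sub>R (a *\<^sub>R u x + b *\<^sub>R v x))
      = a *\<^sub>R (LINT x|disc_measure. partial_deriv i \<phi> x *\<^sub>R u x) + b *\<^sub>R (LINT x|disc_measure. partial_deriv i \<phi> x *\<^sub>R v x)"
      by (rule lin[OF pc(1) _ W12_L2[OF u] W12_L2[OF v]]) (rule pc(2))
    moreover have "(LINT x|disc_measure. \<phi> x *\<^sub>R (a *\<^sub>R weak_partial i u x + b *\<^sub>R weak_partial i v x))
      = a *\<^sub>R (LINT x|disc_measure. \<phi> x *\<^sub>R weak_partial i u x) + b *\<^sub>R (LINT x|disc_measure. \<phi> x *\<^sub>R weak_partial i v x)"
      by (rule lin[OF zc _ W12_weak_partial(1)[OF u] W12_weak_partial(1)[OF v]]) (rule tz(1))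
    ultimately show ?thesis unfolding U by simp
  qed
qed

lemma continuous_support_L2:
  fixes h :: "real^2 \<Rightarrow> 'b::euclidean_space"
  assumes "continuous_on UNIV h" "\<And>x. norm x \<ge> r \<Longrightarrow> h x = 0" "r < 1"
  shows "h \<in> L2_disc"
proof -
  have hb: "h \<in> borel_measurable borel" by (rule borel_measurable_continuous_onI[OF assms(1)])
  have "integrable lborel (\<lambda>x. (norm (h x))\<^sup>2)"
    by (rule integrable_continuous_compact_support[where R=r]) (use assms in \<open>auto intro!: continuous_intros\<close>)
  then have "integrable disc_measure (\<lambda>x. (norm (h x))\<^sup>2)"
    by (subst disc_integral_eq(2)) (use hb assms in auto)
  then show ?thesis using borel_disc_measurable[OF hb] by (simp add: L2_disc_def)
qed

text \<open>Integration by parts: the partial derivative of the product of two test functions has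
  integral zero.\<close>

lemma test_function_weak_partial:
  assumes \<zeta>: "\<zeta> \<in> test_functions"
  shows "\<zeta> \<in> L2_disc" "partial_deriv i \<zeta> \<in> L2_disc" "has_weak_partial i \<zeta> (partial_deriv i \<zeta>)"
proof -
  obtain r where r: "r < 1" and t: "has_partials \<zeta> (partial_deriv 1 \<zeta>) (partial_deriv 2 \<zeta>)"
    and tc: "continuous_on UNIV (partial_deriv 1 \<zeta>)" "continuous_on UNIV (partial_deriv 2 \<zeta>)"
    and tz: "\<And>x. norm x \<ge> r \<Longrightarrow> \<zeta> x = 0" "\<And>x. norm x \<ge> r \<Longrightarrow> partial_deriv 1 \<zeta> x = 0" "\<And>x. norm x \<ge> r \<Longrightarrow> partial_deriv 2 \<zeta> x = 0"
    by (rule test_functionD[OF \<zeta>]) blast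
  have pc: "continuous_on UNIV (partial_deriv i \<zeta>)" "\<And>x. norm x \<ge> r \<Longrightarrow> partial_deriv i \<zeta> x = 0"
    using exhaust_2[of i] tc tz by auto
  have zc: "continuous_on UNIV \<zeta>" using t by (rule has_partials_continuous)
  show "\<zeta> \<in> L2_disc" by (rule continuous_support_L2[OF zc tz(1) r])
  show "partial_deriv i \<zeta> \<in> L2_disc" by (rule continuous_support_L2[OF pc r])
  show "has_weak_partial i \<zeta> (partial_deriv i \<zeta>)"
    unfolding has_weak_partial_def
  proof
    fix \<phi> assume \<phi>: "\<phi> \<in> test_functions"
    obtain s where s: "s < 1" and q: "has_partials \<phi> (partial_deriv 1 \<phi>) (partial_deriv 2 \<phi>)"
      and qc: "continuous_on UNIV (partial_deriv 1 \<phi>)" "continuous_on UNIV (partial_deriv 2 \<phi>)"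
      and qz: "\<And>x. norm x \<ge> s \<Longrightarrow> \<phi> x = 0" "\<And>x. norm x \<ge> s \<Longrightarrow> partial_deriv 1 \<phi> x = 0" "\<And>x. norm x \<ge> s \<Longrightarrow> partial_deriv 2 \<phi> x = 0"
      by (rule test_functionD[OF \<phi>]) blast
    have rc: "continuous_on UNIV (partial_deriv i \<phi>)" "\<And>x. norm x \<ge> s \<Longrightarrow> partial_deriv i \<phi> x = 0"
      using exhaust_2[of i] qc qz by auto
    have yc: "continuous_on UNIV \<phi>" using q by (rule has_partials_continuous)
    have "(LINT x|lborel. \<phi> x * partial_deriv i \<zeta> x + partial_deriv i \<phi> x * \<zeta> x) = 0"
      using exhaust_2[of i]
      by (rule disjE; hypsubst)
        (rule integral_partial_eq_0[OF has_partials_mult[OF q t], where R=r];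
         (simp add: tz; fail | intro continuous_intros zc yc tc qc))+
    moreover have i1: "integrable lborel (\<lambda>x. \<phi> x * partial_deriv i \<zeta> x)" "integrable lborel (\<lambda>x. partial_deriv i \<phi> x * \<zeta> x)"
      by (rule integrable_continuous_compact_support[where R=r], intro continuous_intros yc pc zc rc, simp add: pc(2) tz(1))+
    ultimately have "(LINT x|lborel. partial_deriv i \<phi> x * \<zeta> x) = - (LINT x|lborel. \<phi> x * partial_deriv i \<zeta> x)"
      by simp
    moreover have "(LINT x|disc_measure. partial_deriv i \<phi> x * \<zeta> x) = (LINT x|lborel. partial_deriv i \<phi> x * \<zeta> x)"
      by (rule disc_integral_eq(1)) (use r tz in \<open>auto intro!: borel_measurable_continuous_onI continuous_intros rc zc\<close>)
    moreover have "(LINT x|disc_measure. \<phi> x * partial_deriv i \<zeta> x) = (LINT x|lborel. \<phi> x * partial_deriv i \<zeta> x)"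
      by (rule disc_integral_eq(1)) (use r pc in \<open>auto intro!: borel_measurable_continuous_onI continuous_intros yc\<close>)
    ultimately show "(LINT x|disc_measure. partial_deriv i \<phi> x *\<^sub>R \<zeta> x) = - (LINT x|disc_measure. \<phi> x *\<^sub>R partial_deriv i \<zeta> x)"
      by simp
  qed
qed


section \<open>Norms of weak gradients and the dual norm\<close>

lemma L2_disc_norm_nonneg: "L2_disc_norm f \<ge> 0"
  by (simp add: L2_disc_norm_def)

lemma L2_disc_norm_le:
  assumes g: "g \<in> L2_disc" and fm: "f \<in> borel_measurable disc_measure" and c: "c \<ge> 0"
    and le: "AE x in disc_measure. norm (f x) \<le> c * norm (g x)"
  shows "f \<in> L2_disc" "L2_disc_norm f \<le> c * L2_disc_norm g"
proof -
  have sq: "AE x in disc_measure. (norm (f x))\<^sup>2 \<le> c\<^sup>2 * (norm (g x))\<^sup>2"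
    using le
  proof eventually_elim
    case (elim x)
    then have "(norm (f x))\<^sup>2 \<le> (c * norm (g x))\<^sup>2" by (rule power_mono) simp
    then show ?case by (simp add: power_mult_distrib)
  qed
  have ig: "integrable disc_measure (\<lambda>x. c\<^sup>2 * (norm (g x))\<^sup>2)" using L2_discD(2)[OF g] by simp
  have i: "integrable disc_measure (\<lambda>x. (norm (f x))\<^sup>2)"
    by (rule Bochner_Integration.integrable_bound[OF ig]) (use sq fm in auto)
  then show "f \<in> L2_disc" using fm by (simp add: L2_disc_def)
  have "(LINT x|disc_measure. (norm (f x))\<^sup>2) \<le> (LINT x|disc_measure. c\<^sup>2 * (norm (g x))\<^sup>2)"
    by (rule integral_mono_AE[OF i ig sq])
  also have "\<dots> = c\<^sup>2 * (LINT x|disc_measure. (norm (g x))\<^sup>2)" by simp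
  finally have "L2_disc_norm f \<le> sqrt (c\<^sup>2 * (LINT x|disc_measure. (norm (g x))\<^sup>2))"
    unfolding L2_disc_norm_def by (rule real_sqrt_le_mono)
  also have "\<dots> = c * L2_disc_norm g" using c by (simp add: real_sqrt_mult L2_disc_norm_def)
  finally show "L2_disc_norm f \<le> c * L2_disc_norm g" .
qed

lemma norm_weak_grad_square: "(norm (weak_grad u x))\<^sup>2 = (norm (weak_partial 1 u x))\<^sup>2 + (norm (weak_partial 2 u x))\<^sup>2"
  by (simp add: weak_grad_def norm_vec_def L2_set_def UNIV_2)

lemma weak_grad_L2:
  assumes "\<And>i. weak_partial i u \<in> L2_disc" shows "weak_grad u \<in> L2_disc"
proof -
  have eq: "weak_grad u = (\<lambda>x. axis 1 (weak_partial 1 u x) + axis 2 (weak_partial 2 u x))"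
    by (simp add: fun_eq_iff weak_grad_def vec_eq_iff forall_2 axis_def)
  have ax: "(\<lambda>x. axis i (f x) :: 'b^2) \<in> borel_measurable disc_measure"
    if "f \<in> borel_measurable disc_measure" for i and f :: "real^2 \<Rightarrow> 'b::euclidean_space"
  proof -
    have "linear (axis i :: 'b \<Rightarrow> 'b^2)" by (intro linearI) (simp_all add: vec_eq_iff axis_def)
    then have "continuous_on UNIV (axis i :: 'b \<Rightarrow> 'b^2)" using linear_continuous_on linear_conv_bounded_linear by blast
    then show ?thesis using that by (rule borel_measurable_continuous_on)
  qed
  have "weak_grad u \<in> borel_measurable disc_measure"
    unfolding eq by (intro borel_measurable_add ax L2_discD(1) assms)
  moreover have "integrable disc_measure (\<lambda>x. (norm (weak_grad u x))\<^sup>2)"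
    unfolding norm_weak_grad_square using L2_discD(2)[OF assms] by simp
  ultimately show ?thesis by (simp add: L2_disc_def)
qed

lemma norm_weak_partial_le: "norm (weak_partial i u x) \<le> norm (weak_grad u x)"
proof (rule power2_le_imp_le)
  show "(norm (weak_partial i u x))\<^sup>2 \<le> (norm (weak_grad u x))\<^sup>2"
    using exhaust_2[of i] unfolding norm_weak_grad_square by auto
qed simp

lemma L2_weak_partial_le:
  assumes "u \<in> W12"
  shows "L2_disc_norm (weak_partial i u) \<le> W12_norm u"
proof -
  have L: "weak_partial i u \<in> L2_disc" for i by (rule W12_weak_partial(1)[OF assms])
  have "L2_disc_norm (weak_partial i u) \<le> 1 * L2_disc_norm (weak_grad u)"
    by (rule L2_disc_norm_le(2)[OF weak_grad_L2[OF L] L2_discD(1)[OF L]]) (use norm_weak_partial_le in auto)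
  also have "\<dots> = sqrt ((L2_disc_norm (weak_grad u))\<^sup>2)" by (simp add: L2_disc_norm_nonneg)
  also have "\<dots> \<le> W12_norm u" unfolding W12_norm_def by (intro real_sqrt_le_mono) simp
  finally show ?thesis .
qed

lemma zero_weak_partial:
  "(\<lambda>_. 0 :: real) \<in> L2_disc" "has_weak_partial i (\<lambda>_. 0 :: real) (\<lambda>_. 0)"
  by (auto simp: L2_disc_def has_weak_partial_def)

text \<open>The weak partials of the zero function are chosen and known to vanish only almost
  everywhere, so the norm is computed through integrals.\<close>

lemma W12_norm_zero: "W12_norm (\<lambda>_. 0 :: real) = 0"
proof -
  have "AE x in disc_measure. weak_partial i (\<lambda>_. 0 :: real) x = 0" for i
    by (rule weak_partial_AE(1)[OF zero_weak_partial])
  then have ae: "AE x in disc_measure. weak_partial 1 (\<lambda>_. 0 :: real) x = 0 \<and> weak_partial 2 (\<lambda>_. 0 :: real) x = 0" by simp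
  have "(LINT x|disc_measure. (norm (weak_grad (\<lambda>_. 0 :: real) x))\<^sup>2) = (LINT x|disc_measure. 0)"
  proof (rule integral_cong_AE)
    show "AE x in disc_measure. (norm (weak_grad (\<lambda>_. 0 :: real) x))\<^sup>2 = 0"
      using ae unfolding norm_weak_grad_square by eventually_elim simp
    have "weak_grad (\<lambda>_. 0 :: real) \<in> L2_disc" by (rule weak_grad_L2[OF weak_partial_AE(2)[OF zero_weak_partial]])
    then show "(\<lambda>x. (norm (weak_grad (\<lambda>_. 0 :: real) x))\<^sup>2) \<in> borel_measurable disc_measure"
      using L2_discD(1) by measurable
  qed simp
  then show ?thesis by (simp add: W12_norm_def L2_disc_norm_def)
qed

lemma zero_W12_0: "(\<lambda>_. 0 :: real) \<in> W12_0"
proof -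
  have "(\<lambda>_. 0 :: real) \<in> W12" unfolding W12_def using zero_weak_partial by blast
  moreover have "(\<lambda>_. 0 :: real) \<in> test_functions" by (simp add: test_functions_def)
  ultimately show ?thesis unfolding W12_0_def using W12_norm_zero by (auto intro!: bexI[of _ "\<lambda>_. 0"])
qed

text \<open>The functional extending \<open>\<zeta> \<mapsto> \<integral> \<Phi> \<zeta>\<close> is \<open>u \<mapsto> \<integral> (\<Omega>\<^sub>2 \<partial>\<^sub>1 u - \<Omega>\<^sub>1 \<partial>\<^sub>2 u)\<close>.\<close>

lemma divergence_form_functional:
  assumes \<Omega>: "\<Omega>1 \<in> L2_disc" "\<Omega>2 \<in> L2_disc" "L2_disc_norm \<Omega>1 \<le> C" "L2_disc_norm \<Omega>2 \<le> C"
    and \<Phi>: "integrable disc_measure \<Phi>"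
    and eq: "\<And>\<zeta>. \<zeta> \<in> test_functions \<Longrightarrow> (LINT x|disc_measure. \<Phi> x * \<zeta> x) = (LINT x|disc_measure. \<Omega>2 x * partial_deriv 1 \<zeta> x - \<Omega>1 x * partial_deriv 2 \<zeta> x)"
  obtains T where "induces_functional \<Phi> T" "W12_0_dual_norm T \<le> 2 * C"
proof -
  define T where "T u = (LINT x|disc_measure. \<Omega>2 x * weak_partial 1 u x - \<Omega>1 x * weak_partial 2 u x)" for u :: "real^2 \<Rightarrow> real"
  have C: "C \<ge> 0" using \<Omega>(3) L2_disc_norm_nonneg[of \<Omega>1] by linarith
  have W: "u \<in> W12_0 \<Longrightarrow> u \<in> W12" for u by (simp add: W12_0_def)
  \<comment> \<open>One Cauchy-Schwarz estimate for each of the two terms, hence the factor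
    2.\<close>
  have bound: "\<bar>T u\<bar> \<le> 2 * C * W12_norm u" if u: "u \<in> W12_0" for u
  proof -
    note L = W12_weak_partial(1)[OF W[OF u]]
    have i: "integrable disc_measure (\<lambda>x. \<Omega>2 x * weak_partial 1 u x)" "integrable disc_measure (\<lambda>x. \<Omega>1 x * weak_partial 2 u x)"
      by (intro L2_disc_inner_integrable \<Omega> L)+
    have "T u = (LINT x|disc_measure. \<Omega>2 x * weak_partial 1 u x) - (LINT x|disc_measure. \<Omega>1 x * weak_partial 2 u x)"
      unfolding T_def using i by simp
    moreover have "\<bar>LINT x|disc_measure. \<Omega>2 x * weak_partial 1 u x\<bar> \<le> C * W12_norm u"
      by (rule order_trans[OF L2_disc_Cauchy_Schwarz[OF \<Omega>(2) L]])
        (intro mult_mono \<Omega> L2_weak_partial_le W u C L2_disc_norm_nonneg)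
    moreover have "\<bar>LINT x|disc_measure. \<Omega>1 x * weak_partial 2 u x\<bar> \<le> C * W12_norm u"
      by (rule order_trans[OF L2_disc_Cauchy_Schwarz[OF \<Omega>(1) L]])
        (intro mult_mono \<Omega> L2_weak_partial_le W u C L2_disc_norm_nonneg)
    ultimately show ?thesis by linarith
  qed
  \<comment> \<open>\<open>weak_partial\<close> is additive only almost everywhere, its values being
    chosen; the integral defining \<open>T\<close> does not see the difference.\<close>
  have lin: "T (\<lambda>x. a * u x + b * v x) = a * T u + b * T v" if u: "u \<in> W12_0" and v: "v \<in> W12_0" for u v a b
  proof -
    note Lu = W12_weak_partial(1)[OF W[OF u]] and Lv = W12_weak_partial(1)[OF W[OF v]]
    let ?w = "\<lambda>x. a * u x + b * v x"
    have LC: "(\<lambda>x. a * weak_partial i u x + b * weak_partial i v x) \<in> L2_disc" for i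
      using L2_disc_combination[OF Lu Lv, where a=a and b=b] by simp
    have "has_weak_partial i ?w (\<lambda>x. a * weak_partial i u x + b * weak_partial i v x)" for i
      using has_weak_partial_combination[OF W[OF u] W[OF v], of i a b] by simp
    note wp = weak_partial_AE[OF LC this]
    have i: "integrable disc_measure (\<lambda>x. \<Omega>2 x * weak_partial 1 u x)" "integrable disc_measure (\<lambda>x. \<Omega>1 x * weak_partial 2 u x)"
      "integrable disc_measure (\<lambda>x. \<Omega>2 x * weak_partial 1 v x)" "integrable disc_measure (\<lambda>x. \<Omega>1 x * weak_partial 2 v x)"
      by (intro L2_disc_inner_integrable \<Omega> Lu Lv)+
    have "T ?w = (LINT x|disc_measure. a * (\<Omega>2 x * weak_partial 1 u x - \<Omega>1 x * weak_partial 2 u x) + b * (\<Omega>2 x * weak_partial 1 v x - \<Omega>1 x * weak_partial 2 v x))"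
      unfolding T_def
    proof (rule integral_cong_AE)
      show "AE x in disc_measure. \<Omega>2 x * weak_partial 1 ?w x - \<Omega>1 x * weak_partial 2 ?w x
        = a * (\<Omega>2 x * weak_partial 1 u x - \<Omega>1 x * weak_partial 2 u x) + b * (\<Omega>2 x * weak_partial 1 v x - \<Omega>1 x * weak_partial 2 v x)"
        using wp(1)[of 1] wp(1)[of 2] by eventually_elim (simp add: algebra_simps)
    qed (use L2_discD(1)[OF \<Omega>(1)] L2_discD(1)[OF \<Omega>(2)] L2_discD(1)[OF wp(2)] L2_discD(1)[OF Lu] L2_discD(1)[OF Lv] in measurable)
    also have "\<dots> = a * T u + b * T v" unfolding T_def using i by simp
    finally show ?thesis .
  qed
  have test: "T \<zeta> = (LINT x|disc_measure. \<Phi> x * \<zeta> x)" if \<zeta>: "\<zeta> \<in> test_functions" for \<zeta>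
  proof -
    note wp = weak_partial_AE[OF test_function_weak_partial(2,3)[OF \<zeta>]]
    have "T \<zeta> = (LINT x|disc_measure. \<Omega>2 x * partial_deriv 1 \<zeta> x - \<Omega>1 x * partial_deriv 2 \<zeta> x)"
      unfolding T_def
    proof (rule integral_cong_AE)
      show "AE x in disc_measure. \<Omega>2 x * weak_partial 1 \<zeta> x - \<Omega>1 x * weak_partial 2 \<zeta> x = \<Omega>2 x * partial_deriv 1 \<zeta> x - \<Omega>1 x * partial_deriv 2 \<zeta> x"
        using wp(1)[of 1] wp(1)[of 2] by eventually_elim simp
    qed (use L2_discD(1)[OF \<Omega>(1)] L2_discD(1)[OF \<Omega>(2)] L2_discD(1)[OF wp(2)] L2_discD(1)[OF test_function_weak_partial(2)[OF \<zeta>]] in measurable)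
    then show ?thesis using eq[OF \<zeta>] by simp
  qed
  have "T \<in> W12_0_dual" unfolding W12_0_dual_def using lin bound by blast
  then have "induces_functional \<Phi> T" unfolding induces_functional_def using \<Phi> test by blast
  \<comment> \<open>An upper bound passes to \<open>Sup\<close> of a set of reals once the set is
    non-empty, which the zero function ensures.\<close>
  moreover have "W12_0_dual_norm T \<le> 2 * C"
    unfolding W12_0_dual_norm_def
  proof (rule cSup_least)
    show "{\<bar>T u\<bar> |u. u \<in> W12_0 \<and> W12_norm u \<le> 1} \<noteq> {}" using zero_W12_0 W12_norm_zero by (auto intro!: exI[of _ "\<lambda>_. 0"])
    fix t assume "t \<in> {\<bar>T u\<bar> |u. u \<in> W12_0 \<and> W12_norm u \<le> 1}"
    then obtain u where u: "t = \<bar>T u\<bar>" "u \<in> W12_0" "W12_norm u \<le> 1" by blast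
    have "2 * C * W12_norm u \<le> 2 * C * 1" using u(3) C by (intro mult_left_mono) auto
    then show "t \<le> 2 * C" using bound[OF u(2)] u(1) by simp
  qed
  ultimately show ?thesis by (rule that)
qed

text \<open>The approximation argument wants a Borel map with values in the closed unit ball at
  every point. Values off the sphere, met only on a null set of the disc, are therefore replaced by
  0, and everything is extended by 0 to the plane.\<close>

lemma sphere_map_Borel_version:
  assumes n: "n \<in> W12_sphere"
  obtains N V1 V2 where "weak_diff N V1 V2" "\<And>x. norm (N x) \<le> 1" "AE x in lborel. norm x < 1 \<longrightarrow> norm (N x) = 1"
    "AE x in disc_measure. N x = n x \<and> V1 x = weak_partial 1 n x \<and> V2 x = weak_partial 2 n x"
proof -
  have nW: "n \<in> W12" and ns: "AE x in disc_measure. norm (n x) = 1" using n by (auto simp: W12_sphere_def)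
  note P = W12_weak_partial[OF nW]
  obtain N0 where N0: "N0 \<in> borel_measurable borel" "\<And>x. norm x \<ge> 1 \<Longrightarrow> N0 x = 0" "AE x in disc_measure. N0 x = n x"
    by (rule borel_version[OF L2_discD(1)[OF W12_L2[OF nW]]]) blast
  obtain V1 where V1: "V1 \<in> borel_measurable borel" "\<And>x. norm x \<ge> 1 \<Longrightarrow> V1 x = 0" "AE x in disc_measure. V1 x = weak_partial 1 n x"
    by (rule borel_version[OF L2_discD(1)[OF P(1)[of 1]]]) blast
  obtain V2 where V2: "V2 \<in> borel_measurable borel" "\<And>x. norm x \<ge> 1 \<Longrightarrow> V2 x = 0" "AE x in disc_measure. V2 x = weak_partial 2 n x"
    by (rule borel_version[OF L2_discD(1)[OF P(1)[of 2]]]) blast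
  define N where "N x = (if norm (N0 x) = 1 then N0 x else 0)" for x
  have Nm: "N \<in> borel_measurable borel" unfolding N_def[abs_def] using N0(1) by measurable
  have Nz: "N x = 0" if "norm x \<ge> 1" for x using N0(2)[OF that] by (simp add: N_def)
  have Nn: "AE x in disc_measure. N x = n x" using N0(3) ns by eventually_elim (simp add: N_def)
  have N1: "norm (N x) \<le> 1" for x by (simp add: N_def)
  have "AE x in disc_measure. norm (N x) = 1" using Nn ns by eventually_elim simp
  then have NS: "AE x in lborel. norm x < 1 \<longrightarrow> norm (N x) = 1" by (simp add: AE_disc_iff)
  have sq: "integrable lborel (\<lambda>x. (norm (g x))\<^sup>2)"
    if g: "g \<in> borel_measurable borel" "\<And>x. norm x \<ge> 1 \<Longrightarrow> g x = 0" "AE x in disc_measure. g x = f x" and f: "f \<in> L2_disc" for f g :: "real^2 \<Rightarrow> real^3"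
  proof -
    note gd = borel_disc_measurable[OF g(1)]
    have "integrable disc_measure (\<lambda>x. (norm (g x))\<^sup>2)"
      using L2_discD(2)[OF f] by (rule integrable_cong_AE_imp) (use gd g(3) in \<open>auto elim: eventually_mono\<close>)
    then show ?thesis by (subst (asm) disc_integral_eq(2)) (use g(1,2) in auto)
  qed
  have int: "(LINT x|lborel. h x *\<^sub>R g x) = (LINT x|disc_measure. h x *\<^sub>R f x)"
    if g: "g \<in> borel_measurable borel" "\<And>x. norm x \<ge> 1 \<Longrightarrow> g x = 0" "AE x in disc_measure. g x = f x" and f: "f \<in> L2_disc" and h: "h \<in> borel_measurable borel"
    for f g :: "real^2 \<Rightarrow> real^3" and h
  proof -
    have "(LINT x|lborel. h x *\<^sub>R g x) = (LINT x|disc_measure. h x *\<^sub>R g x)"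
      by (rule disc_integral_eq(1)[symmetric]) (use g h in auto)
    also have "\<dots> = (LINT x|disc_measure. h x *\<^sub>R f x)"
      by (rule integral_cong_AE) (use g(3) borel_disc_measurable[OF g(1)] borel_disc_measurable[OF h] L2_discD(1)[OF f] in \<open>auto elim: eventually_mono\<close>)
    finally show ?thesis .
  qed
  have "weak_diff N V1 V2"
    unfolding weak_diff_def
  proof (intro conjI ballI)
    fix f assume "f \<in> {N, V1, V2}"
    then show "f \<in> borel_measurable borel" "integrable lborel (\<lambda>x. (norm (f x))\<^sup>2)" "\<forall>x. norm x \<ge> 1 \<longrightarrow> f x = 0"
      using Nm V1 V2 Nz sq[OF Nm Nz Nn W12_L2[OF nW]] sq[OF V1 P(1)] sq[OF V2 P(1)] by auto
  next
    fix \<phi> assume \<phi>: "\<phi> \<in> test_functions"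
    obtain r where t: "has_partials \<phi> (partial_deriv 1 \<phi>) (partial_deriv 2 \<phi>)"
      and tc: "continuous_on UNIV (partial_deriv 1 \<phi>)" "continuous_on UNIV (partial_deriv 2 \<phi>)"
      by (rule test_functionD[OF \<phi>]) blast
    note m = borel_measurable_continuous_onI[OF has_partials_continuous[OF t]] borel_measurable_continuous_onI[OF tc(1)] borel_measurable_continuous_onI[OF tc(2)]
    have wk: "(LINT x|disc_measure. partial_deriv i \<phi> x *\<^sub>R n x) = - (LINT x|disc_measure. \<phi> x *\<^sub>R weak_partial i n x)" for i
      using P(2)[of i] \<phi> unfolding has_weak_partial_def by blast
    have iN: "(LINT x|lborel. h x *\<^sub>R N x) = (LINT x|disc_measure. h x *\<^sub>R n x)" if "h \<in> borel_measurable borel" for h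
      by (rule int[OF Nm _ Nn W12_L2[OF nW] that]) (rule Nz)
    have iV: "(LINT x|lborel. \<phi> x *\<^sub>R V1 x) = (LINT x|disc_measure. \<phi> x *\<^sub>R weak_partial 1 n x)"
      "(LINT x|lborel. \<phi> x *\<^sub>R V2 x) = (LINT x|disc_measure. \<phi> x *\<^sub>R weak_partial 2 n x)"
      by (rule int[OF V1(1) _ V1(3) P(1) m(1)], rule V1(2), assumption) (rule int[OF V2(1) _ V2(3) P(1) m(1)], rule V2(2))
    show "(LINT x|lborel. partial_deriv 1 \<phi> x *\<^sub>R N x) = - (LINT x|lborel. \<phi> x *\<^sub>R V1 x)"
      unfolding iN[OF m(2)] iV by (rule wk)
    show "(LINT x|lborel. partial_deriv 2 \<phi> x *\<^sub>R N x) = - (LINT x|lborel. \<phi> x *\<^sub>R V2 x)"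
      unfolding iN[OF m(3)] iV by (rule wk)
  qed
  moreover have "AE x in disc_measure. N x = n x \<and> V1 x = weak_partial 1 n x \<and> V2 x = weak_partial 2 n x"
    using Nn V1(3) V2(3) by eventually_elim blast
  ultimately show ?thesis using N1 NS by (intro that)
qed

text \<open>\<open>\<Omega>1\<close> and \<open>\<Omega>2\<close> are the averaged field
  \<open>A\<close> paired with the weak partials of \<open>n\<close>. The pointwise bound 8
  pi/\<delta> on |A| passes to the norms because each partial is at most the gradient.\<close>

lemma area_density_divergence_form:
  assumes \<delta>: "\<delta> > 0" and n: "n \<in> W12_sphere"
    and area: "(LINT x|disc_measure. norm (cross3 (weak_partial 1 n x) (weak_partial 2 n x))) \<le> 4 * pi - \<delta>"
  defines "\<Phi> \<equiv> \<lambda>x. n x \<bullet> cross3 (weak_partial 1 n x) (weak_partial 2 n x)"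
  obtains \<Omega>1 \<Omega>2 where "\<Omega>1 \<in> L2_disc" "\<Omega>2 \<in> L2_disc"
    "L2_disc_norm \<Omega>1 \<le> (8 * pi / \<delta>) * L2_disc_norm (weak_grad n)" "L2_disc_norm \<Omega>2 \<le> (8 * pi / \<delta>) * L2_disc_norm (weak_grad n)"
    "integrable disc_measure \<Phi>"
    "\<And>\<zeta>. \<zeta> \<in> test_functions \<Longrightarrow> (LINT x|disc_measure. \<Phi> x * \<zeta> x) = (LINT x|disc_measure. \<Omega>2 x * partial_deriv 1 \<zeta> x - \<Omega>1 x * partial_deriv 2 \<zeta> x)"
proof -
  have nW: "n \<in> W12" using n by (simp add: W12_sphere_def)
  note P = W12_weak_partial(1)[OF nW]
  obtain N V1 V2 where w: "weak_diff N V1 V2" and N1: "\<And>x. norm (N x) \<le> 1" and NS: "AE x in lborel. norm x < 1 \<longrightarrow> norm (N x) = 1"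
    and ae: "AE x in disc_measure. N x = n x \<and> V1 x = weak_partial 1 n x \<and> V2 x = weak_partial 2 n x"
    using sphere_map_Borel_version[OF n] by blast
  note W = weak_diffD[OF w]
  note [measurable] = L2_discD(1)[OF P] L2_discD(1)[OF W12_L2[OF nW]]
    borel_disc_measurable[OF W(1)] borel_disc_measurable[OF W(2)] borel_disc_measurable[OF W(3)]
  have "(LINT x|lborel. norm (cross3 (V1 x) (V2 x))) = (LINT x|disc_measure. norm (cross3 (V1 x) (V2 x)))"
    by (rule disc_integral_eq(1)[symmetric]) (use W(2,3) in measurable, simp add: W(8))
  also have "\<dots> = (LINT x|disc_measure. norm (cross3 (weak_partial 1 n x) (weak_partial 2 n x)))"
    by (rule integral_cong_AE) (measurable, use ae in \<open>auto elim: eventually_mono\<close>)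
  finally have "(LINT x|lborel. norm (cross3 (V1 x) (V2 x))) \<le> 4 * pi - \<delta>" using area by simp
  then obtain A where A: "A \<in> borel_measurable borel" "AE x in lborel. norm x < 1 \<longrightarrow> norm (A x) \<le> 8 * pi / \<delta>"
    "\<And>\<zeta>. \<zeta> \<in> test_functions \<Longrightarrow> (LINT x|lborel. partial_deriv 1 \<zeta> x * (A x \<bullet> V2 x) - partial_deriv 2 \<zeta> x * (A x \<bullet> V1 x)
      - \<zeta> x * (N x \<bullet> cross3 (V1 x) (V2 x))) = 0"
    using area_form_primitive[OF w N1 NS \<delta>] by blast
  note [measurable] = borel_disc_measurable[OF A(1)]
  define \<Omega>1 \<Omega>2 where "\<Omega>1 x = A x \<bullet> V1 x" and "\<Omega>2 x = A x \<bullet> V2 x" for x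
  have \<Omega>m [measurable]: "\<Omega>1 \<in> borel_measurable disc_measure" "\<Omega>2 \<in> borel_measurable disc_measure"
    unfolding \<Omega>1_def[abs_def] \<Omega>2_def[abs_def] by measurable
  have Ad: "AE x in disc_measure. norm (A x) \<le> 8 * pi / \<delta>" using A(2) by (simp add: AE_disc_iff)
  have le: "AE x in disc_measure. norm (\<Omega>1 x) \<le> 8 * pi / \<delta> * norm (weak_grad n x)" "AE x in disc_measure. norm (\<Omega>2 x) \<le> 8 * pi / \<delta> * norm (weak_grad n x)"
  proof -
    have c: "\<bar>a \<bullet> v\<bar> \<le> 8 * pi / \<delta> * g" if "norm a \<le> 8 * pi / \<delta>" "norm v \<le> g" for a v :: "real^3" and g
      using order_trans[OF Cauchy_Schwarz_ineq2 mult_mono[OF that]] \<delta> by simp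
    show "AE x in disc_measure. norm (\<Omega>1 x) \<le> 8 * pi / \<delta> * norm (weak_grad n x)"
      using Ad ae by eventually_elim (simp add: \<Omega>1_def c norm_weak_partial_le del: times_divide_eq_left)
    show "AE x in disc_measure. norm (\<Omega>2 x) \<le> 8 * pi / \<delta> * norm (weak_grad n x)"
      using Ad ae by eventually_elim (simp add: \<Omega>2_def c norm_weak_partial_le del: times_divide_eq_left)
  qed
  have C: "8 * pi / \<delta> \<ge> 0" using \<delta> by simp
  note O1 = L2_disc_norm_le[OF weak_grad_L2[OF P] \<Omega>m(1) C le(1)] and O2 = L2_disc_norm_le[OF weak_grad_L2[OF P] \<Omega>m(2) C le(2)]
  have \<Phi>m [measurable]: "\<Phi> \<in> borel_measurable disc_measure" unfolding \<Phi>_def by measurable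
  have ns: "AE x in disc_measure. norm (n x) = 1" using n by (auto simp: W12_sphere_def)
  \<comment> \<open>As |n| = 1, the density is at most the product of the norms of the two partials,
    hence at most the squared norm of the gradient.\<close>
  have \<Phi>i: "integrable disc_measure \<Phi>"
  proof (rule Bochner_Integration.integrable_bound)
    show "integrable disc_measure (\<lambda>x. (norm (weak_grad n x))\<^sup>2)" by (rule L2_discD(2)[OF weak_grad_L2[OF P]])
    show "AE x in disc_measure. norm (\<Phi> x) \<le> norm ((norm (weak_grad n x))\<^sup>2)"
      using ns
    proof eventually_elim
      case (elim x)
      let ?a = "weak_partial 1 n x" and ?b = "weak_partial 2 n x"
      have "\<bar>\<Phi> x\<bar> \<le> norm (cross3 ?a ?b)" unfolding \<Phi>_def using Cauchy_Schwarz_ineq2[of "n x" "cross3 ?a ?b"] elim by simp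
      also have "\<dots> \<le> norm ?a * norm ?b" by (rule norm_cross_le)
      also have "\<dots> \<le> norm (weak_grad n x) * norm (weak_grad n x)" by (intro mult_mono norm_weak_partial_le) auto
      finally show ?case by (simp add: power2_eq_square)
    qed
  qed measurable
  have "(LINT x|disc_measure. \<Phi> x * \<zeta> x) = (LINT x|disc_measure. \<Omega>2 x * partial_deriv 1 \<zeta> x - \<Omega>1 x * partial_deriv 2 \<zeta> x)"
    if \<zeta>: "\<zeta> \<in> test_functions" for \<zeta>
  proof -
    obtain r where r: "r < 1" and t: "has_partials \<zeta> (partial_deriv 1 \<zeta>) (partial_deriv 2 \<zeta>)"
      and tc: "continuous_on UNIV (partial_deriv 1 \<zeta>)" "continuous_on UNIV (partial_deriv 2 \<zeta>)"
      and tz: "\<And>x. norm x \<ge> r \<Longrightarrow> \<zeta> x = 0" "\<And>x. norm x \<ge> r \<Longrightarrow> partial_deriv 1 \<zeta> x = 0" "\<And>x. norm x \<ge> r \<Longrightarrow> partial_deriv 2 \<zeta> x = 0"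
      by (rule test_functionD[OF \<zeta>]) blast
    have zc: "continuous_on UNIV \<zeta>" using t by (rule has_partials_continuous)
    note m = borel_measurable_continuous_onI[OF zc] borel_measurable_continuous_onI[OF tc(1)] borel_measurable_continuous_onI[OF tc(2)]
    note [measurable] = borel_disc_measurable[OF m(1)] borel_disc_measurable[OF m(2)] borel_disc_measurable[OF m(3)]
    let ?F = "\<lambda>x. partial_deriv 1 \<zeta> x * (A x \<bullet> V2 x) - partial_deriv 2 \<zeta> x * (A x \<bullet> V1 x) - \<zeta> x * (N x \<bullet> cross3 (V1 x) (V2 x))"
    have Fb: "?F \<in> borel_measurable borel" using m A(1) W(1,2,3) by measurable
    have "(LINT x|disc_measure. ?F x) = (LINT x|lborel. ?F x)"
      by (rule disc_integral_eq(1)[OF Fb]) (use r tz in simp)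
    then have "(LINT x|disc_measure. ?F x) = 0" using A(3)[OF \<zeta>] by simp
    moreover have "(LINT x|disc_measure. ?F x) = (LINT x|disc_measure. (\<Omega>2 x * partial_deriv 1 \<zeta> x - \<Omega>1 x * partial_deriv 2 \<zeta> x) - \<Phi> x * \<zeta> x)"
    proof (rule integral_cong_AE)
      show "AE x in disc_measure. ?F x = (\<Omega>2 x * partial_deriv 1 \<zeta> x - \<Omega>1 x * partial_deriv 2 \<zeta> x) - \<Phi> x * \<zeta> x"
        using ae by eventually_elim (simp add: \<Omega>1_def \<Omega>2_def \<Phi>_def mult.commute)
    qed measurable
    moreover have "integrable disc_measure (\<lambda>x. \<Phi> x * \<zeta> x)"
    proof -
      obtain B where B: "B > 0" "\<And>x. norm (\<zeta> x) \<le> B" using continuous_compact_support_bounded[OF zc tz(1)] by blast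
      have "integrable disc_measure (\<lambda>x. B * norm (\<Phi> x))" using \<Phi>i by auto
      then show ?thesis
      proof (rule Bochner_Integration.integrable_bound)
        show "AE x in disc_measure. norm (\<Phi> x * \<zeta> x) \<le> norm (B * norm (\<Phi> x))"
        proof (rule AE_I2)
          fix x
          have "\<bar>\<zeta> x\<bar> * \<bar>\<Phi> x\<bar> \<le> B * \<bar>\<Phi> x\<bar>" using B(2)[of x] by (intro mult_right_mono) auto
          then show "norm (\<Phi> x * \<zeta> x) \<le> norm (B * norm (\<Phi> x))" using B(1) by (simp add: abs_mult mult.commute)
        qed
      qed measurable
    qed
    moreover have "integrable disc_measure (\<lambda>x. \<Omega>2 x * partial_deriv 1 \<zeta> x - \<Omega>1 x * partial_deriv 2 \<zeta> x)"
      by (intro Bochner_Integration.integrable_diff L2_disc_inner_integrable O1(1) O2(1) test_function_weak_partial(2)[OF \<zeta>])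
    ultimately show ?thesis by simp
  qed
  then show ?thesis using that[OF O1(1) O2(1) O1(2) O2(2) \<Phi>i] by blast
qed

theorem theorem2p2:
  shows "\<exists>c::real. \<forall>(\<delta>::real) (n :: real^2 \<Rightarrow> real^3).
    \<delta> > 0 \<longrightarrow> n \<in> W12_sphere \<longrightarrow>
    (LINT x|disc_measure. norm (cross3 (weak_partial 1 n x) (weak_partial 2 n x))) \<le> 4 * pi - \<delta> \<longrightarrow>
    (let \<Phi> = (\<lambda>x. n x \<bullet> cross3 (weak_partial 1 n x) (weak_partial 2 n x)) in
      (\<exists>\<Omega>1\<in>L2_disc. \<exists>\<Omega>2\<in>L2_disc.
         L2_disc_norm \<Omega>1 \<le> (2^3 * pi / \<delta>) * L2_disc_norm (weak_grad n) \<and>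
         L2_disc_norm \<Omega>2 \<le> (2^3 * pi / \<delta>) * L2_disc_norm (weak_grad n) \<and>
         (\<forall>\<zeta>\<in>test_functions.
            (LINT x|disc_measure. \<Phi> x * \<zeta> x) =
            (LINT x|disc_measure. \<Omega>2 x * partial_deriv 1 \<zeta> x - \<Omega>1 x * partial_deriv 2 \<zeta> x))) \<and>
      (\<exists>T. induces_functional \<Phi> T \<and> W12_0_dual_norm T \<le> c / \<delta> * L2_disc_norm (weak_grad n)))"
proof (intro exI[of _ "16 * pi"] allI impI)
  fix \<delta> :: real and n :: "real^2 \<Rightarrow> real^3"
  assume \<delta>: "\<delta> > 0" and n: "n \<in> W12_sphere"
    and area: "(LINT x|disc_measure. norm (cross3 (weak_partial 1 n x) (weak_partial 2 n x))) \<le> 4 * pi - \<delta>"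
  let ?\<Phi> = "\<lambda>x. n x \<bullet> cross3 (weak_partial 1 n x) (weak_partial 2 n x)"
  let ?C = "(8 * pi / \<delta>) * L2_disc_norm (weak_grad n)"
  obtain \<Omega>1 \<Omega>2 where \<Omega>: "\<Omega>1 \<in> L2_disc" "\<Omega>2 \<in> L2_disc" "L2_disc_norm \<Omega>1 \<le> ?C" "L2_disc_norm \<Omega>2 \<le> ?C"
    and \<Phi>: "integrable disc_measure ?\<Phi>"
    and eq: "\<And>\<zeta>. \<zeta> \<in> test_functions \<Longrightarrow> (LINT x|disc_measure. ?\<Phi> x * \<zeta> x) = (LINT x|disc_measure. \<Omega>2 x * partial_deriv 1 \<zeta> x - \<Omega>1 x * partial_deriv 2 \<zeta> x)"
    using area_density_divergence_form[OF \<delta> n area] by blast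
  obtain T where T: "induces_functional ?\<Phi> T" "W12_0_dual_norm T \<le> 2 * ?C"
    using divergence_form_functional[OF \<Omega> \<Phi> eq] by blast
  \<comment> \<open>The dual norm collects one bound with 8 pi/\<delta> from each of the two
    components, whence c = 16 pi.\<close>
  have "2 * ?C = 16 * pi / \<delta> * L2_disc_norm (weak_grad n)" by simp
  then have "\<exists>T. induces_functional ?\<Phi> T \<and> W12_0_dual_norm T \<le> 16 * pi / \<delta> * L2_disc_norm (weak_grad n)"
    using T by auto
  moreover have eight: "(2::real)^3 = 8" by simp
  ultimately show "let \<Phi> = (\<lambda>x. n x \<bullet> cross3 (weak_partial 1 n x) (weak_partial 2 n x)) in
      (\<exists>\<Omega>1\<in>L2_disc. \<exists>\<Omega>2\<in>L2_disc.
         L2_disc_norm \<Omega>1 \<le> (2^3 * pi / \<delta>) * L2_disc_norm (weak_grad n) \<and>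
         L2_disc_norm \<Omega>2 \<le> (2^3 * pi / \<delta>) * L2_disc_norm (weak_grad n) \<and>
         (\<forall>\<zeta>\<in>test_functions.
            (LINT x|disc_measure. \<Phi> x * \<zeta> x) =
            (LINT x|disc_measure. \<Omega>2 x * partial_deriv 1 \<zeta> x - \<Omega>1 x * partial_deriv 2 \<zeta> x))) \<and>
      (\<exists>T. induces_functional \<Phi> T \<and> W12_0_dual_norm T \<le> (16 * pi) / \<delta> * L2_disc_norm (weak_grad n))"
    unfolding Let_def eight
    by (intro conjI bexI[OF _ \<Omega>(1)] bexI[OF _ \<Omega>(2)] ballI eq \<Omega>(3,4))
qed

end
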